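(* Let $(A,\mathfrak{m})$ be a (Noetherian) local complete intersection ring of dimension $d$ with residue field $k$. Let $M$ be a (finitely generated) maximal Cohen-Macaulay $A$-module with $\operatorname{cx}_A(M)<\operatorname{cx}_A(k)$. Then $$e(M)\ \geq\ 2\,\mu(M).$$
   Context: All rings are Noetherian and local, and all modules are finitely generated. Let $(A,\mathfrak{m})$ be a local ring with residue field $k$, let $E$ be an $A$-module, and let $\ell(-)$ denote length. - Betti numbers: $\beta_n^A(E)=\ell(\operatorname{Tor}^A_n(E,k))$ for $n\ge 0$. - Complexity: $\operatorname{cx}_A(E)=\min\{m\in\mathbb{N}\mid \limsup_{n\to\infty}\beta_n^A(E)/n^{m-1}<\infty\}$, where $0\in\mathbb{N}$ (so $\operatorname{cx}_A(E)=0$ exactly when $E$ has finite projective dimension). If $A$ is a complete intersection of codimension $c$, then $\operatorname{cx}_A(E)\le\operatorname{cx}_A(k)=c$. - Multiplicity: if $r=\dim E$, then $e(E)=\lim_{n\to\infty} r!\,\ell(E/\mathfrak{m}^nE)/n^r$. - Number of minimal generators: $\mu(E)=\ell(E/\mathfrak{m}E)$. - An $A$-module $M$ is maximal Cohen-Macaulay (MCM) if it is Cohen-Macaulay with $\dim M=\dim A$. *)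

theory Defs
  imports Complex_Main "HOL-Library.FuncSet" "HOL-Library.Extended_Nat"
    "HOL-Library.Extended_Real" "HOL-Library.Liminf_Limsup"
    "HOL-Algebra.Module" "HOL-Algebra.QuotRing" "HOL-Algebra.Ideal_Product"
    "HOL-Algebra.Ring_Divisibility"
begin

section \<open>Submodules, quotients and powers of modules\<close>

definition self_module :: "('a, 'r) ring_scheme \<Rightarrow> ('a, 'a) module" where
  "self_module R =
    \<lparr>carrier = carrier R, monoid.mult = monoid.mult R, one = one R, zero = zero R, add = add R,
     smult = monoid.mult R\<rparr>"

text \<open>The library models modules as extensions of the ring record; the multiplicative fields
  play no role for a module and are left unspecified below.\<close>

definition quot_module :: "('a, 'b, 'm) module_scheme \<Rightarrow> 'b set \<Rightarrow> ('a, 'b set) module" where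
  "quot_module M N =
    \<lparr>carrier = a_rcosets\<^bsub>M\<^esub> N, monoid.mult = undefined, one = undefined, zero = N, add = set_add M,
     smult = (\<lambda>a X. \<Union>x\<in>X. N +>\<^bsub>M\<^esub> (a \<odot>\<^bsub>M\<^esub> x))\<rparr>"

definition module_power :: "('a, 'b, 'm) module_scheme \<Rightarrow> nat \<Rightarrow> ('a, nat \<Rightarrow> 'b) module" where
  "module_power N b =
    \<lparr>carrier = {..<b} \<rightarrow>\<^sub>E carrier N, monoid.mult = undefined, one = undefined,
     zero = (\<lambda>i\<in>{..<b}. \<zero>\<^bsub>N\<^esub>), add = (\<lambda>x y. \<lambda>i\<in>{..<b}. x i \<oplus>\<^bsub>N\<^esub> y i),
     smult = (\<lambda>a x. \<lambda>i\<in>{..<b}. a \<odot>\<^bsub>N\<^esub> x i)\<rparr>"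

definition submodule_gen ::
    "('a, 'r) ring_scheme \<Rightarrow> ('a, 'b, 'm) module_scheme \<Rightarrow> 'b set \<Rightarrow> 'b set" where
  "submodule_gen R M S = \<Inter>{N. submodule N R M \<and> S \<subseteq> N}"

definition finitely_generated :: "('a, 'r) ring_scheme \<Rightarrow> ('a, 'b, 'm) module_scheme \<Rightarrow> bool" where
  "finitely_generated R M \<longleftrightarrow>
    (\<exists>S. finite S \<and> S \<subseteq> carrier M \<and> submodule_gen R M S = carrier M)"

definition ideal_smult ::
    "('a, 'r) ring_scheme \<Rightarrow> 'a set \<Rightarrow> ('a, 'b, 'm) module_scheme \<Rightarrow> 'b set" where
  "ideal_smult R I M = submodule_gen R M {a \<odot>\<^bsub>M\<^esub> x | a x. a \<in> I \<and> x \<in> carrier M}"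

primrec ideal_power :: "('a, 'r) ring_scheme \<Rightarrow> 'a set \<Rightarrow> nat \<Rightarrow> 'a set" where
  "ideal_power R I 0 = carrier R"
| "ideal_power R I (Suc n) = I \<cdot>\<^bsub>R\<^esub> ideal_power R I n"

definition annihilator :: "('a, 'r) ring_scheme \<Rightarrow> ('a, 'b, 'm) module_scheme \<Rightarrow> 'a set" where
  "annihilator R M = {a \<in> carrier R. \<forall>x\<in>carrier M. a \<odot>\<^bsub>M\<^esub> x = \<zero>\<^bsub>M\<^esub>}"

definition module_length :: "('a, 'r) ring_scheme \<Rightarrow> ('a, 'b, 'm) module_scheme \<Rightarrow> enat" where
  "module_length R M =
    Sup {enat n | n N. (\<forall>i\<le>n. submodule (N i) R M) \<and> (\<forall>i<n. N i \<subset> N (Suc i))}"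


section \<open>Local rings, dimension and depth\<close>

definition noetherian_local_ring :: "('a, 'r) ring_scheme \<Rightarrow> bool" where
  "noetherian_local_ring R \<longleftrightarrow>
    cring R \<and> noetherian_ring R \<and> (\<exists>!m. maximalideal m R)"

definition max_ideal :: "('a, 'r) ring_scheme \<Rightarrow> 'a set" where
  "max_ideal R = (THE m. maximalideal m R)"

definition residue_field :: "('a, 'r) ring_scheme \<Rightarrow> ('a, 'a set) module" where
  "residue_field R = quot_module (self_module R) (max_ideal R)"

text \<open>The supremum is taken in \<^typ>\<open>ereal\<close>, so the zero ring and the zero module have
  dimension \<open>-\<infinity>\<close>.\<close>

definition krull_dim :: "('a, 'r) ring_scheme \<Rightarrow> ereal" where
  "krull_dim R =
    Sup {ereal (real n) | n P. (\<forall>i\<le>n. primeideal (P i) R) \<and> (\<forall>i<n. P i \<subset> P (Suc i))}"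

definition module_dim :: "('a, 'r) ring_scheme \<Rightarrow> ('a, 'b, 'm) module_scheme \<Rightarrow> ereal" where
  "module_dim R M = krull_dim (R Quot annihilator R M)"

text \<open>The second conjunct says that \<open>xs ! i\<close> is a nonzerodivisor on
  \<open>M / (xs ! 0, \<dots>, xs ! (i - 1)) M\<close>.\<close>

definition regular_sequence ::
    "('a, 'r) ring_scheme \<Rightarrow> ('a, 'b, 'm) module_scheme \<Rightarrow> 'a list \<Rightarrow> bool" where
  "regular_sequence R M xs \<longleftrightarrow>
    set xs \<subseteq> carrier R \<and>
    (\<forall>i<length xs. \<forall>u\<in>carrier M.
      (xs ! i) \<odot>\<^bsub>M\<^esub> u \<in> ideal_smult R (Idl\<^bsub>R\<^esub> (set (take i xs))) M
        \<longrightarrow> u \<in> ideal_smult R (Idl\<^bsub>R\<^esub> (set (take i xs))) M) \<and>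
    ideal_smult R (Idl\<^bsub>R\<^esub> (set xs)) M \<noteq> carrier M"

definition module_depth :: "('a, 'r) ring_scheme \<Rightarrow> ('a, 'b, 'm) module_scheme \<Rightarrow> ereal" where
  "module_depth R M =
    Sup {ereal (real (length xs)) | xs. set xs \<subseteq> max_ideal R \<and> regular_sequence R M xs}"

definition cohen_macaulay :: "('a, 'r) ring_scheme \<Rightarrow> ('a, 'b, 'm) module_scheme \<Rightarrow> bool" where
  "cohen_macaulay R M \<longleftrightarrow> module_depth R M = module_dim R M"

definition maximal_cohen_macaulay ::
    "('a, 'r) ring_scheme \<Rightarrow> ('a, 'b, 'm) module_scheme \<Rightarrow> bool" where
  "maximal_cohen_macaulay R M \<longleftrightarrow> cohen_macaulay R M \<and> module_dim R M = krull_dim R"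


section \<open>Complete intersections\<close>

definition regular_local_ring :: "('a, 'r) ring_scheme \<Rightarrow> bool" where
  "regular_local_ring R \<longleftrightarrow>
    noetherian_local_ring R \<and>
    (\<exists>S. finite S \<and> S \<subseteq> carrier R \<and> max_ideal R = Idl\<^bsub>R\<^esub> S \<and> krull_dim R = ereal (real (card S)))"

text \<open>The completion is the inverse limit of the rings \<open>R / m\<^sup>n\<close>. Elements of the quotients are
  cosets, and the transition map sends a coset of \<open>m\<^sup>n\<^sup>+\<^sup>1\<close> to the unique coset of \<open>m\<^sup>n\<close>
  containing it.\<close>

definition completion :: "('a, 'r) ring_scheme \<Rightarrow> (nat \<Rightarrow> 'a set) ring" where
  "completion R =
    (let Q = (\<lambda>n. R Quot ideal_power R (max_ideal R) n) in
     \<lparr>carrier = {s. (\<forall>n. s n \<in> carrier (Q n)) \<and> (\<forall>n. s (Suc n) \<subseteq> s n)},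
      monoid.mult = (\<lambda>s t n. s n \<otimes>\<^bsub>Q n\<^esub> t n), one = (\<lambda>n. \<one>\<^bsub>Q n\<^esub>),
      zero = (\<lambda>n. \<zero>\<^bsub>Q n\<^esub>), add = (\<lambda>s t n. s n \<oplus>\<^bsub>Q n\<^esub> t n)\<rparr>)"

text \<open>A local ring is a complete intersection if its completion is a regular local ring modulo a
  regular sequence. HOL cannot quantify over the type of the elements of that regular ring inside
  a formula, so the type is a parameter. A theorem that assumes
  \<open>complete_intersection TYPE('q) R\<close> with \<open>'q\<close> a type variable occurring nowhere else covers
  every such presentation of the completion.\<close>

definition complete_intersection :: "'q itself \<Rightarrow> ('a, 'r) ring_scheme \<Rightarrow> bool" where
  "complete_intersection _ R \<longleftrightarrow>
    noetherian_local_ring R \<and>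
    (\<exists>(Q :: 'q ring) fs. regular_local_ring Q \<and> set fs \<subseteq> max_ideal Q \<and>
      regular_sequence Q (self_module Q) fs \<and>
      completion R \<simeq> Q Quot (Idl\<^bsub>Q\<^esub> (set fs)))"


section \<open>Tor and Betti numbers\<close>

text \<open>A matrix over the base ring with \<open>r\<close> rows and \<open>c\<close> columns acting \<open>N\<^sup>c \<rightarrow> N\<^sup>r\<close>.
  Under the canonical isomorphisms \<open>R\<^sup>b \<otimes> N = N\<^sup>b\<close> this is the map obtained by tensoring
  the map \<open>R\<^sup>c \<rightarrow> R\<^sup>r\<close> of the same matrix with \<open>N\<close>.\<close>

definition matrix_map ::
    "('a, 'b, 'm) module_scheme \<Rightarrow> nat \<Rightarrow> nat \<Rightarrow> (nat \<Rightarrow> nat \<Rightarrow> 'a) \<Rightarrow> (nat \<Rightarrow> 'b) \<Rightarrow> (nat \<Rightarrow> 'b)" where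
  "matrix_map N r c \<phi> x = (\<lambda>i\<in>{..<r}. \<Oplus>\<^bsub>N\<^esub>j\<in>{..<c}. \<phi> i j \<odot>\<^bsub>N\<^esub> x j)"

text \<open>A complex \<open>F\<close> of free modules of finite rank is given by the ranks \<open>b n\<close> of \<open>F\<^sub>n\<close> and the
  matrices \<open>\<phi> n\<close> of the differentials \<open>F\<^sub>n\<^sub>+\<^sub>1 \<rightarrow> F\<^sub>n\<close>. The next two constants are the cycles and
  the boundaries in degree \<open>n\<close> of \<open>F \<otimes> N\<close>.\<close>

definition complex_cycles ::
    "('a, 'b, 'm) module_scheme \<Rightarrow> (nat \<Rightarrow> nat) \<Rightarrow> (nat \<Rightarrow> nat \<Rightarrow> nat \<Rightarrow> 'a) \<Rightarrow> nat \<Rightarrow> (nat \<Rightarrow> 'b) set"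
  where
  "complex_cycles N b \<phi> n =
    (case n of
      0 \<Rightarrow> carrier (module_power N (b 0))
    | Suc l \<Rightarrow> {x \<in> carrier (module_power N (b (Suc l))).
               matrix_map N (b l) (b (Suc l)) (\<phi> l) x = \<zero>\<^bsub>module_power N (b l)\<^esub>})"

definition complex_boundaries ::
    "('a, 'b, 'm) module_scheme \<Rightarrow> (nat \<Rightarrow> nat) \<Rightarrow> (nat \<Rightarrow> nat \<Rightarrow> nat \<Rightarrow> 'a) \<Rightarrow> nat \<Rightarrow> (nat \<Rightarrow> 'b) set"
  where
  "complex_boundaries N b \<phi> n =
    matrix_map N (b n) (b (Suc n)) (\<phi> n) ` carrier (module_power N (b (Suc n)))"

text \<open>\<open>g j\<close> is the image in \<open>E\<close> of the \<open>j\<close>-th basis vector of \<open>F\<^sub>0\<close>.\<close>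

definition augmentation ::
    "('a, 'b, 'm) module_scheme \<Rightarrow> nat \<Rightarrow> (nat \<Rightarrow> 'b) \<Rightarrow> (nat \<Rightarrow> 'a) \<Rightarrow> 'b" where
  "augmentation E b0 g x = (\<Oplus>\<^bsub>E\<^esub>j\<in>{..<b0}. x j \<odot>\<^bsub>E\<^esub> g j)"

definition free_resolution ::
    "('a, 'r) ring_scheme \<Rightarrow> ('a, 'b, 'm) module_scheme \<Rightarrow>
     (nat \<Rightarrow> nat) \<Rightarrow> (nat \<Rightarrow> 'b) \<Rightarrow> (nat \<Rightarrow> nat \<Rightarrow> nat \<Rightarrow> 'a) \<Rightarrow> bool" where
  "free_resolution R E b g \<phi> \<longleftrightarrow>
    (\<forall>j<b 0. g j \<in> carrier E) \<and>
    (\<forall>n. \<forall>i<b n. \<forall>j<b (Suc n). \<phi> n i j \<in> carrier R) \<and>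
    augmentation E (b 0) g ` carrier (module_power (self_module R) (b 0)) = carrier E \<and>
    {x \<in> carrier (module_power (self_module R) (b 0)). augmentation E (b 0) g x = \<zero>\<^bsub>E\<^esub>}
      = complex_boundaries (self_module R) b \<phi> 0 \<and>
    (\<forall>n. complex_cycles (self_module R) b \<phi> (Suc n)
       = complex_boundaries (self_module R) b \<phi> (Suc n))"

text \<open>\<open>Tor\<^sub>n(E, N)\<close> as the homology of \<open>F \<otimes> N\<close> for a chosen resolution \<open>F\<close> of \<open>E\<close> by free modules of
  finite rank, which exists when \<open>E\<close> is finitely generated over a Noetherian ring. Up to
  isomorphism the result does not depend on the choice.\<close>

definition Tor ::
    "('a, 'r) ring_scheme \<Rightarrow> nat \<Rightarrow> ('a, 'b, 'm) module_scheme \<Rightarrow> ('a, 'c, 'k) module_scheme \<Rightarrow>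
     ('a, (nat \<Rightarrow> 'c) set) module" where
  "Tor R n E N =
    (let (b, g, \<phi>) = (SOME (b, g, \<phi>). free_resolution R E b g \<phi>) in
     quot_module ((module_power N (b n))\<lparr>carrier := complex_cycles N b \<phi> n\<rparr>)
       (complex_boundaries N b \<phi> n))"


section \<open>Numerical invariants\<close>

definition betti :: "('a, 'r) ring_scheme \<Rightarrow> ('a, 'b, 'm) module_scheme \<Rightarrow> nat \<Rightarrow> nat" where
  "betti R E n = the_enat (module_length R (Tor R n E (residue_field R)))"

text \<open>The infimum in \<^typ>\<open>enat\<close> is the minimum of the set, and \<open>\<infinity>\<close> if the set is empty.\<close>

definition complexity :: "('a, 'r) ring_scheme \<Rightarrow> ('a, 'b, 'm) module_scheme \<Rightarrow> enat" where
  "complexity R E =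
    Inf {enat m | m :: nat.
      limsup (\<lambda>n. ereal (real (betti R E n) / real n powi (int m - 1))) < \<infinity>}"

definition multiplicity_module :: "('a, 'r) ring_scheme \<Rightarrow> ('a, 'b, 'm) module_scheme \<Rightarrow> real" where
  "multiplicity_module R E =
    (let r = (THE r :: nat. module_dim R E = ereal (real r)) in
     lim (\<lambda>n. fact r *
       real (the_enat (module_length R
         (quot_module E (ideal_smult R (ideal_power R (max_ideal R) n) E)))) / real n ^ r))"

definition num_generators :: "('a, 'r) ring_scheme \<Rightarrow> ('a, 'b, 'm) module_scheme \<Rightarrow> nat" where
  "num_generators R E =
    the_enat (module_length R (quot_module E (ideal_smult R (max_ideal R) E)))"

end

theory Submission
  imports Defs "HOL-Library.Function_Algebras" "HOL-Library.Multiset" "HOL-Library.Poly_Mapping"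
    "HOL-Algebra.Free_Abelian_Groups"
begin

text \<open>
  Let \<open>k\<close> be the residue field. Suppose first that \<open>E\<close> has finite length and put \<open>\<mu> = \<mu>(E)\<close>, \<open>\<nu> = \<ell>(mE)\<close>. The long exact sequence of Tor for \<open>0 \<rightarrow> mE \<rightarrow> E \<rightarrow> k\<^sup>\<mu> \<rightarrow> 0\<close> gives
  \<open>\<mu> \<beta>\<^sub>n\<^sub>+\<^sub>1(k) \<le> \<beta>\<^sub>n\<^sub>+\<^sub>1(E) + \<nu> \<beta>\<^sub>n(k)\<close>. If \<open>\<ell>(E) < 2\<mu>\<close>, that is \<open>\<nu> < \<mu>\<close>, this recursion forces the Betti
  numbers of \<open>k\<close> to grow no faster than those of \<open>E\<close>. Hence \<open>cx(E) < cx(k)\<close> implies \<open>\<ell>(E) \<ge> 2\<mu>\<close>.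

  A maximal Cohen-Macaulay module \<open>M\<close> of dimension \<open>d\<close> is reduced to this case by dividing out \<open>d\<close>
  superficial regular elements, which changes neither \<open>e\<close> nor \<open>\<mu>\<close> up to a common factor and does not
  raise the growth of the Betti numbers. To avoid assumptions on the residue field, the elements are
  generic: \<open>\<Sum>a\<^sub>i T\<^sup>i\<close> for generators \<open>a\<^sub>i\<close> of \<open>m\<close>, acting on \<open>M \<otimes> \<int>[T]/(f)\<close> for a monic integer polynomial
  \<open>f\<close>, where \<open>\<int>[T]/(f)\<close> is free of finite rank. By McCoy's argument this element is regular on
  \<open>M[T]\<close>, and likewise on the associated graded module in high degrees. In a sequence of pairwise
  coprime monic \<open>f\<close> all but finitely many members preserve this, by the ascending chain condition.

  A module over a record ring \<open>A\<close> is handled as a pair of submodules \<open>V \<subseteq> U\<close> of a type on which a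
  type-class ring acts that maps onto \<open>A\<close>. The module is \<open>U/V\<close>, and all lengths, Betti numbers and
  multiplicities are those of pairs.
\<close>

text \<open>The recursion compares different modules along one fixed complex, so that complex has to
  resolve \<open>k\<close>, whereas the Betti numbers of \<open>M\<close> are defined by a
  resolution of \<open>M\<close>. Tor is therefore balanced, in the form of the one inequality that
  the growth argument consumes. The generic element takes the place of the last member of a regular
  sequence of length \<open>d\<close>, and the others stay regular by an exchange argument. That the
  final quotient keeps finite length is a count: otherwise a linearly bounded Hilbert function would
  grow quadratically. At the start, finite length holds because a quotient of infinite length by
  \<open>d\<close> regular elements would give a chain of primes longer than \<open>dim A\<close>
  allows. Integer polynomials act on every abelian group with an additive operator \<open>T\<close>
  and commute with all additive maps that commute with \<open>T\<close>; so one \<open>f\<close> can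
  serve all quotients of the regular sequence at once. Passing to polynomials in \<open>T\<close>
  changes the type of the elements, so the induction over \<open>d\<close> codes the new module back
  into the old type after each step.\<close>

section \<open>Subgroups stable under a set of additive operators\<close>

text \<open>Scalars enter only as a set \<open>\<Omega>\<close> of operators. Modules over
  \<open>S\<close>, over \<open>S[T]\<close> and over the Rees ring then share one theory, and
  enlarging the ring means adding operators such as multiplication by \<open>T\<close>.\<close>

definition sub :: "('x::ab_group_add \<Rightarrow> 'x) set \<Rightarrow> 'x set \<Rightarrow> bool" where
  "sub \<Omega> V \<longleftrightarrow> 0 \<in> V \<and> (\<forall>x\<in>V. \<forall>y\<in>V. x - y \<in> V) \<and> (\<forall>f\<in>\<Omega>. \<forall>x\<in>V. f x \<in> V)"

definition ssum :: "'x::ab_group_add set \<Rightarrow> 'x set \<Rightarrow> 'x set" (infixl "\<boxplus>" 65) where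
  "V \<boxplus> W = {x + y | x y. x \<in> V \<and> y \<in> W}"

definition addv :: "('x::ab_group_add \<Rightarrow> 'y::ab_group_add) \<Rightarrow> bool" where
  "addv f \<longleftrightarrow> (\<forall>x y. f (x + y) = f x + f y)"

lemma addv_add: "addv f \<Longrightarrow> f (x + y) = f x + f y"
  by (simp add: addv_def)

lemma addv_0: "addv f \<Longrightarrow> f 0 = 0"
  by (metis addv_def add_cancel_left_left)

lemma addv_minus: assumes "addv f" shows "f (- x) = - f x"
proof -
  have "f (- x) + f x = 0" using addv_add[OF assms, of "- x" x] addv_0[OF assms] by simp
  then show ?thesis by (simp add: eq_neg_iff_add_eq_0)
qed

lemma addv_diff: assumes "addv f" shows "f (x - y) = f x - f y"
  using addv_add[OF assms, of x "- y"] addv_minus[OF assms, of y] by simp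

lemma addv_sum: "addv f \<Longrightarrow> f (sum g A) = (\<Sum>i\<in>A. f (g i))"
  by (induction A rule: infinite_finite_induct) (auto simp: addv_0 addv_add)

lemma addv_comp: "addv f \<Longrightarrow> addv g \<Longrightarrow> addv (\<lambda>x. f (g x))"
  by (simp add: addv_def)

lemma addv_pow: "addv f \<Longrightarrow> addv ((f :: 'x \<Rightarrow> 'x::ab_group_add) ^^ n)"
  by (induction n) (simp_all add: addv_def)

lemma subI:
  assumes "0 \<in> V" "\<And>x y. x \<in> V \<Longrightarrow> y \<in> V \<Longrightarrow> x - y \<in> V" "\<And>f x. f \<in> \<Omega> \<Longrightarrow> x \<in> V \<Longrightarrow> f x \<in> V"
  shows "sub \<Omega> V"
  using assms by (auto simp: sub_def)

lemma sub_0: "sub \<Omega> V \<Longrightarrow> 0 \<in> V"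
  by (simp add: sub_def)

lemma sub_diff: "sub \<Omega> V \<Longrightarrow> x \<in> V \<Longrightarrow> y \<in> V \<Longrightarrow> x - y \<in> V"
  by (simp add: sub_def)

lemma sub_uminus: "sub \<Omega> V \<Longrightarrow> x \<in> V \<Longrightarrow> - x \<in> V"
  using sub_diff[of \<Omega> V 0 x] by (simp add: sub_0)

lemma sub_add: "sub \<Omega> V \<Longrightarrow> x \<in> V \<Longrightarrow> y \<in> V \<Longrightarrow> x + y \<in> V"
  using sub_diff[of \<Omega> V x "- y"] by (simp add: sub_uminus)

lemma sub_op: "sub \<Omega> V \<Longrightarrow> f \<in> \<Omega> \<Longrightarrow> x \<in> V \<Longrightarrow> f x \<in> V"
  by (simp add: sub_def)

lemma sub_sum: "sub \<Omega> V \<Longrightarrow> (\<And>i. i \<in> A \<Longrightarrow> g i \<in> V) \<Longrightarrow> sum g A \<in> V"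
  by (induction A rule: infinite_finite_induct) (auto simp: sub_0 sub_add)

lemma sub_diff_cancel: "sub \<Omega> V \<Longrightarrow> x - y \<in> V \<Longrightarrow> y \<in> V \<Longrightarrow> x \<in> V"
  using sub_add[of \<Omega> V "x - y" y] by simp

lemma sub_add_cancel: "sub \<Omega> V \<Longrightarrow> x + y \<in> V \<Longrightarrow> y \<in> V \<Longrightarrow> x \<in> V"
  using sub_diff[of \<Omega> V "x + y" y] by simp

lemma sub_Int: "sub \<Omega> V \<Longrightarrow> sub \<Omega> W \<Longrightarrow> sub \<Omega> (V \<inter> W)"
  by (auto simp: sub_def)

lemma sub_UNIV: "sub \<Omega> UNIV"
  by (auto simp: sub_def)

lemma sub_mono: "sub \<Omega>' V \<Longrightarrow> \<Omega> \<subseteq> \<Omega>' \<Longrightarrow> sub \<Omega> V"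
  by (auto simp: sub_def)

lemma ssumI: "x \<in> V \<Longrightarrow> y \<in> W \<Longrightarrow> x + y \<in> V \<boxplus> W"
  by (auto simp: ssum_def)

lemma ssumE: assumes "z \<in> V \<boxplus> W" obtains x y where "x \<in> V" "y \<in> W" "z = x + y"
  using assms by (auto simp: ssum_def)

lemma ssum_left: "0 \<in> W \<Longrightarrow> V \<subseteq> V \<boxplus> W"
  using ssumI[of _ V 0 W] by auto

lemma ssum_right: "0 \<in> V \<Longrightarrow> W \<subseteq> V \<boxplus> W"
  using ssumI[of 0 V _ W] by auto

lemma ssum_mono: "V \<subseteq> V' \<Longrightarrow> W \<subseteq> W' \<Longrightarrow> V \<boxplus> W \<subseteq> V' \<boxplus> W'"
  by (auto simp: ssum_def)

lemma ssum_least: "sub \<Omega> X \<Longrightarrow> V \<subseteq> X \<Longrightarrow> W \<subseteq> X \<Longrightarrow> V \<boxplus> W \<subseteq> X"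
  by (auto simp: ssum_def intro!: sub_add)

lemma ssum_commute: "V \<boxplus> W = W \<boxplus> V"
proof -
  have *: "V \<boxplus> W \<subseteq> W \<boxplus> V" for V W :: "'a set"
  proof
    fix z assume "z \<in> V \<boxplus> W"
    then obtain x y where "x \<in> V" "y \<in> W" "z = x + y" by (rule ssumE)
    then show "z \<in> W \<boxplus> V" using ssumI[of y W x V] by (simp add: add.commute)
  qed
  show ?thesis by (intro equalityI *)
qed

lemma ssum_assoc: "(V \<boxplus> W) \<boxplus> X = V \<boxplus> (W \<boxplus> X)"
proof
  show "(V \<boxplus> W) \<boxplus> X \<subseteq> V \<boxplus> (W \<boxplus> X)"
  proof
    fix x assume "x \<in> V \<boxplus> W \<boxplus> X"
    then obtain a b c where "a \<in> V" "b \<in> W" "c \<in> X" "x = (a + b) + c" by (auto elim!: ssumE)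
    then show "x \<in> V \<boxplus> (W \<boxplus> X)" by (simp only: add.assoc) (intro ssumI)
  qed
  show "V \<boxplus> (W \<boxplus> X) \<subseteq> (V \<boxplus> W) \<boxplus> X"
  proof
    fix x assume "x \<in> V \<boxplus> (W \<boxplus> X)"
    then obtain a b c where "a \<in> V" "b \<in> W" "c \<in> X" "x = a + (b + c)" by (auto elim!: ssumE)
    then show "x \<in> V \<boxplus> W \<boxplus> X" by (simp only: add.assoc[symmetric]) (intro ssumI)
  qed
qed

lemma ssum_absorb: "sub \<Omega> X \<Longrightarrow> V \<subseteq> X \<Longrightarrow> 0 \<in> V \<Longrightarrow> V \<boxplus> X = X"
  using ssum_least[of \<Omega> X V X] ssum_right[of V X] by auto

lemma sub_ssum:
  assumes "sub \<Omega> V" "sub \<Omega> W" "\<And>f. f \<in> \<Omega> \<Longrightarrow> addv f"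
  shows "sub \<Omega> (V \<boxplus> W)"
proof (rule subI)
  show "0 \<in> V \<boxplus> W" using ssumI[of 0 V 0 W] assms by (auto simp: sub_0)
next
  fix x y assume "x \<in> V \<boxplus> W" "y \<in> V \<boxplus> W"
  then obtain a b c d where "a \<in> V" "b \<in> W" "x = a + b" "c \<in> V" "d \<in> W" "y = c + d"
    unfolding ssum_def by blast
  moreover have "(a + b) - (c + d) = (a - c) + (b - d)" by simp
  ultimately show "x - y \<in> V \<boxplus> W" using assms by (metis ssumI sub_diff)
next
  fix f x assume "f \<in> \<Omega>" "x \<in> V \<boxplus> W"
  then obtain a b where "a \<in> V" "b \<in> W" "x = a + b" by (auto elim!: ssumE)
  then show "f x \<in> V \<boxplus> W" using assms(3)[OF \<open>f \<in> \<Omega>\<close>] sub_op[OF assms(1)] sub_op[OF assms(2)] \<open>f \<in> \<Omega>\<close> by (simp add: addv_add ssumI)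
qed

text \<open>Semilinearity between operator sets that may belong to different rings. Matching source
  operators by target operators makes preimages stable; matching in the other direction makes images
  stable.\<close>

definition itw :: "('x::ab_group_add \<Rightarrow> 'x) set \<Rightarrow> ('y::ab_group_add \<Rightarrow> 'y) set \<Rightarrow> ('x \<Rightarrow> 'y) \<Rightarrow> bool" where
  "itw \<Omega> \<Omega>' f \<longleftrightarrow> addv f \<and> (\<forall>g\<in>\<Omega>. \<exists>g'\<in>\<Omega>'. \<forall>x. f (g x) = g' (f x))
    \<and> (\<forall>g'\<in>\<Omega>'. \<exists>g\<in>\<Omega>. \<forall>x. f (g x) = g' (f x))"

definition addops :: "('x::ab_group_add \<Rightarrow> 'x) set \<Rightarrow> bool" where
  "addops \<Omega> \<longleftrightarrow> (\<forall>f\<in>\<Omega>. addv f)"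

lemma sub_ssum':
  "sub \<Omega> V \<Longrightarrow> sub \<Omega> W \<Longrightarrow> addops \<Omega> \<Longrightarrow> sub \<Omega> (V \<boxplus> W)"
  by (auto simp: addops_def intro: sub_ssum)

lemma itw_addv: "itw \<Omega> \<Omega>' f \<Longrightarrow> addv f"
  by (simp add: itw_def)

lemma itw_fwd: "itw \<Omega> \<Omega>' f \<Longrightarrow> g \<in> \<Omega> \<Longrightarrow> \<exists>g'\<in>\<Omega>'. \<forall>x. f (g x) = g' (f x)"
  unfolding itw_def by (drule conjunct2, drule conjunct1, erule bspec)

lemma itw_bwd: "itw \<Omega> \<Omega>' f \<Longrightarrow> g' \<in> \<Omega>' \<Longrightarrow> \<exists>g\<in>\<Omega>. \<forall>x. f (g x) = g' (f x)"
  unfolding itw_def by (drule conjunct2, drule conjunct2, erule bspec)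

lemma sub_image:
  assumes "sub \<Omega> V" "itw \<Omega> \<Omega>' f"
  shows "sub \<Omega>' (f ` V)"
proof (rule subI)
  show "0 \<in> f ` V" using assms(1) itw_addv[OF assms(2)] by (metis addv_0 imageI sub_0)
next
  fix x y assume "x \<in> f ` V" "y \<in> f ` V"
  then obtain a b where "a \<in> V" "b \<in> V" "x = f a" "y = f b" by auto
  then have "x - y = f (a - b)" "a - b \<in> V" using assms(1) itw_addv[OF assms(2)] by (auto simp: addv_diff sub_diff)
  then show "x - y \<in> f ` V" by auto
next
  fix g x assume g: "g \<in> \<Omega>'" "x \<in> f ` V"
  obtain h where h: "h \<in> \<Omega>" "\<forall>x. f (h x) = g (f x)"
    using itw_bwd[OF assms(2) g(1)] by (rule bexE)
  obtain v where v: "v \<in> V" "x = f v" using g(2) by auto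
  have "f (h v) = g (f v)" using h(2) by (rule spec)
  then have "g x = f (h v)" unfolding v(2) by (rule sym)
  moreover have "f (h v) \<in> f ` V" by (rule imageI[OF sub_op[OF assms(1) h(1) v(1)]])
  ultimately show "g x \<in> f ` V" by (simp only:)
qed

lemma sub_vimage:
  assumes "sub \<Omega>' V'" "sub \<Omega> U" "itw \<Omega> \<Omega>' f"
  shows "sub \<Omega> {x \<in> U. f x \<in> V'}"
proof (rule subI)
  show "0 \<in> {x \<in> U. f x \<in> V'}" using assms(1,2) itw_addv[OF assms(3)] by (auto simp: sub_0 addv_0)
next
  fix x y assume "x \<in> {x \<in> U. f x \<in> V'}" "y \<in> {x \<in> U. f x \<in> V'}"
  then show "x - y \<in> {x \<in> U. f x \<in> V'}" using assms(1,2) itw_addv[OF assms(3)] by (auto simp: sub_diff addv_diff)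
next
  fix g x assume g: "g \<in> \<Omega>" "x \<in> {x \<in> U. f x \<in> V'}"
  obtain h where h: "h \<in> \<Omega>'" "\<forall>x. f (g x) = h (f x)"
    using itw_fwd[OF assms(3) g(1)] by (rule bexE)
  have fx: "f x \<in> V'" "x \<in> U" using g(2) by auto
  have "f (g x) = h (f x)" using h(2) by (rule spec)
  then have "f (g x) \<in> V'" using sub_op[OF assms(1) h(1) fx(1)] by (simp only:)
  then show "g x \<in> {x \<in> U. f x \<in> V'}" using sub_op[OF assms(2) g(1) fx(2)] by (rule_tac CollectI) (rule conjI)
qed

subsection \<open>Length\<close>

text \<open>Only the members after \<open>V\<close> have to be submodules, and the last one may be
  smaller than \<open>U\<close>. Chains can thus be widened at both ends by plain
  inclusions.\<close>

primrec ch :: "('x::ab_group_add \<Rightarrow> 'x) set \<Rightarrow> nat \<Rightarrow> 'x set \<Rightarrow> 'x set \<Rightarrow> bool" where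
  "ch \<Omega> 0 V U \<longleftrightarrow> V \<subseteq> U"
| "ch \<Omega> (Suc n) V U \<longleftrightarrow> (\<exists>W. sub \<Omega> W \<and> V \<subset> W \<and> ch \<Omega> n W U)"

definition rlen :: "('x::ab_group_add \<Rightarrow> 'x) set \<Rightarrow> 'x set \<Rightarrow> 'x set \<Rightarrow> enat" where
  "rlen \<Omega> V U = Sup {enat n | n. ch \<Omega> n V U}"

lemma ch_subset: "ch \<Omega> n V U \<Longrightarrow> V \<subseteq> U"
  by (induction n arbitrary: V) auto

lemma ch_Suc_le: "ch \<Omega> (Suc n) V U \<Longrightarrow> ch \<Omega> n V U"
proof (induction n arbitrary: V)
  case 0
  then show ?case by auto
next
  case (Suc n)
  from Suc.prems obtain W where W: "sub \<Omega> W" "V \<subset> W" "ch \<Omega> (Suc n) W U" unfolding ch.simps(2)[of \<Omega> "Suc n"] by blast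
  from Suc.IH[OF W(3)] W show ?case unfolding ch.simps(2)[of \<Omega> n] by blast
qed

lemma ch_le: "ch \<Omega> n V U \<Longrightarrow> k \<le> n \<Longrightarrow> ch \<Omega> k V U"
proof (induction n)
  case (Suc n)
  show ?case
  proof (cases "k = Suc n")
    case False
    then show ?thesis using Suc.IH[OF ch_Suc_le[OF Suc.prems(1)]] Suc.prems(2) by simp
  qed (use Suc.prems in simp)
qed simp

lemma ch_antimono: "ch \<Omega> n W U \<Longrightarrow> V \<subseteq> W \<Longrightarrow> ch \<Omega> n V U"
proof (cases n)
  case (Suc k)
  assume "ch \<Omega> n W U" "V \<subseteq> W"
  then obtain X where "sub \<Omega> X" "W \<subset> X" "ch \<Omega> k X U" using Suc by auto
  moreover have "V \<subset> X" using \<open>W \<subset> X\<close> \<open>V \<subseteq> W\<close> by (rule subset_psubset_trans[rotated])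
  ultimately show ?thesis using Suc by auto
qed auto

lemma ch_mono: "ch \<Omega> n V U \<Longrightarrow> U \<subseteq> U' \<Longrightarrow> ch \<Omega> n V U'"
  by (induction n arbitrary: V) auto

lemma ch_trans: "ch \<Omega> i V W \<Longrightarrow> ch \<Omega> j W U \<Longrightarrow> ch \<Omega> (i + j) V U"
proof (induction i arbitrary: V)
  case 0
  then show ?case by (auto intro: ch_antimono)
next
  case (Suc i)
  from Suc.prems(1) obtain X where "sub \<Omega> X" "V \<subset> X" "ch \<Omega> i X W" by auto
  with Suc.IH[OF this(3) Suc.prems(2)] show ?case by auto
qed

text \<open>Chains can be shortened, so every finite number below the supremum is the length of a
  chain. Together with \<open>enat_le_iffI\<close> this turns inequalities between lengths, infinite
  ones included, into constructions of finite chains.\<close>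

lemma le_rlen_iff: assumes "V \<subseteq> U" shows "enat k \<le> rlen \<Omega> V U \<longleftrightarrow> ch \<Omega> k V U"
proof
  assume "ch \<Omega> k V U" then show "enat k \<le> rlen \<Omega> V U"
    unfolding rlen_def by (intro Sup_upper) auto
next
  assume *: "enat k \<le> rlen \<Omega> V U"
  show "ch \<Omega> k V U"
  proof (cases k)
    case 0 then show ?thesis using assms by simp
  next
    case (Suc j)
    then have "enat j < rlen \<Omega> V U" using * by (metis Suc_ile_eq)
    then obtain n where "ch \<Omega> n V U" "enat j < enat n" unfolding rlen_def less_Sup_iff by auto
    then show ?thesis using Suc ch_le by (metis Suc_leI enat_ord_simps(2))
  qed
qed

lemma enat_le_iffI:
  fixes a b :: enat assumes "\<And>k. enat k \<le> a \<Longrightarrow> enat k \<le> b" shows "a \<le> b"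
proof (cases b)
  case (enat n)
  show ?thesis
  proof (rule ccontr)
    assume "\<not> a \<le> b"
    then have "enat (Suc n) \<le> a" using enat by (simp add: Suc_ile_eq)
    then have "enat (Suc n) \<le> b" by (rule assms)
    then show False using enat by simp
  qed
qed auto

lemma enat_le_addD:
  fixes a b :: enat assumes "enat k \<le> a + b"
  shows "\<exists>i j. k = i + j \<and> enat i \<le> a \<and> enat j \<le> b"
proof (cases a)
  case (enat n)
  show ?thesis
  proof (cases "k \<le> n")
    case True then show ?thesis using enat by (intro exI[of _ k] exI[of _ 0]) (auto simp: zero_enat_def[symmetric])
  next
    case False
    then have "enat (k - n) \<le> b" using assms enat by (cases b) auto
    then show ?thesis using False enat by (intro exI[of _ n] exI[of _ "k - n"]) auto
  qed
next
  case infinity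
  then show ?thesis by (intro exI[of _ k] exI[of _ 0]) (auto simp: zero_enat_def[symmetric])
qed

lemma modular_strict:
  assumes "sub \<Omega> V" "sub \<Omega> V'" "V \<subseteq> V'" "V' \<inter> W \<subseteq> V \<inter> W" "V' \<boxplus> W \<subseteq> V \<boxplus> W" "0 \<in> W"
  shows "V' \<subseteq> V"
proof
  fix x assume x: "x \<in> V'"
  then have "x \<in> V \<boxplus> W" using assms ssum_left by blast
  then obtain v w where vw: "v \<in> V" "w \<in> W" "x = v + w" by (rule ssumE)
  then have "w = x - v" by simp
  then have "w \<in> V" using vw x assms by (metis IntD1 IntI sub_diff subsetD)
  then show "x \<in> V" using vw assms sub_add by blast
qed

text \<open>By \<open>modular_strict\<close> a strict inclusion stays strict after intersecting with
  \<open>W\<close> or after adding \<open>W\<close>, so each step is credited to one of two chains.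
  This is the harder half of the additivity of length.\<close>

lemma ch_split:
  assumes "ch \<Omega> n V U" "sub \<Omega> V" "sub \<Omega> W" "\<And>f. f \<in> \<Omega> \<Longrightarrow> addv f"
  shows "\<exists>i j. i + j = n \<and> ch \<Omega> i (V \<inter> W) (U \<inter> W) \<and> ch \<Omega> j (V \<boxplus> W) (U \<boxplus> W)"
  using assms(1,2)
proof (induction n arbitrary: V)
  case 0
  then show ?case using ssum_mono[of V U W W] by auto
next
  case (Suc n)
  then obtain V' where V': "sub \<Omega> V'" "V \<subset> V'" "ch \<Omega> n V' U" by auto
  from Suc.IH[OF V'(3,1)] obtain i j where ij: "i + j = n" "ch \<Omega> i (V' \<inter> W) (U \<inter> W)"
     "ch \<Omega> j (V' \<boxplus> W) (U \<boxplus> W)" by auto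
  have m: "V \<inter> W \<subseteq> V' \<inter> W" "V \<boxplus> W \<subseteq> V' \<boxplus> W" using V' ssum_mono[of V V' W W] by auto
  show ?case
  proof (cases "V' \<inter> W \<subseteq> V \<inter> W")
    case True
    then have "\<not> V' \<boxplus> W \<subseteq> V \<boxplus> W" using modular_strict[of \<Omega> V V' W] V' Suc.prems assms(3)
      by (auto simp: sub_0)
    then have "V \<boxplus> W \<subset> V' \<boxplus> W" using m by auto
    moreover have "sub \<Omega> (V' \<boxplus> W)" using sub_ssum V'(1) assms by blast
    ultimately have "ch \<Omega> (Suc j) (V \<boxplus> W) (U \<boxplus> W)" using ij by auto
    moreover have "ch \<Omega> i (V \<inter> W) (U \<inter> W)" using ij(2) m(1) ch_antimono by blast
    ultimately show ?thesis using ij by (metis add_Suc_right)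
  next
    case False
    then have "V \<inter> W \<subset> V' \<inter> W" using m(1) by (simp only: psubset_eq) blast
    then have "ch \<Omega> (Suc i) (V \<inter> W) (U \<inter> W)" using ij(2) sub_Int[OF V'(1) assms(3)]
      by (simp only: ch.simps) blast
    moreover have "ch \<Omega> j (V \<boxplus> W) (U \<boxplus> W)" using ij(3) m(2) ch_antimono by blast
    ultimately show ?thesis using ij by (metis add_Suc)
  qed
qed

lemma rlen_add:
  assumes "sub \<Omega> V" "sub \<Omega> W" "sub \<Omega> U" "\<And>f. f \<in> \<Omega> \<Longrightarrow> addv f" "V \<subseteq> W" "W \<subseteq> U"
  shows "rlen \<Omega> V U = rlen \<Omega> V W + rlen \<Omega> W U"
proof (rule antisym)
  show "rlen \<Omega> V U \<le> rlen \<Omega> V W + rlen \<Omega> W U"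
  proof (rule enat_le_iffI)
    fix k assume "enat k \<le> rlen \<Omega> V U"
    then have "ch \<Omega> k V U" using assms le_rlen_iff by (metis order_trans)
    then obtain i j where "i + j = k" "ch \<Omega> i (V \<inter> W) (U \<inter> W)" "ch \<Omega> j (V \<boxplus> W) (U \<boxplus> W)"
      using ch_split assms by blast
    moreover have "V \<inter> W = V" "U \<inter> W = W" using assms by auto
    moreover have "V \<boxplus> W = W" "U \<boxplus> W = U"
      using ssum_absorb[OF assms(2,5)] ssum_absorb[OF assms(3,6)] assms by (auto simp: sub_0 ssum_commute)
    ultimately have "enat i \<le> rlen \<Omega> V W" "enat j \<le> rlen \<Omega> W U" "k = i + j"
      using assms by (auto simp: le_rlen_iff)
    then show "enat k \<le> rlen \<Omega> V W + rlen \<Omega> W U" by (metis add_mono plus_enat_simps(1))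
  qed
next
  show "rlen \<Omega> V W + rlen \<Omega> W U \<le> rlen \<Omega> V U"
  proof (rule enat_le_iffI)
    fix k assume "enat k \<le> rlen \<Omega> V W + rlen \<Omega> W U"
    then obtain i j where "k = i + j" "enat i \<le> rlen \<Omega> V W" "enat j \<le> rlen \<Omega> W U"
      using enat_le_addD by blast
    then have "ch \<Omega> k V U" using assms by (auto simp: le_rlen_iff intro: ch_trans)
    then show "enat k \<le> rlen \<Omega> V U" using assms by (metis le_rlen_iff order_trans)
  qed
qed

lemma rlen_mono: assumes "V \<subseteq> U" "V' \<subseteq> V" "U \<subseteq> U'" shows "rlen \<Omega> V U \<le> rlen \<Omega> V' U'"
proof (rule enat_le_iffI)
  fix k assume "enat k \<le> rlen \<Omega> V U"
  then have "ch \<Omega> k V U" using assms le_rlen_iff by blast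
  then have "ch \<Omega> k V' U'" using assms ch_mono ch_antimono by blast
  then show "enat k \<le> rlen \<Omega> V' U'" using assms by (subst le_rlen_iff) auto
qed

lemma rlen_eq0: "U \<subseteq> V \<Longrightarrow> rlen \<Omega> V U = 0"
proof -
  assume "U \<subseteq> V"
  then have "ch \<Omega> n V U \<Longrightarrow> n = 0" for n by (cases n) (auto dest: ch_subset)
  then have "{enat n | n. ch \<Omega> n V U} \<subseteq> {0}" by (auto simp: zero_enat_def)
  then show ?thesis unfolding rlen_def using Sup_mono[of "{enat n | n. ch \<Omega> n V U}" "{0}"] by fastforce
qed

lemma rlen_ge1: "V \<subset> U \<Longrightarrow> sub \<Omega> U \<Longrightarrow> 1 \<le> rlen \<Omega> V U"
  using le_rlen_iff[of V U 1 \<Omega>] by (auto simp: one_enat_def)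

text \<open>\<open>f\<close> induces an injection from \<open>U/V\<close> to \<open>U'/V'\<close>.\<close>

lemma rlen_le_inj:
  assumes f: "itw \<Omega> \<Omega>' f" and ad: "addops \<Omega>'"
    and "sub \<Omega> V" "sub \<Omega>' V'" "sub \<Omega>' U'" "f ` U \<subseteq> U'" "V' \<subseteq> U'" "V \<subseteq> U"
    and ker: "\<And>x. x \<in> U \<Longrightarrow> f x \<in> V' \<Longrightarrow> x \<in> V"
  shows "rlen \<Omega> V U \<le> rlen \<Omega>' V' U'"
proof (rule enat_le_iffI)
  have af: "addv f" by (rule itw_addv[OF f])
  fix k assume "enat k \<le> rlen \<Omega> V U"
  then have k: "ch \<Omega> k V U" by (simp only: le_rlen_iff[OF assms(8)])
  \<comment> \<open>Chains are pushed forward by taking images and adding \<open>V'\<close>. Steps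
    stay strict because an element whose image falls into \<open>V'\<close> lies in
    \<open>V\<close>, which every member of the chain contains.\<close>
  have "ch \<Omega>' n (f ` W \<boxplus> V') U'" if "ch \<Omega> n W U" "V \<subseteq> W" "sub \<Omega> W" for n W
    using that
  proof (induction n arbitrary: W)
    case 0
    then show ?case using assms(5,6,7) ssum_least[of \<Omega>' U' "f ` W" V'] by auto
  next
    case (Suc n)
    then obtain W2 where W2: "sub \<Omega> W2" "W \<subset> W2" "ch \<Omega> n W2 U" by auto
    have W2U: "W2 \<subseteq> U" using W2(3) by (rule ch_subset)
    have 1: "ch \<Omega>' n (f ` W2 \<boxplus> V') U'" using Suc W2 by auto
    have 2: "sub \<Omega>' (f ` W2 \<boxplus> V')"
      by (intro sub_ssum' sub_image[OF W2(1) f] assms)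
    obtain x where x: "x \<in> W2" "x \<notin> W" using W2 by auto
    have "f x \<notin> f ` W \<boxplus> V'"
    proof
      assume "f x \<in> f ` W \<boxplus> V'"
      then obtain w v where wv: "w \<in> W" "v \<in> V'" "f x = f w + v" by (auto elim!: ssumE)
      then have "f (x - w) \<in> V'" by (simp add: addv_diff[OF af])
      moreover have "x - w \<in> W2" using x wv W2 by (auto intro!: sub_diff)
      ultimately have "x - w \<in> W" using ker W2U Suc.prems by auto
      then show False using wv x Suc.prems sub_diff_cancel by blast
    qed
    moreover have "f x \<in> f ` W2 \<boxplus> V'" using x ssum_left[of V' "f ` W2"] assms(4) by (auto simp: sub_0)
    moreover have "f ` W \<boxplus> V' \<subseteq> f ` W2 \<boxplus> V'" using W2 by (intro ssum_mono) auto
    ultimately have "f ` W \<boxplus> V' \<subset> f ` W2 \<boxplus> V'" by blast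
    then show ?case using 1 2 by auto
  qed
  from this[OF k _ assms(3)] have "ch \<Omega>' k (f ` V \<boxplus> V') U'" by simp
  moreover have "V' \<subseteq> f ` V \<boxplus> V'" using assms(3) af by (intro ssum_right) (metis addv_0 imageI sub_0)
  ultimately show "enat k \<le> rlen \<Omega>' V' U'" using assms(7) ch_antimono by (metis le_rlen_iff)
qed

text \<open>\<open>f\<close> induces a surjection from \<open>U/V\<close> to \<open>U'/V'\<close>.\<close>

lemma rlen_le_surj:
  assumes f: "itw \<Omega> \<Omega>' f" and "sub \<Omega> U" "sub \<Omega>' V'" "U' \<subseteq> f ` U \<boxplus> V'" "f ` V \<subseteq> V'" "V \<subseteq> U"
  shows "rlen \<Omega>' V' U' \<le> rlen \<Omega> V U"
proof (cases "V' \<subseteq> U'")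
  case False
  then have "\<not> ch \<Omega>' n V' U'" for n using ch_subset by blast
  then have "{enat n | n. ch \<Omega>' n V' U'} = {}" by auto
  then have "rlen \<Omega>' V' U' = 0" by (simp add: rlen_def Sup_enat_def)
  then show ?thesis by simp
next
  case True
  show ?thesis
  proof (rule enat_le_iffI)
    have af: "addv f" by (rule itw_addv[OF f])
    fix k assume "enat k \<le> rlen \<Omega>' V' U'"
    then have k: "ch \<Omega>' k V' U'" using True le_rlen_iff by blast
    \<comment> \<open>Chains are pulled back; surjectivity modulo \<open>V'\<close> supplies an
      element of \<open>U\<close> that witnesses each strict step.\<close>
    have "ch \<Omega> n {x \<in> U. f x \<in> W} U" if "ch \<Omega>' n W U'" "V' \<subseteq> W" "sub \<Omega>' W" for n W
      using that
    proof (induction n arbitrary: W)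
      case 0
      then show ?case by auto
    next
      case (Suc n)
      then obtain W2 where W2: "sub \<Omega>' W2" "W \<subset> W2" "ch \<Omega>' n W2 U'" by auto
      have 1: "ch \<Omega> n {x \<in> U. f x \<in> W2} U" using Suc W2 by auto
      have 2: "sub \<Omega> {x \<in> U. f x \<in> W2}" by (rule sub_vimage[OF W2(1) assms(2) f])
      obtain y where y: "y \<in> W2" "y \<notin> W" using W2 by auto
      then have "y \<in> U'" using W2(3) ch_subset by blast
      then obtain u v where uv: "u \<in> U" "v \<in> V'" "y = f u + v" using assms(4) by (auto elim!: ssumE dest!: subsetD)
      have "f u \<in> W2" using uv y W2 Suc.prems sub_add_cancel by blast
      moreover have "f u \<notin> W" using uv y Suc.prems sub_add by blast
      ultimately have "{x \<in> U. f x \<in> W} \<subset> {x \<in> U. f x \<in> W2}" using uv W2 by blast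
      then show ?case using 1 2 by auto
    qed
    from this[OF k _ assms(3)] have "ch \<Omega> k {x \<in> U. f x \<in> V'} U" by simp
    then have "ch \<Omega> k V U" using assms(5,6) by (auto intro: ch_antimono)
    then show "enat k \<le> rlen \<Omega> V U" using assms(6) by (metis le_rlen_iff)
  qed
qed

subsection \<open>Chain conditions\<close>

definition noeth :: "('x::ab_group_add \<Rightarrow> 'x) set \<Rightarrow> 'x set \<Rightarrow> 'x set \<Rightarrow> bool" where
  "noeth \<Omega> C E \<longleftrightarrow> (\<forall>S::nat \<Rightarrow> 'x set.
     (\<forall>n. sub \<Omega> (S n) \<and> C \<subseteq> S n \<and> S n \<subseteq> E \<and> S n \<subseteq> S (Suc n)) \<longrightarrow> (\<exists>N. \<forall>n\<ge>N. S n = S N))"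

lemma noethD:
  assumes "noeth \<Omega> C E" "\<And>n. sub \<Omega> (S n)" "\<And>n. C \<subseteq> S n" "\<And>n. S n \<subseteq> E" "\<And>n. S n \<subseteq> S (Suc n)"
  obtains N where "\<And>n. n \<ge> N \<Longrightarrow> S n = S N"
  using assms unfolding noeth_def by blast

lemma noeth_mono: "noeth \<Omega> C E \<Longrightarrow> C \<subseteq> C' \<Longrightarrow> E' \<subseteq> E \<Longrightarrow> \<Omega> \<subseteq> \<Omega>' \<Longrightarrow> noeth \<Omega>' C' E'"
proof -
  assume a: "noeth \<Omega> C E" "C \<subseteq> C'" "E' \<subseteq> E" "\<Omega> \<subseteq> \<Omega>'"
  show "noeth \<Omega>' C' E'"
    unfolding noeth_def
  proof (intro allI impI)
    fix S assume S: "\<forall>n. sub \<Omega>' (S n) \<and> C' \<subseteq> S n \<and> S n \<subseteq> E' \<and> S n \<subseteq> S (Suc n)"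
    have "sub \<Omega> (S n)" "C \<subseteq> S n" "S n \<subseteq> E" "S n \<subseteq> S (Suc n)" for n
    proof -
      have b: "sub \<Omega>' (S n)" "C' \<subseteq> S n" "S n \<subseteq> E'" "S n \<subseteq> S (Suc n)" using S by auto
      show "sub \<Omega> (S n)" by (rule sub_mono[OF b(1) a(4)])
      show "C \<subseteq> S n" "S n \<subseteq> E" "S n \<subseteq> S (Suc n)" using b a by auto
    qed
    then have P: "\<forall>n. sub \<Omega> (S n) \<and> C \<subseteq> S n \<and> S n \<subseteq> E \<and> S n \<subseteq> S (Suc n)" by simp
    show "\<exists>N. \<forall>n\<ge>N. S n = S N" by (rule a(1)[unfolded noeth_def, THEN spec[of _ S], THEN mp, OF P])
  qed
qed

text \<open>The form in which the chain condition is mostly used: maximal proper submodules, largest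
  finitely generated submodules and prime ideals are all found as maximal members of a
  family.\<close>

lemma noeth_max:
  assumes "noeth \<Omega> C E" "F \<noteq> {}" "\<And>W. W \<in> F \<Longrightarrow> sub \<Omega> W \<and> C \<subseteq> W \<and> W \<subseteq> E"
  shows "\<exists>W\<in>F. \<forall>W'\<in>F. W \<subseteq> W' \<longrightarrow> W' = W"
proof (rule ccontr)
  assume "\<not> ?thesis"
  then have "\<forall>W\<in>F. \<exists>W'\<in>F. W \<subset> W'" by blast
  then obtain g where g: "\<And>W. W \<in> F \<Longrightarrow> g W \<in> F \<and> W \<subset> g W" by metis
  obtain W0 where W0: "W0 \<in> F" using assms(2) by auto
  define S where "S n = (g ^^ n) W0" for n
  have SF: "S n \<in> F" for n by (induction n) (auto simp: S_def W0 g)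
  have Ss: "S n \<subset> S (Suc n)" for n using g[OF SF[of n]] by (simp add: S_def)
  obtain N where "\<And>n. n \<ge> N \<Longrightarrow> S n = S N"
    by (rule noethD[OF assms(1), of S]) (use assms(3) SF Ss in blast)+
  then show False using Ss[of N] by (metis le_SucI order_refl psubset_eq)
qed

lemma noeth_ext:
  assumes "noeth \<Omega> C D" "noeth \<Omega> D E" "sub \<Omega> D" "sub \<Omega> E" "C \<subseteq> D" "D \<subseteq> E" "addops \<Omega>"
  shows "noeth \<Omega> C E"
  unfolding noeth_def
proof (intro allI impI)
  fix S :: "nat \<Rightarrow> 'a set"
  assume S: "\<forall>n. sub \<Omega> (S n) \<and> C \<subseteq> S n \<and> S n \<subseteq> E \<and> S n \<subseteq> S (Suc n)"
  have mono: "n \<le> m \<Longrightarrow> S n \<subseteq> S m" for n m using S by (metis lift_Suc_mono_le)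
  obtain N1 where N1: "\<And>n. n \<ge> N1 \<Longrightarrow> S n \<inter> D = S N1 \<inter> D"
    by (rule noethD[OF assms(1), of "\<lambda>n. S n \<inter> D"]) (use S assms in \<open>auto intro!: sub_Int\<close>)
  have z: "0 \<in> S n" "0 \<in> D" for n using S assms sub_0 by blast+
  obtain N2 where N2: "\<And>n. n \<ge> N2 \<Longrightarrow> S n \<boxplus> D = S N2 \<boxplus> D"
  proof (rule noethD[OF assms(2), of "\<lambda>n. S n \<boxplus> D"])
    fix n
    show "sub \<Omega> (S n \<boxplus> D)" using S assms by (auto intro: sub_ssum')
    show "D \<subseteq> S n \<boxplus> D" using z by (intro ssum_right)
    show "S n \<boxplus> D \<subseteq> E" using S assms by (intro ssum_least[of \<Omega>]) auto
    show "S n \<boxplus> D \<subseteq> S (Suc n) \<boxplus> D" using S by (intro ssum_mono) auto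
  qed metis
  let ?N = "max N1 N2"
  have "S n = S ?N" if "n \<ge> ?N" for n
  proof
    show "S ?N \<subseteq> S n" using mono that by blast
    show "S n \<subseteq> S ?N"
    proof (rule modular_strict[of \<Omega> _ _ D])
      show "S n \<inter> D \<subseteq> S ?N \<inter> D" using N1[of n] N1[of ?N] that by simp
      show "S n \<boxplus> D \<subseteq> S ?N \<boxplus> D" using N2[of n] N2[of ?N] that by simp
    qed (use S z mono that in auto)
  qed
  then show "\<exists>N. \<forall>n\<ge>N. S n = S N" by blast
qed

lemma noeth_image:
  assumes "noeth \<Omega> C E" "itw \<Omega> \<Omega>' f" "sub \<Omega> E" "C \<subseteq> E" "f ` C \<subseteq> C'" "E' \<subseteq> f ` E \<boxplus> C'"
  shows "noeth \<Omega>' C' E'"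
  unfolding noeth_def
proof (intro allI impI)
  fix S assume S: "\<forall>n. sub \<Omega>' (S n) \<and> C' \<subseteq> S n \<and> S n \<subseteq> E' \<and> S n \<subseteq> S (Suc n)"
  have Sn: "sub \<Omega>' (S n)" "C' \<subseteq> S n" "S n \<subseteq> E'" "S n \<subseteq> S (Suc n)" for n using S by simp_all
  obtain N where N: "\<And>n. n \<ge> N \<Longrightarrow> {x \<in> E. f x \<in> S n} = {x \<in> E. f x \<in> S N}"
  proof (rule noethD[OF assms(1), of "\<lambda>n. {x \<in> E. f x \<in> S n}"])
    fix n
    show "sub \<Omega> {x \<in> E. f x \<in> S n}" by (rule sub_vimage[OF Sn(1) assms(3,2)])
    show "C \<subseteq> {x \<in> E. f x \<in> S n}" using Sn(2)[of n] assms(4,5) by auto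
    show "{x \<in> E. f x \<in> S n} \<subseteq> {x \<in> E. f x \<in> S (Suc n)}" using Sn(4)[of n] by auto
  qed auto
  have "S n = f ` {x \<in> E. f x \<in> S n} \<boxplus> C'" for n
  proof
    show "S n \<subseteq> f ` {x \<in> E. f x \<in> S n} \<boxplus> C'"
    proof
      fix y assume y: "y \<in> S n"
      then have "y \<in> f ` E \<boxplus> C'" using Sn(3)[of n] assms(6) by (meson subsetD)
      then obtain w v where wv: "w \<in> f ` E" "v \<in> C'" "y = w + v" by (rule ssumE)
      then obtain u where uv: "u \<in> E" "v \<in> C'" "y = f u + v" by blast
      have "v \<in> S n" using uv Sn(2)[of n] by (meson subsetD)
      then have "f u \<in> S n" using y uv(3) sub_add_cancel[OF Sn(1)[of n], of "f u" v] by simp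
      then show "y \<in> f ` {x \<in> E. f x \<in> S n} \<boxplus> C'" using uv by (auto intro!: ssumI)
    qed
    show "f ` {x \<in> E. f x \<in> S n} \<boxplus> C' \<subseteq> S n" using Sn(1,2)[of n] by (intro ssum_least[of \<Omega>']) auto
  qed
  note eq = this
  have st: "S n = S N" if "n \<ge> N" for n
    by (rule trans[OF eq[of n] trans[OF _ eq[of N, symmetric]]]) (simp only: N[OF that])
  show "\<exists>N. \<forall>n\<ge>N. S n = S N" by (rule exI[of _ N], intro allI impI, rule st)
qed

text \<open>\<open>elow y E0 i\<close> collects the polynomials in \<open>y\<close> of degree below
  \<open>i\<close> with coefficients in \<open>E0\<close>, and \<open>padj\<close> below is their
  union \<open>E0[y]\<close>. The powers of \<open>y\<close> need not be independent, so leading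
  coefficients are not unique in general.\<close>

primrec elow :: "('x::ab_group_add \<Rightarrow> 'x) \<Rightarrow> 'x set \<Rightarrow> nat \<Rightarrow> 'x set" where
  "elow y E0 0 = {0}"
| "elow y E0 (Suc i) = elow y E0 i \<boxplus> (y ^^ i) ` E0"

definition padj :: "('x::ab_group_add \<Rightarrow> 'x) \<Rightarrow> 'x set \<Rightarrow> 'x set" where
  "padj y E0 = (\<Union>i. elow y E0 i)"

context
  fixes \<Omega> :: "('x::ab_group_add \<Rightarrow> 'x) set" and y and E0 :: "'x set"
  assumes ad: "addops \<Omega>" and ay: "addv y" and comm: "\<And>f x. f \<in> \<Omega> \<Longrightarrow> f (y x) = y (f x)"
    and E0: "sub \<Omega> E0"
begin

lemma comm_pow: "f \<in> \<Omega> \<Longrightarrow> f ((y ^^ i) x) = (y ^^ i) (f x)"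
proof (induction i)
  case (Suc i)
  have "f (y ((y ^^ i) x)) = y (f ((y ^^ i) x))" by (rule comm[OF Suc.prems])
  then show ?case using Suc.IH[OF Suc.prems] by simp
qed simp

lemma sub_ypow: "sub \<Omega> ((y ^^ i) ` E0)"
proof (rule subI)
  show "0 \<in> (y ^^ i) ` E0" using E0 addv_0[OF addv_pow[OF ay]] sub_0 by (metis imageI)
  show "u - v \<in> (y ^^ i) ` E0" if uv: "u \<in> (y ^^ i) ` E0" "v \<in> (y ^^ i) ` E0" for u v
  proof -
    obtain a b where "a \<in> E0" "b \<in> E0" "u = (y ^^ i) a" "v = (y ^^ i) b" using uv by auto
    then have *: "u - v = (y ^^ i) (a - b)" "a - b \<in> E0" using E0 by (simp_all add: addv_diff[OF addv_pow[OF ay]] sub_diff)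
    show ?thesis unfolding *(1) by (rule imageI[OF *(2)])
  qed
  show "f u \<in> (y ^^ i) ` E0" if "f \<in> \<Omega>" "u \<in> (y ^^ i) ` E0" for f u
  proof -
    obtain a where a: "a \<in> E0" "u = (y ^^ i) a" using \<open>u \<in> (y ^^ i) ` E0\<close> by (rule imageE)
    have "f u = (y ^^ i) (f a)" unfolding a(2) by (rule comm_pow[OF \<open>f \<in> \<Omega>\<close>])
    then show ?thesis using imageI[OF sub_op[OF E0 \<open>f \<in> \<Omega>\<close> a(1)], of "y ^^ i"] by (simp only:)
  qed
qed

lemma sub_elow: "sub \<Omega> (elow y E0 i)"
proof (induction i)
  case 0
  then show ?case using ad by (auto simp: sub_def addops_def addv_0)
next
  case (Suc i)
  then show ?case by (simp add: sub_ssum' sub_ypow ad)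
qed

lemma elow_Suc: "elow y E0 i \<subseteq> elow y E0 (Suc i)"
  using ssum_left[of "(y ^^ i) ` E0" "elow y E0 i"] sub_0[OF sub_ypow] by auto

lemma elow_mono: "i \<le> j \<Longrightarrow> elow y E0 i \<subseteq> elow y E0 j"
  by (rule lift_Suc_mono_le[of "elow y E0", OF elow_Suc])

lemma y_elow: "x \<in> elow y E0 i \<Longrightarrow> y x \<in> elow y E0 (Suc i)"
proof (induction i arbitrary: x)
  case 0
  then show ?case using sub_0[OF sub_elow[of 1]] by (auto simp: addv_0[OF ay])
next
  case (Suc i)
  then obtain l u where lu: "l \<in> elow y E0 i" "u \<in> E0" "x = l + (y ^^ i) u" by (auto elim!: ssumE)
  then have "y x = y l + (y ^^ Suc i) u" by (simp add: addv_add[OF ay])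
  then show ?case using Suc.IH[OF lu(1)] lu(2) by (subst elow.simps(2)) (auto intro!: ssumI)
qed

lemma sub_padj: "sub (insert y \<Omega>) (padj y E0)"
proof (rule subI)
  show "0 \<in> padj y E0" unfolding padj_def by (auto intro!: exI[of _ 0])
  show "u - v \<in> padj y E0" if uv: "u \<in> padj y E0" "v \<in> padj y E0" for u v
  proof -
    obtain i j where "u \<in> elow y E0 i" "v \<in> elow y E0 j" using uv by (auto simp: padj_def)
    then have "u \<in> elow y E0 (max i j)" "v \<in> elow y E0 (max i j)"
      using elow_mono max.cobounded1 max.cobounded2 by blast+
    then show ?thesis unfolding padj_def using sub_diff[OF sub_elow] by blast
  qed
  show "f u \<in> padj y E0" if "f \<in> insert y \<Omega>" "u \<in> padj y E0" for f u
    using that sub_op[OF sub_elow] y_elow unfolding padj_def by blast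
qed

lemma padj_base: "E0 \<subseteq> padj y E0"
proof
  fix x assume "x \<in> E0"
  then have "0 + x \<in> elow y E0 (Suc 0)" using ssumI[of 0 "{0}" x E0] by simp
  then show "x \<in> padj y E0" unfolding padj_def by (metis UN_I UNIV_I add_0)
qed

text \<open>Hilbert's basis theorem: the leading coefficients of a chain of submodules form a doubly
  indexed increasing family of submodules of \<open>E0\<close>.\<close>

lemma noeth_padj:
  assumes N: "noeth \<Omega> C E0" and yC: "y ` C \<subseteq> C" and CE: "C \<subseteq> E0"
  shows "noeth (insert y \<Omega>) C (padj y E0)"
  unfolding noeth_def
proof (intro allI impI)
  fix S :: "nat \<Rightarrow> 'x set"
  assume S: "\<forall>n. sub (insert y \<Omega>) (S n) \<and> C \<subseteq> S n \<and> S n \<subseteq> padj y E0 \<and> S n \<subseteq> S (Suc n)"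
  show "\<exists>N. \<forall>n\<ge>N. S n = S N"
  proof -
    \<comment> \<open>All possible coefficients of \<open>y^i\<close> in elements of
      \<open>S n\<close> of degree at most \<open>i\<close>.\<close>
    define L where "L i n = {u \<in> E0. \<exists>l\<in>elow y E0 i. (y ^^ i) u + l \<in> S n}" for i n
    have Ssub: "sub \<Omega> (S n)" for n using S by (meson sub_mono subset_insertI)
    have Sy: "x \<in> S n \<Longrightarrow> y x \<in> S n" for x n using S by (meson insertI1 sub_op)
    have yiC: "x \<in> C \<Longrightarrow> (y ^^ i) x \<in> C" for x i using yC by (induction i) auto
    have L1: "sub \<Omega> (L i n)" for i n
    proof (rule subI)
      show "0 \<in> L i n" unfolding L_def using sub_0[OF E0] sub_0[OF sub_elow] sub_0[OF Ssub]
        by (auto simp: addv_0[OF addv_pow[OF ay]] intro!: bexI[of _ 0])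
      show "u - v \<in> L i n" if "u \<in> L i n" "v \<in> L i n" for u v
      proof -
        obtain l l' where l: "l \<in> elow y E0 i" "(y ^^ i) u + l \<in> S n" "l' \<in> elow y E0 i" "(y ^^ i) v + l' \<in> S n"
          using \<open>u \<in> L i n\<close> \<open>v \<in> L i n\<close> by (auto simp: L_def)
        have "(y ^^ i) (u - v) + (l - l') = ((y ^^ i) u + l) - ((y ^^ i) v + l')"
          by (simp add: addv_diff[OF addv_pow[OF ay]])
        then have "(y ^^ i) (u - v) + (l - l') \<in> S n" using sub_diff[OF Ssub l(2) l(4)] by (simp only:)
        then show ?thesis unfolding L_def using that sub_diff[OF E0] sub_diff[OF sub_elow] l by (auto simp: L_def)
      qed
      show "f u \<in> L i n" if "f \<in> \<Omega>" "u \<in> L i n" for f u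
      proof -
        obtain l where l: "l \<in> elow y E0 i" "(y ^^ i) u + l \<in> S n" using \<open>u \<in> L i n\<close> by (auto simp: L_def)
        have "f ((y ^^ i) u + l) = (y ^^ i) (f u) + f l"
          using addv_add[of f "(y ^^ i) u" l] comm_pow[OF \<open>f \<in> \<Omega>\<close>, of i u] ad \<open>f \<in> \<Omega>\<close> by (simp add: addops_def)
        then have "(y ^^ i) (f u) + f l \<in> S n" using sub_op[OF Ssub \<open>f \<in> \<Omega>\<close> l(2)] by simp
        then show ?thesis unfolding L_def using that sub_op[OF E0 \<open>f \<in> \<Omega>\<close>, of u] sub_op[OF sub_elow \<open>f \<in> \<Omega>\<close> l(1)] l by (auto simp: L_def)
      qed
    qed
    have L2: "C \<subseteq> L i n" for i n
      unfolding L_def using CE yiC S sub_0[OF sub_elow] by (force intro!: bexI[of _ 0])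
    have L3: "L i n \<subseteq> E0" for i n unfolding L_def by auto
    have L4: "L i n \<subseteq> L i (Suc n)" for i n unfolding L_def using S by blast
    have L5: "L i n \<subseteq> L (Suc i) n" for i n
    proof
      fix u assume "u \<in> L i n"
      then obtain l where l: "u \<in> E0" "l \<in> elow y E0 i" "(y ^^ i) u + l \<in> S n" by (auto simp: L_def)
      have "(y ^^ Suc i) u + y l \<in> S n" using Sy[OF l(3)] by (simp add: addv_add[OF ay])
      then show "u \<in> L (Suc i) n" unfolding L_def using l y_elow by blast
    qed
    have L4': "n \<le> m \<Longrightarrow> L i n \<subseteq> L i m" for i n m by (rule lift_Suc_mono_le[of "L i" for i, OF L4])
    have L5': "i \<le> j \<Longrightarrow> L i n \<subseteq> L j n" for i j n using lift_Suc_mono_le[of "\<lambda>i. L i n", OF L5] by blast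
    \<comment> \<open>The diagonal controls all degrees from \<open>N\<close> on at once; the
      finitely many smaller degrees are stabilised one by one through \<open>k\<close>.\<close>
    obtain N where N1: "\<And>n. n \<ge> N \<Longrightarrow> L n n = L N N"
      by (rule noethD[OF N, of "\<lambda>n. L n n"]) (use L1 L2 L3 L4 L5 in blast)+
    have "\<exists>k. \<forall>n\<ge>k. L i n = L i k" for i
      by (rule noethD[OF N, of "\<lambda>n. L i n"]) (use L1 L2 L3 L4 in blast)+
    then obtain k where k: "\<And>i n. n \<ge> k i \<Longrightarrow> L i n = L i (k i)" by metis
    define M where "M = N + (\<Sum>i<N. k i)"
    have LM: "L i n = L i M" if "n \<ge> M" for i n
    proof (cases "i < N")
      case True
      then have "k i \<le> M" unfolding M_def using member_le_sum[of i "{..<N}" k] by auto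
      then show ?thesis using k[of i n] k[of i M] that by simp
    next
      case False
      have "L i n \<subseteq> L (max i n) (max i n)" using L4'[of n "max i n" i] L5'[of i "max i n" "max i n"] by auto
      also have "\<dots> = L N N" using False by (intro N1) auto
      also have "\<dots> \<subseteq> L i M" using L4'[of N M i] L5'[of N i N] False by (auto simp: M_def)
      finally show ?thesis using L4'[OF that, of i] by blast
    qed
    have mono: "n \<le> m \<Longrightarrow> S n \<subseteq> S m" for n m using S by (metis lift_Suc_mono_le)
    have "S n = S M" if n: "n \<ge> M" for n
    proof
      show "S M \<subseteq> S n" using mono n by blast
      \<comment> \<open>Induction on the degree: subtracting an element of \<open>S M\<close> with
        the same leading coefficient lowers the degree.\<close>
      have "x \<in> S M" if "x \<in> S n" "x \<in> elow y E0 i" for i x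
        using that
      proof (induction i arbitrary: x)
        case 0
        then show ?case using sub_0[OF Ssub] by auto
      next
        case (Suc i)
        then obtain l u where lu: "l \<in> elow y E0 i" "u \<in> E0" "x = l + (y ^^ i) u" by (auto elim!: ssumE)
        then have "u \<in> L i n" using Suc.prems by (auto simp: L_def add.commute)
        then have "u \<in> L i M" using LM[OF n] by simp
        then obtain l' where l': "l' \<in> elow y E0 i" "(y ^^ i) u + l' \<in> S M" by (auto simp: L_def)
        have "x - ((y ^^ i) u + l') \<in> S n" using Suc.prems l' \<open>S M \<subseteq> S n\<close> by (intro sub_diff[OF Ssub]) auto
        moreover have "x - ((y ^^ i) u + l') = l - l'" using lu by simp
        ultimately have "x - ((y ^^ i) u + l') \<in> S M" using Suc.IH[of "l - l'"] sub_diff[OF sub_elow lu(1) l'(1)] by (simp only:)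
        then show ?case using l' sub_diff_cancel[OF Ssub] by blast
      qed
      then show "S n \<subseteq> S M" using S unfolding padj_def by blast
    qed
    then show ?thesis by blast
  qed
qed

end

lemma rlen_add':
  assumes "addops \<Omega>" "sub \<Omega> V" "sub \<Omega> W" "sub \<Omega> U" "V \<subseteq> W" "W \<subseteq> U"
  shows "rlen \<Omega> V U = rlen \<Omega> V W + rlen \<Omega> W U"
  by (rule rlen_add[OF assms(2,3,4) _ assms(5,6)]) (rule bspec[OF assms(1)[unfolded addops_def]])

section \<open>Modules given by a scalar action, and their finite powers\<close>

abbreviation submod where
  "submod sc \<equiv> sub (range sc)"

locale smod =
  fixes sc :: "'s::comm_ring_1 \<Rightarrow> 'x::ab_group_add \<Rightarrow> 'x"
  assumes sc_add: "sc a (x + y) = sc a x + sc a y"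
    and sc_add_left: "sc (a + b) x = sc a x + sc b x"
    and sc_mult: "sc (a * b) x = sc a (sc b x)"
    and sc_one: "sc 1 x = x"
begin

lemma addv_sc: "addv (sc a)"
  by (simp add: addv_def sc_add)

lemma addv_sc_left: "addv (\<lambda>a. sc a x)"
  by (simp add: addv_def sc_add_left)

lemma addops_sc: "addops (range sc)"
  by (auto simp: addops_def addv_sc)

lemma sc_0: "sc a 0 = 0"
  by (rule addv_0[OF addv_sc])

lemma sc_0_left: "sc 0 x = 0"
  using addv_0[OF addv_sc_left[of x]] .

lemma sc_diff: "sc a (x - y) = sc a x - sc a y"
  by (rule addv_diff[OF addv_sc])

lemma sc_diff_left: "sc (a - b) x = sc a x - sc b x"
  using addv_diff[OF addv_sc_left[of x], of a b] .

lemma sc_sum: "sc a (sum g A) = (\<Sum>i\<in>A. sc a (g i))"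
  by (rule addv_sum[OF addv_sc])

lemma sc_sum_left: "sc (sum g A) x = (\<Sum>i\<in>A. sc (g i) x)"
  using addv_sum[OF addv_sc_left[of x], of g A] .

lemma sc_commute: "sc a (sc b x) = sc b (sc a x)"
  by (metis mult.commute sc_mult)

end

lemma sub_scI:
  assumes "0 \<in> V" "\<And>x y. x \<in> V \<Longrightarrow> y \<in> V \<Longrightarrow> x - y \<in> V" "\<And>s x. x \<in> V \<Longrightarrow> sc s x \<in> V"
  shows "submod sc V"
  by (rule subI) (auto intro: assms)

lemma sub_sc: "submod sc V \<Longrightarrow> x \<in> V \<Longrightarrow> sc s x \<in> V"
  by (rule sub_op) auto

lemma itw_lin:
  assumes "addv f" "\<And>s x. f (sc s x) = sc' s (f x)"
  shows "itw (range sc) (range sc') f"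
  unfolding itw_def
proof (intro conjI ballI)
  fix g assume "g \<in> range sc"
  then obtain s where s: "g = sc s" by (rule rangeE)
  show "\<exists>g'\<in>range sc'. \<forall>x. f (g x) = g' (f x)"
    by (rule bexI[of _ "sc' s"]) (simp_all add: s assms(2))
next
  fix g' assume "g' \<in> range sc'"
  then obtain s where s: "g' = sc' s" by (rule rangeE)
  show "\<exists>g\<in>range sc. \<forall>x. f (g x) = g' (f x)"
    by (rule bexI[of _ "sc s"]) (simp_all add: s assms(2))
qed (rule assms(1))

lemma itw_id: "itw \<Omega> \<Omega> (\<lambda>x. x)"
  unfolding itw_def addv_def by blast

lemma smod_mult: "smod (*)"
  by unfold_locales (simp_all add: algebra_simps)

text \<open>The same coordinatewise action serves finite powers and polynomials with coefficients in
  the module; both live in the function type.\<close>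

definition psc :: "('s \<Rightarrow> 'x \<Rightarrow> 'x) \<Rightarrow> 's \<Rightarrow> (nat \<Rightarrow> 'x) \<Rightarrow> (nat \<Rightarrow> 'x)" where
  "psc sc s x = (\<lambda>i. sc s (x i))"

lemma psc_apply [simp]: "psc sc s x i = sc s (x i)"
  by (simp add: psc_def)

lemma smod_psc: "smod sc \<Longrightarrow> smod (psc sc)"
  unfolding smod_def psc_def by (auto simp: fun_eq_iff)

text \<open>Tuples are padded by zero, so powers of all ranks share one type and differ only as
  subsets.\<close>

definition pw :: "nat \<Rightarrow> 'x::ab_group_add set \<Rightarrow> (nat \<Rightarrow> 'x) set" where
  "pw b U = {x. (\<forall>i<b. x i \<in> U) \<and> (\<forall>i\<ge>b. x i = 0)}"

lemma pwI: "(\<And>i. i < b \<Longrightarrow> x i \<in> U) \<Longrightarrow> (\<And>i. i \<ge> b \<Longrightarrow> x i = 0) \<Longrightarrow> x \<in> pw b U"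
  by (simp add: pw_def)

lemma pwD: "x \<in> pw b U \<Longrightarrow> i < b \<Longrightarrow> x i \<in> U"
  by (simp add: pw_def)

lemma pwD0: "x \<in> pw b U \<Longrightarrow> i \<ge> b \<Longrightarrow> x i = 0"
  by (simp add: pw_def)

lemma pw_mono: "U \<subseteq> V \<Longrightarrow> pw b U \<subseteq> pw b V"
  by (auto simp: pw_def)

lemma sub_pw: "submod sc U \<Longrightarrow> smod sc \<Longrightarrow> submod (psc sc) (pw b U)"
proof (rule sub_scI)
  assume U: "submod sc U" and m: "smod sc"
  show "0 \<in> pw b U" using sub_0[OF U] by (simp add: pw_def)
  show "x - y \<in> pw b U" if "x \<in> pw b U" "y \<in> pw b U" for x y
    using that sub_diff[OF U] by (simp add: pw_def)
  show "psc sc s x \<in> pw b U" if "x \<in> pw b U" for s x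
    using that sub_sc[OF U] by (simp add: pw_def smod.sc_0[OF m])
qed

section \<open>Homology of complexes of free modules with coefficients in a pair\<close>

definition mm :: "('s \<Rightarrow> 'x::ab_group_add \<Rightarrow> 'x) \<Rightarrow> nat \<Rightarrow> nat \<Rightarrow> (nat \<Rightarrow> nat \<Rightarrow> 's) \<Rightarrow> (nat \<Rightarrow> 'x) \<Rightarrow> (nat \<Rightarrow> 'x)" where
  "mm sc r c \<phi> x = (\<lambda>i. if i < r then \<Sum>j<c. sc (\<phi> i j) (x j) else 0)"

text \<open>Cycles and boundaries are taken modulo \<open>V\<close>. The homology of the complex
  tensored with \<open>U/V\<close> thus becomes a pair of submodules of a power of \<open>U\<close>,
  and no quotient type has to be formed.\<close>

definition cyc where
  "cyc sc b \<phi> n V U = (case n of 0 \<Rightarrow> pw (b 0) U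
     | Suc l \<Rightarrow> {x \<in> pw (b (Suc l)) U. mm sc (b l) (b (Suc l)) (\<phi> l) x \<in> pw (b l) V})"

definition bnd where
  "bnd sc b \<phi> n V U = mm sc (b n) (b (Suc n)) (\<phi> n) ` pw (b (Suc n)) U \<boxplus> pw (b n) V"

definition bet where
  "bet sc b \<phi> n V U = rlen (range (psc sc)) (bnd sc b \<phi> n V U) (cyc sc b \<phi> n V U)"

text \<open>The intended base ring is \<open>S/I\<close>: composites of consecutive differentials
  vanish modulo \<open>I\<close>, and \<open>apair\<close> below says that \<open>U/V\<close> is a
  module over this ring.\<close>

definition is_cpx :: "'s::comm_ring_1 set \<Rightarrow> (nat \<Rightarrow> nat) \<Rightarrow> (nat \<Rightarrow> nat \<Rightarrow> nat \<Rightarrow> 's) \<Rightarrow> bool" where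
  "is_cpx I b \<phi> \<longleftrightarrow> (\<forall>n i k. i < b n \<longrightarrow> k < b (Suc (Suc n)) \<longrightarrow> (\<Sum>j<b (Suc n). \<phi> n i j * \<phi> (Suc n) j k) \<in> I)"

definition apair where
  "apair sc I V U \<longleftrightarrow> submod sc V \<and> submod sc U \<and> V \<subseteq> U \<and> (\<forall>s\<in>I. \<forall>u\<in>U. sc s u \<in> V)"

lemma apairD:
  assumes "apair sc I V U"
  shows "submod sc V" "submod sc U" "V \<subseteq> U" "\<And>s u. s \<in> I \<Longrightarrow> u \<in> U \<Longrightarrow> sc s u \<in> V"
  using assms by (auto simp: apair_def)

lemma apair_left: "apair sc I V U \<Longrightarrow> submod sc W \<Longrightarrow> V \<subseteq> W \<Longrightarrow> W \<subseteq> U \<Longrightarrow> apair sc I V W"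
  unfolding apair_def by blast

lemma apair_right: "apair sc I V U \<Longrightarrow> submod sc W \<Longrightarrow> V \<subseteq> W \<Longrightarrow> W \<subseteq> U \<Longrightarrow> apair sc I W U"
  unfolding apair_def by blast

context smod
begin

lemma addv_mm: "addv (mm sc r c \<phi>)"
  by (auto simp: addv_def mm_def sc_add sum.distrib fun_eq_iff)

lemma mm_psc: "mm sc r c \<phi> (psc sc s x) = psc sc s (mm sc r c \<phi> x)"
  by (auto simp: mm_def sc_sum sc_0 fun_eq_iff intro!: sum.cong sc_commute)

lemma itw_mm: "itw (range (psc sc)) (range (psc sc)) (mm sc r c \<phi>)"
  by (rule itw_lin[where sc = "psc sc" and sc' = "psc sc", OF addv_mm]) (rule mm_psc)

lemma mm_pw: "submod sc U \<Longrightarrow> x \<in> pw c U \<Longrightarrow> mm sc r c \<phi> x \<in> pw r U"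
proof (rule pwI)
  fix i assume U: "submod sc U" and x: "x \<in> pw c U" and i: "i < r"
  have "(\<Sum>j<c. sc (\<phi> i j) (x j)) \<in> U"
    by (rule sub_sum[OF U]) (rule sub_sc[OF U pwD[OF x]], simp)
  then show "mm sc r c \<phi> x i \<in> U" using i by (simp add: mm_def)
qed (simp add: mm_def)

lemma mm_mm:
  assumes "is_cpx I b \<phi>" "apair sc I V U" "x \<in> pw (b (Suc (Suc n))) U"
  shows "mm sc (b n) (b (Suc n)) (\<phi> n) (mm sc (b (Suc n)) (b (Suc (Suc n))) (\<phi> (Suc n)) x) \<in> pw (b n) V"
proof (rule pwI)
  fix i assume i: "i < b n"
  have "(\<Sum>j<b (Suc n). sc (\<phi> n i j) (\<Sum>k<b (Suc (Suc n)). sc (\<phi> (Suc n) j k) (x k)))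
      = (\<Sum>j<b (Suc n). \<Sum>k<b (Suc (Suc n)). sc (\<phi> n i j * \<phi> (Suc n) j k) (x k))"
    by (simp add: sc_sum sc_mult)
  also have "\<dots> = (\<Sum>k<b (Suc (Suc n)). sc (\<Sum>j<b (Suc n). \<phi> n i j * \<phi> (Suc n) j k) (x k))"
    by (subst sum.swap) (simp add: sc_sum_left)
  also have "\<dots> \<in> V"
  proof (rule sub_sum[OF apairD(1)[OF assms(2)]])
    fix k assume "k \<in> {..<b (Suc (Suc n))}"
    then show "sc (\<Sum>j<b (Suc n). \<phi> n i j * \<phi> (Suc n) j k) (x k) \<in> V"
      using assms(1) i pwD[OF assms(3)] by (intro apairD(4)[OF assms(2)]) (auto simp: is_cpx_def)
  qed
  finally show "mm sc (b n) (b (Suc n)) (\<phi> n) (mm sc (b (Suc n)) (b (Suc (Suc n))) (\<phi> (Suc n)) x) i \<in> V"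
    using i by (simp add: mm_def)
qed (simp add: mm_def)

lemma addops_psc: "addops (range (psc sc))"
  by (rule smod.addops_sc[OF smod_psc]) unfold_locales

lemma sub_pw': "submod sc U \<Longrightarrow> submod (psc sc) (pw b U)"
  by (rule sub_pw) unfold_locales

lemma sub_cyc: "submod sc V \<Longrightarrow> submod sc U \<Longrightarrow> submod (psc sc) (cyc sc b \<phi> n V U)"
  unfolding cyc_def by (cases n) (auto intro!: sub_pw' sub_vimage[OF _ _ itw_mm])

lemma sub_bnd: "submod sc V \<Longrightarrow> submod sc U \<Longrightarrow> submod (psc sc) (bnd sc b \<phi> n V U)"
  unfolding bnd_def by (intro sub_ssum' sub_image[OF _ itw_mm] sub_pw' addops_psc)

lemma cyc_pw: "cyc sc b \<phi> n V U \<subseteq> pw (b n) U"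
  unfolding cyc_def by (cases n) auto

lemma cyc_mono: "V \<subseteq> V' \<Longrightarrow> U \<subseteq> U' \<Longrightarrow> cyc sc b \<phi> n V U \<subseteq> cyc sc b \<phi> n V' U'"
  unfolding cyc_def using pw_mono[of V V'] pw_mono[of U U'] by (cases n) (auto dest!: subsetD)

lemma bnd_mono: "V \<subseteq> V' \<Longrightarrow> U \<subseteq> U' \<Longrightarrow> bnd sc b \<phi> n V U \<subseteq> bnd sc b \<phi> n V' U'"
  unfolding bnd_def by (intro ssum_mono image_mono pw_mono)

lemma pw_bnd: "submod sc U \<Longrightarrow> pw (b n) V \<subseteq> bnd sc b \<phi> n V U"
  unfolding bnd_def by (rule ssum_right) (rule sub_0[OF sub_image[OF sub_pw' itw_mm]])

lemma mm_bnd: "submod sc V \<Longrightarrow> x \<in> pw (b (Suc n)) U \<Longrightarrow> mm sc (b n) (b (Suc n)) (\<phi> n) x \<in> bnd sc b \<phi> n V U"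
  unfolding bnd_def using ssum_left[OF sub_0[OF sub_pw'], of V "mm sc (b n) (b (Suc n)) (\<phi> n) ` pw (b (Suc n)) U" "b n"]
  by blast

lemma pw_cyc: "submod sc V \<Longrightarrow> V \<subseteq> U \<Longrightarrow> pw (b n) V \<subseteq> cyc sc b \<phi> n V U"
  unfolding cyc_def using pw_mono[of V U] by (cases n) (auto intro: mm_pw)

lemma bnd_cyc:
  assumes "is_cpx I b \<phi>" "apair sc I V U"
  shows "bnd sc b \<phi> n V U \<subseteq> cyc sc b \<phi> n V U"
  unfolding bnd_def
proof (rule ssum_least[OF sub_cyc[OF apairD(1,2)[OF assms(2)]]])
  show "mm sc (b n) (b (Suc n)) (\<phi> n) ` pw (b (Suc n)) U \<subseteq> cyc sc b \<phi> n V U"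
    unfolding cyc_def using mm_mm[OF assms] mm_pw[OF apairD(2)[OF assms(2)]] by (cases n) auto
  show "pw (b n) V \<subseteq> cyc sc b \<phi> n V U" by (rule pw_cyc[OF apairD(1,3)[OF assms(2)]])
qed

lemma bndE:
  assumes "x \<in> bnd sc b \<phi> n V U"
  obtains u v where "u \<in> pw (b (Suc n)) U" "v \<in> pw (b n) V" "x = mm sc (b n) (b (Suc n)) (\<phi> n) u + v"
  using assms unfolding bnd_def by (auto elim!: ssumE)

lemma cyc_add_mm:
  assumes "is_cpx I b \<phi>" "apair sc I V U" "u \<in> pw (b (Suc n)) U"
  shows "mm sc (b n) (b (Suc n)) (\<phi> n) u \<in> cyc sc b \<phi> n V U"
  using bnd_cyc[OF assms(1,2)] mm_bnd[where b = b and n = n, OF apairD(1)[OF assms(2)] assms(3)] by blast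

lemma cyc_restrict:
  "x \<in> cyc sc b \<phi> n V U \<Longrightarrow> x \<in> pw (b n) W \<Longrightarrow> x \<in> cyc sc b \<phi> n V W"
  unfolding cyc_def by (cases n) auto

text \<open>The long exact sequence of Tor, as inequalities of lengths.\<close>

lemma bet_ext:
  assumes c: "is_cpx I b \<phi>" and p: "apair sc I V U" and W: "submod sc W" "V \<subseteq> W" "W \<subseteq> U"
  shows "bet sc b \<phi> n V U \<le> bet sc b \<phi> n V W + bet sc b \<phi> n W U"
proof -
  note V = apairD(1)[OF p] and U = apairD(2)[OF p]
  note pW = apair_left[OF p W] and pU = apair_right[OF p W]
  let ?\<Omega> = "range (psc sc)"
  \<comment> \<open>\<open>K\<close> cuts the homology of \<open>U/V\<close> at the image of the
    homology of \<open>W/V\<close>.\<close>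
  let ?K = "cyc sc b \<phi> n V W \<boxplus> bnd sc b \<phi> n V U"
  have K: "sub ?\<Omega> ?K" by (intro sub_ssum' sub_cyc sub_bnd V W U addops_psc)
  have 1: "bnd sc b \<phi> n V U \<subseteq> ?K" by (rule ssum_right[OF sub_0[OF sub_cyc[OF V W(1)]]])
  have 2: "?K \<subseteq> cyc sc b \<phi> n V U"
    by (rule ssum_least[OF sub_cyc[OF V U]]) (rule cyc_mono[OF order_refl W(3)], rule bnd_cyc[OF c p])
  have "bet sc b \<phi> n V U = rlen ?\<Omega> (bnd sc b \<phi> n V U) ?K + rlen ?\<Omega> ?K (cyc sc b \<phi> n V U)"
    unfolding bet_def by (rule rlen_add'[OF addops_psc sub_bnd[OF V U] K sub_cyc[OF V U] 1 2])
  moreover have "rlen ?\<Omega> (bnd sc b \<phi> n V U) ?K \<le> bet sc b \<phi> n V W"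
    unfolding bet_def
    by (rule rlen_le_surj[OF itw_id sub_cyc[OF V W(1)] sub_bnd[OF V U] _ _ bnd_cyc[OF c pW]])
       (use bnd_mono[OF order_refl W(3)] in auto)
  moreover have "rlen ?\<Omega> ?K (cyc sc b \<phi> n V U) \<le> bet sc b \<phi> n W U"
    unfolding bet_def
  proof (rule rlen_le_inj[OF itw_id addops_psc K sub_bnd[OF W(1) U] sub_cyc[OF W(1) U] _ bnd_cyc[OF c pU] 2])
    show "(\<lambda>x. x) ` cyc sc b \<phi> n V U \<subseteq> cyc sc b \<phi> n W U" using cyc_mono[OF W(2) order_refl] by simp
    fix x assume x: "x \<in> cyc sc b \<phi> n V U" "x \<in> bnd sc b \<phi> n W U"
    from x(2) obtain u w where uw: "u \<in> pw (b (Suc n)) U" "w \<in> pw (b n) W" "x = mm sc (b n) (b (Suc n)) (\<phi> n) u + w"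
      by (rule bndE)
    have "w = x - mm sc (b n) (b (Suc n)) (\<phi> n) u" using uw(3) by simp
    then have "w \<in> cyc sc b \<phi> n V U" using sub_diff[OF sub_cyc[OF V U] x(1) cyc_add_mm[where b = b and n = n, OF c p uw(1)]] by simp
    then have "w \<in> cyc sc b \<phi> n V W" using cyc_restrict uw(2) by blast
    from ssumI[OF this mm_bnd[where b = b and n = n, OF V uw(1)]] show "x \<in> ?K" using uw(3) by (simp add: add.commute)
  qed
  ultimately show ?thesis by (simp add: add_mono)
qed

text \<open>The connecting map is the differential itself: a cycle modulo \<open>W\<close> is sent
  to a cycle of \<open>W/V\<close>, and this is a boundary exactly when the cycle can be corrected
  by a tuple from \<open>W\<close> to a cycle modulo \<open>V\<close>.\<close>

lemma bet_quot:
  assumes c: "is_cpx I b \<phi>" and p: "apair sc I V U" and W: "submod sc W" "V \<subseteq> W" "W \<subseteq> U"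
  shows "bet sc b \<phi> (Suc n) W U \<le> bet sc b \<phi> (Suc n) V U + bet sc b \<phi> n V W"
proof -
  note V = apairD(1)[OF p] and U = apairD(2)[OF p]
  note pW = apair_left[OF p W] and pU = apair_right[OF p W]
  let ?\<Omega> = "range (psc sc)" and ?d = "mm sc (b n) (b (Suc n)) (\<phi> n)"
  let ?K = "cyc sc b \<phi> (Suc n) V U \<boxplus> bnd sc b \<phi> (Suc n) W U"
  have K: "sub ?\<Omega> ?K" by (intro sub_ssum' sub_cyc sub_bnd V W U addops_psc)
  have 1: "bnd sc b \<phi> (Suc n) W U \<subseteq> ?K" by (rule ssum_right[OF sub_0[OF sub_cyc[OF V U]]])
  have 2: "?K \<subseteq> cyc sc b \<phi> (Suc n) W U"
    by (rule ssum_least[OF sub_cyc[OF W(1) U]]) (rule cyc_mono[OF W(2) order_refl], rule bnd_cyc[OF c pU])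
  have "bet sc b \<phi> (Suc n) W U = rlen ?\<Omega> (bnd sc b \<phi> (Suc n) W U) ?K + rlen ?\<Omega> ?K (cyc sc b \<phi> (Suc n) W U)"
    unfolding bet_def by (rule rlen_add'[OF addops_psc sub_bnd[OF W(1) U] K sub_cyc[OF W(1) U] 1 2])
  moreover have "rlen ?\<Omega> (bnd sc b \<phi> (Suc n) W U) ?K \<le> bet sc b \<phi> (Suc n) V U"
    unfolding bet_def
    by (rule rlen_le_surj[OF itw_id sub_cyc[OF V U] sub_bnd[OF W(1) U] _ _ bnd_cyc[OF c p]])
       (use bnd_mono[OF W(2) order_refl] in auto)
  moreover have "rlen ?\<Omega> ?K (cyc sc b \<phi> (Suc n) W U) \<le> bet sc b \<phi> n V W"
    unfolding bet_def
  proof (rule rlen_le_inj[OF itw_mm addops_psc K sub_bnd[OF V W(1)] sub_cyc[OF V W(1)] _ bnd_cyc[OF c pW] 2])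
    show "?d ` cyc sc b \<phi> (Suc n) W U \<subseteq> cyc sc b \<phi> n V W"
    proof
      fix y assume "y \<in> ?d ` cyc sc b \<phi> (Suc n) W U"
      then obtain x where x: "x \<in> cyc sc b \<phi> (Suc n) W U" "y = ?d x" by (rule imageE)
      then have "x \<in> pw (b (Suc n)) U" "?d x \<in> pw (b n) W" by (auto simp: cyc_def)
      then show "y \<in> cyc sc b \<phi> n V W" using cyc_restrict[OF cyc_add_mm[where b = b and n = n, OF c p]] x(2) by simp
    qed
    fix x assume x: "x \<in> cyc sc b \<phi> (Suc n) W U" "?d x \<in> bnd sc b \<phi> n V W"
    from x(2) obtain w v where wv: "w \<in> pw (b (Suc n)) W" "v \<in> pw (b n) V" "?d x = ?d w + v" by (rule bndE)
    have xU: "x \<in> pw (b (Suc n)) U" using x(1) cyc_pw by blast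
    have wU: "w \<in> pw (b (Suc n)) U" using wv(1) pw_mono[OF W(3)] by blast
    have "?d (x - w) = v" using wv(3) by (simp add: addv_diff[OF addv_mm])
    then have "x - w \<in> cyc sc b \<phi> (Suc n) V U" using wv(2) sub_diff[OF sub_pw'[OF U] xU wU] by (simp add: cyc_def)
    moreover have "w \<in> bnd sc b \<phi> (Suc n) W U" using pw_bnd[OF U] wv(1) by blast
    ultimately have "(x - w) + w \<in> ?K" by (rule ssumI)
    then show "x \<in> ?K" by simp
  qed
  ultimately show ?thesis by (simp add: add_mono)
qed

text \<open>The source of lower bounds for Betti numbers of vector spaces. The homology of
  \<open>W2/W\<close> injects into the lower layer of the filtration by \<open>K\<close> and that of
  \<open>W1/W\<close> into the upper one, because \<open>W1\<close> and \<open>W2\<close> meet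
  inside \<open>W\<close>.\<close>

lemma bet_direct_sum:
  assumes c: "is_cpx I b \<phi>" and p: "apair sc I W U" and W1: "submod sc W1" "W \<subseteq> W1" "W1 \<subseteq> U"
    and W2: "submod sc W2" "W \<subseteq> W2" "W2 \<subseteq> U" and int: "W1 \<inter> W2 \<subseteq> W" and sum: "U \<subseteq> W1 \<boxplus> W2"
  shows "bet sc b \<phi> n W W1 + bet sc b \<phi> n W W2 \<le> bet sc b \<phi> n W U"
proof -
  note W = apairD(1)[OF p] and U = apairD(2)[OF p]
  note p1 = apair_left[OF p W1] and p2 = apair_left[OF p W2]
  let ?\<Omega> = "range (psc sc)" and ?d = "mm sc (b n) (b (Suc n)) (\<phi> n)"
  let ?K = "cyc sc b \<phi> n W W2 \<boxplus> bnd sc b \<phi> n W U"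
  have split: "\<exists>u1 u2. u1 \<in> pw k W1 \<and> u2 \<in> pw k W2 \<and> u = u1 + u2" if u: "u \<in> pw k U" for u k
  proof -
    have "\<exists>a c. a \<in> W1 \<and> c \<in> W2 \<and> u i = a + c" if "i < k" for i
      using sum pwD[OF u that] by (auto elim!: ssumE dest!: subsetD)
    then obtain f g where fg: "\<And>i. i < k \<Longrightarrow> f i \<in> W1 \<and> g i \<in> W2 \<and> u i = f i + g i" by metis
    show ?thesis
      by (rule exI[of _ "\<lambda>i. if i < k then f i else 0"], rule exI[of _ "\<lambda>i. if i < k then g i else 0"])
         (use fg pwD0[OF u] in \<open>auto simp: pw_def fun_eq_iff\<close>)
  qed
  have pint: "x \<in> pw k W" if "x \<in> pw k W1" "x \<in> pw k W2" for x k
    using that int by (auto simp: pw_def)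
  have K: "sub ?\<Omega> ?K" by (intro sub_ssum' sub_cyc sub_bnd W W2(1) U addops_psc)
  have 1: "bnd sc b \<phi> n W U \<subseteq> ?K" by (rule ssum_right[OF sub_0[OF sub_cyc[OF W W2(1)]]])
  have 2: "?K \<subseteq> cyc sc b \<phi> n W U"
    by (rule ssum_least[OF sub_cyc[OF W U]]) (rule cyc_mono[OF order_refl W2(3)], rule bnd_cyc[OF c p])
  have eq: "bet sc b \<phi> n W U = rlen ?\<Omega> (bnd sc b \<phi> n W U) ?K + rlen ?\<Omega> ?K (cyc sc b \<phi> n W U)"
    unfolding bet_def by (rule rlen_add'[OF addops_psc sub_bnd[OF W U] K sub_cyc[OF W U] 1 2])
  have i2: "bet sc b \<phi> n W W2 \<le> rlen ?\<Omega> (bnd sc b \<phi> n W U) ?K"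
    unfolding bet_def
  proof (rule rlen_le_inj[OF itw_id addops_psc sub_bnd[OF W W2(1)] sub_bnd[OF W U] K _ 1 bnd_cyc[OF c p2]])
    show "(\<lambda>x. x) ` cyc sc b \<phi> n W W2 \<subseteq> ?K" using ssum_left[OF sub_0[OF sub_bnd[OF W U]]] by simp
    fix x assume x: "x \<in> cyc sc b \<phi> n W W2" "x \<in> bnd sc b \<phi> n W U"
    from x(2) obtain u w where uw: "u \<in> pw (b (Suc n)) U" "w \<in> pw (b n) W" "x = ?d u + w" by (rule bndE)
    obtain u1 u2 where u12: "u1 \<in> pw (b (Suc n)) W1" "u2 \<in> pw (b (Suc n)) W2" "u = u1 + u2" using split[OF uw(1)] by blast
    have x2: "x \<in> pw (b n) W2" using x(1) cyc_pw by blast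
    have w12: "w \<in> pw (b n) W1" "w \<in> pw (b n) W2" using uw(2) pw_mono[OF W1(2)] pw_mono[OF W2(2)] by blast+
    have "?d u1 = x - ?d u2 - w" using uw(3) u12(3) by (simp add: addv_add[OF addv_mm])
    then have "?d u1 \<in> pw (b n) W2"
      using sub_diff[OF sub_pw'[OF W2(1)] sub_diff[OF sub_pw'[OF W2(1)] x2 mm_pw[OF W2(1) u12(2)]] w12(2)] by simp
    then have "?d u1 \<in> pw (b n) W" using pint mm_pw[OF W1(1) u12(1)] by blast
    then have "?d u1 + w \<in> bnd sc b \<phi> n W W2" using sub_add[OF sub_pw'[OF W] _ uw(2)] pw_bnd[OF W2(1)] by blast
    from sub_add[OF sub_bnd[OF W W2(1)] mm_bnd[where b = b and n = n, OF W u12(2)] this]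
    show "x \<in> bnd sc b \<phi> n W W2" using uw(3) u12(3) by (simp add: addv_add[OF addv_mm] algebra_simps)
  qed
  have i1: "bet sc b \<phi> n W W1 \<le> rlen ?\<Omega> ?K (cyc sc b \<phi> n W U)"
    unfolding bet_def
  proof (rule rlen_le_inj[OF itw_id addops_psc sub_bnd[OF W W1(1)] K sub_cyc[OF W U] _ 2 bnd_cyc[OF c p1]])
    show "(\<lambda>x. x) ` cyc sc b \<phi> n W W1 \<subseteq> cyc sc b \<phi> n W U" using cyc_mono[OF order_refl W1(3)] by simp
    fix x assume x: "x \<in> cyc sc b \<phi> n W W1" "x \<in> ?K"
    from x(2) obtain y z where yz: "y \<in> cyc sc b \<phi> n W W2" "z \<in> bnd sc b \<phi> n W U" "x = y + z" by (rule ssumE)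
    from yz(2) obtain u w where uw: "u \<in> pw (b (Suc n)) U" "w \<in> pw (b n) W" "z = ?d u + w" by (rule bndE)
    obtain u1 u2 where u12: "u1 \<in> pw (b (Suc n)) W1" "u2 \<in> pw (b (Suc n)) W2" "u = u1 + u2" using split[OF uw(1)] by blast
    have w2: "w \<in> pw (b n) W2" using uw(2) pw_mono[OF W2(2)] by blast
    have xy: "x \<in> pw (b n) W1" "y \<in> pw (b n) W2" using x(1) yz(1) cyc_pw by blast+
    have e: "x - ?d u1 = y + (?d u2 + w)" using yz(3) uw(3) u12(3) by (simp add: addv_add[OF addv_mm])
    have "x - ?d u1 \<in> pw (b n) W1" by (rule sub_diff[OF sub_pw'[OF W1(1)] xy(1) mm_pw[OF W1(1) u12(1)]])
    moreover have "x - ?d u1 \<in> pw (b n) W2" unfolding e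
      by (intro sub_add[OF sub_pw'[OF W2(1)]] xy(2) mm_pw[OF W2(1) u12(2)] w2)
    ultimately have "x - ?d u1 \<in> bnd sc b \<phi> n W W1" using pint pw_bnd[OF W1(1)] by blast
    then show "x \<in> bnd sc b \<phi> n W W1" by (rule sub_diff_cancel[OF sub_bnd[OF W W1(1)] _ mm_bnd[where b = b and n = n, OF W u12(1)]])
  qed
  show ?thesis unfolding eq using add_mono[OF i2 i1] by (simp add: add.commute)
qed

end

text \<open>The two pairs may live in different types. Betti numbers are moved this way along
  multiplication by a regular element, along division with remainder and along free covers.\<close>

lemma bet_iso:
  fixes sc :: "'s::comm_ring_1 \<Rightarrow> 'x::ab_group_add \<Rightarrow> 'x" and sc' :: "'s \<Rightarrow> 'y::ab_group_add \<Rightarrow> 'y"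
  assumes "smod sc" "smod sc'" and c: "is_cpx I b \<phi>" and p: "apair sc I V U" and p': "apair sc' I V' U'"
    and f: "addv f" "\<And>s x. f (sc s x) = sc' s (f x)"
    and fU: "f ` U \<subseteq> U'" and fV: "f ` V \<subseteq> V'" and surj: "U' \<subseteq> f ` U \<boxplus> V'" and ker: "\<And>x. x \<in> U \<Longrightarrow> f x \<in> V' \<Longrightarrow> x \<in> V"
  shows "bet sc' b \<phi> n V' U' = bet sc b \<phi> n V U"
proof -
  interpret M: smod sc by fact
  interpret N: smod sc' by fact
  note V = apairD(1)[OF p] and U = apairD(2)[OF p] and V' = apairD(1)[OF p'] and U' = apairD(2)[OF p']
  define F where "F x = (\<lambda>i. f (x i))" for x :: "nat \<Rightarrow> 'x"
  have aF: "addv F" by (auto simp: addv_def F_def addv_add[OF f(1)] fun_eq_iff)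
  have itF: "itw (range (psc sc)) (range (psc sc')) F"
    by (rule itw_lin[OF aF]) (auto simp: F_def psc_def f(2))
  have Fmm: "F (mm sc r c \<phi> x) = mm sc' r c \<phi> (F x)" for r c \<phi> x
    by (auto simp: F_def mm_def fun_eq_iff addv_sum[OF f(1)] f(2) addv_0[OF f(1)])
  have FU: "F x \<in> pw k U'" if "x \<in> pw k U" for x k using that fU by (auto simp: pw_def F_def addv_0[OF f(1)])
  have FV: "F x \<in> pw k V'" if "x \<in> pw k V" for x k using that fV by (auto simp: pw_def F_def addv_0[OF f(1)])
  have Fker: "x \<in> pw k V" if "x \<in> pw k U" "F x \<in> pw k V'" for x k
    using that ker by (auto simp: pw_def F_def)
  have lift: "\<exists>u v. u \<in> pw k U \<and> v \<in> pw k V' \<and> y = F u + v" if y: "y \<in> pw k U'" for y k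
  proof -
    have "\<exists>u v. u \<in> U \<and> v \<in> V' \<and> y i = f u + v" if "i < k" for i
    proof -
      have "y i \<in> f ` U \<boxplus> V'" using surj pwD[OF y that] by blast
      then show ?thesis by (auto elim!: ssumE)
    qed
    then obtain g h where gh: "\<And>i. i < k \<Longrightarrow> g i \<in> U \<and> h i \<in> V' \<and> y i = f (g i) + h i" by metis
    show ?thesis
      by (rule exI[of _ "\<lambda>i. if i < k then g i else 0"], rule exI[of _ "\<lambda>i. if i < k then h i else 0"])
         (use gh pwD0[OF y] in \<open>auto simp: pw_def fun_eq_iff F_def addv_0[OF f(1)]\<close>)
  qed
  have FZ: "F x \<in> cyc sc' b \<phi> n V' U'" if "x \<in> cyc sc b \<phi> n V U" for x
    using that FU FV unfolding cyc_def by (cases n) (auto simp: Fmm[symmetric])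
  have FB: "F x \<in> bnd sc' b \<phi> n V' U'" if "x \<in> bnd sc b \<phi> n V U" for x
  proof -
    from that obtain u v where uv: "u \<in> pw (b (Suc n)) U" "v \<in> pw (b n) V" "x = mm sc (b n) (b (Suc n)) (\<phi> n) u + v"
      by (rule M.bndE)
    have "F x = mm sc' (b n) (b (Suc n)) (\<phi> n) (F u) + F v" using uv(3) by (simp add: addv_add[OF aF] Fmm)
    then show ?thesis using sub_add[OF N.sub_bnd[OF V' U'] N.mm_bnd[where b = b and n = n, OF V' FU[OF uv(1)]]] N.pw_bnd[OF U'] FV[OF uv(2)] by (metis subsetD)
  qed
  have le: "bet sc' b \<phi> n V' U' \<le> bet sc b \<phi> n V U"
    unfolding bet_def
  proof (rule rlen_le_surj[OF itF M.sub_cyc[OF V U] N.sub_bnd[OF V' U'] _ _ M.bnd_cyc[OF c p]])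
    show "F ` bnd sc b \<phi> n V U \<subseteq> bnd sc' b \<phi> n V' U'" using FB by blast
    show "cyc sc' b \<phi> n V' U' \<subseteq> F ` cyc sc b \<phi> n V U \<boxplus> bnd sc' b \<phi> n V' U'"
    proof
      fix y assume y: "y \<in> cyc sc' b \<phi> n V' U'"
      then obtain u v where uv: "u \<in> pw (b n) U" "v \<in> pw (b n) V'" "y = F u + v" using lift N.cyc_pw by blast
      have "u \<in> cyc sc b \<phi> n V U"
      proof (cases n)
        case 0 then show ?thesis using uv by (simp add: cyc_def)
      next
        case (Suc l)
        let ?d = "mm sc (b l) (b (Suc l)) (\<phi> l)" and ?d' = "mm sc' (b l) (b (Suc l)) (\<phi> l)"
        have "F (?d u) = ?d' y - ?d' v" using uv(3) by (simp add: Fmm addv_add[OF N.addv_mm])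
        moreover have "?d' y \<in> pw (b l) V'" using y Suc by (simp add: cyc_def)
        moreover have "?d' v \<in> pw (b l) V'" using N.mm_pw[OF V'] uv(2) Suc by simp
        ultimately have "F (?d u) \<in> pw (b l) V'" using sub_diff[OF N.sub_pw'[OF V']] by simp
        then have "?d u \<in> pw (b l) V" using Fker M.mm_pw[OF U] uv(1) Suc by simp
        then show ?thesis using uv(1) Suc by (simp add: cyc_def)
      qed
      moreover have "v \<in> bnd sc' b \<phi> n V' U'" using N.pw_bnd[OF U'] uv(2) by blast
      ultimately show "y \<in> F ` cyc sc b \<phi> n V U \<boxplus> bnd sc' b \<phi> n V' U'" unfolding uv(3) by (intro ssumI imageI)
    qed
  qed
  have ge: "bet sc b \<phi> n V U \<le> bet sc' b \<phi> n V' U'"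
    unfolding bet_def
  proof (rule rlen_le_inj[OF itF N.addops_psc M.sub_bnd[OF V U] N.sub_bnd[OF V' U'] N.sub_cyc[OF V' U'] _ N.bnd_cyc[OF c p'] M.bnd_cyc[OF c p]])
    show "F ` cyc sc b \<phi> n V U \<subseteq> cyc sc' b \<phi> n V' U'" using FZ by blast
    fix x assume x: "x \<in> cyc sc b \<phi> n V U" "F x \<in> bnd sc' b \<phi> n V' U'"
    let ?d = "mm sc (b n) (b (Suc n)) (\<phi> n)" and ?d' = "mm sc' (b n) (b (Suc n)) (\<phi> n)"
    from x(2) obtain y v where yv: "y \<in> pw (b (Suc n)) U'" "v \<in> pw (b n) V'" "F x = ?d' y + v" by (rule N.bndE)
    obtain u w where uw: "u \<in> pw (b (Suc n)) U" "w \<in> pw (b (Suc n)) V'" "y = F u + w" using lift[OF yv(1)] by blast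
    have "F (x - ?d u) = ?d' w + v" using yv(3) uw(3) by (simp add: addv_diff[OF aF] Fmm addv_add[OF N.addv_mm])
    then have "F (x - ?d u) \<in> pw (b n) V'" using sub_add[OF N.sub_pw'[OF V'] N.mm_pw[OF V' uw(2)] yv(2)] by simp
    moreover have "x - ?d u \<in> pw (b n) U" using sub_diff[OF M.sub_pw'[OF U] _ M.mm_pw[OF U uw(1)]] x(1) M.cyc_pw by blast
    ultimately have "x - ?d u \<in> bnd sc b \<phi> n V U" using Fker M.pw_bnd[OF U] by blast
    then show "x \<in> bnd sc b \<phi> n V U" by (rule sub_diff_cancel[OF M.sub_bnd[OF V U] _ M.mm_bnd[where b = b and n = n, OF V uw(1)]])
  qed
  show ?thesis using le ge by (rule antisym)
qed

subsection \<open>Local rings\<close>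

text \<open>\<open>S\<close> itself may be far from local: \<open>N\<close> is the preimage of the
  maximal ideal of \<open>S/I\<close>, and elements outside \<open>N\<close> are invertible modulo
  \<open>I\<close>.\<close>

locale lring =
  fixes I N :: "'s::comm_ring_1 set"
  assumes sub_I: "submod (*) I" and sub_N: "submod (*) N" and IN: "I \<subseteq> N" and N1: "1 \<notin> N"
    and unit: "s \<notin> N \<Longrightarrow> \<exists>s'. s' * s - 1 \<in> I"

locale lmod = lring I N + smod sc for I N :: "'s::comm_ring_1 set" and sc :: "'s \<Rightarrow> 'x::ab_group_add \<Rightarrow> 'x"
begin

abbreviation "len \<equiv> rlen (range sc)"
abbreviation "ssub \<equiv> submod sc"
abbreviation "noe \<equiv> noeth (range sc)"

lemma unit_cancel:
  assumes "apair sc I V U" "u \<in> U" "s \<notin> N" "sc s u \<in> V"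
  shows "u \<in> V"
proof -
  obtain s' where s': "s' * s - 1 \<in> I" using unit[OF assms(3)] by blast
  have 1: "sc (s' * s - 1) u \<in> V" by (rule apairD(4)[OF assms(1) s' assms(2)])
  have "sc s' (sc s u) \<in> V" by (rule sub_sc[OF apairD(1)[OF assms(1)] assms(4)])
  then have "sc s' (sc s u) - sc (s' * s - 1) u \<in> V" using 1 by (rule sub_diff[OF apairD(1)[OF assms(1)]])
  then show ?thesis by (simp add: sc_diff_left sc_mult sc_one)
qed

lemma sub_cyclic: "ssub (range (\<lambda>s. sc s u))"
proof (rule sub_scI)
  show "0 \<in> range (\<lambda>s. sc s u)" by (rule range_eqI[of _ _ 0]) (simp add: sc_0_left)
  show "x - y \<in> range (\<lambda>s. sc s u)" if "x \<in> range (\<lambda>s. sc s u)" "y \<in> range (\<lambda>s. sc s u)" for x y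
  proof -
    from that obtain s t where "x = sc s u" "y = sc t u" by blast
    then show ?thesis by (intro range_eqI[of _ _ "s - t"]) (simp add: sc_diff_left)
  qed
  show "sc s x \<in> range (\<lambda>s. sc s u)" if "x \<in> range (\<lambda>s. sc s u)" for s x
  proof -
    from that obtain t where "x = sc t u" by blast
    then show ?thesis by (intro range_eqI[of _ _ "s * t"]) (simp add: sc_mult)
  qed
qed

lemma sub_add_cyclic: "ssub W \<Longrightarrow> ssub (W \<boxplus> range (\<lambda>s. sc s u))"
  by (rule sub_ssum'[OF _ sub_cyclic addops_sc])

lemma in_cyclic: "u \<in> range (\<lambda>s. sc s u)"
  by (rule range_eqI[of _ _ 1]) (simp add: sc_one)

lemma cyclic_subset: "ssub U \<Longrightarrow> u \<in> U \<Longrightarrow> range (\<lambda>s. sc s u) \<subseteq> U"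
  by (auto intro: sub_sc)

lemma len_add:
  "ssub V \<Longrightarrow> ssub W \<Longrightarrow> ssub U \<Longrightarrow> V \<subseteq> W \<Longrightarrow> W \<subseteq> U \<Longrightarrow> len V U = len V W + len W U"
  by (rule rlen_add'[OF addops_sc])

lemma finite_len_noe:
  assumes p: "apair sc I V U" and fin: "len V U \<noteq> \<infinity>"
  shows "noe V U"
  unfolding noeth_def
proof (intro allI impI)
  fix S assume S: "\<forall>n. ssub (S n) \<and> V \<subseteq> S n \<and> S n \<subseteq> U \<and> S n \<subseteq> S (Suc n)"
  have S1: "ssub (S n)" "V \<subseteq> S n" "S n \<subseteq> U" "S n \<subseteq> S (Suc n)" for n using S by simp_all
  have mono: "n \<le> m \<Longrightarrow> S n \<subseteq> S m" for n m by (rule lift_Suc_mono_le[of S, OF S1(4)])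
  have le: "len V (S n) \<le> len V U" for n by (rule rlen_mono[OF S1(2) order_refl S1(3)])
  have "\<exists>k. len V (S n) = enat k" for n
  proof -
    have "len V (S n) \<noteq> \<infinity>" using le[of n] fin by (metis enat_ord_simps(5))
    then show ?thesis by simp
  qed
  then obtain f where f: "\<And>n. len V (S n) = enat (f n)" by metis
  obtain k where k: "len V U = enat k" using fin by auto
  have "\<And>n. f n \<le> k" using le by (simp add: f k)
  then obtain M where M: "\<And>n. f n \<le> f M" using ex_has_greatest_nat[of "\<lambda>_. True" 0 f "Suc k"] by (auto simp: less_Suc_eq_le)
  have "S n = S M" if "n \<ge> M" for n
  proof (rule ccontr)
    assume ne: "S n \<noteq> S M"
    then have "S M \<subset> S n" using mono[OF that] by blast
    then have "1 \<le> len (S M) (S n)" using S1(1) by (rule rlen_ge1)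
    moreover have "len V (S n) = len V (S M) + len (S M) (S n)"
      by (rule len_add[OF apairD(1)[OF p] S1(1) S1(1) S1(2) mono[OF that]])
    ultimately have "enat (f M) + 1 \<le> enat (f n)" by (simp add: f add_left_mono)
    then show False using M[of n] by (simp add: one_enat_def)
  qed
  then show "\<exists>N. \<forall>n\<ge>N. S n = S N" by blast
qed

text \<open>A maximal proper submodule above \<open>V\<close> leaves a simple quotient, a copy of
  the residue field. This drives the inductions on length.\<close>

lemma max_proper:
  assumes p: "apair sc I V U" and ne: "V \<noteq> U" and no: "noe V U"
  obtains W u where "ssub W" "V \<subseteq> W" "W \<subset> U" "u \<in> U" "u \<notin> W" "U = W \<boxplus> range (\<lambda>s. sc s u)"
    "\<And>s. s \<in> N \<Longrightarrow> sc s u \<in> W" "len W U = 1"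
proof -
  let ?F = "{W. ssub W \<and> V \<subseteq> W \<and> W \<subset> U}"
  have VF: "V \<in> ?F" using apairD(1,3)[OF p] ne by auto
  have "\<exists>W\<in>?F. \<forall>W'\<in>?F. W \<subseteq> W' \<longrightarrow> W' = W"
  proof (rule noeth_max[OF no])
    show "?F \<noteq> {}" by (metis VF empty_iff)
  qed auto
  then obtain W where W: "W \<in> ?F" and mx: "\<And>W'. W' \<in> ?F \<Longrightarrow> W \<subseteq> W' \<Longrightarrow> W' = W"
    by (elim bexE) (rule that, assumption, simp)
  have Ws: "ssub W" "V \<subseteq> W" "W \<subset> U" using W by auto
  have U: "ssub U" by (rule apairD(2)[OF p])
  have pW: "apair sc I W U" using apair_right[OF p] Ws by blast
  obtain u where u: "u \<in> U" "u \<notin> W" using Ws by blast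
  have big: "X = U" if X: "ssub X" "W \<subset> X" "X \<subseteq> U" for X
    using mx[of X] X Ws by blast
  have gen: "W \<boxplus> range (\<lambda>s. sc s v) = U" if v: "v \<in> U" "v \<notin> W" for v
  proof (rule big)
    show "ssub (W \<boxplus> range (\<lambda>s. sc s v))" by (rule sub_add_cyclic[OF Ws(1)])
    have "W \<subseteq> W \<boxplus> range (\<lambda>s. sc s v)" by (rule ssum_left[OF sub_0[OF sub_cyclic]])
    moreover have "v \<in> W \<boxplus> range (\<lambda>s. sc s v)" using ssum_right[OF sub_0[OF Ws(1)]] in_cyclic by blast
    ultimately show "W \<subset> W \<boxplus> range (\<lambda>s. sc s v)" using v by blast
    show "W \<boxplus> range (\<lambda>s. sc s v) \<subseteq> U" using Ws v by (intro ssum_least[OF U] cyclic_subset[OF U]) auto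
  qed
  have Nu: "sc s u \<in> W" if s: "s \<in> N" for s
  proof (rule ccontr)
    assume "sc s u \<notin> W"
    moreover have "sc s u \<in> U" by (rule sub_sc[OF U u(1)])
    ultimately have "u \<in> W \<boxplus> range (\<lambda>r. sc r (sc s u))" using gen u(1) by blast
    then obtain w r where wr: "w \<in> W" "u = w + sc r (sc s u)" by (auto elim!: ssumE)
    \<comment> \<open>Since \<open>r s\<close> lies in \<open>N\<close>, the element
      \<open>1 - r s\<close> is invertible modulo \<open>I\<close>; it sends \<open>u\<close> into
      \<open>W\<close>, so \<open>u\<close> itself would lie in \<open>W\<close>.\<close>
    have "r * s \<in> N" by (rule sub_sc[OF sub_N s])
    then have "1 - r * s \<notin> N" using N1 sub_add[OF sub_N, of "1 - r * s" "r * s"] by auto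
    moreover have "sc (1 - r * s) u = u - sc r (sc s u)" by (simp add: sc_diff_left sc_one sc_mult)
    then have "sc (1 - r * s) u = w" using wr(2) by (metis add_diff_cancel_right')
    ultimately have "u \<in> W" using unit_cancel[OF pW u(1)] wr(1) by simp
    then show False using u by simp
  qed
  have "len W U \<le> 1"
  proof (rule enat_le_iffI)
    fix k assume k: "enat k \<le> len W U"
    have "\<not> ch (range sc) (Suc (Suc 0)) W U"
    proof
      assume "ch (range sc) (Suc (Suc 0)) W U"
      then obtain X Y where "ssub X" "W \<subset> X" "X \<subset> Y" "Y \<subseteq> U" by auto
      then show False using big[of X] by blast
    qed
    moreover have "ch (range sc) k W U" using k Ws le_rlen_iff by blast
    ultimately have "\<not> Suc (Suc 0) \<le> k" using ch_le by blast
    then show "enat k \<le> 1" by (simp add: one_enat_def)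
  qed
  then have L: "len W U = 1" by (rule antisym) (rule rlen_ge1[OF Ws(3) U])
  show ?thesis by (rule that[OF Ws u gen[OF u, symmetric] _ L]) (rule Nu)
qed

lemma bet_cyclic:
  assumes c: "is_cpx I b \<phi>" and p: "apair sc I V U" and u: "u \<in> U" "u \<notin> V" "U = V \<boxplus> range (\<lambda>s. sc s u)"
    and Nu: "\<And>s. s \<in> N \<Longrightarrow> sc s u \<in> V"
  shows "bet sc b \<phi> n V U = bet (*) b \<phi> n N UNIV"
proof (rule bet_iso[OF smod_mult _ c _ p, of _ _ "\<lambda>s. sc s u"])
  show "smod sc" by unfold_locales
  show "apair (*) I N UNIV"
    unfolding apair_def using sub_N sub_UNIV IN sub_sc[OF sub_I] by (auto simp: mult.commute)
  show "addv (\<lambda>s. sc s u)" by (rule addv_sc_left)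
  show "sc (s * x) u = sc s (sc x u)" for s x by (rule sc_mult)
  show "range (\<lambda>s. sc s u) \<subseteq> U" by (rule cyclic_subset[OF apairD(2)[OF p] u(1)])
  show "(\<lambda>s. sc s u) ` N \<subseteq> V" using Nu by blast
  show "U \<subseteq> range (\<lambda>s. sc s u) \<boxplus> V" using u(3) by (simp add: ssum_commute)
  show "x \<in> N" if "sc x u \<in> V" for x using unit_cancel[OF p u(1) _ that] u(2) by blast
qed

text \<open>Subadditivity along a composition series, all of whose factors are the residue
  field.\<close>

lemma bet_le_len:
  assumes c: "is_cpx I b \<phi>" and p: "apair sc I V U" and len: "len V U = enat k"
  shows "bet sc b \<phi> n V U \<le> enat k * bet (*) b \<phi> n N UNIV"
  using p len
proof (induction k arbitrary: U)
  case 0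
  then have "U \<subseteq> V" using rlen_ge1[of V U "range sc"] apairD(2,3)[OF 0(1)] by (auto simp: zero_enat_def[symmetric])
  then have "U = V" using apairD(3)[OF 0(1)] by simp
  then have "cyc sc b \<phi> n V U \<subseteq> bnd sc b \<phi> n V U" using cyc_pw[of b \<phi> n V U] pw_bnd[OF apairD(2)[OF 0(1)], of b n V \<phi>] by blast
  then show ?case by (simp add: bet_def rlen_eq0)
next
  case (Suc k)
  have ne: "V \<noteq> U" using Suc.prems(2) rlen_eq0[of U V "range sc"] by (auto simp: zero_enat_def)
  obtain W u where W: "ssub W" "V \<subseteq> W" "W \<subset> U" "u \<in> U" "u \<notin> W" "U = W \<boxplus> range (\<lambda>s. sc s u)"
    "\<And>s. s \<in> N \<Longrightarrow> sc s u \<in> W" "len W U = 1"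
    using max_proper[OF Suc.prems(1) ne] finite_len_noe[OF Suc.prems(1)] Suc.prems(2) by (metis enat.distinct(2))
  have WU: "W \<subseteq> U" using W by blast
  have "enat (Suc k) = len V W + 1"
    using len_add[OF apairD(1)[OF Suc.prems(1)] W(1) apairD(2)[OF Suc.prems(1)] W(2) WU] Suc.prems(2) W(8) by simp
  then have "len V W = enat k" by (cases "len V W") (auto simp: one_enat_def)
  then have 1: "bet sc b \<phi> n V W \<le> enat k * bet (*) b \<phi> n N UNIV"
    by (rule Suc.IH[OF apair_left[OF Suc.prems(1) W(1,2) WU]])
  have 2: "bet sc b \<phi> n W U = bet (*) b \<phi> n N UNIV"
    by (rule bet_cyclic[OF c apair_right[OF Suc.prems(1) W(1,2) WU] W(4,5,6,7)])
  have "bet sc b \<phi> n V U \<le> bet sc b \<phi> n V W + bet sc b \<phi> n W U" by (rule bet_ext[OF c Suc.prems(1) W(1,2) WU])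
  also have "\<dots> \<le> enat k * bet (*) b \<phi> n N UNIV + bet (*) b \<phi> n N UNIV" using 1 2 by (simp add: add_right_mono)
  also have "\<dots> = enat (Suc k) * bet (*) b \<phi> n N UNIV"
  proof -
    have "enat (Suc k) = enat k + 1" by (simp add: one_enat_def)
    then show ?thesis by (simp add: distrib_right)
  qed
  finally show ?case .
qed

text \<open>A module killed by \<open>N\<close> is a vector space, so the simple quotient found by
  \<open>max_proper\<close> splits off and contributes its Betti numbers in full.\<close>

lemma len_le_bet:
  assumes c: "is_cpx I b \<phi>" and p: "apair sc I V U" and len: "len V U = enat k"
    and NU: "\<And>s u. s \<in> N \<Longrightarrow> u \<in> U \<Longrightarrow> sc s u \<in> V"
  shows "enat k * bet (*) b \<phi> n N UNIV \<le> bet sc b \<phi> n V U"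
  using p len NU
proof (induction k arbitrary: U)
  case 0
  then show ?case by (simp add: zero_enat_def[symmetric])
next
  case (Suc k)
  have ne: "V \<noteq> U" using Suc.prems(2) rlen_eq0[of U V "range sc"] by (auto simp: zero_enat_def)
  obtain W u where W: "ssub W" "V \<subseteq> W" "W \<subset> U" "u \<in> U" "u \<notin> W" "U = W \<boxplus> range (\<lambda>s. sc s u)"
    "\<And>s. s \<in> N \<Longrightarrow> sc s u \<in> W" "len W U = 1"
    using max_proper[OF Suc.prems(1) ne] finite_len_noe[OF Suc.prems(1)] Suc.prems(2) by (metis enat.distinct(2))
  note V = apairD(1)[OF Suc.prems(1)] and U = apairD(2)[OF Suc.prems(1)]
  have WU: "W \<subseteq> U" using W by blast
  have "enat (Suc k) = len V W + 1"
    using len_add[OF V W(1) U W(2) WU] Suc.prems(2) W(8) by simp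
  then have "len V W = enat k" by (cases "len V W") (auto simp: one_enat_def)
  then have 1: "enat k * bet (*) b \<phi> n N UNIV \<le> bet sc b \<phi> n V W"
    using Suc.IH[OF apair_left[OF Suc.prems(1) W(1,2) WU]] Suc.prems(3) WU by blast
  \<comment> \<open>The line through \<open>u\<close> is a complement of \<open>W\<close>.\<close>
  let ?W1 = "V \<boxplus> range (\<lambda>s. sc s u)"
  have W1: "ssub ?W1" "V \<subseteq> ?W1" "?W1 \<subseteq> U"
    using sub_add_cyclic[OF V] ssum_left[OF sub_0[OF sub_cyclic]]
      ssum_least[OF U apairD(3)[OF Suc.prems(1)] cyclic_subset[OF U W(4)]] by blast+
  have uW1: "u \<in> ?W1" using ssum_right[OF sub_0[OF V]] in_cyclic by blast
  have 2: "bet sc b \<phi> n V ?W1 = bet (*) b \<phi> n N UNIV"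
    by (rule bet_cyclic[OF c apair_left[OF Suc.prems(1) W1] uW1]) (use W(2,4,5) Suc.prems(3) in auto)
  have "bet sc b \<phi> n V ?W1 + bet sc b \<phi> n V W \<le> bet sc b \<phi> n V U"
  proof (rule bet_direct_sum[OF c Suc.prems(1) W1 W(1,2) WU])
    show "?W1 \<inter> W \<subseteq> V"
    proof
      fix x assume x: "x \<in> ?W1 \<inter> W"
      then obtain v s where vs: "v \<in> V" "x = v + sc s u" by (auto elim!: ssumE)
      have "sc s u = x - v" using vs by simp
      then have "sc s u \<in> W" using x vs(1) W(2) sub_diff[OF W(1)] by auto
      then have "s \<in> N" using unit_cancel[OF apair_right[OF Suc.prems(1) W(1,2) WU] W(4)] W(5) by blast
      then have "sc s u \<in> V" using Suc.prems(3) W(4) by blast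
      then show "x \<in> V" using vs sub_add[OF V] by simp
    qed
    have "U \<subseteq> W \<boxplus> ?W1" using W(6) ssum_mono[OF order_refl ssum_right[OF sub_0[OF V]], of W "range (\<lambda>s. sc s u)"] by simp
    then show "U \<subseteq> ?W1 \<boxplus> W" by (simp add: ssum_commute)
  qed
  note S = this
  have "enat (Suc k) * bet (*) b \<phi> n N UNIV = bet (*) b \<phi> n N UNIV + enat k * bet (*) b \<phi> n N UNIV"
  proof -
    have "enat (Suc k) = 1 + enat k" by (simp add: one_enat_def)
    then show ?thesis by (simp add: distrib_right)
  qed
  note E = this
  show ?case unfolding E using add_mono[OF eq_refl[OF 2[symmetric]] 1] S by (rule order_trans)
qed

text \<open>Otherwise a maximal proper submodule between \<open>V\<close> and \<open>U\<close> would
  contain \<open>N U\<close>, because the quotient is simple. The hypothesis \<open>gen\<close>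
  speaks about all such submodules so that no product \<open>N U\<close> has to be formed.\<close>

lemma nakayama:
  assumes p: "apair sc I V U" and no: "noe V U"
    and gen: "\<And>W. ssub W \<Longrightarrow> V \<subseteq> W \<Longrightarrow> (\<And>s u. s \<in> N \<Longrightarrow> u \<in> U \<Longrightarrow> sc s u \<in> W) \<Longrightarrow> U \<subseteq> W"
  shows "U = V"
proof (rule ccontr)
  assume "U \<noteq> V"
  then obtain W u where W: "ssub W" "V \<subseteq> W" "W \<subset> U" "u \<in> U" "u \<notin> W" "U = W \<boxplus> range (\<lambda>s. sc s u)"
    "\<And>s. s \<in> N \<Longrightarrow> sc s u \<in> W" "len W U = 1"
    using max_proper[OF p _ no] by metis
  have "sc s v \<in> W" if "s \<in> N" "v \<in> U" for s v
  proof -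
    have "v \<in> W \<boxplus> range (\<lambda>s. sc s u)" using that W(6) by blast
    then obtain w r where "w \<in> W" "v = w + sc r u" by (auto elim!: ssumE)
    moreover have "sc s (sc r u) \<in> W" using sub_sc[OF W(1) W(7)[OF that(1)]] by (simp add: sc_commute)
    ultimately show ?thesis using sub_add[OF W(1)] sub_sc[OF W(1)] by (simp add: sc_add)
  qed
  then have "U \<subseteq> W" using gen W by blast
  then show False using W by blast
qed

text \<open>A noetherian vector space has finite dimension: a submodule maximal among those of
  finite length absorbs every \<open>u\<close>, since adding one generator raises the length by at
  most one.\<close>

lemma noe_finite_len:
  assumes p: "apair sc I V U" and no: "noe V U" and NU: "\<And>s u. s \<in> N \<Longrightarrow> u \<in> U \<Longrightarrow> sc s u \<in> V"
  shows "len V U \<noteq> \<infinity>"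
proof -
  note V = apairD(1)[OF p] and U = apairD(2)[OF p]
  let ?F = "{W. ssub W \<and> V \<subseteq> W \<and> W \<subseteq> U \<and> len V W \<noteq> \<infinity>}"
  have "V \<in> ?F" using V apairD(3)[OF p] by (auto simp: rlen_eq0 zero_enat_def)
  note VF = this
  have "\<exists>W\<in>?F. \<forall>W'\<in>?F. W \<subseteq> W' \<longrightarrow> W' = W"
  proof (rule noeth_max[OF no])
    show "?F \<noteq> {}" by (metis VF empty_iff)
  qed auto
  then obtain W where W: "W \<in> ?F" and mx: "\<And>W'. W' \<in> ?F \<Longrightarrow> W \<subseteq> W' \<Longrightarrow> W' = W"
    by (elim bexE) (rule that, assumption, simp)
  have Ws: "ssub W" "V \<subseteq> W" "W \<subseteq> U" "len V W \<noteq> \<infinity>" using W by auto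
  have "W = U"
  proof (rule ccontr)
    assume "W \<noteq> U"
    then obtain u where u: "u \<in> U" "u \<notin> W" using Ws by blast
    let ?X = "W \<boxplus> range (\<lambda>s. sc s u)"
    have X: "ssub ?X" "W \<subseteq> ?X" "?X \<subseteq> U"
      using sub_add_cyclic[OF Ws(1)] ssum_left[OF sub_0[OF sub_cyclic]]
        ssum_least[OF U Ws(3) cyclic_subset[OF U u(1)]] by blast+
    have "u \<in> ?X" using ssum_right[OF sub_0[OF Ws(1)]] in_cyclic by blast
    have "len W ?X \<le> 1"
    proof -
      have "len W ?X \<le> rlen (range (*)) N UNIV"
        by (rule rlen_le_surj[where f = "\<lambda>s. sc s u"])
           (use Ws u NU in \<open>auto simp: sub_UNIV ssum_commute[of W] intro!: itw_lin addv_sc_left sc_mult\<close>)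
      also have "\<dots> \<le> 1"
      proof (rule enat_le_iffI)
        fix k assume k: "enat k \<le> rlen (range (*)) N UNIV"
        have "\<not> ch (range (*)) (Suc (Suc 0)) N UNIV"
        proof
          assume "ch (range (*)) (Suc (Suc 0)) N UNIV"
          then obtain X Y where X: "submod (*) X" "N \<subset> X" "X \<subset> Y" by auto
          then obtain s where s: "s \<in> X" "s \<notin> N" by blast
          obtain s' where "s' * s - 1 \<in> I" using unit[OF s(2)] by blast
          then have "s' * s - 1 \<in> X" "s' * s \<in> X" using IN X sub_sc[OF X(1) s(1)] by auto
          then have "1 \<in> X" using sub_diff[OF X(1), of "s' * s" "s' * s - 1"] by simp
          then have "r \<in> X" for r using sub_sc[OF X(1), of 1 r] by simp
          then show False using X by blast
        qed
        moreover have "ch (range (*)) k N UNIV" using k le_rlen_iff by blast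
        ultimately have "\<not> Suc (Suc 0) \<le> k" using ch_le by blast
        then show "enat k \<le> 1" by (simp add: one_enat_def)
      qed
      finally show ?thesis .
    qed
    then have "len V ?X \<noteq> \<infinity>" using len_add[OF V Ws(1) X(1) Ws(2) X(2)] Ws(4)
      by (cases "len V W"; cases "len W ?X") auto
    then have "?X = W" using mx[of ?X] X Ws by blast
    then show False using u \<open>u \<in> ?X\<close> by blast
  qed
  then show ?thesis using Ws by simp
qed

end

subsection \<open>Polynomials with coefficients in a module\<close>

definition Pol :: "'x::ab_group_add set \<Rightarrow> (nat \<Rightarrow> 'x) set" where
  "Pol U = {x. (\<forall>i. x i \<in> U) \<and> (\<exists>K. \<forall>i\<ge>K. x i = 0)}"

definition TT :: "(nat \<Rightarrow> 'x::ab_group_add) \<Rightarrow> (nat \<Rightarrow> 'x)" where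
  "TT x = (\<lambda>i. case i of 0 \<Rightarrow> 0 | Suc k \<Rightarrow> x k)"

lemma TT_0 [simp]: "TT x 0 = 0" and TT_Suc [simp]: "TT x (Suc k) = x k"
  by (simp_all add: TT_def)

lemma addv_TT: "addv TT"
  by (auto simp: addv_def TT_def fun_eq_iff split: nat.splits)

lemma PolI: "(\<And>i. x i \<in> U) \<Longrightarrow> (\<And>i. i \<ge> K \<Longrightarrow> x i = 0) \<Longrightarrow> x \<in> Pol U"
  unfolding Pol_def by blast

lemma PolD: "x \<in> Pol U \<Longrightarrow> x i \<in> U"
  unfolding Pol_def by blast

lemma PolE: assumes "x \<in> Pol U" obtains K where "\<And>i. i \<ge> K \<Longrightarrow> x i = 0"
  using assms unfolding Pol_def by blast

lemma Pol_mono: "U \<subseteq> W \<Longrightarrow> Pol U \<subseteq> Pol W"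
  unfolding Pol_def by blast

lemma Pol_restrict: "x \<in> Pol U \<Longrightarrow> (\<And>i. x i \<in> W) \<Longrightarrow> x \<in> Pol W"
  unfolding Pol_def by blast

lemma Pol_TT: "0 \<in> U \<Longrightarrow> x \<in> Pol U \<Longrightarrow> TT x \<in> Pol U"
proof -
  assume 0: "0 \<in> U" and x: "x \<in> Pol U"
  obtain K where K: "\<And>i. i \<ge> K \<Longrightarrow> x i = 0" using PolE[OF x] by blast
  show "TT x \<in> Pol U"
  proof (rule PolI[of _ _ "Suc K"])
    show "TT x i \<in> U" for i using 0 PolD[OF x] by (cases i) simp_all
    show "TT x i = 0" if "i \<ge> Suc K" for i using K that by (cases i) simp_all
  qed
qed

lemma Pol_diff: "sub \<Omega> U \<Longrightarrow> x \<in> Pol U \<Longrightarrow> y \<in> Pol U \<Longrightarrow> x - y \<in> Pol U"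
proof -
  assume U: "sub \<Omega> U" and x: "x \<in> Pol U" and y: "y \<in> Pol U"
  obtain K where K: "\<And>i. i \<ge> K \<Longrightarrow> x i = 0" using PolE[OF x] by blast
  obtain L where L: "\<And>i. i \<ge> L \<Longrightarrow> y i = 0" using PolE[OF y] by blast
  show "x - y \<in> Pol U"
    by (rule PolI[of _ _ "max K L"]) (simp_all add: K L sub_diff[OF U PolD[OF x] PolD[OF y]])
qed

lemma Pol_0: "0 \<in> U \<Longrightarrow> 0 \<in> Pol U"
  by (rule PolI[of _ _ 0]) simp_all

lemma sub_Pol:
  assumes "smod sc" and U: "submod sc U"
  shows "sub (insert TT (range (psc sc))) (Pol U)"
proof (rule subI)
  show "0 \<in> Pol U" by (rule Pol_0[OF sub_0[OF U]])
  show "x - y \<in> Pol U" if "x \<in> Pol U" "y \<in> Pol U" for x y by (rule Pol_diff[OF U that])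
  fix f x assume f: "f \<in> insert TT (range (psc sc))" and x: "x \<in> Pol U"
  show "f x \<in> Pol U"
  proof (cases "f = TT")
    case True then show ?thesis using Pol_TT[OF sub_0[OF U] x] by simp
  next
    case False
    then obtain s where s: "f = psc sc s" using f by blast
    obtain K where K: "\<And>i. i \<ge> K \<Longrightarrow> x i = 0" using PolE[OF x] by blast
    show ?thesis unfolding s
      by (rule PolI[of _ _ K]) (simp_all add: K smod.sc_0[OF assms(1)] sub_sc[OF U PolD[OF x]])
  qed
qed

lemma sub_Pol': "smod sc \<Longrightarrow> submod sc U \<Longrightarrow> submod (psc sc) (Pol U)"
  using sub_mono[OF sub_Pol] by blast

subsection \<open>Integer polynomials as operators\<close>

text \<open>Stands for multiplication by an integer polynomial in \<open>T\<close>, described by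
  what it respects instead of by coefficients. The same polynomial can then act on
  \<open>U[T]\<close> and on the Rees module.\<close>

definition polop :: "('y::ab_group_add \<Rightarrow> 'y) \<Rightarrow> ('y \<Rightarrow> 'y) \<Rightarrow> bool" where
  "polop T f \<longleftrightarrow> addv f \<and> (\<forall>g x. addv g \<longrightarrow> (\<forall>x. g (T x) = T (g x)) \<longrightarrow> f (g x) = g (f x))
     \<and> (\<forall>W x. sub {T} W \<longrightarrow> x \<in> W \<longrightarrow> f x \<in> W)"

lemma polop_addv: "polop T f \<Longrightarrow> addv f"
  by (simp add: polop_def)

lemma polop_comm:
  assumes "polop T f" "addv g" "\<And>x. g (T x) = T (g x)" shows "f (g x) = g (f x)"
proof -
  have "\<forall>x. g (T x) = T (g x)" using assms(3) by blast
  with assms(1,2) show ?thesis unfolding polop_def by (elim conjE) (erule allE[of _ g], erule allE[of _ x], erule (1) impE, erule (1) impE, assumption)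
qed

lemma polop_closed:
  assumes "polop T f" "sub {T} W" "x \<in> W" shows "f x \<in> W"
  using assms unfolding polop_def by blast

lemma polop_id: "polop T (\<lambda>x. x)"
  by (simp add: polop_def addv_def)

lemma polop_T: assumes "addv T" shows "polop T T"
  unfolding polop_def
proof (intro conjI allI impI)
  show "T x \<in> W" if "sub {T} W" "x \<in> W" for W x by (rule sub_op[OF that(1) _ that(2)]) simp
qed (use assms in simp_all)

lemma polop_comp:
  assumes f: "polop T f" and g: "polop T g" shows "polop T (\<lambda>x. f (g x))"
  unfolding polop_def
proof (intro conjI allI impI)
  show "addv (\<lambda>x. f (g x))" by (rule addv_comp[OF polop_addv[OF f] polop_addv[OF g]])
  fix h x assume h: "addv h" "\<forall>x. h (T x) = T (h x)"
  have "g (h x) = h (g x)" by (rule polop_comm[OF g h(1)]) (rule spec[OF h(2)])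
  moreover have "f (h (g x)) = h (f (g x))" by (rule polop_comm[OF f h(1)]) (rule spec[OF h(2)])
  ultimately show "f (g (h x)) = h (f (g x))" by (simp only:)
next
  fix W x assume W: "sub {T} W" "x \<in> W"
  show "f (g x) \<in> W" by (rule polop_closed[OF f W(1) polop_closed[OF g W]])
qed

lemma polop_plus:
  assumes f: "polop T f" and g: "polop T g" shows "polop T (\<lambda>x. f x + g x)"
  unfolding polop_def
proof (intro conjI allI impI)
  show "addv (\<lambda>x. f x + g x)" using polop_addv[OF f] polop_addv[OF g] by (simp add: addv_def algebra_simps)
  fix h x assume h: "addv h" "\<forall>x. h (T x) = T (h x)"
  have 1: "g (h x) = h (g x)" by (rule polop_comm[OF g h(1)]) (rule spec[OF h(2)])
  have 2: "f (h x) = h (f x)" by (rule polop_comm[OF f h(1)]) (rule spec[OF h(2)])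
  show "f (h x) + g (h x) = h (f x + g x)" unfolding 1 2 addv_add[OF h(1)] ..
next
  fix W x assume W: "sub {T} W" "x \<in> W"
  show "f x + g x \<in> W" by (rule sub_add[OF W(1) polop_closed[OF f W] polop_closed[OF g W]])
qed

text \<open>\<open>Qop T 0 = 1\<close>, \<open>Pop T j = 1 + T * Qop T j\<close> and \<open>Qop T (j + 1) = Qop T j * Pop T j\<close>: the monic integer
  polynomials \<open>Pop T j\<close> are pairwise coprime, so in a noetherian situation all but finitely many
  of them act injectively.\<close>

primrec Qop :: "('y::ab_group_add \<Rightarrow> 'y) \<Rightarrow> nat \<Rightarrow> 'y \<Rightarrow> 'y" where
  "Qop T 0 = (\<lambda>x. x)"
| "Qop T (Suc j) = (\<lambda>x. Qop T j (x + T (Qop T j x)))"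

definition Pop :: "('y::ab_group_add \<Rightarrow> 'y) \<Rightarrow> nat \<Rightarrow> 'y \<Rightarrow> 'y" where
  "Pop T j x = x + T (Qop T j x)"

lemma Qop_Suc: "Qop T (Suc j) x = Qop T j (Pop T j x)"
  by (simp add: Pop_def)

lemma polop_Qop: assumes "addv T" shows "polop T (Qop T j)"
proof (induction j)
  case 0
  then show ?case by (simp add: polop_id)
next
  case (Suc j)
  have "polop T (\<lambda>x. x + T (Qop T j x))"
    by (rule polop_plus[OF polop_id polop_comp[OF polop_T[OF assms] Suc]])
  from polop_comp[OF Suc this] show ?case by (simp only: Qop.simps)
qed

lemma polop_Pop: assumes "addv T" shows "polop T (Pop T j)"
proof -
  have "Pop T j = (\<lambda>x. x + T (Qop T j x))" by (rule ext) (rule Pop_def)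
  then show ?thesis using polop_plus[OF polop_id polop_comp[OF polop_T[OF assms] polop_Qop[OF assms]]] by (simp only:)
qed

lemma Qop_Suc': assumes "addv T" shows "Qop T (Suc j) x = Pop T j (Qop T j x)"
  unfolding Qop_Suc
proof (rule polop_comm[OF polop_Qop[OF assms] polop_addv[OF polop_Pop[OF assms]]])
  fix x show "Pop T j (T x) = T (Pop T j x)" by (rule polop_comm[OF polop_Pop[OF assms] assms]) (rule refl)
qed

text \<open>Injectivity of \<open>z\<close> modulo \<open>C\<close> survives reduction by
  \<open>P = Pop T j\<close>. If \<open>z g\<close> agrees with \<open>P w\<close> modulo
  \<open>C\<close>, then \<open>P w\<close> and hence \<open>Q P w\<close> lie in
  \<open>S = z X + C\<close>; stability puts \<open>Q w\<close> into \<open>S\<close>, and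
  \<open>w = P w - T Q w\<close> follows. So \<open>w\<close> is some \<open>z g'\<close> modulo
  \<open>C\<close>, and \<open>z (g - P g')\<close> lies in \<open>C\<close>.\<close>

lemma pop_lemma:
  fixes z T :: "'y::ab_group_add \<Rightarrow> 'y"
  assumes T: "addv T" and z: "addv z" "\<And>x. z (T x) = T (z x)"
    and X: "sub {T} X" and C: "sub {T} C"
    and st: "\<And>w. w \<in> E \<Longrightarrow> Qop T (Suc j) w \<in> z ` X \<boxplus> C \<Longrightarrow> Qop T j w \<in> z ` X \<boxplus> C"
    and inj: "\<And>g. g \<in> X \<Longrightarrow> z g \<in> C \<Longrightarrow> g \<in> C"
    and g: "g \<in> X" "w \<in> E" "z g - Pop T j w \<in> C"
  shows "\<exists>g'\<in>X. g - Pop T j g' \<in> C"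
proof -
  let ?Q = "Qop T j" and ?P = "Pop T j" and ?S = "z ` X \<boxplus> C"
  note Q = polop_Qop[OF T, of j] and P = polop_Pop[OF T, of j]
  have zX: "sub {T} (z ` X)"
  proof (rule sub_image[OF X])
    show "itw {T} {T} z" unfolding itw_def using z by simp
  qed
  have S: "sub {T} ?S" by (rule sub_ssum'[OF zX C]) (simp add: addops_def T)
  have zS: "z x \<in> ?S" if "x \<in> X" for x using ssum_left[OF sub_0[OF C]] that by blast
  have CS: "x \<in> ?S" if "x \<in> C" for x using ssum_right[OF sub_0[OF zX]] that by blast
  have "?P w = z g - (z g - ?P w)" by simp
  then have "?P w \<in> ?S" using sub_diff[OF S zS[OF g(1)] CS[OF g(3)]] by simp
  then have "Qop T (Suc j) w \<in> ?S" unfolding Qop_Suc by (rule polop_closed[OF Q S])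
  then have Qw: "?Q w \<in> ?S" by (rule st[OF g(2)])
  have "T (?Q w) \<in> ?S" by (rule polop_closed[OF polop_T[OF T] S Qw])
  then have "?P w - T (?Q w) \<in> ?S" by (rule sub_diff[OF S \<open>?P w \<in> ?S\<close>])
  then have "w \<in> ?S" by (simp add: Pop_def)
  then obtain y c where "y \<in> z ` X" "c \<in> C" "w = y + c" by (rule ssumE)
  then obtain g' where g': "g' \<in> X" "w = z g' + c" "c \<in> C" by blast
  have "?P (z g') = z (?P g')" by (rule polop_comm[OF P z])
  then have "?P w = z (?P g') + ?P c" using g'(2) addv_add[OF polop_addv[OF P]] by simp
  then have "z (g - ?P g') = (z g - ?P w) + ?P c" by (simp add: addv_diff[OF z(1)])
  then have "z (g - ?P g') \<in> C" using sub_add[OF C g(3) polop_closed[OF P C g'(3)]] by simp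
  then have "g - ?P g' \<in> C" by (rule inj[OF sub_diff[OF X g(1) polop_closed[OF P X g'(1)]]])
  then show ?thesis using g'(1) by blast
qed

text \<open>The chain \<open>{w. Qop T j w \<in> S}\<close> is increasing.\<close>

lemma pop_stable:
  assumes T: "addv T" and no: "noeth \<Omega> C0 E" and E: "sub \<Omega> E" and S: "sub \<Omega> S" and TO: "T \<in> \<Omega>"
    and ad: "addops \<Omega>" and comm: "\<And>f x. f \<in> \<Omega> \<Longrightarrow> f (T x) = T (f x)"
    and C0: "C0 \<subseteq> E" "C0 \<subseteq> S" "sub \<Omega> C0"
  shows "\<exists>j0. \<forall>j\<ge>j0. \<forall>w\<in>E. Qop T (Suc j) w \<in> S \<longrightarrow> Qop T j w \<in> S"
proof -
  define W where "W j = {w \<in> E. Qop T j w \<in> S}" for j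
  have ST: "sub {T} S" and CT: "sub {T} C0" using sub_mono[OF S, of "{T}"] sub_mono[OF C0(3), of "{T}"] TO by auto
  have it: "itw \<Omega> \<Omega> (Qop T j)" for j
    unfolding itw_def
  proof (intro conjI ballI)
    show "addv (Qop T j)" by (rule polop_addv[OF polop_Qop[OF T]])
    fix g assume g: "g \<in> \<Omega>"
    have "Qop T j (g x) = g (Qop T j x)" for x
    proof (rule polop_comm[OF polop_Qop[OF T]])
      show "addv g" using ad g by (simp add: addops_def)
      show "g (T x) = T (g x)" for x by (rule comm[OF g])
    qed
    then show "\<exists>g'\<in>\<Omega>. \<forall>x. Qop T j (g x) = g' (Qop T j x)" "\<exists>g'\<in>\<Omega>. \<forall>x. Qop T j (g' x) = g (Qop T j x)"
      using g by - (rule bexI[of _ g], simp_all)+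
  qed
  obtain N where N: "\<And>n. n \<ge> N \<Longrightarrow> W n = W N"
  proof (rule noethD[OF no, of W])
    show "sub \<Omega> (W j)" for j unfolding W_def by (rule sub_vimage[OF S E it])
    show "C0 \<subseteq> W j" for j unfolding W_def using polop_closed[OF polop_Qop[OF T] CT] C0 by blast
    show "W j \<subseteq> E" for j unfolding W_def by blast
    show "W j \<subseteq> W (Suc j)" for j
      unfolding W_def Qop_Suc'[OF T] using polop_closed[OF polop_Pop[OF T] ST] by blast
  qed metis
  have "Qop T j w \<in> S" if "j \<ge> N" "w \<in> E" "Qop T (Suc j) w \<in> S" for j w
  proof -
    have "w \<in> W (Suc j)" using that by (simp add: W_def)
    moreover have "W (Suc j) = W j" using N[of j] N[of "Suc j"] that(1) by simp
    ultimately have "w \<in> W j" by simp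
    then show ?thesis unfolding W_def by blast
  qed
  then show ?thesis by blast
qed

subsection \<open>Division by monic polynomials\<close>

text \<open>Multiplication by a monic polynomial of degree \<open>D\<close>, seen through supports
  only; this is all that division with remainder uses.\<close>

definition monop :: "nat \<Rightarrow> ((nat \<Rightarrow> 'x::ab_group_add) \<Rightarrow> nat \<Rightarrow> 'x) \<Rightarrow> bool" where
  "monop D f \<longleftrightarrow> (\<forall>K x. (\<forall>i\<ge>K. x i = 0) \<longrightarrow> (\<forall>i\<ge>K + D. f x i = 0) \<and> (\<forall>k. K = Suc k \<longrightarrow> f x (k + D) = x k))"

lemma monD0: "monop D f \<Longrightarrow> (\<And>i. i \<ge> K \<Longrightarrow> x i = 0) \<Longrightarrow> i \<ge> K + D \<Longrightarrow> f x i = 0"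
  unfolding monop_def by blast

lemma monD: "monop D f \<Longrightarrow> (\<And>i. i > k \<Longrightarrow> x i = 0) \<Longrightarrow> f x (k + D) = x k"
  unfolding monop_def by (metis Suc_le_eq)

lemma monI:
  assumes "\<And>K x i. (\<And>i. i \<ge> K \<Longrightarrow> x i = 0) \<Longrightarrow> i \<ge> K + D \<Longrightarrow> f x i = 0"
    and "\<And>k x. (\<And>i. i > k \<Longrightarrow> x i = 0) \<Longrightarrow> f x (k + D) = x k"
  shows "monop D f"
  unfolding monop_def
proof (intro allI impI conjI)
  show "f x i = 0" if "\<forall>i\<ge>K. x i = 0" "K + D \<le> i" for K x i using assms(1)[of K x i] that by simp
  show "f x (k + D) = x k" if "\<forall>i\<ge>K. x i = 0" "K = Suc k" for K x k using assms(2)[of k x] that by simp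
qed

lemma mon_comp:
  fixes f g :: "(nat \<Rightarrow> 'x::ab_group_add) \<Rightarrow> nat \<Rightarrow> 'x"
  assumes f: "monop D f" and g: "monop D' g" shows "monop (D + D') (\<lambda>x. f (g x))"
proof (rule monI)
  fix K and x :: "nat \<Rightarrow> 'x" and i assume x: "\<And>i. i \<ge> K \<Longrightarrow> x i = 0" and i: "i \<ge> K + (D + D')"
  have gx: "g x l = 0" if "l \<ge> K + D'" for l by (rule monD0[OF g, of K]) (use x that in simp_all)
  show "f (g x) i = 0" by (rule monD0[OF f, of "K + D'"]) (use gx i in simp_all)
next
  fix k and x :: "nat \<Rightarrow> 'x" assume x: "\<And>i. i > k \<Longrightarrow> x i = 0"
  have "f (g x) ((k + D') + D) = g x (k + D')"
    by (rule monD[OF f]) (rule monD0[OF g, of "Suc k"], use x in simp_all)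
  also have "\<dots> = x k" by (rule monD[OF g x])
  finally show "f (g x) (k + (D + D')) = x k" by (simp add: algebra_simps)
qed

lemma mon_1T:
  fixes f :: "(nat \<Rightarrow> 'x::ab_group_add) \<Rightarrow> nat \<Rightarrow> 'x"
  assumes "monop D f" shows "monop (Suc D) (\<lambda>x. x + TT (f x))"
proof (rule monI)
  fix K and x :: "nat \<Rightarrow> 'x" and i assume x: "\<And>i. i \<ge> K \<Longrightarrow> x i = 0" and i: "i \<ge> K + Suc D"
  then obtain l where l: "i = Suc l" by (cases i) simp_all
  have "f x l = 0" by (rule monD0[OF assms, of K]) (use x i l in simp_all)
  then show "(x + TT (f x)) i = 0" using x[of i] i l by simp
next
  fix k and x :: "nat \<Rightarrow> 'x" assume x: "\<And>i. i > k \<Longrightarrow> x i = 0"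
  show "(x + TT (f x)) (k + Suc D) = x k" using monD[OF assms, of k x] x by simp
qed

lemma mon_Qop: "\<exists>D. monop D (Qop (TT :: (nat \<Rightarrow> 'x::ab_group_add) \<Rightarrow> _) j)"
proof (induction j)
  case 0
  have "monop 0 (\<lambda>x. x)" by (rule monI) simp_all
  then show ?case by auto
next
  case (Suc j)
  then obtain D where D: "monop D (Qop (TT :: (nat \<Rightarrow> 'x) \<Rightarrow> _) j)" by blast
  from mon_comp[OF D mon_1T[OF D]] show ?case unfolding Qop.simps by (rule exI)
qed

text \<open>Positivity of the degree matters at the end of a reduction step, where multiplicities
  are divided by \<open>D\<close>.\<close>

lemma mon_Pop: "\<exists>D>0. monop D (Pop (TT :: (nat \<Rightarrow> 'x::ab_group_add) \<Rightarrow> _) j)"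
proof -
  let ?T = "TT :: (nat \<Rightarrow> 'x) \<Rightarrow> _"
  obtain D where D: "monop D (Qop ?T j)" using mon_Qop by blast
  have "Pop ?T j = (\<lambda>x. x + ?T (Qop ?T j x))" by (rule ext) (rule Pop_def)
  then have "monop (Suc D) (Pop ?T j)" using mon_1T[OF D] by (simp only:)
  then show ?thesis by blast
qed

text \<open>The leading coefficient of a nonzero \<open>y\<close> would reappear in
  \<open>f y\<close> in some degree at least \<open>D\<close>.\<close>

lemma mon_inj:
  assumes f: "monop D f" and y: "y \<in> Pol U" and 0: "\<And>i. i \<ge> D \<Longrightarrow> f y i = 0" shows "y = 0"
proof -
  obtain K where K: "\<And>i. i \<ge> K \<Longrightarrow> y i = 0" using PolE[OF y] by blast
  have "\<forall>i\<ge>k. y i = 0" if "k \<le> K" for k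
    using that
  proof (induction rule: inc_induct)
    case base
    then show ?case using K by blast
  next
    case (step n)
    have "f y (n + D) = y n" by (rule monD[OF f]) (use step in simp)
    then have "y n = 0" using 0[of "n + D"] by simp
    show ?case
    proof (intro allI impI)
      fix i assume "n \<le> i"
      then show "y i = 0" using \<open>y n = 0\<close> step.IH by (cases "i = n") simp_all
    qed
  qed
  from this[of 0] show ?thesis by (simp add: fun_eq_iff)
qed

lemma sub_Pol_TT: "sub \<Omega> U \<Longrightarrow> sub {TT} (Pol U)"
  by (rule subI) (auto intro: Pol_0 sub_0 Pol_diff Pol_TT)

lemma division:
  assumes f: "monop D f" and po: "polop TT f" and U: "sub \<Omega> U" and x: "x \<in> Pol U"
  shows "\<exists>y\<in>Pol U. x - f y \<in> pw D U"
proof -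
  have main: "\<exists>y\<in>Pol U. x - f y \<in> pw D U" if "x \<in> Pol U" "\<forall>i\<ge>K. x i = 0" for K x
    using that
  proof (induction K arbitrary: x)
    case 0
    then have x0: "x = 0" by (simp add: fun_eq_iff)
    have "x - f 0 = 0" unfolding x0 addv_0[OF polop_addv[OF po]] by (rule diff_self)
    moreover have "(0 :: nat \<Rightarrow> 'a) \<in> pw D U" using sub_0[OF U] by (simp add: pw_def)
    ultimately show ?case using Pol_0[OF sub_0[OF U]] by (intro bexI[of _ 0]) (simp_all only:)
  next
    case (Suc K)
    show ?case
    proof (cases "Suc K \<le> D")
      case True
      have "x - f 0 \<in> pw D U" using Suc.prems True PolD[OF Suc.prems(1)]
        by (auto simp: pw_def addv_0[OF polop_addv[OF po]])
      then show ?thesis using Pol_0[OF sub_0[OF U]] by blast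
    next
      case False
      \<comment> \<open>The monomial whose image under \<open>f\<close> cancels the top coefficient
        of \<open>x\<close>.\<close>
      define y where "y = (\<lambda>i. if i = K - D then x K else 0)"
      have y: "y \<in> Pol U" by (rule PolI[of _ _ "Suc (K - D)"]) (auto simp: y_def PolD[OF Suc.prems(1)] sub_0[OF U])
      have fy: "f y \<in> Pol U" by (rule polop_closed[OF po sub_Pol_TT[OF U] y])
      have 1: "f y ((K - D) + D) = y (K - D)" by (rule monD[OF f]) (simp add: y_def)
      have 2: "f y i = 0" if "i \<ge> Suc K" for i
        by (rule monD0[OF f, of "Suc (K - D)"]) (use that False in \<open>auto simp: y_def\<close>)
      have "(x - f y) i = 0" if "i \<ge> K" for i
        using that 1 2[of i] Suc.prems(2) False by (cases "i = K") (auto simp: y_def)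
      then obtain y' where y': "y' \<in> Pol U" "x - f y - f y' \<in> pw D U"
        using Suc.IH[OF Pol_diff[OF U Suc.prems(1) fy]] by blast
      have "y + y' \<in> Pol U" by (rule sub_add[OF sub_Pol_TT[OF U] y y'(1)])
      moreover have "x - f (y + y') \<in> pw D U" using y'(2) by (simp add: addv_add[OF polop_addv[OF po]] algebra_simps)
      ultimately show ?thesis by blast
    qed
  qed
  obtain K where "\<And>i. i \<ge> K \<Longrightarrow> x i = 0" using PolE[OF x] by blast
  then show ?thesis using main[OF x] by blast
qed

text \<open>The polynomial has constant term 1, so the coefficients of \<open>x\<close> can be
  recovered one after another from those of its image.\<close>

lemma Pop_reflect:
  assumes U: "sub \<Omega> U" and W: "sub \<Omega> W" and x: "x \<in> Pol U" and Px: "Pop TT j x \<in> Pol W"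
  shows "x \<in> Pol W"
proof (rule Pol_restrict[OF x])
  \<comment> \<open>Coefficient \<open>k\<close> of \<open>Qop TT j x\<close> depends only on the
    coefficients of \<open>x\<close> up to \<open>k\<close>.\<close>
  have causal: "Qop TT j x k \<in> W" if "\<And>i. i \<le> k \<Longrightarrow> x i \<in> W" for x j k
    using that
  proof (induction j arbitrary: x k)
    case 0
    then show ?case by simp
  next
    case (Suc j)
    have A: "(x + TT (Qop TT j x)) i \<in> W" if "i \<le> k" for i
    proof (cases i)
      case 0 then show ?thesis using Suc.prems that by simp
    next
      case (Suc l)
      have "Qop TT j x l \<in> W" by (rule Suc.IH) (use Suc.prems that \<open>i = Suc l\<close> in simp)
      then show ?thesis using Suc.prems[OF that] sub_add[OF W] \<open>i = Suc l\<close> by simp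
    qed
    have "Qop TT j (x + TT (Qop TT j x)) k \<in> W" by (rule Suc.IH) (rule A)
    then show ?case by (simp only: Qop.simps)
  qed
  fix i show "x i \<in> W"
  proof (induction i rule: less_induct)
    case (less i)
    have P: "x i + TT (Qop TT j x) i \<in> W" using PolD[OF Px, of i] by (simp add: Pop_def)
    have "TT (Qop TT j x) i \<in> W"
    proof (cases i)
      case 0 then show ?thesis using sub_0[OF W] by simp
    next
      case (Suc l)
      then show ?thesis using causal[of l x j] less by simp
    qed
    then show ?case using sub_add_cancel[OF W P] by simp
  qed
qed

subsection \<open>Powers of the maximal ideal and the generic linear form\<close>

context smod
begin

definition am :: "(nat \<Rightarrow> 's) \<Rightarrow> nat \<Rightarrow> 'x set \<Rightarrow> 'x set" where
  "am a t U = {\<Sum>i<t. sc (a i) (u i) | u. \<forall>i<t. u i \<in> U}"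

lemma amI: "(\<And>i. i < t \<Longrightarrow> u i \<in> U) \<Longrightarrow> (\<Sum>i<t. sc (a i) (u i)) \<in> am a t U"
  unfolding am_def by blast

lemma sub_am: assumes U: "submod sc U" shows "submod sc (am a t U)"
proof (rule sub_scI)
  show "0 \<in> am a t U" using amI[of t "\<lambda>_. 0" U a] sub_0[OF U] by (simp add: sc_0)
  show "x - y \<in> am a t U" if xy: "x \<in> am a t U" "y \<in> am a t U" for x y
  proof -
    obtain u v where u: "\<forall>i<t. u i \<in> U" "x = (\<Sum>i<t. sc (a i) (u i))" and v: "\<forall>i<t. v i \<in> U" "y = (\<Sum>i<t. sc (a i) (v i))"
      using xy unfolding am_def by blast
    have "x - y = (\<Sum>i<t. sc (a i) (u i - v i))" by (simp add: u v sc_diff sum_subtractf)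
    then show ?thesis using amI[of t "\<lambda>i. u i - v i" U a] u v sub_diff[OF U] by simp
  qed
  show "sc s x \<in> am a t U" if xx: "x \<in> am a t U" for s x
  proof -
    obtain u where u: "\<forall>i<t. u i \<in> U" "x = (\<Sum>i<t. sc (a i) (u i))" using xx unfolding am_def by blast
    have "sc s x = (\<Sum>i<t. sc (a i) (sc s (u i)))" by (simp add: u sc_sum sc_commute)
    then show ?thesis using amI[of t "\<lambda>i. sc s (u i)" U a] u sub_sc[OF U] by simp
  qed
qed

lemma am_subset: "submod sc U \<Longrightarrow> am a t U \<subseteq> U"
proof
  fix x assume U: "submod sc U" and "x \<in> am a t U"
  then obtain u where u: "\<forall>i<t. u i \<in> U" "x = (\<Sum>i<t. sc (a i) (u i))" unfolding am_def by blast
  show "x \<in> U" unfolding u(2) by (rule sub_sum[OF U]) (rule sub_sc[OF U], use u(1) in simp)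
qed

lemma am_gen: assumes U: "submod sc U" "u \<in> U" and i: "i < t" shows "sc (a i) u \<in> am a t U"
proof -
  have "(\<Sum>k<t. sc (a k) (if k = i then u else 0)) = sc (a i) u"
    using i by (subst sum.cong[OF refl, of _ _ "\<lambda>k. if k = i then sc (a i) u else 0"]) (auto simp: sc_0)
  then show ?thesis using amI[of t "\<lambda>k. if k = i then u else 0" U a] U sub_0[OF U(1)] by simp
qed

text \<open>In the application this is \<open>m^n U\<close> only after adding \<open>V\<close>,
  because the \<open>a i\<close> generate the maximal ideal modulo \<open>I\<close>.\<close>

definition mpw :: "(nat \<Rightarrow> 's) \<Rightarrow> nat \<Rightarrow> nat \<Rightarrow> 'x set \<Rightarrow> 'x set" where
  "mpw a t n U = (am a t ^^ n) U"

lemma mpw_0 [simp]: "mpw a t 0 U = U" and mpw_Suc: "mpw a t (Suc n) U = am a t (mpw a t n U)"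
  by (simp_all add: mpw_def)

lemma sub_mpw: "submod sc U \<Longrightarrow> submod sc (mpw a t n U)"
  by (induction n) (simp_all add: mpw_Suc sub_am)

lemma mpw_decr: "submod sc U \<Longrightarrow> mpw a t (Suc n) U \<subseteq> mpw a t n U"
  by (simp add: mpw_Suc am_subset sub_mpw)

text \<open>Multiplication of polynomials by the generic linear form, whose coefficient at
  \<open>T^i\<close> is \<open>a i\<close>.\<close>

definition zz :: "(nat \<Rightarrow> 's) \<Rightarrow> nat \<Rightarrow> (nat \<Rightarrow> 'x) \<Rightarrow> (nat \<Rightarrow> 'x)" where
  "zz a t x = (\<lambda>k. \<Sum>i<t. if i \<le> k then sc (a i) (x (k - i)) else 0)"

lemma addv_zz: "addv (zz a t)"
  by (auto simp: addv_def zz_def fun_eq_iff sum.distrib[symmetric] sc_add intro!: sum.cong)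

lemma zz_TT: "zz a t (TT x) = TT (zz a t x)"
proof (rule ext)
  fix k show "zz a t (TT x) k = TT (zz a t x) k"
  proof (cases k)
    case 0
    then show ?thesis by (auto simp: zz_def sc_0 intro!: sum.neutral)
  next
    case (Suc l)
    then show ?thesis by (auto simp: zz_def sc_0 Suc_diff_le le_Suc_eq intro!: sum.cong)
  qed
qed

lemma zz_psc: "zz a t (psc sc s x) = psc sc s (zz a t x)"
  by (auto simp: zz_def fun_eq_iff sc_sum sc_0 sc_commute intro!: sum.cong)

lemma zz_Pol:
  assumes U: "\<And>i u. i < t \<Longrightarrow> u \<in> U \<Longrightarrow> sc (a i) u \<in> W" and W: "submod sc W" and x: "x \<in> Pol U"
  shows "zz a t x \<in> Pol W"
proof -
  obtain K where K: "\<And>i. i \<ge> K \<Longrightarrow> x i = 0" using PolE[OF x] by blast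
  show ?thesis
  proof (rule PolI[of _ _ "K + t"])
    show "zz a t x k \<in> W" for k unfolding zz_def
      by (rule sub_sum[OF W]) (use U PolD[OF x] sub_0[OF W] in auto)
    show "zz a t x k = 0" if "k \<ge> K + t" for k unfolding zz_def
      by (rule sum.neutral) (use K that in \<open>auto simp: sc_0\<close>)
  qed
qed

text \<open>McCoy: a polynomial annihilated by the generic linear form has coefficients that are
  annihilated by a power of each \<open>a i\<close>.\<close>

lemma mccoy:
  assumes A: "\<And>n. submod sc (A n)" and B: "\<And>n. submod sc (B n)"
    and aA: "\<And>n i u. i < t \<Longrightarrow> u \<in> A n \<Longrightarrow> sc (a i) u \<in> A (Suc n)"
    and aB: "\<And>n i u. i < t \<Longrightarrow> u \<in> B n \<Longrightarrow> sc (a i) u \<in> B (Suc n)"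
    and soc: "\<And>n u. n \<ge> c \<Longrightarrow> u \<in> A n \<Longrightarrow> (\<And>i. i < t \<Longrightarrow> sc (a i) u \<in> B (Suc n)) \<Longrightarrow> u \<in> B n"
    and n: "n \<ge> c" and g: "g \<in> Pol (A n)" and zg: "zz a t g \<in> Pol (B (Suc n))"
  shows "g \<in> Pol (B n)"
proof -
  \<comment> \<open>\<open>r\<close> counts the generators already known to push \<open>g\<close>
    into \<open>B\<close>. For \<open>r = t\<close> the socle hypothesis applies; for smaller
    \<open>r\<close> the knowledge about \<open>a r\<close> is regained from the equation for
    \<open>zz a t g\<close>. The index of \<open>A\<close> and \<open>B\<close> is a filtration
    degree, so constant families cover \<open>U/V\<close> itself and varying ones the associated
    graded module.\<close>
  have main: "\<forall>n g. n \<ge> c \<longrightarrow> g \<in> Pol (A n) \<longrightarrow> (\<forall>i<r. \<forall>k. sc (a i) (g k) \<in> B (Suc n)) \<longrightarrow> (\<forall>k. zz a t g k \<in> B (Suc n))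
      \<longrightarrow> (\<forall>k. g k \<in> B n)" if "r \<le> t" for r
    using that
  proof (induction rule: inc_induct)
    case base
    then show ?case using soc PolD by blast
  next
    case (step r)
    note IH = step.IH
    have rt: "r < t" by (rule step.hyps)
    show ?case
    proof (intro allI impI)
      fix n g k0
      assume n: "n \<ge> c" and g: "g \<in> Pol (A n)" and ag: "\<forall>i<r. \<forall>k. sc (a i) (g k) \<in> B (Suc n)"
        and zg: "\<forall>k. zz a t g k \<in> B (Suc n)"
      let ?y = "sc (a r)"
      have yB: "(?y ^^ l) u \<in> B (m + l)" if "u \<in> B m" for l u m
        using that aB[OF rt] by (induction l) auto
      have yA: "(?y ^^ l) u \<in> A (m + l)" if "u \<in> A m" for l u m
        using that aA[OF rt] by (induction l) auto
      have ay: "addv (?y ^^ l)" for l by (rule addv_pow[OF addv_sc])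
      have ycomm: "(?y ^^ l) (sc s u) = sc s ((?y ^^ l) u)" for l s u
        by (induction l) (simp_all add: sc_commute)
      \<comment> \<open>Coefficient \<open>r + k\<close> of \<open>zz a t g\<close> is isolated. Its
        terms with \<open>i < r\<close> are harmless by \<open>ag\<close>; those with
        \<open>i > r\<close> involve some \<open>g k'\<close> with \<open>k' < k\<close>, already
        treated by a smaller power of \<open>a r\<close>.\<close>
      have pow: "(?y ^^ Suc k) (g k) \<in> B (n + Suc k)" for k
      proof (induction k rule: less_induct)
        case (less k)
        have split: "zz a t g (r + k) = ?y (g k) + (\<Sum>i\<in>{..<t} - {r}. if i \<le> r + k then sc (a i) (g (r + k - i)) else 0)"
          using rt by (simp add: zz_def sum.remove[of "{..<t}" r])
        have "(?y ^^ k) (zz a t g (r + k)) \<in> B (Suc n + k)" by (rule yB[OF spec[OF zg]])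
        moreover have "(?y ^^ k) (\<Sum>i\<in>{..<t} - {r}. if i \<le> r + k then sc (a i) (g (r + k - i)) else 0) \<in> B (Suc n + k)"
          unfolding addv_sum[OF ay]
        proof (rule sub_sum[OF B])
          fix i assume i: "i \<in> {..<t} - {r}"
          show "(?y ^^ k) (if i \<le> r + k then sc (a i) (g (r + k - i)) else 0) \<in> B (Suc n + k)"
          proof (cases "i \<le> r + k")
            case False then show ?thesis using sub_0[OF B] addv_0[OF ay] by simp
          next
            case le: True
            show ?thesis
            proof (cases "i < r")
              case True
              then show ?thesis using yB[of "sc (a i) (g (r + k - i))" "Suc n" k] ag le by simp
            next
              case False
              then have ir: "i > r" using i by simp
              define k' where "k' = r + k - i"
              have k': "k' < k" using ir le by (simp add: k'_def)
              have k: "k = (k - Suc k') + Suc k'" using k' by simp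
              have E: "(?y ^^ k) (sc (a i) (g k')) = sc (a i) ((?y ^^ (k - Suc k')) ((?y ^^ Suc k') (g k')))"
                by (subst k) (simp only: funpow_add comp_apply ycomm)
              have nk: "n + Suc k' + (k - Suc k') = n + k" using k' by simp
              have M: "(?y ^^ (k - Suc k')) ((?y ^^ Suc k') (g k')) \<in> B (n + k)"
                using yB[OF less[OF k'], of "k - Suc k'"] unfolding nk .
              have "(?y ^^ k) (sc (a i) (g k')) \<in> B (Suc (n + k))" unfolding E by (rule aB[OF _ M]) (use i in simp)
              then show ?thesis using le by (simp add: k'_def)
            qed
          qed
        qed
        ultimately have "(?y ^^ k) (?y (g k)) \<in> B (Suc n + k)"
          unfolding split addv_add[OF ay] by (rule sub_add_cancel[OF B])
        then show ?case by (simp add: funpow_swap1)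
      qed
      obtain K where K: "\<And>i. i \<ge> K \<Longrightarrow> g i = 0" using PolE[OF g] by blast
      \<comment> \<open>The power \<open>K\<close> works for all coefficients. Passing from
        \<open>l + 1\<close> to \<open>l\<close> applies the induction hypothesis for
        \<open>r + 1\<close> to the polynomial with coefficients \<open>(a r)^l g k\<close>, which
        \<open>a r\<close> pushes into \<open>B\<close>.\<close>
      have desc: "\<forall>k. (?y ^^ l) (g k) \<in> B (n + l)" if "l \<le> K" for l
        using that
      proof (induction rule: inc_induct)
        case base
        show ?case
        proof
          fix k show "(?y ^^ K) (g k) \<in> B (n + K)"
          proof (cases "k < K")
            case True
            then have "K = (K - Suc k) + Suc k" by simp
            then have "(?y ^^ K) (g k) = (?y ^^ (K - Suc k)) ((?y ^^ Suc k) (g k))" by (metis funpow_add comp_apply)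
            moreover have "(?y ^^ (K - Suc k)) ((?y ^^ Suc k) (g k)) \<in> B (n + Suc k + (K - Suc k))" by (rule yB[OF pow])
            moreover have "n + Suc k + (K - Suc k) = n + K" using True by simp
            ultimately show ?thesis by simp
          next
            case False then show ?thesis using K addv_0[OF ay] sub_0[OF B] by simp
          qed
        qed
      next
        case (step l)
        let ?g = "\<lambda>k. (?y ^^ l) (g k)"
        have 1: "?g \<in> Pol (A (n + l))"
          by (rule PolI[of _ _ K]) (use yA PolD[OF g] K addv_0[OF ay] in auto)
        have 2: "sc (a i) (?g k) \<in> B (Suc (n + l))" if "i < Suc r" for i k
        proof (cases "i = r")
          case True then show ?thesis using step.IH by simp
        next
          case False
          then have "sc (a i) (g k) \<in> B (Suc n)" using ag that by simp
          from yB[OF this, of l] show ?thesis by (simp add: ycomm)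
        qed
        have "zz a t ?g k = (?y ^^ l) (zz a t g k)" for k
          unfolding zz_def addv_sum[OF ay] by (rule sum.cong) (simp_all add: ycomm addv_0[OF ay])
        then have 3: "zz a t ?g k \<in> B (Suc (n + l))" for k using yB[of "zz a t g k" "Suc n" l] zg by simp
        show ?case using IH[rule_format, of "n + l" ?g] 1 2 3 n by simp
      qed
      from desc[of 0] show "g k0 \<in> B n" by simp
    qed
  qed
  have "\<forall>k. g k \<in> B n" using main[of 0] n g PolD[OF zg] by blast
  then show ?thesis using Pol_restrict[OF g] by blast
qed

end

lemma sum_fun_app: "(sum f A) k = (\<Sum>i\<in>A. (f i k :: 'x::ab_group_add))"
  by (induction A rule: infinite_finite_induct) simp_all

text \<open>The monomial of degree \<open>n\<close> with coefficient \<open>x\<close>, used for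
  polynomials in \<open>T\<close>, for Rees degrees and for unit vectors.\<close>

definition dlt :: "nat \<Rightarrow> 'x::ab_group_add \<Rightarrow> nat \<Rightarrow> 'x" where
  "dlt n x = (\<lambda>m. if m = n then x else 0)"

lemma addv_dlt: "addv (dlt n)"
  by (auto simp: addv_def dlt_def fun_eq_iff)

lemma dlt_Pol: "0 \<in> U \<Longrightarrow> x \<in> U \<Longrightarrow> dlt n x \<in> Pol U"
  by (rule PolI[of _ _ "Suc n"]) (auto simp: dlt_def)

lemma dlt_expand: assumes "\<And>i. i \<ge> K \<Longrightarrow> x i = 0" shows "x = (\<Sum>n<K. dlt n (x n))"
proof (rule ext)
  fix m
  have "(\<Sum>n<K. dlt n (x n)) m = (\<Sum>n<K. if n = m then x m else 0)"
    unfolding sum_fun_app dlt_def by (rule sum.cong) auto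
  also have "\<dots> = x m" using assms[of m] by auto
  finally show "x m = (\<Sum>n<K. dlt n (x n)) m" ..
qed

lemma Pol_ssum:
  assumes "0 \<in> A" "0 \<in> B" "x \<in> Pol (A \<boxplus> B)"
  shows "\<exists>y\<in>Pol A. \<exists>z\<in>Pol B. x = y + z"
proof -
  obtain K where K: "\<And>i. i \<ge> K \<Longrightarrow> x i = 0" using PolE[OF assms(3)] by blast
  have "\<exists>u v. u \<in> A \<and> v \<in> B \<and> x i = u + v" for i
    using PolD[OF assms(3), of i] by (auto elim!: ssumE)
  then obtain f g where fg: "\<And>i. f i \<in> A \<and> g i \<in> B \<and> x i = f i + g i" by metis
  show ?thesis
  proof (intro bexI)
    show "(\<lambda>i. if i < K then f i else 0) \<in> Pol A" "(\<lambda>i. if i < K then g i else 0) \<in> Pol B"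
      using fg assms by (auto intro!: PolI[of _ _ K])
    show "x = (\<lambda>i. if i < K then f i else 0) + (\<lambda>i. if i < K then g i else 0)"
      using fg K by (auto simp: fun_eq_iff)
  qed
qed

lemma Pol_ssum': "sub \<Omega> A \<Longrightarrow> sub \<Omega> B \<Longrightarrow> addops \<Omega> \<Longrightarrow> Pol A \<boxplus> Pol B = Pol (A \<boxplus> B)"
proof
  assume A: "sub \<Omega> A" and B: "sub \<Omega> B" and ad: "addops \<Omega>"
  show "Pol A \<boxplus> Pol B \<subseteq> Pol (A \<boxplus> B)"
    by (rule ssum_least[OF sub_Pol_TT[OF sub_ssum'[OF A B ad]]])
       (rule Pol_mono, rule ssum_left[OF sub_0[OF B]], rule Pol_mono, rule ssum_right[OF sub_0[OF A]])
  show "Pol (A \<boxplus> B) \<subseteq> Pol A \<boxplus> Pol B"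
  proof
    fix x assume "x \<in> Pol (A \<boxplus> B)"
    then obtain y z where "y \<in> Pol A" "z \<in> Pol B" "x = y + z" using Pol_ssum[OF sub_0[OF A] sub_0[OF B]] by blast
    then show "x \<in> Pol A \<boxplus> Pol B" using ssumI by blast
  qed
qed

locale glmod = lmod I N sc for I N :: "'s::comm_ring_1 set" and sc :: "'s \<Rightarrow> 'x::ab_group_add \<Rightarrow> 'x" +
  fixes a :: "nat \<Rightarrow> 's" and t :: nat
  assumes aN: "\<And>i. i < t \<Longrightarrow> a i \<in> N" and gens: "\<And>s. s \<in> N \<Longrightarrow> \<exists>c. s - (\<Sum>i<t. c i * a i) \<in> I"
begin

lemma smod_axioms': "smod sc" by unfold_locales

lemma N_am: assumes p: "apair sc I V U" and s: "s \<in> N" and u: "u \<in> W" and W: "ssub W" "W \<subseteq> U"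
  shows "sc s u \<in> am a t W \<boxplus> V"
proof -
  obtain c where c: "s - (\<Sum>i<t. c i * a i) \<in> I" using gens[OF s] by blast
  have "sc (\<Sum>i<t. c i * a i) u = (\<Sum>i<t. sc (a i) (sc (c i) u))"
    by (simp add: sc_sum_left sc_mult sc_commute)
  moreover have "\<dots> \<in> am a t W" by (rule amI) (rule sub_sc[OF W(1) u])
  ultimately have "sc (\<Sum>i<t. c i * a i) u \<in> am a t W" by simp
  moreover have "sc (s - (\<Sum>i<t. c i * a i)) u \<in> V" using apairD(4)[OF p c] u W by blast
  ultimately have "sc (\<Sum>i<t. c i * a i) u + sc (s - (\<Sum>i<t. c i * a i)) u \<in> am a t W \<boxplus> V" by (rule ssumI)
  then show ?thesis by (simp add: sc_diff_left)
qed

lemma Pol_am: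
  assumes W: "0 \<in> W" and x: "x \<in> Pol (am a t W)"
  shows "\<exists>y. (\<forall>i<t. y i \<in> Pol W) \<and> x = (\<Sum>i<t. psc sc (a i) (y i))"
proof -
  obtain K where K: "\<And>i. i \<ge> K \<Longrightarrow> x i = 0" using PolE[OF x] by blast
  have "\<exists>u. (\<forall>i<t. u i \<in> W) \<and> x k = (\<Sum>i<t. sc (a i) (u i))" for k
    using PolD[OF x, of k] unfolding am_def by blast
  then obtain u where u: "\<And>k i. i < t \<Longrightarrow> u k i \<in> W" "\<And>k. x k = (\<Sum>i<t. sc (a i) (u k i))" by metis
  define y where "y i = (\<lambda>k. if k < K then u k i else 0)" for i
  have "y i \<in> Pol W" if "i < t" for i
    by (rule PolI[of _ _ K]) (use u(1)[OF that] W in \<open>simp_all add: y_def\<close>)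
  moreover have "x = (\<Sum>i<t. psc sc (a i) (y i))"
  proof (rule ext)
    fix k show "x k = (\<Sum>i<t. psc sc (a i) (y i)) k"
      unfolding sum_fun_app using u(2)[of k] K[of k] by (cases "k < K") (simp_all add: y_def sc_0)
  qed
  ultimately show ?thesis by blast
qed

lemma addops_T: "addops (insert TT (range (psc sc)))"
  using addops_psc by (simp add: addops_def addv_TT)

lemma TT_psc: "TT (psc sc s x) = psc sc s (TT x)"
  by (auto simp: TT_def psc_def fun_eq_iff sc_0 split: nat.splits)

text \<open>The basis theorem over the constants. \<open>Pol V\<close> is put among the coefficients
  because \<open>noeth_padj\<close> works above a submodule of its coefficient module.\<close>

lemma noeth_Pol:
  assumes p: "apair sc I V U" and no: "noe V U"
  shows "noeth (insert TT (range (psc sc))) (Pol V) (Pol U)"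
proof -
  note V = apairD(1)[OF p] and U = apairD(2)[OF p]
  let ?E0 = "dlt 0 ` U \<boxplus> Pol V"
  have itd: "itw (range sc) (range (psc sc)) (dlt 0)"
    by (rule itw_lin[where sc = sc and sc' = "psc sc", OF addv_dlt]) (auto simp: dlt_def psc_def sc_0 fun_eq_iff)
  have PV: "submod (psc sc) (Pol V)" by (rule sub_Pol'[OF smod_axioms' V])
  have dU: "submod (psc sc) (dlt 0 ` U)" by (rule sub_image[OF U itd])
  have E0: "submod (psc sc) ?E0" by (rule sub_ssum'[OF dU PV addops_psc])
  have n0: "noeth (range (psc sc)) (Pol V) ?E0"
    by (rule noeth_image[OF no itd U apairD(3)[OF p]]) (use dlt_Pol[OF sub_0[OF V]] in auto)
  have cm: "f (TT x) = TT (f x)" if "f \<in> range (psc sc)" for f x using that by (auto simp: TT_psc)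
  have CE: "Pol V \<subseteq> ?E0" by (rule ssum_right[OF sub_0[OF dU]])
  have "noeth (insert TT (range (psc sc))) (Pol V) (padj TT ?E0)"
    by (rule noeth_padj[OF addops_psc addv_TT cm E0 n0 _ CE]) (use Pol_TT[OF sub_0[OF V]] in auto)
  moreover have "Pol U \<subseteq> padj TT ?E0"
  proof
    fix x assume x: "x \<in> Pol U"
    have S: "sub (insert TT (range (psc sc))) (padj TT ?E0)" by (rule sub_padj[OF addops_psc addv_TT cm E0])
    obtain K where K: "\<And>i. i \<ge> K \<Longrightarrow> x i = 0" using PolE[OF x] by blast
    have d: "dlt n u \<in> padj TT ?E0" if "u \<in> U" for n u
    proof (induction n)
      case 0
      have "dlt 0 u \<in> ?E0" using ssum_left[OF sub_0[OF PV]] that by blast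
      then show ?case using padj_base[OF addops_psc addv_TT cm E0] by blast
    next
      case (Suc n)
      have "dlt (Suc n) u = TT (dlt n u)" by (auto simp: dlt_def TT_def fun_eq_iff split: nat.splits)
      then show ?case using sub_op[OF S _ Suc, of TT] by simp
    qed
    have "(\<Sum>n<K. dlt n (x n)) \<in> padj TT ?E0" by (rule sub_sum[OF S]) (rule d[OF PolD[OF x]])
    then show "x \<in> padj TT ?E0" using dlt_expand[of K x, OF K] by simp
  qed
  ultimately show ?thesis by (rule noeth_mono[OF _ order_refl _ order_refl])
qed

subsection \<open>The Rees module\<close>

definition TT2 :: "(nat \<Rightarrow> nat \<Rightarrow> 'x) \<Rightarrow> (nat \<Rightarrow> nat \<Rightarrow> 'x)" where
  "TT2 r = (\<lambda>n. TT (r n))"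

definition YY :: "nat \<Rightarrow> (nat \<Rightarrow> nat \<Rightarrow> 'x) \<Rightarrow> (nat \<Rightarrow> nat \<Rightarrow> 'x)" where
  "YY i r = (\<lambda>n. case n of 0 \<Rightarrow> 0 | Suc k \<Rightarrow> psc sc (a i) (r k))"

text \<open>The Rees ring over \<open>S[T]\<close> as a set of operators: \<open>YY i\<close>
  multiplies by \<open>a i\<close> and raises the Rees degree. The index \<open>k\<close> lets its
  variables be adjoined one at a time.\<close>

definition Om :: "nat \<Rightarrow> ((nat \<Rightarrow> nat \<Rightarrow> 'x) \<Rightarrow> (nat \<Rightarrow> nat \<Rightarrow> 'x)) set" where
  "Om k = insert TT2 (range (psc (psc sc))) \<union> YY ` {..<k}"

abbreviation UU :: "'x set \<Rightarrow> 'x set \<Rightarrow> nat \<Rightarrow> 'x set" where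
  "UU V U n \<equiv> mpw a t n U \<boxplus> V"

text \<open>The Rees module of the filtration of \<open>U[T]\<close> by the polynomials with
  coefficients in \<open>m^n U + V\<close>.\<close>

definition Rs :: "'x set \<Rightarrow> 'x set \<Rightarrow> (nat \<Rightarrow> nat \<Rightarrow> 'x) set" where
  "Rs V U = {r. (\<forall>n. r n \<in> Pol (UU V U n)) \<and> (\<exists>L. \<forall>n\<ge>L. r n = 0)}"

lemma addv_TT2: "addv TT2"
  by (simp add: addv_def TT2_def fun_eq_iff addv_add[OF addv_TT])

lemma smod_p: "smod (psc sc)" by (rule smod_psc[OF smod_axioms'])
lemma smod_pp: "smod (psc (psc sc))" by (rule smod_psc[OF smod_p])

lemma addv_YY: "addv (YY i)"
  by (auto simp: addv_def YY_def fun_eq_iff sc_add split: nat.splits)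

lemma YY_0 [simp]: "YY i r 0 = 0" and YY_Suc [simp]: "YY i r (Suc n) = psc sc (a i) (r n)"
  by (simp_all add: YY_def)

lemma addops_Om: "addops (Om k)"
  unfolding addops_def Om_def using addv_TT2 addv_YY smod.addv_sc[OF smod_pp] by blast

lemma psc_0 [simp]: "psc sc s 0 = 0"
  by (simp add: psc_def sc_0 fun_eq_iff)

lemma YY_Om_comm: "f \<in> Om k \<Longrightarrow> f (YY i r) = YY i (f r)"
proof (rule ext)
  fix n assume f: "f \<in> Om k"
  then consider "f = TT2" | s where "f = psc (psc sc) s" | j where "f = YY j" unfolding Om_def by blast
  then show "f (YY i r) n = YY i (f r) n"
  proof cases
    case 1 then show ?thesis by (cases n) (simp_all add: TT2_def TT_psc addv_0[OF addv_TT])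
  next
    case 2 then show ?thesis by (cases n) (simp_all add: smod.sc_commute[OF smod_p])
  next
    case 3
    show ?thesis
    proof (cases n)
      case (Suc m) then show ?thesis using 3 by (cases m) (simp_all add: smod.sc_commute[OF smod_p])
    qed (simp add: 3)
  qed
qed

lemma TT2_Om_comm: "f \<in> Om k \<Longrightarrow> f (TT2 r) = TT2 (f r)"
proof (rule ext)
  fix n assume f: "f \<in> Om k"
  then consider "f = TT2" | s where "f = psc (psc sc) s" | j where "f = YY j" unfolding Om_def by blast
  then show "f (TT2 r) n = TT2 (f r) n"
  proof cases
    case 3 then show ?thesis by (cases n) (simp_all add: TT2_def TT_psc addv_0[OF addv_TT])
  qed (simp_all add: TT2_def TT_psc)
qed

context
  fixes V U assumes p: "apair sc I V U" and no: "noe V U"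
begin

lemma V: "ssub V" and U: "ssub U" and VU: "V \<subseteq> U"
  using apairD[OF p] by blast+

lemma sub_UU: "ssub (UU V U n)"
  by (rule sub_ssum'[OF sub_mpw[OF U] V addops_sc])

lemma V_UU: "V \<subseteq> UU V U n"
  by (rule ssum_right[OF sub_0[OF sub_mpw[OF U]]])

lemma UU_0: "UU V U 0 = U"
  using ssum_absorb[OF U VU sub_0[OF V]] by (simp add: ssum_commute)

lemma UU_decr: "UU V U (Suc n) \<subseteq> UU V U n"
  by (intro ssum_mono mpw_decr U order_refl)

lemma UU_mono: "m \<le> n \<Longrightarrow> UU V U n \<subseteq> UU V U m"
  by (rule lift_Suc_antimono_le[of "UU V U", OF UU_decr])

lemma UU_U: "UU V U n \<subseteq> U"
  using UU_mono[of 0 n] UU_0 by simp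

lemma a_UU: assumes i: "i < t" and u: "u \<in> UU V U n" shows "sc (a i) u \<in> UU V U (Suc n)"
proof -
  from u obtain x v where "x \<in> mpw a t n U" "v \<in> V" "u = x + v" by (rule ssumE)
  then show ?thesis unfolding mpw_Suc using am_gen[OF sub_mpw[OF U] _ i] sub_sc[OF V]
    by (auto simp: sc_add intro!: ssumI)
qed

lemma a_PUU: assumes i: "i < t" and u: "u \<in> Pol (UU V U n)" shows "psc sc (a i) u \<in> Pol (UU V U (Suc n))"
proof -
  obtain K where K: "\<And>i. i \<ge> K \<Longrightarrow> u i = 0" using PolE[OF u] by blast
  show ?thesis by (rule PolI[of _ _ K]) (simp_all add: K sc_0 a_UU[OF i PolD[OF u]])
qed

lemma sub_PUU: "sub (insert TT (range (psc sc))) (Pol (UU V U n))"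
  by (rule sub_Pol[OF smod_axioms' sub_UU])

text \<open>Up to \<open>V\<close>, the Rees module is generated in degree 0 over the variables
  \<open>YY i\<close>, so the basis theorem is applied \<open>t\<close> times to an extension of
  \<open>U[T]\<close>.\<close>

lemma noeth_Rs: "noeth (Om t) (Pol (Pol V)) (Rs V U)"
proof -
  note PV = sub_Pol[OF smod_axioms' V] and PU = sub_Pol[OF smod_axioms' U]
  let ?C = "Pol (Pol V)"
  have C: "sub (Om k) ?C" for k
  proof (rule subI)
    show "0 \<in> ?C" by (rule Pol_0[OF sub_0[OF PV]])
    show "x - y \<in> ?C" if "x \<in> ?C" "y \<in> ?C" for x y by (rule Pol_diff[OF PV that])
    fix f x assume f: "f \<in> Om k" and x: "x \<in> ?C"
    obtain K where K: "\<And>i. i \<ge> K \<Longrightarrow> x i = 0" using PolE[OF x] by blast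
    from f consider "f = TT2" | s where "f = psc (psc sc) s" | j where "f = YY j" unfolding Om_def by blast
    then show "f x \<in> ?C"
    proof cases
      case 1
      show ?thesis unfolding 1
        by (rule PolI[of _ _ K]) (simp_all add: TT2_def K addv_0[OF addv_TT] Pol_TT[OF sub_0[OF V] PolD[OF x]])
    next
      case 2
      have "psc sc s (x i) \<in> Pol V" for i by (rule sub_op[OF PV _ PolD[OF x]]) (rule insertI2, rule rangeI)
      then show ?thesis unfolding 2 by (rule_tac PolI[of _ _ K]) (simp_all add: K)
    next
      case 3
      have "psc sc s (x i) \<in> Pol V" for i s by (rule sub_op[OF PV _ PolD[OF x]]) (rule insertI2, rule rangeI)
      then have "YY j x i \<in> Pol V" for i using sub_0[OF PV] by (cases i) simp_all
      moreover have "YY j x i = 0" if "i \<ge> Suc K" for i using K that by (cases i) simp_all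
      ultimately show ?thesis unfolding 3 by (rule PolI)
    qed
  qed
  let ?E0 = "dlt 0 ` Pol U \<boxplus> ?C"
  have itd: "itw (insert TT (range (psc sc))) (Om 0) (dlt 0)"
    unfolding itw_def
  proof (intro conjI ballI)
    have 1: "dlt 0 (TT x) = TT2 (dlt 0 x)" for x by (auto simp: dlt_def TT2_def fun_eq_iff addv_0[OF addv_TT])
    have 2: "dlt 0 (psc sc s x) = psc (psc sc) s (dlt 0 x)" for s x by (auto simp: dlt_def fun_eq_iff sc_0)
    fix g assume "g \<in> insert TT (range (psc sc))"
    then consider "g = TT" | s where "g = psc sc s" by blast
    then show "\<exists>g'\<in>Om 0. \<forall>x. dlt 0 (g x) = g' (dlt 0 x)"
    proof cases
      case 1 then show ?thesis using \<open>\<And>x. dlt 0 (TT x) = TT2 (dlt 0 x)\<close> by (intro bexI[of _ TT2]) (simp_all add: Om_def)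
    next
      case 2 then show ?thesis using \<open>\<And>s x. dlt 0 (psc sc s x) = psc (psc sc) s (dlt 0 x)\<close>
        by (intro bexI[of _ "psc (psc sc) s"]) (simp_all add: Om_def)
    qed
  next
    have 1: "dlt 0 (TT x) = TT2 (dlt 0 x)" for x by (auto simp: dlt_def TT2_def fun_eq_iff addv_0[OF addv_TT])
    have 2: "dlt 0 (psc sc s x) = psc (psc sc) s (dlt 0 x)" for s x by (auto simp: dlt_def fun_eq_iff sc_0)
    fix g assume "g \<in> Om 0"
    then consider "g = TT2" | s where "g = psc (psc sc) s" unfolding Om_def by blast
    then show "\<exists>g'\<in>insert TT (range (psc sc)). \<forall>x. dlt 0 (g' x) = g (dlt 0 x)"
    proof cases
      case 1 then show ?thesis using \<open>\<And>x. dlt 0 (TT x) = TT2 (dlt 0 x)\<close> by (intro bexI[of _ TT]) simp_all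
    next
      case 2 then show ?thesis using \<open>\<And>s x. dlt 0 (psc sc s x) = psc (psc sc) s (dlt 0 x)\<close>
        by (intro bexI[of _ "psc sc s"]) simp_all
    qed
  qed (rule addv_dlt)
  have dPU: "sub (Om 0) (dlt 0 ` Pol U)" by (rule sub_image[OF PU itd])
  have E0: "sub (Om 0) ?E0" by (rule sub_ssum'[OF dPU C addops_Om])
  have CE0: "?C \<subseteq> ?E0" by (rule ssum_right[OF sub_0[OF dPU]])
  have n0: "noeth (Om 0) ?C ?E0"
    by (rule noeth_image[OF noeth_Pol[OF p no] itd PU Pol_mono[OF VU]]) (use dlt_Pol[OF sub_0[OF PV]] in auto)
  have "\<exists>E. sub (Om k) E \<and> noeth (Om k) ?C E \<and> ?E0 \<subseteq> E" for k
  proof (induction k)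
    case 0
    show ?case by (rule exI[of _ ?E0]) (simp add: E0 n0)
  next
    case (Suc k)
    then obtain E where E: "sub (Om k) E" "noeth (Om k) ?C E" "?E0 \<subseteq> E" by blast
    have ins: "insert (YY k) (Om k) = Om (Suc k)" by (auto simp: Om_def lessThan_Suc)
    have CE: "?C \<subseteq> E" using CE0 E(3) by blast
    have cm: "f (YY k x) = YY k (f x)" if "f \<in> Om k" for f x by (rule YY_Om_comm[OF that])
    have yC: "YY k ` ?C \<subseteq> ?C"
    proof
      fix y assume "y \<in> YY k ` ?C"
      then obtain x where x: "x \<in> ?C" "y = YY k x" by blast
      show "y \<in> ?C" unfolding x(2) by (rule sub_op[OF C[of "Suc k"] _ x(1)]) (simp add: Om_def)
    qed
    show ?case
    proof (intro exI conjI)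
      show "sub (Om (Suc k)) (padj (YY k) E)" using sub_padj[OF addops_Om addv_YY cm E(1)] unfolding ins .
      show "noeth (Om (Suc k)) ?C (padj (YY k) E)"
        using noeth_padj[OF addops_Om addv_YY cm E(1,2) yC CE] unfolding ins .
      show "?E0 \<subseteq> padj (YY k) E" using padj_base[OF addops_Om addv_YY cm E(1)] E(3) by (rule order_trans[rotated])
    qed
  qed
  then obtain E where E: "sub (Om t) E" "noeth (Om t) ?C E" "?E0 \<subseteq> E" by blast
  have d: "x \<in> Pol (UU V U n) \<Longrightarrow> dlt n x \<in> E" for n x
  proof (induction n arbitrary: x)
    case 0
    then have "x \<in> Pol U" unfolding UU_0 .
    then have "dlt 0 x \<in> ?E0" using ssum_left[OF sub_0[OF C]] by blast
    then show ?case using E(3) by blast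
  next
    case (Suc n)
    \<comment> \<open>An element of degree \<open>n + 1\<close> is a sum of products of the
      \<open>a i\<close> with elements of degree \<open>n\<close>, up to \<open>Pol V\<close>, which
      was placed in every degree from the start.\<close>
    obtain w v where wv: "w \<in> Pol (am a t (mpw a t n U))" "v \<in> Pol V" "x = w + v"
      using Pol_ssum[OF sub_0[OF sub_mpw[OF U]] sub_0[OF V] Suc.prems] unfolding mpw_Suc by blast
    obtain y where y: "\<And>i. i < t \<Longrightarrow> y i \<in> Pol (mpw a t n U)" "w = (\<Sum>i<t. psc sc (a i) (y i))"
      using Pol_am[OF sub_0[OF sub_mpw[OF U]] wv(1)] by blast
    have "y i \<in> Pol (UU V U n)" if "i < t" for i
      using Pol_mono[OF ssum_left[OF sub_0[OF V]]] y(1)[OF that] by blast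
    then have dy: "dlt n (y i) \<in> E" if "i < t" for i using Suc.IH that by blast
    have Yd: "dlt (Suc n) (psc sc (a i) z) = YY i (dlt n z)" for i z
    proof (rule ext)
      fix m show "dlt (Suc n) (psc sc (a i) z) m = YY i (dlt n z) m" by (cases m) (simp_all add: dlt_def)
    qed
    have "dlt (Suc n) x = (\<Sum>i<t. YY i (dlt n (y i))) + dlt (Suc n) v"
      unfolding wv(3) y(2) addv_add[OF addv_dlt] addv_sum[OF addv_dlt] Yd ..
    moreover have "(\<Sum>i<t. YY i (dlt n (y i))) \<in> E"
    proof (rule sub_sum[OF E(1)])
      fix i assume i: "i \<in> {..<t}"
      show "YY i (dlt n (y i)) \<in> E" by (rule sub_op[OF E(1) _ dy]) (use i in \<open>auto simp: Om_def\<close>)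
    qed
    moreover have "dlt (Suc n) v \<in> E" using dlt_Pol[OF sub_0[OF PV] wv(2)] CE0 E(3) by blast
    ultimately show ?case using sub_add[OF E(1)] by (simp only:)
  qed
  have "Rs V U \<subseteq> E"
  proof
    fix r assume r: "r \<in> Rs V U"
    then obtain L where L: "\<And>n. n \<ge> L \<Longrightarrow> r n = 0" unfolding Rs_def by blast
    have "(\<Sum>n<L. dlt n (r n)) \<in> E" by (rule sub_sum[OF E(1)]) (use r d in \<open>simp add: Rs_def\<close>)
    then show "r \<in> E" using dlt_expand[of L r, OF L] by simp
  qed
  then show ?thesis by (rule noeth_mono[OF E(2) order_refl _ order_refl])
qed

lemma RsI: "(\<And>n. r n \<in> Pol (UU V U n)) \<Longrightarrow> (\<And>n. n \<ge> L \<Longrightarrow> r n = 0) \<Longrightarrow> r \<in> Rs V U"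
  unfolding Rs_def by blast

lemma RsD: "r \<in> Rs V U \<Longrightarrow> r n \<in> Pol (UU V U n)"
  unfolding Rs_def by blast

lemma RsE: assumes "r \<in> Rs V U" obtains L where "\<And>n. n \<ge> L \<Longrightarrow> r n = 0"
  using assms unfolding Rs_def by blast

text \<open>Degreewise conditions compatible with the \<open>a i\<close> cut out Rees submodules.
  Statements about all large filtration degrees become ascending chains to which
  \<open>noeth_Rs\<close> applies.\<close>

lemma sub_Rs_family:
  assumes G: "\<And>n. sub (insert TT (range (psc sc))) (G n)"
    and aG: "\<And>n i x. i < t \<Longrightarrow> x \<in> G n \<Longrightarrow> x \<in> Pol (UU V U n) \<Longrightarrow> psc sc (a i) x \<in> G (Suc n)"
  shows "sub (Om t) {r \<in> Rs V U. \<forall>n. r n \<in> G n}"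
proof (rule subI)
  show "0 \<in> {r \<in> Rs V U. \<forall>n. r n \<in> G n}" using sub_0[OF G] sub_0[OF sub_PUU] by (auto intro: RsI[of _ 0])
  show "x - y \<in> {r \<in> Rs V U. \<forall>n. r n \<in> G n}" if x: "x \<in> {r \<in> Rs V U. \<forall>n. r n \<in> G n}" and y: "y \<in> {r \<in> Rs V U. \<forall>n. r n \<in> G n}" for x y
  proof -
    obtain K where K: "\<And>n. n \<ge> K \<Longrightarrow> x n = 0" using RsE[of x] x by blast
    obtain L where L: "\<And>n. n \<ge> L \<Longrightarrow> y n = 0" using RsE[of y] y by blast
    have "x - y \<in> Rs V U"
      by (rule RsI[of _ "max K L"]) (use x y K L in \<open>simp_all add: sub_diff[OF sub_PUU] RsD\<close>)
    then show ?thesis using x y sub_diff[OF G] by simp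
  qed
  fix f x assume f: "f \<in> Om t" and x: "x \<in> {r \<in> Rs V U. \<forall>n. r n \<in> G n}"
  obtain K where K: "\<And>n. n \<ge> K \<Longrightarrow> x n = 0" using RsE[of x] x by blast
  have xR: "x n \<in> Pol (UU V U n)" and xG: "x n \<in> G n" for n using x RsD by auto
  from f consider "f = TT2" | s where "f = psc (psc sc) s" | j where "f = YY j" "j < t" unfolding Om_def by blast
  then show "f x \<in> {r \<in> Rs V U. \<forall>n. r n \<in> G n}"
  proof cases
    case 1
    have "TT (x n) \<in> Pol (UU V U n)" "TT (x n) \<in> G n" for n
      using sub_op[OF sub_PUU _ xR, of TT n] sub_op[OF G _ xG, of TT n] by simp_all
    then show ?thesis unfolding 1 by (auto simp: TT2_def K addv_0[OF addv_TT] intro!: RsI[of _ K])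
  next
    case 2
    have *: "psc sc s (x n) \<in> Pol (UU V U n)" "psc sc s (x n) \<in> G n" for n
      using sub_op[OF sub_PUU _ xR, of "psc sc s" n] sub_op[OF G _ xG, of "psc sc s" n] by simp_all
    have e: "psc (psc sc) s x n = psc sc s (x n)" for n by (rule psc_apply)
    have "psc (psc sc) s x \<in> Rs V U"
    proof (rule RsI[of _ K])
      show "psc (psc sc) s x n \<in> Pol (UU V U n)" for n unfolding e by (rule *(1))
      show "psc (psc sc) s x n = 0" if "n \<ge> K" for n unfolding e K[OF that] by (rule psc_0)
    qed
    moreover have "psc (psc sc) s x n \<in> G n" for n unfolding e by (rule *(2))
    ultimately show ?thesis unfolding 2 by blast
  next
    case 3
    have "YY j x n \<in> Pol (UU V U n) \<and> YY j x n \<in> G n" for n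
    proof (cases n)
      case 0
      show ?thesis unfolding 0 YY_0 using sub_0[OF sub_PUU] sub_0[OF G] by (rule conjI)
    next
      case (Suc m)
      show ?thesis unfolding Suc YY_Suc using a_PUU[OF 3(2) xR] aG[OF 3(2) xG xR] by (rule conjI)
    qed
    moreover have "YY j x n = 0" if "n \<ge> Suc K" for n using K that by (cases n) simp_all
    ultimately show ?thesis unfolding 3(1) by (auto intro!: RsI[of _ "Suc K"])
  qed
qed

lemma C_Rs: "Pol (Pol V) \<subseteq> Rs V U"
proof
  fix x assume x: "x \<in> Pol (Pol V)"
  obtain K where K: "\<And>i. i \<ge> K \<Longrightarrow> x i = 0" using PolE[OF x] by blast
  show "x \<in> Rs V U" by (rule RsI[of _ K]) (use K PolD[OF x] Pol_mono[OF V_UU] in blast)+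
qed

lemma dlt_Rs: "x \<in> Pol (UU V U n) \<Longrightarrow> dlt n x \<in> Rs V U"
  by (rule RsI[of _ "Suc n"]) (auto simp: dlt_def sub_0[OF sub_PUU])

text \<open>The socle of the associated graded module lives in finitely many degrees.\<close>

lemma gr_socle: "\<exists>c. \<forall>n\<ge>c. \<forall>u\<in>UU V U n. (\<forall>i<t. sc (a i) u \<in> UU V U (Suc (Suc n))) \<longrightarrow> u \<in> UU V U (Suc n)"
proof -
  \<comment> \<open>Socle elements of the associated graded module that have to vanish in degrees
    from \<open>s\<close> on. The requirement weakens as \<open>s\<close> grows, so an ascending
    chain arises; that it stops means that socle elements vanish in all large degrees.\<close>
  define G where "G s n = {x. (\<forall>i<t. psc sc (a i) x \<in> Pol (UU V U (Suc (Suc n)))) \<and> (n \<ge> s \<longrightarrow> x \<in> Pol (UU V U (Suc n)))}" for s n :: nat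
  define W where "W s = {r \<in> Rs V U. \<forall>n. r n \<in> G s n}" for s
  have G: "sub (insert TT (range (psc sc))) (G s n)" for s n
  proof (rule subI)
    show "0 \<in> G s n" unfolding G_def using sub_0[OF sub_PUU] by simp
    show "x - y \<in> G s n" if "x \<in> G s n" "y \<in> G s n" for x y
      using that unfolding G_def by (simp add: smod.sc_diff[OF smod_p] sub_diff[OF sub_PUU])
    fix f x assume f: "f \<in> insert TT (range (psc sc))" and x: "x \<in> G s n"
    have c: "psc sc r (f x) = f (psc sc r x)" for r using f by (auto simp: TT_psc smod.sc_commute[OF smod_p])
    show "f x \<in> G s n" using x sub_op[OF sub_PUU f] unfolding G_def by (simp add: c)
  qed
  obtain M where M: "\<And>s. s \<ge> M \<Longrightarrow> W s = W M"
  proof (rule noethD[OF noeth_Rs, of W])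
    show "sub (Om t) (W s)" for s unfolding W_def
    proof (rule sub_Rs_family[OF G])
      fix n i x assume "i < t" "x \<in> G s n"
      then show "psc sc (a i) x \<in> G s (Suc n)" unfolding G_def using a_PUU by blast
    qed
    show "Pol (Pol V) \<subseteq> W s" for s
    proof
      fix x assume x: "x \<in> Pol (Pol V)"
      have "x n \<in> G s n" for n
      proof -
        have v: "x n \<in> Pol V" by (rule PolD[OF x])
        have "psc sc r (x n) \<in> Pol V" for r by (rule sub_op[OF sub_Pol[OF smod_axioms' V] _ v]) (rule insertI2, rule rangeI)
        then show ?thesis using v Pol_mono[OF V_UU] unfolding G_def by blast
      qed
      then show "x \<in> W s" using x C_Rs unfolding W_def by blast
    qed
    show "W s \<subseteq> Rs V U" for s unfolding W_def by blast
    show "W s \<subseteq> W (Suc s)" for s unfolding W_def G_def by auto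
  qed metis
  have "u \<in> UU V U (Suc n)" if n: "n \<ge> M" and u: "u \<in> UU V U n" and au: "\<forall>i<t. sc (a i) u \<in> UU V U (Suc (Suc n))" for n u
  proof -
    have du: "dlt 0 u \<in> Pol (UU V U n)" by (rule dlt_Pol[OF sub_0[OF sub_UU] u])
    have "psc sc (a i) (dlt 0 u) \<in> Pol (UU V U (Suc (Suc n)))" if "i < t" for i
    proof -
      have "psc sc (a i) (dlt 0 u) = dlt 0 (sc (a i) u)" by (auto simp: dlt_def fun_eq_iff sc_0)
      then show ?thesis using dlt_Pol[OF sub_0[OF sub_UU]] au that by simp
    qed
    then have "dlt n (dlt 0 u) m \<in> G (Suc n) m" for m
      unfolding G_def dlt_def using sub_0[OF sub_PUU] by (auto simp: dlt_def[symmetric])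
    then have "dlt n (dlt 0 u) \<in> W (Suc n)" unfolding W_def using dlt_Rs[OF du] by simp
    then have "dlt n (dlt 0 u) \<in> W M" using M[of "Suc n"] n by simp
    then have "dlt n (dlt 0 u) n \<in> G M n" unfolding W_def by blast
    then have "dlt 0 u \<in> Pol (UU V U (Suc n))" using n by (simp add: G_def dlt_def[of n])
    from PolD[OF this, of 0] show ?thesis by (simp add: dlt_def)
  qed
  then show ?thesis by blast
qed

lemma zz_UU: "x \<in> Pol (UU V U n) \<Longrightarrow> zz a t x \<in> Pol (UU V U (Suc n))"
  by (rule zz_Pol[OF a_UU sub_UU])

text \<open>The generic linear form is regular modulo \<open>Pop TT j\<close> if the socle vanishes.\<close>

lemma zz_regular:
  assumes soc: "\<And>u. u \<in> U \<Longrightarrow> (\<And>i. i < t \<Longrightarrow> sc (a i) u \<in> V) \<Longrightarrow> u \<in> V"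
  shows "\<exists>j0. \<forall>j\<ge>j0. \<forall>x\<in>Pol U. zz a t x \<in> Pol V \<boxplus> Pop TT j ` Pol U \<longrightarrow> x \<in> Pol V \<boxplus> Pop TT j ` Pol U"
proof -
  let ?Om = "insert TT (range (psc sc))"
  note PV = sub_Pol[OF smod_axioms' V] and PU = sub_Pol[OF smod_axioms' U]
  have itz: "itw ?Om ?Om (zz a t)"
    unfolding itw_def
  proof (intro conjI ballI)
    fix g assume g: "g \<in> ?Om"
    have c: "zz a t (g x) = g (zz a t x)" for x using g by (auto simp: zz_TT zz_psc)
    show "\<exists>g'\<in>?Om. \<forall>x. zz a t (g x) = g' (zz a t x)" "\<exists>g'\<in>?Om. \<forall>x. zz a t (g' x) = g (zz a t x)"
      using g c by - (rule bexI[of _ g], simp, simp)+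
  qed (rule addv_zz)
  have zPU: "sub ?Om (zz a t ` Pol U)" by (rule sub_image[OF PU itz])
  have S: "sub ?Om (zz a t ` Pol U \<boxplus> Pol V)" by (rule sub_ssum'[OF zPU PV addops_T])
  have cm: "f (TT x) = TT (f x)" if "f \<in> ?Om" for f x using that by (auto simp: TT_psc)
  have "\<exists>j0. \<forall>j\<ge>j0. \<forall>w\<in>Pol U. Qop TT (Suc j) w \<in> zz a t ` Pol U \<boxplus> Pol V \<longrightarrow> Qop TT j w \<in> zz a t ` Pol U \<boxplus> Pol V"
    by (rule pop_stable[OF addv_TT noeth_Pol[OF p no] PU S _ addops_T cm Pol_mono[OF VU] ssum_right[OF sub_0[OF zPU]] PV]) simp
  then obtain j0 where j0: "\<And>j w. j \<ge> j0 \<Longrightarrow> w \<in> Pol U \<Longrightarrow> Qop TT (Suc j) w \<in> zz a t ` Pol U \<boxplus> Pol V \<Longrightarrow> Qop TT j w \<in> zz a t ` Pol U \<boxplus> Pol V" by metis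
  have aU: "\<And>n i u. i < t \<Longrightarrow> u \<in> U \<Longrightarrow> sc (a i) u \<in> U" using sub_sc[OF U] by blast
  have aV: "\<And>n i u. i < t \<Longrightarrow> u \<in> V \<Longrightarrow> sc (a i) u \<in> V" using sub_sc[OF V] by blast
  have inj: "g \<in> Pol V" if "g \<in> Pol U" "zz a t g \<in> Pol V" for g
    by (rule mccoy[where A = "\<lambda>_. U" and B = "\<lambda>_. V" and c = 0 and n = 0, OF U V aU aV soc _ that]) auto
  have "x \<in> Pol V \<boxplus> Pop TT j ` Pol U" if j: "j \<ge> j0" and x: "x \<in> Pol U" and zx: "zz a t x \<in> Pol V \<boxplus> Pop TT j ` Pol U" for j x
  proof -
    obtain v w where vw: "v \<in> Pol V" "w \<in> Pol U" "zz a t x = v + Pop TT j w" using zx by (auto elim!: ssumE)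
    have "zz a t x - Pop TT j w \<in> Pol V" using vw by simp
    then obtain g' where g': "g' \<in> Pol U" "x - Pop TT j g' \<in> Pol V"
      using pop_lemma[OF addv_TT addv_zz zz_TT sub_Pol_TT[OF U] sub_Pol_TT[OF V] j0[OF j] inj x vw(2)] by blast
    from ssumI[OF g'(2) imageI[OF g'(1), of "Pop TT j"]] show ?thesis by simp
  qed
  then show ?thesis by blast
qed

end

end

section \<open>Invariants of finite powers and of U[T]/(f)\<close>

lemma rlen_iso:
  fixes sc :: "'s::comm_ring_1 \<Rightarrow> 'x::ab_group_add \<Rightarrow> 'x" and sc' :: "'s \<Rightarrow> 'y::ab_group_add \<Rightarrow> 'y"
  assumes "smod sc" "smod sc'" and p: "submod sc V" "submod sc U" "V \<subseteq> U"
    and p': "submod sc' V'" "submod sc' U'" "V' \<subseteq> U'"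
    and f: "addv f" "\<And>s x. f (sc s x) = sc' s (f x)"
    and fU: "f ` U \<subseteq> U'" and fV: "f ` V \<subseteq> V'" and surj: "U' \<subseteq> f ` U \<boxplus> V'" and ker: "\<And>x. x \<in> U \<Longrightarrow> f x \<in> V' \<Longrightarrow> x \<in> V"
  shows "rlen (range sc') V' U' = rlen (range sc) V U"
proof -
  have it: "itw (range sc) (range sc') f" by (rule itw_lin[where sc = sc and sc' = sc', OF f(1)]) (rule f(2))
  show ?thesis
    by (rule antisym[OF rlen_le_surj[OF it p(2) p'(1) surj fV p(3)]
        rlen_le_inj[OF it smod.addops_sc[OF assms(2)] p(1) p'(1,2) fU p'(3) p(3) ker]])
qed

context smod
begin

lemma smod': "smod sc" by unfold_locales

lemma smod_p': "smod (psc sc)" by (rule smod_psc[OF smod'])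

text \<open>\<open>X\<close> lies between the powers with exponent \<open>D + 1\<close> of
  \<open>V\<close> and \<open>U\<close>; the lower factor is \<open>(U/V)^D\<close> and the upper
  one is \<open>U/V\<close>, read off from coordinate \<open>D\<close>. The inductions on the rank
  below use this filtration.\<close>

lemma pw_step:
  fixes D :: nat
  assumes V: "submod sc V" and U: "submod sc U" and VU: "V \<subseteq> U"
  defines "X \<equiv> pw D U \<boxplus> pw (Suc D) V"
  shows "submod (psc sc) X" "pw (Suc D) V \<subseteq> X" "X \<subseteq> pw (Suc D) U" "pw D V \<subseteq> pw (Suc D) V"
    "pw D U \<subseteq> X" "\<And>x. x \<in> pw D U \<Longrightarrow> x \<in> pw (Suc D) V \<Longrightarrow> x \<in> pw D V"
    "\<And>x. x \<in> pw (Suc D) U \<Longrightarrow> x D \<in> V \<Longrightarrow> x \<in> X" "\<And>x. x \<in> X \<Longrightarrow> x D \<in> V"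
proof -
  have DS: "pw D W \<subseteq> pw (Suc D) W" if "0 \<in> W" for W using that by (auto simp: pw_def less_Suc_eq)
  show "submod (psc sc) X" unfolding X_def by (intro sub_ssum' sub_pw' U V addops_psc)
  show "pw (Suc D) V \<subseteq> X" unfolding X_def by (rule ssum_right[OF sub_0[OF sub_pw'[OF U]]])
  show "X \<subseteq> pw (Suc D) U" unfolding X_def
    by (rule ssum_least[OF sub_pw'[OF U] DS[OF sub_0[OF U]] pw_mono[OF VU]])
  show "pw D V \<subseteq> pw (Suc D) V" by (rule DS[OF sub_0[OF V]])
  show "pw D U \<subseteq> X" unfolding X_def by (rule ssum_left[OF sub_0[OF sub_pw'[OF V]]])
  show "x \<in> pw D V" if "x \<in> pw D U" "x \<in> pw (Suc D) V" for x using that by (auto simp: pw_def)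
  show "x \<in> X" if x: "x \<in> pw (Suc D) U" "x D \<in> V" for x
  proof -
    have 1: "x - dlt D (x D) \<in> pw D U" using x(1) by (auto simp: pw_def dlt_def Suc_le_eq)
    have 2: "dlt D (x D) \<in> pw (Suc D) V" using x(2) sub_0[OF V] by (auto simp: pw_def dlt_def)
    from ssumI[OF 1 2] show ?thesis unfolding X_def by simp
  qed
  show "x D \<in> V" if x: "x \<in> X" for x
  proof -
    obtain y z where "y \<in> pw D U" "z \<in> pw (Suc D) V" "x = y + z" using x unfolding X_def by (rule ssumE)
    then show ?thesis by (simp add: pw_def)
  qed
qed

lemma rlen_pw:
  assumes V: "submod sc V" and U: "submod sc U" and VU: "V \<subseteq> U"
  shows "rlen (range (psc sc)) (pw D V) (pw D U) = enat D * rlen (range sc) V U"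
proof (induction D)
  case 0
  have "pw 0 U \<subseteq> pw 0 V" by (auto simp: pw_def)
  then show ?case by (simp add: rlen_eq0 zero_enat_def[symmetric])
next
  case (Suc D)
  let ?X = "pw D U \<boxplus> pw (Suc D) V"
  note X = pw_step[where D = D, OF assms]
  have e1: "rlen (range (psc sc)) (pw (Suc D) V) (pw (Suc D) U)
      = rlen (range (psc sc)) (pw (Suc D) V) ?X + rlen (range (psc sc)) ?X (pw (Suc D) U)"
    by (rule rlen_add'[OF addops_psc sub_pw'[OF V] X(1) sub_pw'[OF U] X(2,3)])
  have e2: "rlen (range (psc sc)) (pw (Suc D) V) ?X = rlen (range (psc sc)) (pw D V) (pw D U)"
    by (rule rlen_iso[where f = "\<lambda>x. x", OF smod_p' smod_p' sub_pw'[OF V] sub_pw'[OF U] pw_mono[OF VU] sub_pw'[OF V] X(1,2)])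
       (use X in \<open>auto simp: addv_def\<close>)
  have e3: "rlen (range sc) V U = rlen (range (psc sc)) ?X (pw (Suc D) U)"
  proof (rule rlen_iso[where f = "\<lambda>x. x D", OF smod_p' smod' X(1) sub_pw'[OF U] X(3) V U VU])
    show "U \<subseteq> (\<lambda>x. x D) ` pw (Suc D) U \<boxplus> V"
    proof
      fix u assume u: "u \<in> U"
      have "dlt D u \<in> pw (Suc D) U" using u sub_0[OF U] by (auto simp: pw_def dlt_def)
      then have "dlt D u D \<in> (\<lambda>x. x D) ` pw (Suc D) U" by (rule imageI)
      moreover have "dlt D u D = u" by (simp add: dlt_def)
      ultimately have "u \<in> (\<lambda>x. x D) ` pw (Suc D) U" by (simp only:)
      then show "u \<in> (\<lambda>x. x D) ` pw (Suc D) U \<boxplus> V" by (rule subsetD[OF ssum_left[OF sub_0[OF V]]])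
    qed
    show "(\<lambda>x. x D) ` pw (Suc D) U \<subseteq> U" by (auto simp: pw_def)
    show "(\<lambda>x. x D) ` ?X \<subseteq> V" using X(8) by blast
    show "x \<in> ?X" if "x \<in> pw (Suc D) U" "x D \<in> V" for x by (rule X(7)[OF that])
  qed (simp_all add: addv_def)
  have e4: "enat (Suc D) = enat D + 1" by (simp add: one_enat_def)
  show ?case unfolding e1 e2 e3[symmetric] Suc.IH e4 distrib_right mult_1 ..
qed

lemma bet_pw:
  assumes c: "is_cpx I b \<phi>" and p: "apair sc I V U"
  shows "bet (psc sc) b \<phi> n (pw D V) (pw D U) \<le> enat D * bet sc b \<phi> n V U"
proof (induction D)
  case 0
  have "pw k (pw 0 U) \<subseteq> pw k (pw 0 V)" for k by (rule pw_mono) (auto simp: pw_def)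
  then have "cyc (psc sc) b \<phi> n (pw 0 V) (pw 0 U) \<subseteq> bnd (psc sc) b \<phi> n (pw 0 V) (pw 0 U)"
    using smod.cyc_pw[OF smod_p', of b \<phi> n "pw 0 V" "pw 0 U"] smod.pw_bnd[OF smod_p' sub_pw'[OF apairD(2)[OF p]], of b n "pw 0 V" \<phi> 0] by blast
  then have "bet (psc sc) b \<phi> n (pw 0 V) (pw 0 U) = 0" unfolding bet_def by (rule rlen_eq0)
  then show ?case by (simp only: zero_le)
next
  case (Suc D)
  note V = apairD(1)[OF p] and U = apairD(2)[OF p] and VU = apairD(3)[OF p]
  let ?X = "pw D U \<boxplus> pw (Suc D) V"
  note X = pw_step[where D = D, OF V U VU]
  have ap: "apair (psc sc) I (pw k V) (pw k U)" for k
    unfolding apair_def using sub_pw'[OF V] sub_pw'[OF U] pw_mono[OF VU] apairD(4)[OF p] by (auto simp: pw_def sc_0)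
  have e1: "bet (psc sc) b \<phi> n (pw (Suc D) V) (pw (Suc D) U)
      \<le> bet (psc sc) b \<phi> n (pw (Suc D) V) ?X + bet (psc sc) b \<phi> n ?X (pw (Suc D) U)"
    by (rule smod.bet_ext[OF smod_p' c ap X(1,2,3)])
  have e2: "bet (psc sc) b \<phi> n (pw (Suc D) V) ?X = bet (psc sc) b \<phi> n (pw D V) (pw D U)"
    by (rule bet_iso[where f = "\<lambda>x. x", OF smod_p' smod_p' c ap apair_left[OF ap X(1,2,3)]])
       (use X in \<open>auto simp: addv_def\<close>)
  have e3: "bet sc b \<phi> n V U = bet (psc sc) b \<phi> n ?X (pw (Suc D) U)"
  proof (rule bet_iso[where f = "\<lambda>x. x D", OF smod_p' smod' c apair_right[OF ap X(1,2,3)] p])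
    show "U \<subseteq> (\<lambda>x. x D) ` pw (Suc D) U \<boxplus> V"
    proof
      fix u assume u: "u \<in> U"
      have "dlt D u \<in> pw (Suc D) U" using u sub_0[OF U] by (auto simp: pw_def dlt_def)
      then have "dlt D u D \<in> (\<lambda>x. x D) ` pw (Suc D) U" by (rule imageI)
      moreover have "dlt D u D = u" by (simp add: dlt_def)
      ultimately have "u \<in> (\<lambda>x. x D) ` pw (Suc D) U" by (simp only:)
      then show "u \<in> (\<lambda>x. x D) ` pw (Suc D) U \<boxplus> V" by (rule subsetD[OF ssum_left[OF sub_0[OF V]]])
    qed
    show "(\<lambda>x. x D) ` pw (Suc D) U \<subseteq> U" by (auto simp: pw_def)
    show "(\<lambda>x. x D) ` ?X \<subseteq> V" using X(8) by blast
    show "x \<in> ?X" if "x \<in> pw (Suc D) U" "x D \<in> V" for x by (rule X(7)[OF that])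
  qed (simp_all add: addv_def)
  have e4: "enat (Suc D) = enat D + 1" by (simp add: one_enat_def)
  show ?case unfolding e4 distrib_right mult_1
    by (rule order_trans[OF e1]) (unfold e2 e3[symmetric], rule add_right_mono[OF Suc.IH])
qed

lemma noeth_pw:
  assumes V: "submod sc V" and U: "submod sc U" and VU: "V \<subseteq> U" and no: "noeth (range sc) V U"
  shows "noeth (range (psc sc)) (pw D V) (pw D U)"
proof (induction D)
  case 0
  have "pw 0 U = {0}" by (auto simp: pw_def)
  moreover have "pw 0 V = {0}" by (auto simp: pw_def)
  ultimately show ?case unfolding noeth_def by (metis subset_antisym)
next
  case (Suc D)
  let ?X = "pw D U \<boxplus> pw (Suc D) V"
  note X = pw_step[where D = D, OF V U VU]
  have 1: "noeth (range (psc sc)) (pw (Suc D) V) ?X"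
    by (rule noeth_image[OF Suc.IH itw_id sub_pw'[OF U] pw_mono[OF VU]]) (use X(4) in auto)
  have itd: "itw (range sc) (range (psc sc)) (dlt D)"
    by (rule itw_lin[where sc = sc and sc' = "psc sc", OF addv_dlt]) (auto simp: dlt_def psc_def sc_0 fun_eq_iff)
  have 2: "noeth (range (psc sc)) ?X (pw (Suc D) U)"
  proof (rule noeth_image[OF no itd U VU])
    show "dlt D ` V \<subseteq> ?X"
    proof -
      have "dlt D ` V \<subseteq> pw (Suc D) V" using sub_0[OF V] by (auto simp: pw_def dlt_def)
      then show ?thesis using X(2) by blast
    qed
    show "pw (Suc D) U \<subseteq> dlt D ` U \<boxplus> ?X"
    proof
      fix x assume x: "x \<in> pw (Suc D) U"
      have "x - dlt D (x D) \<in> pw D U" using x by (auto simp: pw_def dlt_def Suc_le_eq)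
      then have "x - dlt D (x D) \<in> ?X" using X(5) by blast
      moreover have "dlt D (x D) \<in> dlt D ` U" using x by (auto simp: pw_def)
      ultimately have "dlt D (x D) + (x - dlt D (x D)) \<in> dlt D ` U \<boxplus> ?X" by (intro ssumI)
      then show "x \<in> dlt D ` U \<boxplus> ?X" by simp
    qed
  qed
  show ?case by (rule noeth_ext[OF 1 2 X(1) sub_pw'[OF U] X(2,3) addops_psc])
qed

text \<open>Division with remainder identifies \<open>U[T]/(V[T] + f U[T])\<close> with \<open>(U/V)\<^sup>D\<close>.\<close>

context
  fixes f :: "(nat \<Rightarrow> 'x) \<Rightarrow> nat \<Rightarrow> 'x" and D and U
  assumes mf: "monop D f" and pf: "polop TT f" and U: "submod sc U"
begin

lemma f_psc: "f (psc sc s x) = psc sc s (f x)"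
proof (rule polop_comm[OF pf smod.addv_sc[OF smod_p']])
  show "psc sc s (TT x) = TT (psc sc s x)" for x
    by (auto simp: TT_def psc_def fun_eq_iff sc_0 split: nat.splits)
qed

lemma sub_fPol: "submod (psc sc) (f ` Pol U)"
  by (rule sub_image[OF sub_Pol'[OF smod' U]], rule itw_lin[where sc = "psc sc" and sc' = "psc sc", OF polop_addv[OF pf]])
     (rule f_psc)

lemma sub_Pf: "submod sc W \<Longrightarrow> submod (psc sc) (Pol W \<boxplus> f ` Pol U)"
  by (rule sub_ssum'[OF sub_Pol'[OF smod'] sub_fPol addops_psc])

lemma f_Pol: "submod sc W \<Longrightarrow> x \<in> Pol W \<Longrightarrow> f x \<in> Pol W"
  by (rule polop_closed[OF pf sub_Pol_TT])

lemma Pf_subset: "submod sc W \<Longrightarrow> W \<subseteq> U \<Longrightarrow> Pol W \<boxplus> f ` Pol U \<subseteq> Pol U"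
  by (rule ssum_least[OF sub_Pol'[OF smod' U] Pol_mono]) (use f_Pol[OF U] in auto)

lemma pw_Pol: "0 \<in> W \<Longrightarrow> pw k W \<subseteq> Pol W"
proof
  fix x assume "0 \<in> W" "x \<in> pw k W"
  then show "x \<in> Pol W" by (intro PolI[of _ _ k]) (auto simp: pw_def not_less, metis not_less)
qed

text \<open>Uniqueness of remainders: dividing the part from \<open>W[T]\<close> by \<open>f\<close>
  leaves an identity between a multiple of \<open>f\<close> and polynomials of degree below
  \<open>D\<close>, and \<open>mon_inj\<close> makes the multiplier vanish.\<close>

lemma Pf_pw:
  assumes W: "submod sc W" and WU: "W \<subseteq> U" and x: "x \<in> pw D U" "x \<in> Pol W \<boxplus> f ` Pol U"
  shows "x \<in> pw D W"
proof -
  obtain w y where wy: "w \<in> Pol W" "y \<in> Pol U" "x = w + f y" using x(2) by (auto elim!: ssumE)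
  obtain y' where y': "y' \<in> Pol W" "w - f y' \<in> pw D W" using division[OF mf pf W wy(1)] by blast
  have y'U: "y' \<in> Pol U" using Pol_mono[OF WU] y'(1) by blast
  have e: "f (y' + y) = x - (w - f y')" using wy(3) by (simp add: addv_add[OF polop_addv[OF pf]])
  have "w - f y' \<in> pw D U" using y'(2) pw_mono[OF WU] by blast
  then have "f (y' + y) \<in> pw D U" unfolding e by (rule sub_diff[OF sub_pw'[OF U] x(1)])
  then have "y' + y = 0"
    by (intro mon_inj[OF mf sub_add[OF sub_Pol'[OF smod' U] y'U wy(2)]]) (simp add: pw_def)
  then have "x - (w - f y') = 0" using e addv_0[OF polop_addv[OF pf]] by simp
  then show ?thesis using y'(2) by simp
qed

lemma pw_Pf_iso:
  assumes W: "submod sc W" and WU: "W \<subseteq> U"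
  shows "Pol U \<subseteq> (\<lambda>x. x) ` pw D U \<boxplus> (Pol W \<boxplus> f ` Pol U)" "(\<lambda>x. x) ` pw D U \<subseteq> Pol U"
    "(\<lambda>x. x) ` pw D W \<subseteq> Pol W \<boxplus> f ` Pol U"
proof -
  show "Pol U \<subseteq> (\<lambda>x. x) ` pw D U \<boxplus> (Pol W \<boxplus> f ` Pol U)"
  proof
    fix x assume "x \<in> Pol U"
    then obtain y where y: "y \<in> Pol U" "x - f y \<in> pw D U" using division[OF mf pf U] by blast
    have "f y \<in> Pol W \<boxplus> f ` Pol U" using ssum_right[OF sub_0[OF sub_Pol'[OF smod' W]]] y(1) by blast
    then have "(x - f y) + f y \<in> pw D U \<boxplus> (Pol W \<boxplus> f ` Pol U)" using y(2) by (intro ssumI)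
    then show "x \<in> (\<lambda>x. x) ` pw D U \<boxplus> (Pol W \<boxplus> f ` Pol U)" by simp
  qed
  show "(\<lambda>x. x) ` pw D U \<subseteq> Pol U" using pw_Pol[OF sub_0[OF U]] by simp
  show "(\<lambda>x. x) ` pw D W \<subseteq> Pol W \<boxplus> f ` Pol U"
    unfolding image_ident by (rule order_trans[OF pw_Pol[OF sub_0[OF W]] ssum_left[OF sub_0[OF sub_fPol]]])
qed

lemma rlen_Pf:
  assumes W: "submod sc W" and WU: "W \<subseteq> U"
  shows "rlen (range (psc sc)) (Pol W \<boxplus> f ` Pol U) (Pol U) = enat D * rlen (range sc) W U"
  unfolding rlen_pw[OF W U WU, symmetric]
  by (rule rlen_iso[where f = "\<lambda>x. x", OF smod_p' smod_p' sub_pw'[OF W] sub_pw'[OF U] pw_mono[OF WU]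
        sub_Pf[OF W] sub_Pol'[OF smod' U] Pf_subset[OF W WU] _ _ pw_Pf_iso(2)[OF W WU] pw_Pf_iso(3)[OF W WU] pw_Pf_iso(1)[OF W WU]])
     (simp_all add: addv_def Pf_pw[OF W WU])

lemma apair_Pf:
  assumes p: "apair sc I W U" shows "apair (psc sc) I (Pol W \<boxplus> f ` Pol U) (Pol U)"
  unfolding apair_def
proof (intro conjI ballI)
  note W = apairD(1)[OF p]
  show "submod (psc sc) (Pol W \<boxplus> f ` Pol U)" by (rule sub_Pf[OF W])
  show "submod (psc sc) (Pol U)" by (rule sub_Pol'[OF smod' U])
  show "Pol W \<boxplus> f ` Pol U \<subseteq> Pol U" by (rule Pf_subset[OF W apairD(3)[OF p]])
  fix s x assume s: "s \<in> I" and x: "x \<in> Pol U"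
  obtain K where K: "\<And>i. i \<ge> K \<Longrightarrow> x i = 0" using PolE[OF x] by blast
  have "psc sc s x \<in> Pol W" by (rule PolI[of _ _ K]) (simp_all add: K sc_0 apairD(4)[OF p s PolD[OF x]])
  then show "psc sc s x \<in> Pol W \<boxplus> f ` Pol U" using ssum_left[OF sub_0[OF sub_fPol]] by blast
qed

lemma bet_Pf:
  assumes c: "is_cpx I b \<phi>" and p: "apair sc I W U"
  shows "bet (psc sc) b \<phi> n (Pol W \<boxplus> f ` Pol U) (Pol U) \<le> enat D * bet sc b \<phi> n W U"
proof -
  note W = apairD(1)[OF p] and WU = apairD(3)[OF p]
  have ap: "apair (psc sc) I (pw D W) (pw D U)"
    unfolding apair_def using sub_pw'[OF W] sub_pw'[OF U] pw_mono[OF WU] apairD(4)[OF p] by (auto simp: pw_def sc_0)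
  have "bet (psc sc) b \<phi> n (Pol W \<boxplus> f ` Pol U) (Pol U) = bet (psc sc) b \<phi> n (pw D W) (pw D U)"
    by (rule bet_iso[where f = "\<lambda>x. x", OF smod_p' smod_p' c ap apair_Pf[OF p] _ _ pw_Pf_iso(2)[OF W WU] pw_Pf_iso(3)[OF W WU] pw_Pf_iso(1)[OF W WU]])
       (simp_all add: addv_def Pf_pw[OF W WU])
  then show ?thesis using bet_pw[OF c p] by simp
qed

lemma noeth_Pf:
  assumes W: "submod sc W" and WU: "W \<subseteq> U" and no: "noeth (range sc) W U"
  shows "noeth (range (psc sc)) (Pol W \<boxplus> f ` Pol U) (Pol U)"
  by (rule noeth_image[OF noeth_pw[OF W U WU no] itw_id sub_pw'[OF U] pw_mono[OF WU] pw_Pf_iso(3)[OF W WU] pw_Pf_iso(1)[OF W WU]])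

text \<open>On remainders, that is on \<open>(U/W)^D\<close>, multiplication by \<open>s\<close>
  acts coordinatewise.\<close>

lemma regular_Pf:
  assumes W: "submod sc W" and WU: "W \<subseteq> U" and reg: "\<And>u. u \<in> U \<Longrightarrow> sc s u \<in> W \<Longrightarrow> u \<in> W"
    and x: "x \<in> Pol U" "psc sc s x \<in> Pol W \<boxplus> f ` Pol U"
  shows "x \<in> Pol W \<boxplus> f ` Pol U"
proof -
  obtain y where y: "y \<in> Pol U" "x - f y \<in> pw D U" using division[OF mf pf U x(1)] by blast
  have fy: "f z \<in> Pol W \<boxplus> f ` Pol U" if "z \<in> Pol U" for z
    using ssum_right[OF sub_0[OF sub_Pol'[OF smod' W]]] that by blast
  have "psc sc s (x - f y) = psc sc s x - f (psc sc s y)"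
    by (simp add: smod.sc_diff[OF smod_p'] f_psc)
  moreover have "psc sc s y \<in> Pol U" by (rule sub_sc[OF sub_Pol'[OF smod' U] y(1)])
  ultimately have 1: "psc sc s (x - f y) \<in> Pol W \<boxplus> f ` Pol U" using sub_diff[OF sub_Pf[OF W] x(2) fy] by simp
  have "psc sc s (x - f y) \<in> pw D U" by (rule sub_sc[OF sub_pw'[OF U] y(2)])
  then have 2: "psc sc s (x - f y) \<in> pw D W" using 1 by (rule Pf_pw[OF W WU])
  have "x - f y \<in> pw D W"
  proof (rule pwI)
    fix i assume i: "i < D"
    have "sc s ((x - f y) i) \<in> W" using pwD[OF 2 i] by simp
    then show "(x - f y) i \<in> W" by (rule reg[OF pwD[OF y(2) i]])
  next
    fix i assume "i \<ge> D" then show "(x - f y) i = 0" by (rule pwD0[OF y(2)])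
  qed
  then have "x - f y \<in> Pol W \<boxplus> f ` Pol U" using pw_Pf_iso(3)[OF W WU] by blast
  then show ?thesis by (rule sub_diff_cancel[OF sub_Pf[OF W] _ fy[OF y(1)]])
qed

end

end

section \<open>Superficiality of the generic linear form\<close>

lemma ssum_imageI: "x \<in> V \<Longrightarrow> y \<in> W \<Longrightarrow> z = x + f y \<Longrightarrow> z \<in> V \<boxplus> f ` W"
  by (simp only:) (rule ssumI, assumption, rule imageI)

context glmod
begin

text \<open>The generic linear form as a homogeneous element of Rees degree one.\<close>

definition z2 :: "(nat \<Rightarrow> nat \<Rightarrow> 'x) \<Rightarrow> (nat \<Rightarrow> nat \<Rightarrow> 'x)" where
  "z2 r = (\<lambda>n. case n of 0 \<Rightarrow> 0 | Suc k \<Rightarrow> zz a t (r k))"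

lemma z2_0 [simp]: "z2 r 0 = 0" and z2_Suc [simp]: "z2 r (Suc n) = zz a t (r n)"
  by (simp_all add: z2_def)

lemma addv_z2: "addv z2"
  by (auto simp: addv_def z2_def fun_eq_iff addv_add[OF addv_zz] split: nat.splits)

lemma z2_Om: "f \<in> Om k \<Longrightarrow> z2 (f r) = f (z2 r)"
proof (rule ext)
  fix n assume f: "f \<in> Om k"
  then consider "f = TT2" | s where "f = psc (psc sc) s" | j where "f = YY j" unfolding Om_def by blast
  then show "z2 (f r) n = f (z2 r) n"
  proof cases
    case 1 then show ?thesis by (cases n) (simp_all add: TT2_def zz_TT addv_0[OF addv_TT])
  next
    case 2 then show ?thesis by (cases n) (simp_all add: zz_psc)
  next
    case 3
    show ?thesis
    proof (cases n)
      case (Suc m) then show ?thesis using 3 by (cases m) (simp_all add: zz_psc addv_0[OF addv_zz])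
    qed (simp add: 3)
  qed
qed

lemma itw_z2: "itw (Om k) (Om k) z2"
  unfolding itw_def
proof (intro conjI ballI)
  fix g assume g: "g \<in> Om k"
  show "\<exists>g'\<in>Om k. \<forall>x. z2 (g x) = g' (z2 x)" "\<exists>g'\<in>Om k. \<forall>x. z2 (g' x) = g (z2 x)"
    by (rule bexI[OF _ g], intro allI, rule z2_Om[OF g])+
qed (rule addv_z2)

lemma Qop_TT2: "Qop TT2 j r = (\<lambda>n. Qop TT j (r n))"
proof (induction j arbitrary: r)
  case (Suc j)
  have "(r + TT2 (Qop TT2 j r)) n = r n + TT (Qop TT j (r n))" for n by (simp add: TT2_def Suc.IH)
  then show ?case by (simp only: Qop.simps Suc.IH)
qed simp

lemma Pop_TT2: "Pop TT2 j r n = Pop TT j (r n)"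
  by (simp add: Pop_def TT2_def Qop_TT2)

lemmas polP = polop_Pop[OF addv_TT]

context
  fixes V U assumes p: "apair sc I V U" and no: "noe V U"
begin

text \<open>The generic linear form is regular on the associated graded module in high degrees.\<close>

lemma gr_pop:
  "\<exists>c j0. \<forall>j\<ge>j0. \<forall>n\<ge>c. \<forall>u\<in>Pol (UU V U n). \<forall>w\<in>Pol (UU V U (Suc n)).
     zz a t u - Pop TT j w \<in> Pol (UU V U (Suc (Suc n))) \<longrightarrow> (\<exists>g'\<in>Pol (UU V U n). u - Pop TT j g' \<in> Pol (UU V U (Suc n)))"
proof -
  note sP = sub_PUU[OF p no]
  obtain c where c: "\<And>n u. n \<ge> c \<Longrightarrow> u \<in> UU V U n \<Longrightarrow> (\<And>i. i < t \<Longrightarrow> sc (a i) u \<in> UU V U (Suc (Suc n))) \<Longrightarrow> u \<in> UU V U (Suc n)"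
    using gr_socle[OF p no] by metis
  \<comment> \<open>Components below degree \<open>c\<close> are forced to vanish, since the socle
    condition needed for \<open>mccoy\<close> holds only from \<open>c\<close> on.\<close>
  define G1 :: "nat \<Rightarrow> (nat \<Rightarrow> 'x) set" where "G1 n = (if n < c then {0} else UNIV)" for n
  define X where "X = {r \<in> Rs V U. \<forall>n. r n \<in> G1 n}"
  define C where "C = {r \<in> Rs V U. \<forall>n. r n \<in> Pol (UU V U (Suc n))}"
  have X: "sub (Om t) X" unfolding X_def
  proof (rule sub_Rs_family[OF p no])
    show "sub (insert TT (range (psc sc))) (G1 n)" for n
      unfolding G1_def by (auto simp: sub_def addv_0[OF addv_TT])
    show "psc sc (a i) x \<in> G1 (Suc n)" if "x \<in> G1 n" for n i x
      using that unfolding G1_def by (auto split: if_splits)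
  qed
  have C: "sub (Om t) C" unfolding C_def
    by (rule sub_Rs_family[OF p no sP]) (rule a_PUU[OF p no])
  have "sub (Om t) {r \<in> Rs V U. \<forall>n. r n \<in> UNIV}"
    by (rule sub_Rs_family[OF p no sub_UNIV]) (rule UNIV_I)
  then have R: "sub (Om t) (Rs V U)" by simp
  have PC: "Pol (Pol V) = {r \<in> Rs V U. \<forall>n. r n \<in> Pol V}"
    using C_Rs[OF p no] by (auto simp: Rs_def intro: PolD) (auto simp: Pol_def)
  have PP: "sub (Om t) (Pol (Pol V))" unfolding PC
    by (rule sub_Rs_family[OF p no sub_Pol[OF smod_axioms' apairD(1)[OF p]]])
       (rule sub_op[OF sub_Pol[OF smod_axioms' apairD(1)[OF p]]], rule insertI2, rule rangeI)
  have PPC: "Pol (Pol V) \<subseteq> C" unfolding PC C_def using Pol_mono[OF V_UU[OF p no]] by blast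
  have zX: "sub (Om t) (z2 ` X)" by (rule sub_image[OF X itw_z2])
  have S: "sub (Om t) (z2 ` X \<boxplus> C)" by (rule sub_ssum'[OF zX C addops_Om])
  have TO: "TT2 \<in> Om t" by (simp add: Om_def)
  \<comment> \<open>A single chain in the Rees module yields one \<open>j0\<close> that is valid in
    all degrees.\<close>
  have "\<exists>j0. \<forall>j\<ge>j0. \<forall>w\<in>Rs V U. Qop TT2 (Suc j) w \<in> z2 ` X \<boxplus> C \<longrightarrow> Qop TT2 j w \<in> z2 ` X \<boxplus> C"
    by (rule pop_stable[OF addv_TT2 noeth_Rs[OF p no] R S TO addops_Om TT2_Om_comm C_Rs[OF p no] order_trans[OF PPC ssum_right[OF sub_0[OF zX]]] PP])
  then obtain j0 where j0: "\<And>j w. j \<ge> j0 \<Longrightarrow> w \<in> Rs V U \<Longrightarrow> Qop TT2 (Suc j) w \<in> z2 ` X \<boxplus> C \<Longrightarrow> Qop TT2 j w \<in> z2 ` X \<boxplus> C" by metis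
  have inj: "g \<in> C" if g: "g \<in> X" "z2 g \<in> C" for g
  proof -
    have gR: "g \<in> Rs V U" using g(1) unfolding X_def by blast
    have "g n \<in> Pol (UU V U (Suc n))" for n
    proof (cases "n < c")
      case True
      have "g n \<in> G1 n" using g(1) unfolding X_def by blast
      then have "g n = 0" using True by (simp add: G1_def)
      then show ?thesis using sub_0[OF sP] by simp
    next
      case False
      have z: "zz a t (g n) \<in> Pol (UU V U (Suc (Suc n)))"
      proof -
        have "z2 g (Suc n) \<in> Pol (UU V U (Suc (Suc n)))" using g(2) unfolding C_def by blast
        then show ?thesis by simp
      qed
      show ?thesis
        by (rule mccoy[where A = "UU V U" and B = "\<lambda>n. UU V U (Suc n)" and c = c and n = n,
              OF sub_UU[OF p no] sub_UU[OF p no] a_UU[OF p no] a_UU[OF p no] c _ RsD[OF p no gR] z])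
           (use False in auto)
    qed
    then show ?thesis using gR unfolding C_def by blast
  qed
  have "\<exists>g'\<in>Pol (UU V U n). u - Pop TT j g' \<in> Pol (UU V U (Suc n))"
    if j: "j \<ge> j0" and n: "n \<ge> c" and u: "u \<in> Pol (UU V U n)" and w: "w \<in> Pol (UU V U (Suc n))"
      and zu: "zz a t u - Pop TT j w \<in> Pol (UU V U (Suc (Suc n)))" for j n u w
  proof -
    \<comment> \<open>The relation in degree \<open>n\<close> is placed in the Rees module as a
      homogeneous one; \<open>w\<close> sits in degree \<open>n + 1\<close> because
      \<open>z2\<close> raises the degree.\<close>
    have uX: "dlt n u \<in> X" unfolding X_def using dlt_Rs[OF p no u] n by (auto simp: G1_def dlt_def)
    have wR: "dlt (Suc n) w \<in> Rs V U" by (rule dlt_Rs[OF p no w])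
    have e: "z2 (dlt n u) - Pop TT2 j (dlt (Suc n) w) = dlt (Suc n) (zz a t u - Pop TT j w)"
    proof (rule ext)
      fix m show "(z2 (dlt n u) - Pop TT2 j (dlt (Suc n) w)) m = dlt (Suc n) (zz a t u - Pop TT j w) m"
        by (cases m) (simp_all add: Pop_TT2 dlt_def addv_0[OF addv_zz] addv_0[OF polop_addv[OF polP]])
    qed
    have "zz a t u - Pop TT j w \<in> Pol (UU V U (Suc n))"
      using Pol_mono[OF UU_decr[OF p no]] zu by blast
    then have "dlt (Suc n) (zz a t u - Pop TT j w) \<in> C"
      unfolding C_def using dlt_Rs[OF p no] zu sub_0[OF sP] by (simp add: dlt_def)
    then have zC: "z2 (dlt n u) - Pop TT2 j (dlt (Suc n) w) \<in> C" unfolding e .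
    have TX: "sub {TT2} X" "sub {TT2} C" using sub_mono[OF X] sub_mono[OF C] TO by auto
    have cm: "z2 (TT2 x) = TT2 (z2 x)" for x by (rule z2_Om[OF TO])
    obtain g' where g': "g' \<in> X" "dlt n u - Pop TT2 j g' \<in> C"
      using pop_lemma[OF addv_TT2 addv_z2 cm TX j0[OF j] inj uX wR zC] by blast
    have "g' n \<in> Pol (UU V U n)" using g'(1) RsD[OF p no] unfolding X_def by blast
    moreover have "(dlt n u - Pop TT2 j g') n \<in> Pol (UU V U (Suc n))" using g'(2) unfolding C_def by blast
    then have "u - Pop TT j (g' n) \<in> Pol (UU V U (Suc n))" by (simp add: Pop_TT2 dlt_def)
    ultimately show ?thesis by blast
  qed
  then show ?thesis by blast
qed

text \<open>An Artin--Rees statement for the submodule generated by the generic linear form and \<open>Pop TT j\<close>.\<close>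

lemma artin_rees:
  fixes j
  defines "K n \<equiv> zz a t ` Pol (UU V U n) \<boxplus> Pop TT j ` Pol (UU V U n) \<boxplus> Pol V"
  shows "\<exists>s. \<forall>n\<ge>s. K 0 \<inter> Pol (UU V U n) \<subseteq> K (n - s)"
proof -
  note sP = sub_PUU[OF p no]
  let ?Om = "insert TT (range (psc sc))"
  have itz: "itw ?Om ?Om (zz a t)"
    unfolding itw_def
  proof (intro conjI ballI)
    fix g assume g: "g \<in> ?Om"
    have c: "zz a t (g x) = g (zz a t x)" for x using g by (auto simp: zz_TT zz_psc)
    show "\<exists>g'\<in>?Om. \<forall>x. zz a t (g x) = g' (zz a t x)" "\<exists>g'\<in>?Om. \<forall>x. zz a t (g' x) = g (zz a t x)"
      by (rule bexI[OF _ g], intro allI, rule c)+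
  qed (rule addv_zz)
  have Pg: "Pop TT j (g x) = g (Pop TT j x)" if g: "g \<in> ?Om" for g x
  proof (rule polop_comm[OF polP])
    show "addv g" by (rule bspec[OF addops_T[unfolded addops_def] g])
    show "g (TT y) = TT (g y)" for y using g by (auto simp: TT_psc)
  qed
  have itP: "itw ?Om ?Om (Pop TT j)"
    unfolding itw_def
  proof (intro conjI ballI)
    fix g assume g: "g \<in> ?Om"
    show "\<exists>g'\<in>?Om. \<forall>x. Pop TT j (g x) = g' (Pop TT j x)" "\<exists>g'\<in>?Om. \<forall>x. Pop TT j (g' x) = g (Pop TT j x)"
      by (rule bexI[OF _ g], intro allI, rule Pg[OF g])+
  qed (rule polop_addv[OF polP])
  have PV: "sub ?Om (Pol V)" by (rule sub_Pol[OF smod_axioms' apairD(1)[OF p]])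
  have K: "sub ?Om (K n)" for n unfolding K_def
    by (intro sub_ssum' sub_image[OF sP itz] sub_image[OF sP itP] PV addops_T)
  have Kd: "K (Suc n) \<subseteq> K n" for n
    unfolding K_def using Pol_mono[OF UU_decr[OF p no]] by (intro ssum_mono image_mono order_refl) auto
  have Km: "m \<le> n \<Longrightarrow> K n \<subseteq> K m" for m n by (rule lift_Suc_antimono_le[of K, OF Kd])
  have aK: "psc sc (a i) x \<in> K (Suc n)" if i: "i < t" and x: "x \<in> K n" for i x n
  proof -
    obtain y where y: "y \<in> zz a t ` Pol (UU V U n) \<boxplus> Pop TT j ` Pol (UU V U n)" and "\<exists>v\<in>Pol V. x = y + v"
      using x unfolding K_def by (auto elim: ssumE)
    then obtain v where v: "v \<in> Pol V" "x = y + v" by blast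
    obtain g h where gh: "g \<in> Pol (UU V U n)" "h \<in> Pol (UU V U n)" "y = zz a t g + Pop TT j h"
      using y by (auto elim!: ssumE)
    have "psc sc (a i) x = zz a t (psc sc (a i) g) + Pop TT j (psc sc (a i) h) + psc sc (a i) v"
      unfolding v(2) gh(3) smod.sc_add[OF smod_p] zz_psc Pg[OF insertI2[OF rangeI]] ..
    moreover have "psc sc (a i) v \<in> Pol V" by (rule sub_op[OF PV _ v(1)]) (rule insertI2, rule rangeI)
    ultimately show ?thesis unfolding K_def
      using a_PUU[OF p no i gh(1)] a_PUU[OF p no i gh(2)] by (auto intro!: ssumI imageI)
  qed
  \<comment> \<open>In degree \<open>n \<ge> s\<close> the entries must lie \<open>n - s\<close>
    deep in the filtration \<open>K\<close>. This weakens with \<open>s\<close>; an element of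
    \<open>K 0\<close> in degree \<open>n\<close> satisfies it for \<open>s = n\<close>, and
    stabilisation carries it back to a fixed \<open>s\<close>.\<close>
  define G where "G s n = (if n \<ge> s then K (n - s) \<inter> K 0 else K 0)" for s n
  define W where "W s = {r \<in> Rs V U. \<forall>n. r n \<in> G s n}" for s
  obtain M where M: "\<And>s. s \<ge> M \<Longrightarrow> W s = W M"
  proof (rule noethD[OF noeth_Rs[OF p no], of W])
    show "sub (Om t) (W s)" for s unfolding W_def
    proof (rule sub_Rs_family[OF p no])
      show "sub ?Om (G s n)" for n unfolding G_def
        by (cases "s \<le> n") (simp_all only: if_True if_False sub_Int[OF K K] K)
      fix n i x assume i: "i < t" and x: "x \<in> G s n"
      have x0: "x \<in> K 0" using x unfolding G_def by (auto split: if_splits)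
      have 0: "psc sc (a i) x \<in> K 0" by (rule sub_op[OF K _ x0]) (rule insertI2, rule rangeI)
      show "psc sc (a i) x \<in> G s (Suc n)"
      proof (cases "n \<ge> s")
        case True
        then have "psc sc (a i) x \<in> K (Suc (n - s))" using aK[OF i] x unfolding G_def by auto
        then show ?thesis using True 0 by (simp add: G_def Suc_diff_le)
      next
        case False
        then have "Suc n - s = 0" by simp
        then show ?thesis using 0 by (simp add: G_def)
      qed
    qed
    show "Pol (Pol V) \<subseteq> W s" for s
    proof
      fix x assume x: "x \<in> Pol (Pol V)"
      have "Pol V \<subseteq> K n" for n unfolding K_def
        by (rule ssum_right) (intro sub_0[of ?Om] sub_ssum' sub_image[OF sP itz] sub_image[OF sP itP] addops_T)
      then have "x n \<in> G s n" for n using PolD[OF x, of n] unfolding G_def by auto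
      then show "x \<in> W s" unfolding W_def using C_Rs[OF p no] x by blast
    qed
    show "W s \<subseteq> Rs V U" for s unfolding W_def by blast
    show "W s \<subseteq> W (Suc s)" for s
    proof -
      have "G s n \<subseteq> G (Suc s) n" for n
      proof (cases "n \<ge> Suc s")
        case True
        then have "K (n - s) \<subseteq> K (n - Suc s)" by (intro Km) simp
        then show ?thesis using True by (auto simp: G_def)
      qed (auto simp: G_def)
      then show ?thesis unfolding W_def by blast
    qed
  qed metis
  have "x \<in> K (n - M)" if n: "n \<ge> M" and x: "x \<in> K 0" "x \<in> Pol (UU V U n)" for n x
  proof -
    have "dlt n x m \<in> G n m" for m using x sub_0[OF K] by (auto simp: G_def dlt_def)
    then have "dlt n x \<in> W n" unfolding W_def using dlt_Rs[OF p no x(2)] by blast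
    then have "dlt n x \<in> W M" using M[OF n] by simp
    then have "dlt n x n \<in> G M n" unfolding W_def by blast
    then show ?thesis using n by (simp add: G_def dlt_def)
  qed
  then show ?thesis by blast
qed

text \<open>For large \<open>j\<close> the generic linear form is a superficial element for \<open>U[T]/(V[T] + Pop TT j U[T])\<close>.\<close>

lemma superficial:
  assumes soc: "\<And>u. u \<in> U \<Longrightarrow> (\<And>i. i < t \<Longrightarrow> sc (a i) u \<in> V) \<Longrightarrow> u \<in> V"
  shows "\<exists>j0. \<forall>j\<ge>j0. (\<forall>x\<in>Pol U. zz a t x \<in> Pol V \<boxplus> Pop TT j ` Pol U \<longrightarrow> x \<in> Pol V \<boxplus> Pop TT j ` Pol U)
     \<and> (\<exists>n0. \<forall>n\<ge>n0. \<forall>x\<in>Pol U. zz a t x \<in> Pol (UU V U (Suc n)) \<boxplus> Pop TT j ` Pol U \<longrightarrow> x \<in> Pol (UU V U n) \<boxplus> Pop TT j ` Pol U)"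
proof -
  note V = apairD(1)[OF p] and U = apairD(2)[OF p]
  let ?E = "Pol U"
  obtain j1 where j1: "\<And>j x. j \<ge> j1 \<Longrightarrow> x \<in> ?E \<Longrightarrow> zz a t x \<in> Pol V \<boxplus> Pop TT j ` ?E \<Longrightarrow> x \<in> Pol V \<boxplus> Pop TT j ` ?E"
    using zz_regular[OF p no soc] by metis
  obtain c j2 where j2: "\<And>j n u w. j \<ge> j2 \<Longrightarrow> n \<ge> c \<Longrightarrow> u \<in> Pol (UU V U n) \<Longrightarrow> w \<in> Pol (UU V U (Suc n)) \<Longrightarrow>
     zz a t u - Pop TT j w \<in> Pol (UU V U (Suc (Suc n))) \<Longrightarrow> (\<exists>g'\<in>Pol (UU V U n). u - Pop TT j g' \<in> Pol (UU V U (Suc n)))"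
    using gr_pop by metis
  have "\<exists>n0. \<forall>n\<ge>n0. \<forall>x\<in>?E. zz a t x \<in> Pol (UU V U (Suc n)) \<boxplus> Pop TT j ` ?E \<longrightarrow> x \<in> Pol (UU V U n) \<boxplus> Pop TT j ` ?E"
    if j: "j \<ge> max j1 j2" for j
  proof -
    let ?P = "Pop TT j"
    obtain D where mD: "monop D (?P :: (nat \<Rightarrow> 'x) \<Rightarrow> _)" using mon_Pop by blast
    have aP: "addv ?P" by (rule polop_addv[OF polP])
    note sPf = sub_Pf[OF mD polP U]
    have UP: "submod (psc sc) (Pol (UU V U n) \<boxplus> ?P ` ?E)" for n by (rule sPf[OF sub_UU[OF p no]])
    have UE: "Pol (UU V U n) \<subseteq> ?E" for n by (rule Pol_mono[OF UU_U[OF p no]])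
    obtain s where s0: "\<forall>n\<ge>s. (zz a t ` Pol (UU V U 0) \<boxplus> ?P ` Pol (UU V U 0) \<boxplus> Pol V) \<inter> Pol (UU V U n)
        \<subseteq> zz a t ` Pol (UU V U (n - s)) \<boxplus> ?P ` Pol (UU V U (n - s)) \<boxplus> Pol V"
      using artin_rees[of j] by (rule exE)
    have s: "y \<in> zz a t ` Pol (UU V U (n - s)) \<boxplus> ?P ` Pol (UU V U (n - s)) \<boxplus> Pol V"
      if "n \<ge> s" "y \<in> zz a t ` Pol (UU V U 0) \<boxplus> ?P ` Pol (UU V U 0) \<boxplus> Pol V" "y \<in> Pol (UU V U n)" for n y
      by (rule subsetD[OF s0[rule_format, OF that(1)] IntI[OF that(2,3)]])
    have VUn: "x \<in> Pol V \<boxplus> ?P ` ?E \<Longrightarrow> x \<in> Pol (UU V U n) \<boxplus> ?P ` ?E" for x n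
      using ssum_mono[OF Pol_mono[OF V_UU[OF p no]] order_refl] by blast
    have PE: "?P x \<in> Pol (UU V U n) \<boxplus> ?P ` ?E" if "x \<in> ?E" for x n
      using ssum_right[OF sub_0[OF sub_PUU[OF p no]]] that by blast
    \<comment> \<open>Regularity on the graded pieces raises the order of \<open>x\<close> one
      degree at a time, from a starting degree \<open>i0 \<ge> c\<close> up to
      \<open>n\<close>.\<close>
    have down: "x \<in> Pol (UU V U i) \<boxplus> ?P ` ?E"
      if x: "x \<in> ?E" and zx: "zz a t x \<in> Pol (UU V U (Suc n)) \<boxplus> ?P ` ?E" and i0: "i0 \<ge> c" "i0 \<le> n"
        and x0: "x \<in> Pol (UU V U i0) \<boxplus> ?P ` ?E" and i: "i0 \<le> i" "i \<le> n" for x n i i0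
      using i
    proof (induction i rule: dec_induct)
      case base
      show ?case by (rule x0)
    next
      case (step m)
      then have "x \<in> Pol (UU V U m) \<boxplus> ?P ` ?E" by simp
      then obtain g y where g: "g \<in> Pol (UU V U m)" "y \<in> ?E" "x = g + ?P y" by (auto elim!: ssumE)
      have "?P (zz a t y) = zz a t (?P y)" by (rule polop_comm[where f = ?P and g = "zz a t", OF polP addv_zz zz_TT])
      then have zg: "zz a t g = zz a t x - ?P (zz a t y)" using g(3) by (simp add: addv_add[OF addv_zz])
      have zy: "zz a t y \<in> ?E" by (rule zz_Pol[OF _ U g(2)]) (rule sub_sc[OF U])
      have "zz a t g \<in> Pol (UU V U (Suc n)) \<boxplus> ?P ` ?E" unfolding zg by (rule sub_diff[OF UP zx PE[OF zy]])
      then obtain e w where ew: "e \<in> Pol (UU V U (Suc n))" "w \<in> ?E" "zz a t g = e + ?P w" by (auto elim!: ssumE)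
      have e1: "e \<in> Pol (UU V U (Suc (Suc m)))"
        using ew(1) Pol_mono[OF UU_mono[OF p no, of "Suc (Suc m)" "Suc n"]] step.prems by auto
      have e2: "e \<in> Pol (UU V U (Suc m))" using e1 Pol_mono[OF UU_decr[OF p no]] by blast
      \<comment> \<open>\<open>gr_pop\<close> needs \<open>w\<close> to have the right order; since
        \<open>Pop TT j\<close> reflects orders, the order of \<open>?P w\<close> suffices.\<close>
      have "?P w = zz a t g - e" using ew(3) by simp
      then have "?P w \<in> Pol (UU V U (Suc m))" using sub_diff[OF sub_PUU[OF p no] zz_UU[OF p no g(1)] e2] by simp
      then have w: "w \<in> Pol (UU V U (Suc m))" by (rule Pop_reflect[OF U sub_UU[OF p no] ew(2)])
      have "zz a t g - ?P w \<in> Pol (UU V U (Suc (Suc m)))" using e1 ew(3) by simp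
      moreover have "j2 \<le> j" "c \<le> m" using j step.hyps i0 by auto
      ultimately obtain g' where g': "g' \<in> Pol (UU V U m)" "g - ?P g' \<in> Pol (UU V U (Suc m))"
        using j2 g(1) w by blast
      have "x = (g - ?P g') + ?P (g' + y)" using g(3) by (simp add: addv_add[OF aP])
      moreover have "g' + y \<in> ?E" using sub_add[OF sub_Pol'[OF smod_axioms' U]] g'(1) UE g(2) by blast
      ultimately show ?case by (rule ssum_imageI[OF g'(2), rotated])
    qed
    \<comment> \<open>The starting degree for \<open>down\<close> is \<open>n - s\<close>, by
      Artin-Rees: the part \<open>m\<close> of \<open>zz a t x\<close> equals
      \<open>zz a t g\<close> up to multiples of the polynomial and \<open>V[T]\<close>, with
      \<open>g\<close> of order \<open>n + 1 - s\<close>. Regularity then shows that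
      \<open>x\<close> and \<open>g\<close> differ only by such terms.\<close>
    have "x \<in> Pol (UU V U n) \<boxplus> ?P ` ?E"
      if n: "n \<ge> s + c" and x: "x \<in> ?E" and zx: "zz a t x \<in> Pol (UU V U (Suc n)) \<boxplus> ?P ` ?E" for n x
    proof -
      obtain m y where m: "m \<in> Pol (UU V U (Suc n))" "y \<in> ?E" "zz a t x = m + ?P y" using zx by (auto elim!: ssumE)
      have "m = zz a t x + ?P (- y) + 0" using m(3) by (simp add: addv_minus[OF aP])
      moreover have "- y \<in> ?E" by (rule sub_uminus[OF sub_Pol'[OF smod_axioms' U] m(2)])
      ultimately have "m \<in> zz a t ` Pol (UU V U 0) \<boxplus> ?P ` Pol (UU V U 0) \<boxplus> Pol V"
        unfolding UU_0[OF p no] by (simp only:) (intro ssumI imageI x sub_0[OF sub_Pol'[OF smod_axioms' V]])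
      then have "m \<in> zz a t ` Pol (UU V U (Suc n - s)) \<boxplus> ?P ` Pol (UU V U (Suc n - s)) \<boxplus> Pol V"
        using s[OF _ _ m(1)] n by simp
      then obtain g h v where g: "g \<in> Pol (UU V U (Suc n - s))" "h \<in> Pol (UU V U (Suc n - s))" "v \<in> Pol V" "m = zz a t g + ?P h + v"
        by (auto elim!: ssumE)
      have gE: "g \<in> ?E" "h \<in> ?E" using g UE by blast+
      have "zz a t (x - g) = v + ?P (h + y)"
        using m(3) g(4) by (simp add: addv_diff[OF addv_zz] addv_add[OF aP])
      moreover have "h + y \<in> ?E" by (rule sub_add[OF sub_Pol'[OF smod_axioms' U] gE(2) m(2)])
      ultimately have "zz a t (x - g) \<in> Pol V \<boxplus> ?P ` ?E" by (rule ssum_imageI[OF g(3), rotated])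
      then have "x - g \<in> Pol V \<boxplus> ?P ` ?E"
        using j1 j sub_diff[OF sub_Pol'[OF smod_axioms' U] x gE(1)] by simp
      then have 1: "x - g \<in> Pol (UU V U (n - s)) \<boxplus> ?P ` ?E" by (rule VUn)
      have "g \<in> Pol (UU V U (n - s))" by (rule subsetD[OF Pol_mono[OF UU_mono[OF p no]] g(1)]) simp
      then have "g \<in> Pol (UU V U (n - s)) \<boxplus> ?P ` ?E" using ssum_left[OF sub_0[OF sub_fPol[OF mD polP U]]] by blast
      with 1 have "x \<in> Pol (UU V U (n - s)) \<boxplus> ?P ` ?E" by (rule sub_diff_cancel[OF UP])
      from down[OF x zx _ _ this _ order_refl] show ?thesis using n by simp
    qed
    then show ?thesis by blast
  qed
  then show ?thesis using j1 by (metis max.bounded_iff)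
qed

end

end

section \<open>Regular sequences and one reduction step\<close>

primrec vx :: "('s \<Rightarrow> 'x::ab_group_add \<Rightarrow> 'x) \<Rightarrow> (nat \<Rightarrow> 's) \<Rightarrow> 'x set \<Rightarrow> 'x set \<Rightarrow> nat \<Rightarrow> 'x set" where
  "vx sc x V U 0 = V"
| "vx sc x V U (Suc i) = vx sc x V U i \<boxplus> sc (x i) ` U"

text \<open>Finite length of the last quotient is carried along, so that for \<open>d = 0\<close>
  the module \<open>U/V\<close> itself has finite length.\<close>

definition regseq where
  "regseq sc I N d x V U \<longleftrightarrow> apair sc I V U \<and> noeth (range sc) V U \<and> (\<forall>i<d. x i \<in> N)
     \<and> (\<forall>i<d. \<forall>u\<in>U. sc (x i) u \<in> vx sc x V U i \<longrightarrow> u \<in> vx sc x V U i) \<and> rlen (range sc) (vx sc x V U d) U \<noteq> \<infinity>"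

text \<open>The Hilbert-Samuel function of \<open>U/V\<close>.\<close>

definition hs where
  "hs sc a t n V U = rlen (range sc) (smod.mpw sc a t n U \<boxplus> V) U"

lemma ssum_left_commute: "A \<boxplus> (B \<boxplus> C) = B \<boxplus> (A \<boxplus> C)"
  by (simp only: ssum_assoc[symmetric] ssum_commute[of A B])

lemmas ssum_ac = ssum_assoc ssum_commute ssum_left_commute

lemma (in smod) sub_scimage: assumes "submod sc U" shows "submod sc (sc s ` U)"
proof (rule sub_image[OF assms])
  show "itw (range sc) (range sc) (sc s)"
    by (rule itw_lin[where sc = sc and sc' = sc, OF addv_sc]) (rule sc_commute)
qed

lemma (in smod) mpw_subset:
  assumes U: "submod sc U" shows "mpw a t n U \<subseteq> U"
proof (induction n)
  case (Suc n)
  show ?case by (rule order_trans[OF mpw_decr[OF U] Suc])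
qed simp

lemma (in smod) vx_facts:
  assumes V: "submod sc V" and U: "submod sc U" and VU: "V \<subseteq> U"
  shows "submod sc (vx sc x V U i) \<and> V \<subseteq> vx sc x V U i \<and> vx sc x V U i \<subseteq> U"
proof (induction i)
  case 0
  then show ?case using V VU by simp
next
  case (Suc i)
  then have s: "submod sc (vx sc x V U i)" by simp
  note im = sub_scimage[OF U, of "x i"]
  have "submod sc (vx sc x V U (Suc i))" unfolding vx.simps by (rule sub_ssum'[OF s im addops_sc])
  moreover have "vx sc x V U i \<subseteq> vx sc x V U (Suc i)" unfolding vx.simps by (rule ssum_left[OF sub_0[OF im]])
  moreover have "vx sc x V U (Suc i) \<subseteq> U" unfolding vx.simps
    by (rule ssum_least[OF U]) (use Suc sub_sc[OF U] in blast)+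
  ultimately show ?case using Suc by blast
qed

context glmod
begin

lemma Pmpw: assumes U: "ssub U" shows "smod.mpw (psc sc) a t n (Pol U) = Pol (mpw a t n U)"
proof (induction n)
  case 0
  show ?case by (simp only: smod.mpw_0[OF smod_p] mpw_0)
next
  case (Suc n)
  note W = sub_mpw[OF U, of a t n]
  have sA: "submod (psc sc) (Pol (am a t (mpw a t n U)))" by (rule sub_Pol'[OF smod_axioms' sub_am[OF W]])
  have "smod.am (psc sc) a t (Pol (mpw a t n U)) = Pol (am a t (mpw a t n U))"
  proof
    show "Pol (am a t (mpw a t n U)) \<subseteq> smod.am (psc sc) a t (Pol (mpw a t n U))"
    proof
      fix x assume "x \<in> Pol (am a t (mpw a t n U))"
      then obtain y where y: "\<And>i. i < t \<Longrightarrow> y i \<in> Pol (mpw a t n U)" "x = (\<Sum>i<t. psc sc (a i) (y i))"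
        using Pol_am[OF sub_0[OF W]] by blast
      show "x \<in> smod.am (psc sc) a t (Pol (mpw a t n U))" unfolding y(2) by (rule smod.amI[OF smod_p]) (rule y(1))
    qed
    show "smod.am (psc sc) a t (Pol (mpw a t n U)) \<subseteq> Pol (am a t (mpw a t n U))"
    proof
      fix x assume "x \<in> smod.am (psc sc) a t (Pol (mpw a t n U))"
      then obtain y where y: "\<And>i. i < t \<Longrightarrow> y i \<in> Pol (mpw a t n U)" "x = (\<Sum>i<t. psc sc (a i) (y i))"
        unfolding smod.am_def[OF smod_p] by blast
      show "x \<in> Pol (am a t (mpw a t n U))" unfolding y(2)
      proof (rule sub_sum[OF sA])
        fix i assume "i \<in> {..<t}"
        then have i: "i < t" by simp
        obtain K where K: "\<And>k. k \<ge> K \<Longrightarrow> y i k = 0" using PolE[OF y(1)[OF i]] by blast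
        show "psc sc (a i) (y i) \<in> Pol (am a t (mpw a t n U))"
          by (rule PolI[of _ _ K]) (simp_all add: K sc_0 am_gen[OF W PolD[OF y(1)[OF i]] i])
      qed
    qed
  qed
  then show ?case by (simp only: smod.mpw_Suc[OF smod_p] mpw_Suc Suc)
qed

lemma Pol_scimage: "psc sc s ` Pol U = Pol (sc s ` U)" if "0 \<in> U"
proof
  show "psc sc s ` Pol U \<subseteq> Pol (sc s ` U)"
  proof
    fix x assume "x \<in> psc sc s ` Pol U"
    then obtain y where y: "y \<in> Pol U" "x = psc sc s y" by blast
    obtain K where K: "\<And>k. k \<ge> K \<Longrightarrow> y k = 0" using PolE[OF y(1)] by blast
    show "x \<in> Pol (sc s ` U)" unfolding y(2) by (rule PolI[of _ _ K]) (simp_all add: K sc_0 PolD[OF y(1)])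
  qed
  show "Pol (sc s ` U) \<subseteq> psc sc s ` Pol U"
  proof
    fix x assume x: "x \<in> Pol (sc s ` U)"
    obtain K where K: "\<And>k. k \<ge> K \<Longrightarrow> x k = 0" using PolE[OF x] by blast
    have "\<exists>u\<in>U. x k = sc s u" for k using PolD[OF x, of k] by blast
    then obtain u where u: "\<And>k. u k \<in> U" "\<And>k. x k = sc s (u k)" by metis
    have "x = psc sc s (\<lambda>k. if k < K then u k else 0)" using u(2) K by (auto simp: fun_eq_iff sc_0)
    moreover have "(\<lambda>k. if k < K then u k else 0) \<in> Pol U" by (rule PolI[of _ _ K]) (simp_all add: u(1) that)
    ultimately show "x \<in> psc sc s ` Pol U" by blast
  qed
qed

text \<open>The modules \<open>m^n U + W\<close> have decreasing finite lengths over
  \<open>W\<close>; where the descent stops, Nakayama's lemma gives \<open>W\<close>.\<close>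

lemma finite_len_nilpotent:
  assumes p: "apair sc I W U" and fin: "len W U \<noteq> \<infinity>"
  shows "\<exists>c. mpw a t c U \<subseteq> W"
proof -
  note W = apairD(1)[OF p] and U = apairD(2)[OF p] and WU = apairD(3)[OF p]
  define X where "X n = mpw a t n U \<boxplus> W" for n
  note mU = mpw_subset[OF U, of a t]
  have X: "ssub (X n)" "W \<subseteq> X n" "X n \<subseteq> U" "X (Suc n) \<subseteq> X n" for n
    unfolding X_def using sub_ssum'[OF sub_mpw[OF U] W addops_sc] ssum_right[OF sub_0[OF sub_mpw[OF U]]]
      ssum_least[OF U mU WU] ssum_mono[OF mpw_decr[OF U] order_refl] by blast+
  have "\<exists>k. len W (X n) = enat k" for n
    using rlen_mono[OF X(2)[of n] order_refl X(3)[of n], of "range sc"] fin by (metis enat_ord_simps(5) not_infinity_eq)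
  then obtain f where f: "\<And>n. len W (X n) = enat (f n)" by metis
  have "\<exists>n. X (Suc n) = X n"
  proof (rule ccontr)
    assume "\<nexists>n. X (Suc n) = X n"
    then have lt: "X (Suc n) \<subset> X n" for n using X(4)[of n] by blast
    have "f (Suc n) < f n" for n
    proof -
      have "len W (X n) = len W (X (Suc n)) + len (X (Suc n)) (X n)"
        by (rule len_add[OF W X(1) X(1) X(2) X(4)])
      moreover have "1 \<le> len (X (Suc n)) (X n)" by (rule rlen_ge1[OF lt X(1)])
      ultimately have "enat (f (Suc n)) + 1 \<le> enat (f n)" by (simp only: f add_left_mono)
      then show ?thesis by (simp add: one_enat_def)
    qed
    then have "f n + n \<le> f 0" for n by (induction n) (simp, metis Suc_leI add_Suc_right add_Suc_shift add_le_mono1 order_trans)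
    from this[of "Suc (f 0)"] show False by simp
  qed
  then obtain n where n: "X (Suc n) = X n" by blast
  have "X n = W"
  proof (rule nakayama)
    show "apair sc I W (X n)" by (rule apair_left[OF p X(1,2,3)])
    show "noe W (X n)" by (rule noeth_mono[OF finite_len_noe[OF p fin] order_refl X(3) order_refl])
    fix Y assume Y: "ssub Y" "W \<subseteq> Y" and NY: "\<And>s u. s \<in> N \<Longrightarrow> u \<in> X n \<Longrightarrow> sc s u \<in> Y"
    have "am a t (mpw a t n U) \<subseteq> Y"
    proof
      fix y assume "y \<in> am a t (mpw a t n U)"
      then obtain u where u: "\<forall>i<t. u i \<in> mpw a t n U" "y = (\<Sum>i<t. sc (a i) (u i))" unfolding am_def by blast
      show "y \<in> Y" unfolding u(2)
      proof (rule sub_sum[OF Y(1)])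
        fix i assume i: "i \<in> {..<t}"
        then have "u i \<in> X n" using u(1) ssum_left[OF sub_0[OF W]] unfolding X_def by blast
        then show "sc (a i) (u i) \<in> Y" using NY aN i by simp
      qed
    qed
    then have "X (Suc n) \<subseteq> Y" unfolding X_def mpw_Suc by (rule ssum_least[OF Y(1) _ Y(2)])
    then show "X n \<subseteq> Y" using n by simp
  qed
  moreover have "mpw a t n U \<subseteq> X n" unfolding X_def by (rule ssum_left[OF sub_0[OF W]])
  ultimately show ?thesis by blast
qed

text \<open>As \<open>s^q U\<close> lies in \<open>m^q U + W\<close>, it suffices to bound the
  colength of \<open>W + s^q U\<close>. Each of the \<open>q\<close> factors of the filtration by
  powers of \<open>s\<close> is an image of \<open>U/(W + s U)\<close>.\<close>

lemma linear_growth: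
  assumes p: "apair sc I W U" and s: "s \<in> N" and fin: "len (W \<boxplus> sc s ` U) U = enat l"
  shows "len (UU W U q) U \<le> enat (q * l)"
proof -
  note W = apairD(1)[OF p] and U = apairD(2)[OF p] and WU = apairD(3)[OF p]
  let ?W1 = "W \<boxplus> sc s ` U"
  have sU: "sc s ` U \<subseteq> U" using sub_sc[OF U] by blast
  have W1: "ssub ?W1" "W \<subseteq> ?W1" "?W1 \<subseteq> U"
    using sub_ssum'[OF W sub_scimage[OF U] addops_sc] ssum_left[OF sub_0[OF sub_scimage[OF U]]] ssum_least[OF U WU sU] by blast+
  let ?f = "\<lambda>q. sc s ^^ q"
  have af: "addv (?f q)" for q by (rule addv_pow[OF addv_sc])
  have fs: "?f q (sc r u) = sc r (?f q u)" for q r u by (induction q) (simp_all add: sc_commute)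
  define S where "S q = W \<boxplus> ?f q ` U" for q
  have itf: "itw (range sc) (range sc) (?f q)" for q
    by (rule itw_lin[where sc = sc and sc' = sc, OF af]) (rule fs)
  have fW: "?f q u \<in> W" if "u \<in> W" for q u using that by (induction q) (simp_all add: sub_sc[OF W])
  have fU: "?f q u \<in> U" if "u \<in> U" for q u using that by (induction q) (simp_all add: sub_sc[OF U])
  have fUs: "ssub (?f q ` U)" for q by (rule sub_image[OF U itf])
  have S: "ssub (S q)" for q unfolding S_def by (rule sub_ssum'[OF W fUs addops_sc])
  have SU: "S q \<subseteq> U" for q unfolding S_def by (rule ssum_least[OF U WU]) (use fU in blast)
  have WS: "W \<subseteq> S q" for q unfolding S_def by (rule ssum_left[OF sub_0[OF fUs]])
  have fW1: "?f q ` ?W1 \<subseteq> S (Suc q)" for q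
  proof
    fix y assume "y \<in> ?f q ` ?W1"
    then obtain z where z: "z \<in> ?W1" "y = ?f q z" by (rule imageE)
    then obtain w u where wu: "w \<in> W" "u \<in> U" "z = w + sc s u" by (auto elim!: ssumE)
    have "y = ?f q w + ?f (Suc q) u" using z(2) wu(3) by (simp add: addv_add[OF af] fs)
    moreover have "?f q w + ?f (Suc q) u \<in> W \<boxplus> ?f (Suc q) ` U" by (rule ssumI[OF fW[OF wu(1)] imageI[OF wu(2)]])
    ultimately show "y \<in> S (Suc q)" unfolding S_def by (simp only:)
  qed
  have dec: "S (Suc q) \<subseteq> S q" for q
  proof -
    have "?f (Suc q) u \<in> ?f q ` U" if "u \<in> U" for u
      using imageI[OF sub_sc[OF U that, of s], of "?f q"] by (simp add: fs)
    then show ?thesis unfolding S_def by (intro ssum_mono order_refl) blast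
  qed
  have lS: "len (S q) U \<le> enat (q * l)" for q
  proof (induction q)
    case 0
    have "U \<subseteq> S 0" using ssum_right[OF sub_0[OF W], of U] by (simp add: S_def)
    then show ?case by (simp add: rlen_eq0)
  next
    case (Suc q)
    have e: "len (S (Suc q)) U = len (S (Suc q)) (S q) + len (S q) U" by (rule len_add[OF S S U dec SU])
    have "len (S (Suc q)) (S q) \<le> len ?W1 U"
    proof (rule rlen_le_surj[OF itf[of q] U S _ fW1 W1(3)])
      show "S q \<subseteq> ?f q ` U \<boxplus> S (Suc q)"
        unfolding S_def[of q] ssum_commute[of W] by (rule ssum_mono[OF order_refl WS])
    qed
    then have "len (S (Suc q)) U \<le> enat l + enat (q * l)" unfolding e fin by (rule add_mono[OF _ Suc])
    then show ?case by simp
  qed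
  have SUU: "S q \<subseteq> UU W U q" for q
  proof (induction q)
    case 0
    show ?case unfolding S_def by (simp add: ssum_commute)
  next
    case (Suc q)
    note UUs = sub_ssum'[OF sub_mpw[OF U] W addops_sc]
    have "?f (Suc q) u \<in> UU W U (Suc q)" if u: "u \<in> U" for u
    proof -
      have "?f q u \<in> S q" unfolding S_def using ssum_right[OF sub_0[OF W]] u by blast
      then have "?f q u \<in> UU W U q" using Suc by blast
      then obtain m w where mw: "m \<in> mpw a t q U" "w \<in> W" "?f q u = m + w" by (rule ssumE)
      note mU = mpw_subset[OF U, of a t q]
      have 1: "sc s m \<in> UU W U (Suc q)" unfolding mpw_Suc by (rule N_am[OF p s mw(1) sub_mpw[OF U] mU])
      have 2: "sc s w \<in> UU W U (Suc q)" using sub_sc[OF W mw(2)] ssum_right[OF sub_0[OF sub_mpw[OF U]]] by blast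
      have "?f (Suc q) u = sc s m + sc s w" using mw(3) by (simp add: sc_add)
      then show ?thesis using sub_add[OF UUs 1 2] by (simp only:)
    qed
    then show ?case unfolding S_def
      by (intro ssum_least[OF UUs] ssum_right[OF sub_0[OF sub_mpw[OF U]]]) blast
  qed
  have "len (UU W U q) U \<le> len (S q) U"
    by (rule rlen_mono[OF ssum_least[OF U mpw_subset[OF U] WU] SUU order_refl])
  then show ?thesis using lS[of q] by (rule order_trans)
qed

lemma UU_step_fin:
  assumes p: "apair sc I V U" and no: "noe V U"
  shows "len (UU V U n) U \<noteq> \<infinity>"
proof (induction n)
  case 0
  have "U \<subseteq> UU V U 0" unfolding UU_0[OF p no] by (rule order_refl)
  then show ?case by (simp add: rlen_eq0 zero_enat_def)
next
  case (Suc n)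
  note V = apairD(1)[OF p] and U = apairD(2)[OF p]
  note s = sub_UU[OF p no] and d = UU_decr[OF p no, of n] and u = UU_U[OF p no]
  have "len (UU V U (Suc n)) (UU V U n) \<noteq> \<infinity>"
  proof (rule noe_finite_len)
    show "apair sc I (UU V U (Suc n)) (UU V U n)"
      by (rule apair_right[OF apair_left[OF p s V_UU[OF p no] u] s V_UU[OF p no] d])
    show "noe (UU V U (Suc n)) (UU V U n)" by (rule noeth_mono[OF no V_UU[OF p no] u order_refl])
    fix r x assume r: "r \<in> N" and "x \<in> UU V U n"
    then obtain y v where yv: "y \<in> mpw a t n U" "v \<in> V" "x = y + v" by (auto elim!: ssumE)
    have mU: "mpw a t n U \<subseteq> U" using ssum_left[OF sub_0[OF V]] u by blast
    have 1: "sc r y \<in> UU V U (Suc n)" unfolding mpw_Suc by (rule N_am[OF p r yv(1) sub_mpw[OF U] mU])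
    have 2: "sc r v \<in> UU V U (Suc n)" using sub_sc[OF V yv(2)] V_UU[OF p no] by blast
    show "sc r x \<in> UU V U (Suc n)" unfolding yv(3) sc_add by (rule sub_add[OF s 1 2])
  qed
  moreover have "len (UU V U (Suc n)) U = len (UU V U (Suc n)) (UU V U n) + len (UU V U n) U"
    by (rule len_add[OF s s U d u])
  ultimately show ?case using Suc by (cases "len (UU V U n) U"; cases "len (UU V U (Suc n)) (UU V U n)") auto
qed

lemma zz_PE:
  assumes pf: "polop TT f" and U: "ssub U" and x: "x \<in> Pol W \<boxplus> f ` Pol U" and W: "\<And>x. x \<in> Pol W \<Longrightarrow> zz a t x \<in> Pol W'"
  shows "zz a t x \<in> Pol W' \<boxplus> f ` Pol U"
proof -
  obtain w y where wy: "w \<in> Pol W" "y \<in> Pol U" "x = w + f y" using x by (auto elim!: ssumE)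
  have "f (zz a t y) = zz a t (f y)" by (rule polop_comm[where f = f and g = "zz a t", OF pf addv_zz zz_TT])
  then have "zz a t x = zz a t w + f (zz a t y)" using wy(3) by (simp add: addv_add[OF addv_zz])
  moreover have "zz a t y \<in> Pol U" by (rule zz_Pol[OF _ U wy(2)]) (rule sub_sc[OF U])
  ultimately show ?thesis by (rule ssum_imageI[OF W[OF wy(1)], rotated])
qed

lemma sub_zE: assumes U: "ssub U" shows "submod (psc sc) (zz a t ` Pol U)"
proof (rule sub_image[OF sub_Pol'[OF smod_axioms' U]])
  show "itw (range (psc sc)) (range (psc sc)) (zz a t)"
    by (rule itw_lin[where sc = "psc sc" and sc' = "psc sc", OF addv_zz]) (rule zz_psc)
qed

lemma zE_subset: assumes U: "ssub U" shows "zz a t ` Pol U \<subseteq> Pol U"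
  using zz_Pol[OF _ U] sub_sc[OF U] by blast

text \<open>By \<open>S4\<close> multiplication by the generic form embeds the quotient of
  \<open>U[T]\<close> in degree \<open>n\<close> into the one in degree \<open>n + 1\<close>, with
  the quotient by the form as cokernel. The factor \<open>D\<close> comes from
  \<open>rlen_Pf\<close>.\<close>

lemma hilb_step:
  assumes p: "apair sc I V U" and no: "noe V U" and mf: "monop D f" and pf: "polop TT f"
    and S4: "\<And>x. x \<in> Pol U \<Longrightarrow> zz a t x \<in> Pol (UU V U (Suc n)) \<boxplus> f ` Pol U \<Longrightarrow> x \<in> Pol (UU V U n) \<boxplus> f ` Pol U"
  shows "rlen (range (psc sc)) (Pol (UU V U (Suc n)) \<boxplus> f ` Pol U \<boxplus> zz a t ` Pol U) (Pol U) + enat D * len (UU V U n) U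
     = enat D * len (UU V U (Suc n)) U"
proof -
  note U = apairD(2)[OF p]
  let ?E = "Pol U" and ?O = "range (psc sc)"
  let ?F = "\<lambda>n. Pol (UU V U n) \<boxplus> f ` ?E" and ?Z = "zz a t ` ?E"
  note F = sub_Pf[OF mf pf U sub_UU[OF p no]] and FE = Pf_subset[OF mf pf U sub_UU[OF p no] UU_U[OF p no]]
  note E = sub_Pol'[OF smod_axioms' U] and Z = sub_zE[OF U]
  have FZ: "sub ?O (?F (Suc n) \<boxplus> ?Z)" by (rule sub_ssum'[OF F Z smod.addops_sc[OF smod_p]])
  have FFZ: "?F (Suc n) \<subseteq> ?F (Suc n) \<boxplus> ?Z" by (rule ssum_left[OF sub_0[OF Z]])
  have FZE: "?F (Suc n) \<boxplus> ?Z \<subseteq> ?E" by (rule ssum_least[OF E FE zE_subset[OF U]])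
  have "rlen ?O (?F (Suc n)) ?E = rlen ?O (?F (Suc n)) (?F (Suc n) \<boxplus> ?Z) + rlen ?O (?F (Suc n) \<boxplus> ?Z) ?E"
    by (rule rlen_add'[OF smod.addops_sc[OF smod_p] F FZ E FFZ FZE])
  moreover have "rlen ?O (?F (Suc n)) (?F (Suc n) \<boxplus> ?Z) = rlen ?O (?F n) ?E"
  proof (rule rlen_iso[where f = "zz a t", OF smod_p smod_p F E FE F FZ FFZ addv_zz zz_psc])
    show "?Z \<subseteq> ?F (Suc n) \<boxplus> ?Z" by (rule ssum_right[OF sub_0[OF F]])
    show "zz a t ` ?F n \<subseteq> ?F (Suc n)" using zz_PE[OF pf U _ zz_UU[OF p no]] by blast
    show "?F (Suc n) \<boxplus> ?Z \<subseteq> ?Z \<boxplus> ?F (Suc n)" by (simp add: ssum_commute)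
    show "x \<in> ?F n" if "x \<in> ?E" "zz a t x \<in> ?F (Suc n)" for x by (rule S4[OF that])
  qed
  moreover have "rlen ?O (?F m) ?E = enat D * len (UU V U m) U" for m
    by (rule rlen_Pf[OF mf pf U sub_UU[OF p no] UU_U[OF p no]])
  ultimately show ?thesis by (simp add: add.commute)
qed

lemma am_subset_N:
  assumes Y: "ssub Y" and NY: "\<And>s u. s \<in> N \<Longrightarrow> u \<in> X \<Longrightarrow> sc s u \<in> Y"
  shows "am a t X \<subseteq> Y"
proof
  fix y assume "y \<in> am a t X"
  then obtain u where u: "\<forall>i<t. u i \<in> X" "y = (\<Sum>i<t. sc (a i) (u i))" unfolding am_def by blast
  show "y \<in> Y" unfolding u(2) by (rule sub_sum[OF Y]) (use NY aN u(1) in simp)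
qed

lemma glmod_p: "glmod I N (psc sc) a t"
proof -
  interpret P: smod "psc sc" by (rule smod_p)
  show ?thesis by unfold_locales (use aN gens in auto)
qed

text \<open>The generic form does the work of the parameter \<open>s\<close>. Otherwise the
  colengths \<open>g n\<close> of \<open>Y (n + 1)\<close> increase strictly by Nakayama's lemma;
  since \<open>g n\<close> is the increment of \<open>D h\<close>, the function \<open>h\<close>
  would grow quadratically, against \<open>linear_growth\<close>.\<close>

lemma finite_len_step:
  assumes p: "apair sc I W U" and no: "noe W U" and mf: "monop D f" and pf: "polop TT f"
    and s: "s \<in> N" and fin: "len (W \<boxplus> sc s ` U) U \<noteq> \<infinity>"
    and S4: "\<And>n x. n \<ge> n0 \<Longrightarrow> x \<in> Pol U \<Longrightarrow> zz a t x \<in> Pol (UU W U (Suc n)) \<boxplus> f ` Pol U \<Longrightarrow> x \<in> Pol (UU W U n) \<boxplus> f ` Pol U"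
  shows "rlen (range (psc sc)) (Pol W \<boxplus> f ` Pol U \<boxplus> zz a t ` Pol U) (Pol U) \<noteq> \<infinity>"
proof (rule ccontr)
  assume inf: "\<not> rlen (range (psc sc)) (Pol W \<boxplus> f ` Pol U \<boxplus> zz a t ` Pol U) (Pol U) \<noteq> \<infinity>"
  interpret P: glmod I N "psc sc" a t by (rule glmod_p)
  note W = apairD(1)[OF p] and U = apairD(2)[OF p] and WU = apairD(3)[OF p]
  let ?E = "Pol U" and ?O = "range (psc sc)"
  let ?Z = "zz a t ` ?E"
  define Y where "Y n = Pol (UU W U n) \<boxplus> f ` ?E \<boxplus> ?Z" for n
  let ?W' = "Pol W \<boxplus> f ` ?E \<boxplus> ?Z"
  note E = sub_Pol'[OF smod_axioms' U] and Z = sub_zE[OF U]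
  note adp = smod.addops_sc[OF smod_p]
  have Y: "sub ?O (Y n)" for n unfolding Y_def
    by (rule sub_ssum'[OF sub_Pf[OF mf pf U sub_UU[OF p no]] Z adp])
  have YE: "Y n \<subseteq> ?E" for n unfolding Y_def
    by (rule ssum_least[OF E Pf_subset[OF mf pf U sub_UU[OF p no] UU_U[OF p no]] zE_subset[OF U]])
  have Yd: "Y (Suc n) \<subseteq> Y n" for n unfolding Y_def
    by (intro ssum_mono Pol_mono UU_decr[OF p no] order_refl)
  have W': "sub ?O ?W'" by (rule sub_ssum'[OF sub_Pf[OF mf pf U W] Z adp])
  have W'Y: "?W' \<subseteq> Y n" for n unfolding Y_def by (intro ssum_mono Pol_mono V_UU[OF p no] order_refl)
  have PfW': "Pol W \<boxplus> f ` ?E \<subseteq> ?W'" by (rule ssum_left[OF sub_0[OF Z]])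
  have W'E: "?W' \<subseteq> ?E" using W'Y YE by blast
  have pW': "apair (psc sc) I ?W' ?E" by (rule apair_right[OF apair_Pf[OF mf pf U p] W' PfW' W'E])
  have nW': "noeth ?O ?W' ?E" by (rule noeth_mono[OF noeth_Pf[OF mf pf U W WU no] PfW' order_refl order_refl])
  have "\<exists>k. len (UU W U n) U = enat k" for n using UU_step_fin[OF p no, of n] by simp
  then obtain h where h: "\<And>n. len (UU W U n) U = enat (h n)" by metis
  have eq: "rlen ?O (Y (Suc n)) ?E + enat (D * h n) = enat (D * h (Suc n))" if "n \<ge> n0" for n
    using hilb_step[OF p no mf pf S4[OF that]] by (simp add: Y_def h)
  have "\<exists>k. rlen ?O (Y (Suc n)) ?E = enat k" if "n \<ge> n0" for n
    using eq[OF that] by (cases "rlen ?O (Y (Suc n)) ?E") auto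
  then obtain g where g: "\<And>n. n \<ge> n0 \<Longrightarrow> rlen ?O (Y (Suc n)) ?E = enat (g n)" by metis
  have gh: "g n + D * h n = D * h (Suc n)" if "n \<ge> n0" for n using eq[OF that] g[OF that] by simp
  have lt: "g n < g (Suc n)" if n: "n \<ge> n0" for n
  proof (rule ccontr)
    assume "\<not> g n < g (Suc n)"
    have e: "rlen ?O (Y (Suc (Suc n))) ?E = rlen ?O (Y (Suc (Suc n))) (Y (Suc n)) + rlen ?O (Y (Suc n)) ?E"
      by (rule rlen_add'[OF adp Y Y E Yd YE])
    have "\<not> Y (Suc (Suc n)) \<subset> Y (Suc n)"
    proof
      assume "Y (Suc (Suc n)) \<subset> Y (Suc n)"
      then have "1 \<le> rlen ?O (Y (Suc (Suc n))) (Y (Suc n))" by (rule rlen_ge1[OF _ Y])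
      then have "1 + enat (g n) \<le> enat (g (Suc n))" using e g[of n] g[of "Suc n"] n by (simp add: add_right_mono)
      then show False using \<open>\<not> g n < g (Suc n)\<close> by (simp add: one_enat_def)
    qed
    then have YY: "Y (Suc (Suc n)) = Y (Suc n)" using Yd by blast
    \<comment> \<open>A repetition in the chain would identify \<open>Y (n + 1)\<close> with
      \<open>?W'\<close>, whose colength is infinite by assumption, whereas \<open>g n\<close> is
      finite.\<close>
    have "Y (Suc n) = ?W'"
    proof (rule P.nakayama)
      show "apair (psc sc) I ?W' (Y (Suc n))" by (rule apair_left[OF pW' Y W'Y YE])
      show "noeth ?O ?W' (Y (Suc n))" by (rule noeth_mono[OF nW' order_refl YE order_refl])
      fix X assume X: "sub ?O X" "?W' \<subseteq> X" and NX: "\<And>s u. s \<in> N \<Longrightarrow> u \<in> Y (Suc n) \<Longrightarrow> psc sc s u \<in> X"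
      have m1: "Pol (mpw a t (Suc n) U) \<subseteq> Y (Suc n)"
      proof -
        have "Pol (mpw a t (Suc n) U) \<subseteq> Pol (UU W U (Suc n))" by (rule Pol_mono[OF ssum_left[OF sub_0[OF W]]])
        also have "\<dots> \<subseteq> Pol (UU W U (Suc n)) \<boxplus> f ` ?E" by (rule ssum_left[OF sub_0[OF sub_fPol[OF mf pf U]]])
        also have "\<dots> \<subseteq> Y (Suc n)" unfolding Y_def by (rule ssum_left[OF sub_0[OF Z]])
        finally show ?thesis .
      qed
      have "Pol (mpw a t (Suc (Suc n)) U) = P.am a t (Pol (mpw a t (Suc n) U))"
        using Pmpw[OF U, of "Suc (Suc n)"] Pmpw[OF U, of "Suc n"] P.mpw_Suc by metis
      also have "\<dots> \<subseteq> X" by (rule P.am_subset_N[OF X(1)]) (use NX m1 in blast)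
      finally have 1: "Pol (mpw a t (Suc (Suc n)) U) \<subseteq> X" .
      have 2: "Pol W \<subseteq> X" "f ` ?E \<subseteq> X" "?Z \<subseteq> X"
        using X(2) PfW' ssum_left[OF sub_0[OF sub_fPol[OF mf pf U]], of "Pol W"]
          ssum_right[OF sub_0[OF sub_Pol'[OF smod_axioms' W]], of "f ` ?E"] ssum_right[OF sub_0[OF sub_Pf[OF mf pf U W]], of ?Z] by blast+
      have "Pol (UU W U (Suc (Suc n))) \<subseteq> X"
        unfolding Pol_ssum'[OF sub_mpw[OF U] W addops_sc, symmetric] by (rule ssum_least[OF X(1) 1 2(1)])
      then have "Y (Suc (Suc n)) \<subseteq> X" unfolding Y_def by (intro ssum_least[OF X(1)] 2)
      then show "Y (Suc n) \<subseteq> X" using YY by simp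
    qed
    then show False using g[OF n] inf by simp
  qed
  have gm: "g (n0 + m) \<ge> m" for m
  proof (induction m)
    case (Suc m)
    then show ?case using lt[of "n0 + m"] by simp
  qed simp
  obtain l where l: "len (W \<boxplus> sc s ` U) U = enat l" using fin by auto
  have hl: "h q \<le> q * l" for q using linear_growth[OF p s l, of q] by (simp add: h)
  \<comment> \<open>One more than the slope \<open>D l\<close> of the linear bound. The increments
    of \<open>D h\<close> eventually reach \<open>K\<close>, and after \<open>K (n0 + K) + 1\<close>
    further steps the bound is overtaken.\<close>
  define K where "K = D * l + 1"
  have "D * h (n0 + K + m) \<ge> K * m" for m
  proof (induction m)
    case (Suc m)
    have "D * h (Suc (n0 + K + m)) = g (n0 + (K + m)) + D * h (n0 + K + m)" using gh[of "n0 + K + m"] by (simp add: add.assoc)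
    moreover have "g (n0 + (K + m)) \<ge> K" using gm[of "K + m"] by simp
    ultimately show ?case using Suc by simp
  qed simp
  from this[of "K * (n0 + K) + 1"] have "K * (K * (n0 + K) + 1) \<le> D * h (n0 + K + (K * (n0 + K) + 1))" .
  also have "\<dots> \<le> D * ((n0 + K + (K * (n0 + K) + 1)) * l)" by (rule mult_le_mono2[OF hl])
  finally have "(D * l + 1) * (K * (n0 + K) + 1) \<le> D * l * (n0 + K) + D * l * (K * (n0 + K) + 1)"
    by (simp only: K_def[symmetric]) (simp only: distrib_left distrib_right mult_ac)
  then have "K * (n0 + K) + 1 \<le> D * l * (n0 + K)" by simp
  moreover have "D * l * (n0 + K) \<le> K * (n0 + K)" unfolding K_def by (rule mult_le_mono1) simp
  ultimately show False by simp
qed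

text \<open>The generic form replaces \<open>x d\<close>. It is made regular and superficial modulo
  \<open>vx sc x V U i\<close> for all \<open>i \<le> d\<close> with one polynomial
  \<open>f\<close>.\<close>

lemma step:
  assumes R: "regseq sc I N (Suc d) x V U"
  shows "\<exists>D V'. D > 0 \<and> regseq (psc sc) I N d x V' (Pol U)
    \<and> (\<exists>n0. \<forall>n\<ge>n0. hs (psc sc) a t (Suc n) V' (Pol U) + enat D * hs sc a t n V U = enat D * hs sc a t (Suc n) V U)
    \<and> hs (psc sc) a t 1 V' (Pol U) = enat D * hs sc a t 1 V U
    \<and> (\<forall>b \<phi> n. is_cpx I b \<phi> \<longrightarrow>
         bet (psc sc) b \<phi> (Suc n) V' (Pol U) \<le> enat D * bet sc b \<phi> (Suc n) V U + enat D * bet sc b \<phi> n V U)"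
proof -
  have p: "apair sc I V U" and no: "noe V U" and xN: "\<And>i. i < Suc d \<Longrightarrow> x i \<in> N"
    and reg: "\<And>i u. i < Suc d \<Longrightarrow> u \<in> U \<Longrightarrow> sc (x i) u \<in> vx sc x V U i \<Longrightarrow> u \<in> vx sc x V U i"
    and fin: "len (vx sc x V U (Suc d)) U \<noteq> \<infinity>"
    using R unfolding regseq_def by blast+
  note V = apairD(1)[OF p] and U = apairD(2)[OF p] and VU = apairD(3)[OF p]
  let ?v = "vx sc x V U" and ?E = "Pol U" and ?O = "range (psc sc)"
  have v: "ssub (?v i)" "V \<subseteq> ?v i" "?v i \<subseteq> U" for i using vx_facts[OF V U VU, of x i] by blast+
  have pi: "apair sc I (?v i) U" for i by (rule apair_right[OF p v])
  have ni: "noe (?v i) U" for i by (rule noeth_mono[OF no v(2) order_refl order_refl])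
  \<comment> \<open>An element killed by all \<open>a k\<close> is killed by \<open>x i\<close>,
    which is a combination of them modulo \<open>I\<close>.\<close>
  have soc: "u \<in> ?v i" if i: "i < Suc d" and u: "u \<in> U" and au: "\<And>k. k < t \<Longrightarrow> sc (a k) u \<in> ?v i" for i u
  proof (rule reg[OF i u])
    obtain c where c: "x i - (\<Sum>k<t. c k * a k) \<in> I" using gens[OF xN[OF i]] by blast
    have 1: "sc (x i - (\<Sum>k<t. c k * a k)) u \<in> ?v i" by (rule apairD(4)[OF pi c u])
    have "sc (\<Sum>k<t. c k * a k) u = (\<Sum>k<t. sc (c k) (sc (a k) u))" by (simp add: sc_sum_left sc_mult)
    moreover have "\<dots> \<in> ?v i" by (rule sub_sum[OF v(1)]) (rule sub_sc[OF v(1)], use au in simp)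
    ultimately have 2: "sc (\<Sum>k<t. c k * a k) u \<in> ?v i" by simp
    have "sc (x i - (\<Sum>k<t. c k * a k)) u + sc (\<Sum>k<t. c k * a k) u = sc (x i) u"
      by (simp add: sc_diff_left)
    then show "sc (x i) u \<in> ?v i" using sub_add[OF v(1) 1 2] by simp
  qed
  have "\<exists>j0. i < Suc d \<longrightarrow> (\<forall>j\<ge>j0. (\<forall>y\<in>?E. zz a t y \<in> Pol (?v i) \<boxplus> Pop TT j ` ?E \<longrightarrow> y \<in> Pol (?v i) \<boxplus> Pop TT j ` ?E)
     \<and> (\<exists>n0. \<forall>n\<ge>n0. \<forall>y\<in>?E. zz a t y \<in> Pol (UU (?v i) U (Suc n)) \<boxplus> Pop TT j ` ?E \<longrightarrow> y \<in> Pol (UU (?v i) U n) \<boxplus> Pop TT j ` ?E))" for i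
  proof (cases "i < Suc d")
    case True
    show ?thesis using superficial[OF pi ni soc[OF True]] by blast
  qed simp
  then obtain j0 where j0: "\<And>i j. i < Suc d \<Longrightarrow> j \<ge> j0 i \<Longrightarrow> (\<forall>y\<in>?E. zz a t y \<in> Pol (?v i) \<boxplus> Pop TT j ` ?E \<longrightarrow> y \<in> Pol (?v i) \<boxplus> Pop TT j ` ?E)
     \<and> (\<exists>n0. \<forall>n\<ge>n0. \<forall>y\<in>?E. zz a t y \<in> Pol (UU (?v i) U (Suc n)) \<boxplus> Pop TT j ` ?E \<longrightarrow> y \<in> Pol (UU (?v i) U n) \<boxplus> Pop TT j ` ?E)"
    by metis
  \<comment> \<open>A common upper bound for the finitely many thresholds.\<close>
  define j where "j = (\<Sum>i<Suc d. j0 i)"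
  have jge: "j0 i \<le> j" if "i < Suc d" for i unfolding j_def by (rule member_le_sum) (use that in simp_all)
  define f where "f = (Pop TT j :: (nat \<Rightarrow> 'x) \<Rightarrow> _)"
  have pf: "polop TT f" unfolding f_def by (rule polP)
  obtain D where D: "D > 0" "monop D f" unfolding f_def using mon_Pop by blast
  note mf = D(2)
  let ?Z = "zz a t ` ?E"
  define G where "G i = Pol (?v i) \<boxplus> f ` ?E" for i
  have Zreg: "y \<in> G i" if "i < Suc d" "y \<in> ?E" "zz a t y \<in> G i" for i y
    using j0[OF that(1) jge[OF that(1)]] that unfolding G_def f_def by blast
  have S4: "\<exists>n0. \<forall>n\<ge>n0. \<forall>y\<in>?E. zz a t y \<in> Pol (UU (?v i) U (Suc n)) \<boxplus> f ` ?E \<longrightarrow> y \<in> Pol (UU (?v i) U n) \<boxplus> f ` ?E"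
    if "i < Suc d" for i
    using j0[OF that jge[OF that]] unfolding f_def by blast
  have Greg: "y \<in> G i" if i: "i < Suc d" and y: "y \<in> ?E" "psc sc (x i) y \<in> G i" for i y
    unfolding G_def by (rule regular_Pf[OF mf pf U v(1,3) reg[OF i] y(1) y(2)[unfolded G_def]])
  note E = sub_Pol'[OF smod_axioms' U] and Z = sub_zE[OF U] and adp = smod.addops_sc[OF smod_p]
  have G1: "sub ?O (G i)" for i unfolding G_def by (rule sub_Pf[OF mf pf U v(1)])
  have G2: "G i \<subseteq> ?E" for i unfolding G_def by (rule Pf_subset[OF mf pf U v(1,3)])
  note G = G1 G2
  have pG: "apair (psc sc) I (G i) ?E" for i unfolding G_def by (rule apair_Pf[OF mf pf U pi])
  have ZE: "?Z \<subseteq> ?E" by (rule zE_subset[OF U])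
  let ?V' = "G 0 \<boxplus> ?Z"
  have GZ1: "sub ?O (G i \<boxplus> ?Z)" for i by (rule sub_ssum'[OF G(1) Z adp])
  have GZ2: "G i \<subseteq> G i \<boxplus> ?Z" for i by (rule ssum_left[OF sub_0[OF Z]])
  have GZ3: "?Z \<subseteq> G i \<boxplus> ?Z" for i by (rule ssum_right[OF sub_0[OF G(1)]])
  have GZ4: "G i \<boxplus> ?Z \<subseteq> ?E" for i by (rule ssum_least[OF E G(2) ZE])
  note GZ = GZ1 GZ2 GZ3 GZ4
  have pV': "apair (psc sc) I ?V' ?E" by (rule apair_right[OF pG GZ(1,2,4)])
  have nG: "noeth ?O (G 0) ?E" unfolding G_def by (rule noeth_Pf[OF mf pf U v(1,3) ni])
  have nV': "noeth ?O ?V' ?E" by (rule noeth_mono[OF nG GZ(2) order_refl order_refl])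
  have GS: "G (Suc i) = G i \<boxplus> psc sc (x i) ` ?E" for i
  proof -
    have "Pol (?v (Suc i)) = Pol (?v i) \<boxplus> psc sc (x i) ` ?E"
      unfolding vx.simps Pol_scimage[OF sub_0[OF U]] by (rule Pol_ssum'[OF v(1) sub_scimage[OF U] addops_sc, symmetric])
    then show ?thesis unfolding G_def by (simp only: ssum_ac)
  qed
  have vxG: "vx (psc sc) x ?V' ?E i = G i \<boxplus> ?Z" for i
  proof (induction i)
    case (Suc i)
    show ?case unfolding vx.simps(2) Suc GS by (simp only: ssum_ac)
  qed simp
  \<comment> \<open>Exchange of regular elements: from \<open>x i y = g + z w\<close> regularity of
    \<open>z\<close> modulo \<open>G (i + 1)\<close> gives \<open>w = g' + x i w'\<close>, and
    regularity of \<open>x i\<close> modulo \<open>G i\<close> then applies to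
    \<open>y - z w'\<close>.\<close>
  have r1: "y \<in> G i \<boxplus> ?Z" if i: "i < d" and y: "y \<in> ?E" "psc sc (x i) y \<in> G i \<boxplus> ?Z" for i y
  proof -
    obtain g w where gw: "g \<in> G i" "w \<in> ?E" "psc sc (x i) y = g + zz a t w" using y(2) by (auto elim!: ssumE)
    have "psc sc (x i) y \<in> G (Suc i)" unfolding GS by (rule subsetD[OF ssum_right[OF sub_0[OF G(1)]]]) (rule imageI[OF y(1)])
    moreover have "g \<in> G (Suc i)" unfolding GS
      by (rule subsetD[OF ssum_left gw(1)]) (rule sub_0[OF smod.sub_scimage[OF smod_p E]])
    moreover have "zz a t w = psc sc (x i) y - g" using gw(3) by (simp only: add_diff_cancel_left')
    ultimately have zwG: "zz a t w \<in> G (Suc i)" using sub_diff[OF G(1)] by (simp only:)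
    have "w \<in> G (Suc i)" by (rule Zreg[OF _ gw(2) zwG]) (use i in simp)
    then obtain g' w' where gw': "g' \<in> G i" "w' \<in> ?E" "w = g' + psc sc (x i) w'" unfolding GS by (auto elim!: ssumE)
    have zw: "zz a t w = zz a t g' + psc sc (x i) (zz a t w')" unfolding gw'(3) addv_add[OF addv_zz] zz_psc ..
    have zg: "zz a t g' \<in> G i" unfolding G_def
      by (rule zz_PE[OF pf U gw'(1)[unfolded G_def]]) (rule zz_Pol[OF sub_sc[OF v(1)] v(1)])
    have zw': "zz a t w' \<in> ?E" using ZE gw'(2) by blast
    have "psc sc (x i) (y - zz a t w') = g + zz a t g'"
      unfolding smod.sc_diff[OF smod_p] gw(3) zw by (simp only: add_diff_cancel_right' add.assoc[symmetric])
    then have yG: "psc sc (x i) (y - zz a t w') \<in> G i" using sub_add[OF G(1) gw(1) zg] by (simp only:)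
    have "y - zz a t w' \<in> G i" by (rule Greg[OF _ sub_diff[OF E y(1) zw'] yG]) (use i in simp)
    then have "(y - zz a t w') + zz a t w' \<in> G i \<boxplus> ?Z" by (rule ssumI) (rule imageI[OF gw'(2)])
    then show ?thesis by (simp only: diff_add_cancel)
  qed
  \<comment> \<open>Modulo the first \<open>d\<close> elements, \<open>x d\<close> is a parameter
    with quotient of finite length, which the generic form can replace.\<close>
  have fin': "rlen ?O (G d \<boxplus> ?Z) ?E \<noteq> \<infinity>"
  proof -
    obtain n0 where n0: "\<And>n y. n \<ge> n0 \<Longrightarrow> y \<in> ?E \<Longrightarrow> zz a t y \<in> Pol (UU (?v d) U (Suc n)) \<boxplus> f ` ?E \<Longrightarrow> y \<in> Pol (UU (?v d) U n) \<boxplus> f ` ?E"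
      using S4[of d] by blast
    show ?thesis unfolding G_def
      by (rule finite_len_step[OF pi ni mf pf xN _ n0]) (use fin in simp_all)
  qed
  have R': "regseq (psc sc) I N d x ?V' ?E"
    unfolding regseq_def vxG using pV' nV' xN r1 fin' by simp
  have mp: "smod.mpw (psc sc) a t n ?E \<boxplus> ?V' = Pol (UU V U n) \<boxplus> f ` ?E \<boxplus> ?Z" for n
    unfolding Pmpw[OF U] G_def Pol_ssum'[OF sub_mpw[OF U] V addops_sc, symmetric] by (simp only: vx.simps ssum_ac)
  obtain n0 where n0: "\<And>n y. n \<ge> n0 \<Longrightarrow> y \<in> ?E \<Longrightarrow> zz a t y \<in> Pol (UU V U (Suc n)) \<boxplus> f ` ?E \<Longrightarrow> y \<in> Pol (UU V U n) \<boxplus> f ` ?E"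
    using S4[of 0] by auto
  have H1: "\<forall>n\<ge>n0. hs (psc sc) a t (Suc n) ?V' ?E + enat D * hs sc a t n V U = enat D * hs sc a t (Suc n) V U"
  proof (intro allI impI)
    fix n assume "n0 \<le> n"
    then show "hs (psc sc) a t (Suc n) ?V' ?E + enat D * hs sc a t n V U = enat D * hs sc a t (Suc n) V U"
      unfolding hs_def mp by (intro hilb_step[OF p no mf pf n0])
  qed
  \<comment> \<open>The form has coefficients in \<open>m\<close>, so dividing by it leaves the
    quotient by \<open>m\<close> unchanged; only the factor \<open>D\<close> remains.\<close>
  have H2: "hs (psc sc) a t 1 ?V' ?E = enat D * hs sc a t 1 V U"
  proof -
    have Z1: "?Z \<subseteq> Pol (UU V U 1) \<boxplus> f ` ?E"
    proof
      fix y assume "y \<in> ?Z"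
      then obtain w where w: "w \<in> ?E" "y = zz a t w" by blast
      have "w \<in> Pol (UU V U 0)" using w(1) unfolding UU_0[OF p no] .
      then have "y \<in> Pol (UU V U 1)" unfolding w(2) One_nat_def by (rule zz_UU[OF p no])
      then show "y \<in> Pol (UU V U 1) \<boxplus> f ` ?E" by (rule subsetD[OF ssum_left[OF sub_0[OF sub_fPol[OF mf pf U]]]])
    qed
    have "Pol (UU V U 1) \<boxplus> f ` ?E \<boxplus> ?Z = Pol (UU V U 1) \<boxplus> f ` ?E"
      unfolding ssum_commute[of _ ?Z] by (rule ssum_absorb[OF sub_Pf[OF mf pf U sub_UU[OF p no]] Z1 sub_0[OF Z]])
    then show ?thesis unfolding hs_def mp
      using rlen_Pf[OF mf pf U sub_UU[OF p no] UU_U[OF p no], of 1] by (simp only:)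
  qed
  \<comment> \<open>By regularity the kernel \<open>V'/G 0\<close> of the quotient map is a copy of
    the whole module, so the long exact sequence involves no third set of Betti numbers.\<close>
  have H3: "bet (psc sc) b \<phi> (Suc n) ?V' ?E \<le> enat D * bet sc b \<phi> (Suc n) V U + enat D * bet sc b \<phi> n V U"
    if c: "is_cpx I b \<phi>" for b \<phi> n
  proof -
    have le: "bet (psc sc) b \<phi> m (G 0) ?E \<le> enat D * bet sc b \<phi> m V U" for m
      using bet_Pf[OF mf pf U c p] unfolding G_def vx.simps .
    have "bet (psc sc) b \<phi> (Suc n) ?V' ?E \<le> bet (psc sc) b \<phi> (Suc n) (G 0) ?E + bet (psc sc) b \<phi> n (G 0) ?V'"
      by (rule smod.bet_quot[OF smod_p c pG GZ(1,2,4)])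
    moreover have "bet (psc sc) b \<phi> n (G 0) ?V' = bet (psc sc) b \<phi> n (G 0) ?E"
    proof (rule bet_iso[where f = "zz a t", OF smod_p smod_p c pG apair_left[OF pG GZ(1,2,4)] addv_zz zz_psc GZ(3)])
      show "zz a t ` G 0 \<subseteq> G 0"
      proof
        fix y assume "y \<in> zz a t ` G 0"
        then obtain g where g: "g \<in> G 0" "y = zz a t g" by blast
        show "y \<in> G 0" unfolding G_def g(2)
          by (rule zz_PE[OF pf U g(1)[unfolded G_def]]) (rule zz_Pol[OF sub_sc[OF v(1)] v(1)])
      qed
      show "?V' \<subseteq> ?Z \<boxplus> G 0" by (simp only: ssum_commute[of "G 0"] order_refl)
      show "y \<in> G 0" if "y \<in> ?E" "zz a t y \<in> G 0" for y by (rule Zreg[OF _ that]) simp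
    qed
    ultimately show ?thesis using add_mono[OF le le] by (simp only:) (rule order_trans)
  qed
  show ?thesis
  proof (intro exI conjI)
    show "D > 0" by (rule D(1))
    show "regseq (psc sc) I N d x ?V' ?E" by (rule R')
    show "\<forall>n\<ge>n0. hs (psc sc) a t (Suc n) ?V' ?E + enat D * hs sc a t n V U = enat D * hs sc a t (Suc n) V U" by (rule H1)
    show "hs (psc sc) a t 1 ?V' ?E = enat D * hs sc a t 1 V U" by (rule H2)
    show "\<forall>b \<phi> n. is_cpx I b \<phi> \<longrightarrow>
         bet (psc sc) b \<phi> (Suc n) ?V' ?E \<le> enat D * bet sc b \<phi> (Suc n) V U + enat D * bet sc b \<phi> n V U"
      using H3 by blast
  qed
qed

end

subsection \<open>Polynomial growth\<close>

abbreviation pwr :: "nat \<Rightarrow> nat \<Rightarrow> real" where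
  "pwr m n \<equiv> real n powi (int m - 1)"

text \<open>For \<open>m = 0\<close> the exponent is -1, and a sequence of natural numbers below
  \<open>C / n\<close> is eventually zero; this is the case of finite projective dimension.\<close>

definition grow :: "nat \<Rightarrow> (nat \<Rightarrow> enat) \<Rightarrow> bool" where
  "grow m f \<longleftrightarrow> (\<exists>C n1. \<forall>n\<ge>n1. \<exists>k. f n = enat k \<and> real k \<le> C * pwr m n)"

lemma growI: "(\<And>n. n \<ge> n1 \<Longrightarrow> \<exists>k. f n = enat k \<and> real k \<le> C * pwr m n) \<Longrightarrow> grow m f"
  unfolding grow_def by blast

lemma growE:
  assumes "grow m f"
  obtains C n1 g where "C \<ge> 0" "\<And>n. n \<ge> n1 \<Longrightarrow> f n = enat (g n)" "\<And>n. n \<ge> n1 \<Longrightarrow> real (g n) \<le> C * pwr m n"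
proof -
  obtain C n1 where "\<forall>n\<ge>n1. \<exists>k. f n = enat k \<and> real k \<le> C * pwr m n"
    using assms unfolding grow_def by blast
  then obtain g where g: "\<And>n. n \<ge> n1 \<Longrightarrow> f n = enat (g n) \<and> real (g n) \<le> C * pwr m n" by metis
  show ?thesis
  proof (rule that[of "\<bar>C\<bar>" n1 g])
    fix n assume n: "n \<ge> n1"
    have "C * pwr m n \<le> \<bar>C\<bar> * pwr m n"
      by (rule mult_right_mono) simp_all
    then show "real (g n) \<le> \<bar>C\<bar> * pwr m n" using g[OF n] by linarith
  qed (use g in auto)
qed

lemma grow_mono:
  assumes "grow m g" "\<And>n. n \<ge> n0 \<Longrightarrow> f n \<le> g n" shows "grow m f"
proof -
  obtain C n1 h where h: "C \<ge> 0" "\<And>n. n \<ge> n1 \<Longrightarrow> g n = enat (h n)" "\<And>n. n \<ge> n1 \<Longrightarrow> real (h n) \<le> C * pwr m n"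
    using growE[OF assms(1)] by metis
  show ?thesis
  proof (rule growI[of "max n0 n1"])
    fix n assume n: "n \<ge> max n0 n1"
    then have "f n \<le> enat (h n)" using assms(2)[of n] h(2)[of n] by simp
    then obtain k where k: "f n = enat k" "k \<le> h n" by (cases "f n") auto
    then show "\<exists>k. f n = enat k \<and> real k \<le> C * pwr m n" using h(3)[of n] n by fastforce
  qed
qed

lemma grow_add:
  assumes "grow m f" "grow m g" shows "grow m (\<lambda>n. f n + g n)"
proof -
  obtain C n1 h where h: "C \<ge> 0" "\<And>n. n \<ge> n1 \<Longrightarrow> f n = enat (h n)" "\<And>n. n \<ge> n1 \<Longrightarrow> real (h n) \<le> C * pwr m n"
    using growE[OF assms(1)] by metis
  obtain C' n1' h' where h': "C' \<ge> 0" "\<And>n. n \<ge> n1' \<Longrightarrow> g n = enat (h' n)" "\<And>n. n \<ge> n1' \<Longrightarrow> real (h' n) \<le> C' * pwr m n"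
    using growE[OF assms(2)] by metis
  show ?thesis
  proof (rule growI[of "max n1 n1'"])
    fix n assume n: "n \<ge> max n1 n1'"
    show "\<exists>k. f n + g n = enat k \<and> real k \<le> (C + C') * pwr m n"
      using h(2,3)[of n] h'(2,3)[of n] n by (intro exI[of _ "h n + h' n"]) (simp add: distrib_right)
  qed
qed

lemma grow_cmult:
  assumes "grow m f" shows "grow m (\<lambda>n. enat D * f n)"
proof -
  obtain C n1 h where h: "C \<ge> 0" "\<And>n. n \<ge> n1 \<Longrightarrow> f n = enat (h n)" "\<And>n. n \<ge> n1 \<Longrightarrow> real (h n) \<le> C * pwr m n"
    using growE[OF assms(1)] by metis
  show ?thesis
  proof (rule growI[of n1])
    fix n assume n: "n \<ge> n1"
    have "real D * real (h n) \<le> real D * (C * pwr m n)" by (rule mult_left_mono[OF h(3)[OF n]]) simp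
    then show "\<exists>k. enat D * f n = enat k \<and> real k \<le> (real D * C) * pwr m n"
      using h(2)[OF n] by (intro exI[of _ "D * h n"]) simp
  qed
qed

lemma powi_ratio:
  assumes n: "n \<ge> 1"
  shows "pwr m n * real n \<le> pwr m (Suc n) * real (Suc n)"
    and "pwr m n * real n \<le> real (Suc n) * pwr m (Suc n)"
    and "real n * pwr m n \<le> real (Suc n) * pwr m (Suc n)"
proof -
  have e: "pwr m k * real k = real k ^ m" if "k \<ge> 1" for k
    using that power_int_add[of "real k" "int m - 1" 1] by simp
  show "pwr m n * real n \<le> pwr m (Suc n) * real (Suc n)"
    unfolding e[OF n] using e[of "Suc n"] by (simp add: power_mono)
  then show "pwr m n * real n \<le> real (Suc n) * pwr m (Suc n)"
    "real n * pwr m n \<le> real (Suc n) * pwr m (Suc n)"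
    by (simp_all only: mult.commute)
qed

text \<open>Limits how fast the comparison function can drop in one step; for \<open>m = 0\<close>,
  where it decreases, this is an equality.\<close>

lemma powi_Suc:
  assumes n: "n \<ge> 1" shows "pwr m n \<le> (1 + 1 / real n) * pwr m (Suc n)"
proof -
  have "pwr m n = (real n * pwr m n) / real n" using n by simp
  also have "\<dots> \<le> (real (Suc n) * pwr m (Suc n)) / real n"
    using powi_ratio(3)[OF n] by (rule divide_right_mono) simp
  also have "\<dots> = (1 + 1 / real n) * pwr m (Suc n)" using n by (simp add: field_simps)
  finally show ?thesis .
qed

lemma grow_Suc:
  assumes "grow m f" "\<And>n. g (Suc n) \<le> f n" shows "grow m g"
proof -
  obtain C n1 h where h: "C \<ge> 0" "\<And>n. n \<ge> n1 \<Longrightarrow> f n = enat (h n)" "\<And>n. n \<ge> n1 \<Longrightarrow> real (h n) \<le> C * pwr m n"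
    using growE[OF assms(1)] by metis
  show ?thesis
  proof (rule growI[of "Suc (Suc n1)"])
    fix n assume n: "n \<ge> Suc (Suc n1)"
    then obtain l where l: "n = Suc l" "l \<ge> n1" "l \<ge> 1" by (cases n) auto
    have "g n \<le> enat (h l)" using assms(2)[of l] h(2)[OF l(2)] l by simp
    then obtain k where k: "g n = enat k" "k \<le> h l" by (cases "g n") auto
    have "1 + 1 / real l \<le> 2" using l(3) by simp
    then have "(1 + 1 / real l) * pwr m n \<le> 2 * pwr m n"
      by (rule mult_right_mono) simp
    moreover have "pwr m l \<le> (1 + 1 / real l) * pwr m n" unfolding l(1) by (rule powi_Suc[OF l(3)])
    ultimately have "pwr m l \<le> 2 * pwr m n" by linarith
    then have "C * pwr m l \<le> C * (2 * pwr m n)" by (rule mult_left_mono[OF _ h(1)])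
    moreover have "real k \<le> real (h l)" using k(2) by simp
    ultimately have "real k \<le> (2 * C) * pwr m n" using h(3)[OF l(2)] by (simp add: mult.assoc mult.left_commute)
    then show "\<exists>k. g n = enat k \<and> real k \<le> (2 * C) * pwr m n" using k(1) by blast
  qed
qed

text \<open>The recursion contracts with ratio \<open>\<nu>/\<mu> < 1\<close>, so the inhomogeneous term dominates.\<close>

lemma grow_rec:
  fixes B :: "nat \<Rightarrow> nat"
  assumes c: "grow m c" and lt: "\<nu> < \<mu>" and rec: "\<And>n. enat (\<mu> * B (Suc n)) \<le> c (Suc n) + enat (\<nu> * B n)"
  shows "grow m (\<lambda>n. enat (B n))"
proof -
  obtain C n1 h where h: "C \<ge> 0" "\<And>n. n \<ge> n1 \<Longrightarrow> c n = enat (h n)" "\<And>n. n \<ge> n1 \<Longrightarrow> real (h n) \<le> C * pwr m n"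
    using growE[OF c] by metis
  define w where "w n = pwr m n" for n :: nat
  \<comment> \<open>\<open>\<rho>\<close> is the contraction ratio; the midpoint
    \<open>\<sigma>\<close> between it and 1 leaves room for the factor \<open>1 + 1/n\<close> of
    \<open>powi_Suc\<close>.\<close>
  define \<rho> where "\<rho> = real \<nu> / real \<mu>"
  define \<sigma> where "\<sigma> = (1 + \<rho>) / 2"
  have \<rho>: "0 \<le> \<rho>" "\<rho> < 1" using lt by (auto simp: \<rho>_def)
  have \<sigma>: "\<rho> < \<sigma>" "\<sigma> < 1" using \<rho> by (auto simp: \<sigma>_def)
  obtain n2 :: nat where n2: "real n2 > 1 / (\<sigma> - \<rho>)" using reals_Archimedean2 by blast
  define n3 where "n3 = max n1 (max n2 1)"
  have wpos: "w n > 0" if "n \<ge> 1" for n unfolding w_def using that by (intro zero_less_power_int) simp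
  have \<rho>w: "\<rho> * w n \<le> \<sigma> * w (Suc n)" if n: "n \<ge> n3" for n
  proof -
    have n1: "n \<ge> 1" "n \<ge> n2" using n by (auto simp: n3_def)
    have "1 / real n < \<sigma> - \<rho>"
    proof -
      have "1 / (\<sigma> - \<rho>) < real n" using n2 n1(2) by linarith
      then show ?thesis using \<sigma> n1 by (simp add: field_simps)
    qed
    then have "\<rho> * (1 + 1 / real n) \<le> \<sigma>" using \<rho> mult_left_le_one_le[of "1 / real n" \<rho>] by (simp add: algebra_simps)
    then have "\<rho> * (1 + 1 / real n) * w (Suc n) \<le> \<sigma> * w (Suc n)" by (rule mult_right_mono) (use wpos[of "Suc n"] in simp)
    moreover have "\<rho> * w n \<le> \<rho> * ((1 + 1 / real n) * w (Suc n))"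
      using powi_Suc[OF n1(1), of m] \<rho>(1) unfolding w_def by (intro mult_left_mono)
    ultimately show ?thesis by (simp add: mult.assoc)
  qed
  have step: "real (B (Suc n)) \<le> C * w (Suc n) + \<rho> * real (B n)" if n: "n \<ge> n3" for n
  proof -
    have n1: "Suc n \<ge> n1" using n by (simp add: n3_def)
    have "\<mu> * B (Suc n) \<le> h (Suc n) + \<nu> * B n" using rec[of n] h(2)[OF n1] by simp
    then have "real \<mu> * real (B (Suc n)) \<le> real (h (Suc n)) + real \<nu> * real (B n)"
      by (metis of_nat_add of_nat_le_iff of_nat_mult)
    then have "real \<mu> * real (B (Suc n)) \<le> C * w (Suc n) + real \<nu> * real (B n)" using h(3)[OF n1] by (simp add: w_def)
    then have "real (B (Suc n)) \<le> (C * w (Suc n) + real \<nu> * real (B n)) / real \<mu>" using lt by (simp add: field_simps)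
    also have "\<dots> = C * w (Suc n) / real \<mu> + \<rho> * real (B n)" by (simp add: \<rho>_def add_divide_distrib)
    also have "C * w (Suc n) / real \<mu> \<le> C * w (Suc n)"
    proof -
      have "0 \<le> C * w (Suc n)" using h(1) wpos[of "Suc n"] by simp
      moreover have "1 \<le> real \<mu>" using lt by simp
      ultimately show ?thesis by (simp add: divide_le_eq mult_le_cancel_left1)
    qed
    finally show ?thesis by simp
  qed
  \<comment> \<open>The first entry makes the bound reproduce itself under the recursion, the second
    starts the induction at \<open>n3\<close>.\<close>
  define C' where "C' = max (C / (1 - \<sigma>)) (real (B n3) / w n3)"
  have C': "C \<le> (1 - \<sigma>) * C'"
  proof -
    have "C / (1 - \<sigma>) \<le> C'" by (simp add: C'_def)
    then show ?thesis using \<sigma> by (simp add: field_simps)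
  qed
  have C'0: "C' \<ge> 0" using h(1) \<sigma> unfolding C'_def by (simp add: le_max_iff_disj)
  have n31: "n3 \<ge> 1" by (simp add: n3_def)
  have main: "real (B n) \<le> C' * w n" if "n \<ge> n3" for n
    using that
  proof (induction n rule: dec_induct)
    case base
    have "real (B n3) / w n3 \<le> C'" by (simp add: C'_def)
    then show ?case using wpos[OF n31] by (simp add: field_simps)
  next
    case (step n)
    have "real (B (Suc n)) \<le> C * w (Suc n) + \<rho> * real (B n)" by (rule \<open>\<And>n. n3 \<le> n \<Longrightarrow> real (B (Suc n)) \<le> C * w (Suc n) + \<rho> * real (B n)\<close>[OF step.hyps(1)])
    also have "\<rho> * real (B n) \<le> \<rho> * (C' * w n)" using step.IH \<rho>(1) by (intro mult_left_mono)
    also have "\<rho> * (C' * w n) = C' * (\<rho> * w n)" by simp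
    also have "\<dots> \<le> C' * (\<sigma> * w (Suc n))" using \<rho>w[OF step.hyps(1)] C'0 by (intro mult_left_mono)
    also have "C * w (Suc n) \<le> (1 - \<sigma>) * C' * w (Suc n)" using C' wpos[of "Suc n"] by (intro mult_right_mono) simp_all
    finally have "real (B (Suc n)) \<le> (1 - \<sigma>) * C' * w (Suc n) + C' * (\<sigma> * w (Suc n))" by simp
    then show ?case by (simp add: algebra_simps)
  qed
  show ?thesis by (rule growI[of n3]) (use main in \<open>auto simp: w_def\<close>)
qed

subsection \<open>Summing Hilbert functions\<close>

text \<open>With \<open>diff_pow_upper\<close> this pins the increment of \<open>n^(d+1)\<close>
  between \<open>(d+1) n^d\<close> and \<open>(d+1) (n+1)^d\<close>.\<close>

lemma diff_pow_lower: "real n ^ Suc d + (real d + 1) * real n ^ d \<le> (real n + 1) ^ Suc d"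
proof (induction d)
  case (Suc d)
  have "real n ^ Suc (Suc d) + (real (Suc d) + 1) * real n ^ Suc d
      \<le> (real n + 1) * (real n ^ Suc d + (real d + 1) * real n ^ d)" by (simp add: algebra_simps)
  also have "\<dots> \<le> (real n + 1) * (real n + 1) ^ Suc d" by (rule mult_left_mono[OF Suc]) simp
  finally show ?case by simp
qed simp

lemma diff_pow_upper: "(real n + 1) ^ Suc d - (real d + 1) * (real n + 1) ^ d \<le> real n ^ Suc d"
proof (induction d)
  case (Suc d)
  have "(real n + 1) ^ Suc (Suc d) - (real (Suc d) + 1) * (real n + 1) ^ Suc d
      \<le> real n * ((real n + 1) ^ Suc d - (real d + 1) * (real n + 1) ^ d)"
  proof -
    define y where "y = (real n + 1) ^ d"
    have "y \<ge> 0" by (simp add: y_def)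
    then have "(real d + 1) * y \<ge> 0" by simp
    then show ?thesis by (simp add: y_def[symmetric] algebra_simps)
  qed
  also have "\<dots> \<le> real n * real n ^ Suc d" by (rule mult_left_mono[OF Suc]) simp
  finally show ?case by simp
qed simp

text \<open>A Cesaro argument: \<open>n\<close> increments of size at most \<open>r/2\<close> times
  \<open>n^d\<close> sum to at most \<open>r/2\<close> times \<open>n^(d+1)\<close>, and the initial
  value is negligible.\<close>

lemma small_increments:
  fixes u :: "nat \<Rightarrow> real"
  assumes "(\<lambda>n. (u (Suc n) - u n) / (real n + 1) ^ d) \<longlonglongrightarrow> 0"
  shows "(\<lambda>n. u n / real n ^ Suc d) \<longlonglongrightarrow> 0"
proof (rule LIMSEQ_I)
  fix r :: real assume r: "0 < r"
  from LIMSEQ_D[OF assms, of "r / 2"] r obtain n1 where n1: "\<And>n. n \<ge> n1 \<Longrightarrow> \<bar>(u (Suc n) - u n) / (real n + 1) ^ d\<bar> < r / 2" by auto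
  have inc: "\<bar>u (Suc n) - u n\<bar> \<le> r / 2 * (real n + 1) ^ d" if "n \<ge> n1" for n
    using n1[OF that] by (simp add: field_simps abs_divide)
  have bound: "\<bar>u n\<bar> \<le> \<bar>u n1\<bar> + r / 2 * real n * real n ^ d" if "n \<ge> n1" for n
    using that
  proof (induction n rule: dec_induct)
    case base
    then show ?case using r by simp
  next
    case (step n)
    have "\<bar>u (Suc n)\<bar> \<le> \<bar>u n\<bar> + \<bar>u (Suc n) - u n\<bar>" by linarith
    also have "\<dots> \<le> \<bar>u n1\<bar> + r / 2 * real n * real n ^ d + r / 2 * (real n + 1) ^ d" using step inc by (simp add: add_mono)
    also have "r / 2 * real n * real n ^ d \<le> r / 2 * real n * (real n + 1) ^ d"
      using r by (intro mult_left_mono power_mono) simp_all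
    finally show ?case by (simp add: algebra_simps add_divide_distrib)
  qed
  obtain n2 :: nat where n2: "real n2 > 2 * \<bar>u n1\<bar> / r" using reals_Archimedean2 by blast
  have "norm (u n / real n ^ Suc d - 0) < r" if n: "n \<ge> max n1 (max n2 1)" for n
  proof -
    have np: "real n ^ d \<ge> 1" "real n \<ge> 1" using n by (auto intro: one_le_power)
    have "2 * \<bar>u n1\<bar> / r < real n" using n2 n by (smt (verit) max.bounded_iff of_nat_mono)
    then have "\<bar>u n1\<bar> < r / 2 * real n" using r by (simp add: field_simps)
    also have "\<dots> \<le> r / 2 * real n * real n ^ d" using mult_left_mono[OF np(1), of "r / 2 * real n"] r by simp
    finally have "\<bar>u n\<bar> < r * (real n * real n ^ d)" using bound[of n] n by simp
    then show ?thesis using np by (simp add: abs_divide divide_less_eq)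
  qed
  then show "\<exists>no. \<forall>n\<ge>no. norm (u n / real n ^ Suc d - 0) < r" by blast
qed

text \<open>The increments of \<open>D h\<close> are the values of \<open>h'\<close>, whose leading
  behaviour is \<open>e n^d / d!\<close>. The auxiliary \<open>u\<close> subtracts the expected main
  term, so its increments are of smaller order and \<open>small_increments\<close> applies.\<close>

lemma hilbert_sum:
  fixes h h' :: "nat \<Rightarrow> real"
  assumes D: "D > 0" and rec: "\<And>n. n \<ge> n0 \<Longrightarrow> h' (Suc n) + D * h n = D * h (Suc n)"
    and lim: "(\<lambda>n. fact d * h' n / real n ^ d) \<longlonglongrightarrow> e"
  shows "(\<lambda>n. fact (Suc d) * h n / real n ^ Suc d) \<longlonglongrightarrow> e / D"
proof -
  define u where "u n = fact (Suc d) * D * h n - e * real n ^ Suc d" for n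
  have lim1: "(\<lambda>n. fact d * h' (Suc n) / (real n + 1) ^ d) \<longlonglongrightarrow> e"
    using LIMSEQ_Suc[OF lim] by (simp add: add.commute)
  define v where "v n = ((real n + 1) ^ Suc d - real n ^ Suc d) / (real n + 1) ^ d" for n :: nat
  have "(\<lambda>n. real n / real (Suc n)) \<longlonglongrightarrow> 1" by (rule LIMSEQ_n_over_Suc_n)
  then have "(\<lambda>n. (real d + 1) * (real n / real (Suc n)) ^ d) \<longlonglongrightarrow> (real d + 1) * 1 ^ d"
    by (intro tendsto_mult tendsto_const tendsto_power)
  then have lo: "(\<lambda>n. (real d + 1) * (real n / real (Suc n)) ^ d) \<longlonglongrightarrow> real d + 1" by simp
  have v: "v \<longlonglongrightarrow> real d + 1"
  proof (rule tendsto_sandwich[OF _ _ lo tendsto_const])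
    show "\<forall>\<^sub>F n in sequentially. (real d + 1) * (real n / real (Suc n)) ^ d \<le> v n"
    proof (rule always_eventually, rule allI)
      fix n
      have "(real d + 1) * real n ^ d \<le> (real n + 1) ^ Suc d - real n ^ Suc d" using diff_pow_lower[of n d] by simp
      then have "(real d + 1) * real n ^ d / (real n + 1) ^ d \<le> v n" unfolding v_def by (rule divide_right_mono) simp
      then show "(real d + 1) * (real n / real (Suc n)) ^ d \<le> v n" by (simp add: power_divide add.commute)
    qed
    show "\<forall>\<^sub>F n in sequentially. v n \<le> real d + 1"
    proof (rule always_eventually, rule allI)
      fix n
      have "(real n + 1) ^ Suc d - real n ^ Suc d \<le> (real d + 1) * (real n + 1) ^ d" using diff_pow_upper[of n d] by simp
      then show "v n \<le> real d + 1" unfolding v_def by (simp add: divide_le_eq)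
    qed
  qed
  have "(\<lambda>n. (real d + 1) * (fact d * h' (Suc n) / (real n + 1) ^ d) - e * v n) \<longlonglongrightarrow> (real d + 1) * e - e * (real d + 1)"
    by (intro tendsto_intros lim1 v)
  then have "(\<lambda>n. (real d + 1) * (fact d * h' (Suc n) / (real n + 1) ^ d) - e * v n) \<longlonglongrightarrow> 0" by (simp add: mult.commute)
  moreover have "\<forall>\<^sub>F n in sequentially. (real d + 1) * (fact d * h' (Suc n) / (real n + 1) ^ d) - e * v n = (u (Suc n) - u n) / (real n + 1) ^ d"
    unfolding eventually_sequentially
  proof (intro exI allI impI)
    fix n assume "n0 \<le> n"
    then have rc: "D * h (Suc n) = h' (Suc n) + D * h n" using rec[of n] by simp
    have sn: "real (Suc n) = real n + 1" by simp
    have "u (Suc n) - u n = fact (Suc d) * h' (Suc n) - e * ((real n + 1) ^ Suc d - real n ^ Suc d)"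
      unfolding u_def sn mult.assoc[of "fact (Suc d)"] rc right_diff_distrib distrib_left[of "fact (Suc d)"] by linarith
    then show "(real d + 1) * (fact d * h' (Suc n) / (real n + 1) ^ d) - e * v n = (u (Suc n) - u n) / (real n + 1) ^ d"
      unfolding v_def by (simp add: diff_divide_distrib right_diff_distrib mult.assoc add.commute del: power_Suc)
  qed
  ultimately have "(\<lambda>n. (u (Suc n) - u n) / (real n + 1) ^ d) \<longlonglongrightarrow> 0" by (rule Lim_transform_eventually)
  then have "(\<lambda>n. u n / real n ^ Suc d) \<longlonglongrightarrow> 0" by (rule small_increments)
  then have "(\<lambda>n. (u n / real n ^ Suc d + e) / D) \<longlonglongrightarrow> (0 + e) / D" using D by (intro tendsto_intros) simp_all
  moreover have "\<forall>\<^sub>F n in sequentially. (u n / real n ^ Suc d + e) / D = fact (Suc d) * h n / real n ^ Suc d"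
    unfolding eventually_sequentially
  proof (intro exI[of _ 1] allI impI)
    fix n :: nat assume "1 \<le> n"
    then have "real n ^ Suc d \<noteq> 0" by simp
    then show "(u n / real n ^ Suc d + e) / D = fact (Suc d) * h n / real n ^ Suc d"
      using D unfolding u_def by (simp add: diff_divide_distrib del: power_Suc fact_Suc)
  qed
  ultimately have "(\<lambda>n. fact (Suc d) * h n / real n ^ Suc d) \<longlonglongrightarrow> (0 + e) / D" by (rule Lim_transform_eventually)
  then show ?thesis by simp
qed

subsection \<open>Transport along an isomorphism\<close>

lemma image_ssum: "addv f \<Longrightarrow> f ` (A \<boxplus> B) = f ` A \<boxplus> f ` B"
proof
  assume f: "addv f"
  show "f ` (A \<boxplus> B) \<subseteq> f ` A \<boxplus> f ` B"
  proof
    fix y assume "y \<in> f ` (A \<boxplus> B)"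
    then obtain x where x: "x \<in> A \<boxplus> B" "y = f x" by (rule imageE)
    then obtain u v where "u \<in> A" "v \<in> B" "x = u + v" by (auto elim!: ssumE)
    then show "y \<in> f ` A \<boxplus> f ` B" unfolding x(2) by (simp only: addv_add[OF f]) (intro ssumI imageI)
  qed
  show "f ` A \<boxplus> f ` B \<subseteq> f ` (A \<boxplus> B)"
  proof
    fix y assume "y \<in> f ` A \<boxplus> f ` B"
    then obtain p q where pq: "p \<in> f ` A" "q \<in> f ` B" "y = p + q" by (rule ssumE)
    then obtain u v where uv: "u \<in> A" "p = f u" "v \<in> B" "q = f v" by blast
    have "y = f (u + v)" unfolding pq(3) uv addv_add[OF f] ..
    moreover have "f (u + v) \<in> f ` (A \<boxplus> B)" by (rule imageI[OF ssumI[OF uv(1,3)]])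
    ultimately show "y \<in> f ` (A \<boxplus> B)" by (simp only:)
  qed
qed

locale transport = A: smod sc + B: smod sc'
  for sc :: "'s::comm_ring_1 \<Rightarrow> 'y::ab_group_add \<Rightarrow> 'y" and sc' :: "'s \<Rightarrow> 'z::ab_group_add \<Rightarrow> 'z" +
  fixes f :: "'y \<Rightarrow> 'z"
  assumes af: "addv f" and lf: "f (sc s x) = sc' s (f x)" and inj: "f x = f y \<Longrightarrow> x = y"
begin

lemma it: "itw (range sc) (range sc') f"
  by (rule itw_lin[where sc = sc and sc' = sc', OF af]) (rule lf)

lemma sub_f: "submod sc U \<Longrightarrow> submod sc' (f ` U)"
  by (rule sub_image[OF _ it])

lemma mem_f: "f x \<in> f ` V \<Longrightarrow> x \<in> V"
  using inj by blast

lemma rlen_f: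
  assumes "submod sc V" "submod sc U" "V \<subseteq> U"
  shows "rlen (range sc') (f ` V) (f ` U) = rlen (range sc) V U"
  by (rule rlen_iso[where f = f, OF A.smod' B.smod' assms sub_f[OF assms(1)] sub_f[OF assms(2)] image_mono[OF assms(3)] af lf order_refl order_refl
        ssum_left[OF sub_0[OF sub_f[OF assms(1)]]] mem_f])

lemma apair_f: assumes p: "apair sc I V U" shows "apair sc' I (f ` V) (f ` U)"
  unfolding apair_def
proof (intro conjI ballI)
  fix s u assume s: "s \<in> I" "u \<in> f ` U"
  then obtain v where v: "v \<in> U" "u = f v" by blast
  show "sc' s u \<in> f ` V" unfolding v(2) lf[symmetric] by (rule imageI[OF apairD(4)[OF p s(1) v(1)]])
qed (use apairD[OF p] sub_f in blast)+

lemma bet_f: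
  assumes c: "is_cpx I b \<phi>" and p: "apair sc I V U"
  shows "bet sc' b \<phi> n (f ` V) (f ` U) = bet sc b \<phi> n V U"
  by (rule bet_iso[where f = f, OF A.smod' B.smod' c p apair_f[OF p] af lf order_refl order_refl
        ssum_left[OF sub_0[OF sub_f[OF apairD(1)[OF p]]]] mem_f])

lemma am_f: "B.am a t (f ` W) = f ` A.am a t W"
proof
  show "B.am a t (f ` W) \<subseteq> f ` A.am a t W"
  proof
    fix y assume "y \<in> B.am a t (f ` W)"
    then obtain u where u: "\<forall>i<t. u i \<in> f ` W" "y = (\<Sum>i<t. sc' (a i) (u i))" unfolding B.am_def by blast
    then have "\<exists>v. i < t \<longrightarrow> v \<in> W \<and> u i = f v" for i by blast
    then obtain v where v: "\<And>i. i < t \<Longrightarrow> v i \<in> W \<and> u i = f (v i)" by metis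
    have "y = f (\<Sum>i<t. sc (a i) (v i))" unfolding u(2) addv_sum[OF af] lf by (rule sum.cong) (use v in simp_all)
    moreover have "(\<Sum>i<t. sc (a i) (v i)) \<in> A.am a t W" by (rule A.amI) (use v in simp)
    ultimately show "y \<in> f ` A.am a t W" by blast
  qed
  show "f ` A.am a t W \<subseteq> B.am a t (f ` W)"
  proof
    fix y assume "y \<in> f ` A.am a t W"
    then obtain x where x: "x \<in> A.am a t W" "y = f x" by blast
    then obtain u where u: "\<forall>i<t. u i \<in> W" "x = (\<Sum>i<t. sc (a i) (u i))" unfolding A.am_def by blast
    show "y \<in> B.am a t (f ` W)" unfolding x(2) u(2) addv_sum[OF af] lf by (rule B.amI) (use u(1) in blast)
  qed
qed

lemma mpw_f: "B.mpw a t n (f ` U) = f ` A.mpw a t n U"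
  by (induction n) (simp_all only: A.mpw_0 B.mpw_0 A.mpw_Suc B.mpw_Suc am_f)

lemma hs_f:
  assumes "submod sc V" "submod sc U" "V \<subseteq> U"
  shows "hs sc' a t n (f ` V) (f ` U) = hs sc a t n V U"
  unfolding hs_def mpw_f image_ssum[OF af, symmetric]
  by (rule rlen_f[OF sub_ssum'[OF A.sub_mpw[OF assms(2)] assms(1) A.addops_sc] assms(2) ssum_least[OF assms(2) A.mpw_subset[OF assms(2)] assms(3)]])

lemma vx_f: "vx sc' x (f ` V) (f ` U) i = f ` vx sc x V U i"
proof (induction i)
  case (Suc i)
  have "sc' s ` f ` U = f ` sc s ` U" for s unfolding image_image by (rule image_cong) (simp_all only: lf)
  then show ?case by (simp only: vx.simps Suc image_ssum[OF af])
qed simp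

lemma regseq_f:
  assumes R: "regseq sc I N d x V U" shows "regseq sc' I N d x (f ` V) (f ` U)"
proof -
  have p: "apair sc I V U" and no: "noeth (range sc) V U" and xN: "\<And>i. i < d \<Longrightarrow> x i \<in> N"
    and reg: "\<And>i u. i < d \<Longrightarrow> u \<in> U \<Longrightarrow> sc (x i) u \<in> vx sc x V U i \<Longrightarrow> u \<in> vx sc x V U i"
    and fin: "rlen (range sc) (vx sc x V U d) U \<noteq> \<infinity>"
    using R unfolding regseq_def by blast+
  note V = apairD(1)[OF p] and U = apairD(2)[OF p] and VU = apairD(3)[OF p]
  have v: "submod sc (vx sc x V U d)" "vx sc x V U d \<subseteq> U" using A.vx_facts[OF V U VU, of x d] by blast+
  have "noeth (range sc') (f ` V) (f ` U)"
    by (rule noeth_image[OF no it U VU order_refl ssum_left[OF sub_0[OF sub_f[OF V]]]])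
  moreover have "u \<in> f ` vx sc x V U i" if i: "i < d" and u: "u \<in> f ` U" "sc' (x i) u \<in> f ` vx sc x V U i" for i u
  proof -
    obtain w where w: "w \<in> U" "u = f w" using u(1) by blast
    have "sc (x i) w \<in> vx sc x V U i" by (rule mem_f) (use u(2) in \<open>simp only: w(2) lf\<close>)
    from imageI[OF reg[OF i w(1) this], of f] show ?thesis unfolding w(2) .
  qed
  ultimately show ?thesis unfolding regseq_def vx_f rlen_f[OF v(1) U v(2)] using apair_f[OF p] xN fin by simp
qed

end

subsection \<open>The inequality for modules with a regular sequence\<close>

text \<open>One reduction step turns sequences into double sequences. The bijection between pairs
  and numbers codes them back, so that the induction over \<open>d\<close> stays in one
  type.\<close>

definition dc :: "(nat \<Rightarrow> nat \<Rightarrow> 's) \<Rightarrow> (nat \<Rightarrow> 's)" where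
  "dc y k = y (fst (prod_decode k)) (snd (prod_decode k))"

lemma transport_dc: "transport (psc (psc (*))) (psc (*)) (dc :: (nat \<Rightarrow> nat \<Rightarrow> 's::comm_ring_1) \<Rightarrow> (nat \<Rightarrow> 's))"
proof -
  interpret A: smod "psc (psc (*)) :: 's \<Rightarrow> (nat \<Rightarrow> nat \<Rightarrow> 's) \<Rightarrow> _" by (rule smod_psc[OF smod_psc[OF smod_mult]])
  interpret B: smod "psc (*) :: 's \<Rightarrow> (nat \<Rightarrow> 's) \<Rightarrow> _" by (rule smod_psc[OF smod_mult])
  show ?thesis
  proof
    show "addv (dc :: (nat \<Rightarrow> nat \<Rightarrow> 's) \<Rightarrow> _)" by (simp add: addv_def dc_def fun_eq_iff)
    show "dc (psc (psc (*)) s x) = psc (*) s (dc x)" for s and x :: "nat \<Rightarrow> nat \<Rightarrow> 's"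
      by (rule ext) (simp add: dc_def psc_def)
    show "x = y" if "dc x = dc y" for x y :: "nat \<Rightarrow> nat \<Rightarrow> 's"
    proof (intro ext)
      fix i j
      have "dc x (prod_encode (i, j)) = dc y (prod_encode (i, j))" by (simp only: that)
      then show "x i j = y i j" by (simp add: dc_def)
    qed
  qed
qed

text \<open>The part of \<open>glmod\<close> that concerns the ring. Modules of several types occur
  in one proof while the ring and the generators of its maximal ideal stay fixed.\<close>

locale glring = lring I N for I N :: "'s::comm_ring_1 set" +
  fixes a :: "nat \<Rightarrow> 's" and t :: nat
  assumes aN: "\<And>i. i < t \<Longrightarrow> a i \<in> N" and gens: "\<And>s. s \<in> N \<Longrightarrow> \<exists>c. s - (\<Sum>i<t. c i * a i) \<in> I"
begin

lemma glmod_I: "smod sc \<Longrightarrow> glmod I N sc a t"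
  unfolding glmod_def lmod_def glmod_axioms_def using lring_axioms aN gens by blast

lemma apair_k: "apair (*) I N UNIV"
  unfolding apair_def using sub_N sub_UNIV IN sub_sc[OF sub_I] by (auto simp: mult.commute)

text \<open>The homology is a subquotient of a power of the residue field, which has finite
  length.\<close>

lemma bet_k_finite:
  assumes c: "is_cpx I b \<phi>" shows "bet (*) b \<phi> n N UNIV \<noteq> \<infinity>"
proof -
  interpret M: lmod I N "(*)" unfolding lmod_def using lring_axioms smod_mult by blast
  have no: "noeth (range (*)) N UNIV"
  proof -
    have fin: "rlen (range (*)) N UNIV \<noteq> \<infinity>"
    proof -
      have "\<not> ch (range (*)) (Suc (Suc 0)) N UNIV"
      proof
        assume "ch (range (*)) (Suc (Suc 0)) N UNIV"
        then obtain X Y where X: "submod (*) X" "N \<subset> X" "X \<subset> Y" by auto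
        then obtain s where s: "s \<in> X" "s \<notin> N" by blast
        obtain s' where "s' * s - 1 \<in> I" using unit[OF s(2)] by blast
        then have "s' * s - 1 \<in> X" "s' * s \<in> X" using IN X sub_sc[OF X(1) s(1)] by auto
        then have "1 \<in> X" using sub_diff[OF X(1), of "s' * s" "s' * s - 1"] by simp
        then have "r \<in> X" for r using sub_sc[OF X(1), of 1 r] by simp
        then show False using X by blast
      qed
      then have "\<not> enat (Suc (Suc 0)) \<le> rlen (range (*)) N UNIV" by (simp only: le_rlen_iff[OF subset_UNIV] not_False_eq_True)
      then show ?thesis by (rule contrapos_nn) simp
    qed
    then show ?thesis by (rule M.finite_len_noe[OF apair_k])
  qed
  have fin: "rlen (range (*)) N UNIV \<noteq> \<infinity>"
    by (rule M.noe_finite_len[OF apair_k no]) (rule sub_sc[OF sub_N, THEN subst[OF mult.commute, of "\<lambda>z. z \<in> N"]])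
  have "bet (*) b \<phi> n N UNIV \<le> rlen (range (psc (*))) (pw (b n) N) (pw (b n) UNIV)"
    unfolding bet_def by (rule rlen_mono[OF M.bnd_cyc[OF c apair_k] M.pw_bnd[OF sub_UNIV] M.cyc_pw])
  also have "\<dots> = enat (b n) * rlen (range (*)) N UNIV" by (rule M.rlen_pw[OF sub_N sub_UNIV subset_UNIV])
  finally have le: "bet (*) b \<phi> n N UNIV \<le> enat (b n) * rlen (range (*)) N UNIV" .
  obtain k where "rlen (range (*)) N UNIV = enat k" using fin by auto
  then have "bet (*) b \<phi> n N UNIV \<le> enat (b n * k)" using le by simp
  then show ?thesis by (rule contrapos_pn) simp
qed

text \<open>The case of finite length: comparing \<open>U/mU\<close>, \<open>mU/V\<close> and \<open>U/V\<close>.\<close>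

lemma finite_length_case:
  assumes sc: "smod sc" and R: "regseq sc I N 0 x V U" and c: "is_cpx I b \<phi>"
    and g: "grow m (\<lambda>n. bet sc b \<phi> n V U)" and ng: "\<not> grow m (\<lambda>n. bet (*) b \<phi> n N UNIV)"
  shows "\<exists>e. (\<lambda>n. fact 0 * real (the_enat (hs sc a t n V U)) / real n ^ 0) \<longlonglongrightarrow> e \<and> 2 * real (the_enat (hs sc a t 1 V U)) \<le> e"
proof -
  interpret M: glmod I N sc a t by (rule glmod_I[OF sc])
  have p: "apair sc I V U" and no: "M.noe V U" and fin: "M.len V U \<noteq> \<infinity>" using R unfolding regseq_def by auto
  note V = apairD(1)[OF p] and U = apairD(2)[OF p] and VU = apairD(3)[OF p]
  obtain l where l: "M.len V U = enat l" using fin by auto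
  obtain k where k: "M.mpw a t k U \<subseteq> V" using M.finite_len_nilpotent[OF p fin] by blast
  have hk: "hs sc a t n V U = enat l" if "n \<ge> k" for n
  proof -
    have "M.UU V U n \<subseteq> M.UU V U k" by (rule M.UU_mono[OF p no that])
    also have "\<dots> \<subseteq> V" by (rule ssum_least[OF V k order_refl])
    finally have "M.UU V U n = V" using M.V_UU[OF p no] by blast
    then show ?thesis unfolding hs_def using l by simp
  qed
  have "(\<lambda>n. fact 0 * real (the_enat (hs sc a t n V U)) / real n ^ 0) \<longlonglongrightarrow> real l"
    by (rule tendsto_eventually, rule eventually_sequentiallyI[of k]) (simp add: hk)
  moreover have "2 * real (the_enat (hs sc a t 1 V U)) \<le> real l"
  proof (rule ccontr)
    assume lt: "\<not> 2 * real (the_enat (hs sc a t 1 V U)) \<le> real l"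
    let ?W = "M.UU V U 1"
    have W: "M.ssub ?W" "V \<subseteq> ?W" "?W \<subseteq> U" using M.sub_UU[OF p no] M.V_UU[OF p no] M.UU_U[OF p no] by blast+
    have "enat l = M.len V ?W + M.len ?W U" using M.len_add[OF V W(1) U W(2,3)] l by simp
    then obtain \<nu> \<mu> where nm: "M.len V ?W = enat \<nu>" "M.len ?W U = enat \<mu>" "l = \<nu> + \<mu>"
      by (cases "M.len V ?W"; cases "M.len ?W U") auto
    have "hs sc a t 1 V U = enat \<mu>" unfolding hs_def using nm(2) .
    then have num: "\<nu> < \<mu>" using lt nm(3) by simp
    have "\<exists>z. bet (*) b \<phi> n N UNIV = enat z" for n using bet_k_finite[OF c, of n] by auto
    then obtain B where B: "\<And>n. bet (*) b \<phi> n N UNIV = enat (B n)" by metis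
    have NW: "sc s u \<in> ?W" if "s \<in> N" "u \<in> U" for s u
      unfolding One_nat_def M.mpw_Suc M.mpw_0 by (rule M.N_am[OF p that U order_refl])
    \<comment> \<open>\<open>U/W\<close> is a vector space of dimension \<open>\<mu>\<close> and
      bounds from below; \<open>W/V\<close> is only known to have length \<open>\<nu>\<close> and is
      bounded from above.\<close>
    have rec: "enat (\<mu> * B (Suc n)) \<le> bet sc b \<phi> (Suc n) V U + enat (\<nu> * B n)" for n
    proof -
      have "enat \<mu> * bet (*) b \<phi> (Suc n) N UNIV \<le> bet sc b \<phi> (Suc n) ?W U"
        by (rule M.len_le_bet[OF c apair_right[OF p W] nm(2) NW])
      also have "\<dots> \<le> bet sc b \<phi> (Suc n) V U + bet sc b \<phi> n V ?W" by (rule M.bet_quot[OF c p W])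
      also have "bet sc b \<phi> n V ?W \<le> enat \<nu> * bet (*) b \<phi> n N UNIV" by (rule M.bet_le_len[OF c apair_left[OF p W] nm(1)])
      finally show ?thesis by (simp add: B add_left_mono)
    qed
    have "grow m (\<lambda>n. enat (B n))" by (rule grow_rec[OF g num rec])
    then show False using ng by (simp add: B)
  qed
  ultimately show ?thesis by blast
qed

lemma grow_step:
  assumes g: "grow m F" and le: "\<And>n. G (Suc n) \<le> enat D * F (Suc n) + enat D * F n"
  shows "grow m G"
proof (rule grow_mono[of m "\<lambda>n. enat D * F n + enat D * F (n - 1)" 1])
  have "grow m (\<lambda>n. F (n - 1))" by (rule grow_Suc[OF g]) simp
  then show "grow m (\<lambda>n. enat D * F n + enat D * F (n - 1))" by (intro grow_add grow_cmult g)
  show "G n \<le> enat D * F n + enat D * F (n - 1)" if "1 \<le> n" for n using le[of "n - 1"] that by simp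
qed

lemma hs_finite:
  assumes sc: "smod sc" and R: "regseq sc I N d x V U" shows "hs sc a t n V U \<noteq> \<infinity>"
proof -
  interpret M: glmod I N sc a t by (rule glmod_I[OF sc])
  show ?thesis unfolding hs_def by (rule M.UU_step_fin) (use R in \<open>auto simp: regseq_def\<close>)
qed

text \<open>Both the limit and the number of generators of the reduced module are \<open>D\<close>
  times those of \<open>U/V\<close>, so the inequality passes back.\<close>

lemma conclusion_step:
  assumes sc: "smod sc" "smod sc'" and R: "regseq sc I N (Suc d) x V U" "regseq sc' I N d x V' U'" and D: "D > 0"
    and H: "\<exists>n0. \<forall>n\<ge>n0. hs sc' a t (Suc n) V' U' + enat D * hs sc a t n V U = enat D * hs sc a t (Suc n) V U"
    and H1: "hs sc' a t 1 V' U' = enat D * hs sc a t 1 V U"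
    and e: "\<exists>e. (\<lambda>n. fact d * real (the_enat (hs sc' a t n V' U')) / real n ^ d) \<longlonglongrightarrow> e \<and> 2 * real (the_enat (hs sc' a t 1 V' U')) \<le> e"
  shows "\<exists>e. (\<lambda>n. fact (Suc d) * real (the_enat (hs sc a t n V U)) / real n ^ Suc d) \<longlonglongrightarrow> e \<and> 2 * real (the_enat (hs sc a t 1 V U)) \<le> e"
proof -
  have "\<exists>k. hs sc a t n V U = enat k" for n using hs_finite[OF sc(1) R(1), of n] by simp
  then obtain h where h: "\<And>n. hs sc a t n V U = enat (h n)" by metis
  have "\<exists>k. hs sc' a t n V' U' = enat k" for n using hs_finite[OF sc(2) R(2), of n] by simp
  then obtain h' where h': "\<And>n. hs sc' a t n V' U' = enat (h' n)" by metis
  obtain n0 where n0: "\<And>n. n \<ge> n0 \<Longrightarrow> h' (Suc n) + D * h n = D * h (Suc n)" using H by (auto simp: h h')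
  obtain e where e: "(\<lambda>n. fact d * real (h' n) / real n ^ d) \<longlonglongrightarrow> e" "2 * real (h' 1) \<le> e" using e by (auto simp: h')
  have rr: "real (h' (Suc n)) + real D * real (h n) = real D * real (h (Suc n))" if "n \<ge> n0" for n
    using n0[OF that] by (metis of_nat_add of_nat_mult)
  have Dp: "real D > 0" using D by simp
  have "(\<lambda>n. fact (Suc d) * real (h n) / real n ^ Suc d) \<longlonglongrightarrow> e / real D"
    by (rule hilbert_sum[where D = "real D" and h = "\<lambda>n. real (h n)" and h' = "\<lambda>n. real (h' n)", OF Dp rr e(1)])
  moreover have "h' 1 = D * h 1" using H1 by (simp add: h h')
  then have "2 * real (h 1) \<le> e / real D" using e(2) D by (simp add: field_simps)
  ultimately show ?thesis by (auto simp: h simp del: fact_Suc power_Suc)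
qed

text \<open>The complex stays fixed during the induction on \<open>d\<close>. The new Betti numbers
  are bounded by \<open>D\<close> times two consecutive old ones, so the growth exponent
  \<open>m\<close> survives down to finite length.\<close>

theorem regular_sequence_case:
  fixes V U :: "(nat \<Rightarrow> 's) set"
  assumes R: "regseq (psc (*)) I N d x V U" and c: "is_cpx I b \<phi>"
    and g: "grow m (\<lambda>n. bet (psc (*)) b \<phi> n V U)" and ng: "\<not> grow m (\<lambda>n. bet (*) b \<phi> n N UNIV)"
  shows "\<exists>e. (\<lambda>n. fact d * real (the_enat (hs (psc (*)) a t n V U)) / real n ^ d) \<longlonglongrightarrow> e
     \<and> 2 * real (the_enat (hs (psc (*)) a t 1 V U)) \<le> e"
  using R g
proof (induction d arbitrary: V U)
  case 0
  show ?case by (rule finite_length_case[OF smod_psc[OF smod_mult] 0(1) c 0(2) ng])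
next
  case (Suc d)
  interpret M: glmod I N "psc (*)" a t by (rule glmod_I[OF smod_psc[OF smod_mult]])
  interpret T: transport "psc (psc (*))" "psc (*)" "dc :: (nat \<Rightarrow> nat \<Rightarrow> 's) \<Rightarrow> _" by (rule transport_dc)
  let ?E = "Pol U"
  obtain D V' where S: "D > 0" "regseq (psc (psc (*))) I N d x V' ?E"
    "\<exists>n0. \<forall>n\<ge>n0. hs (psc (psc (*))) a t (Suc n) V' ?E + enat D * hs (psc (*)) a t n V U = enat D * hs (psc (*)) a t (Suc n) V U"
    "hs (psc (psc (*))) a t 1 V' ?E = enat D * hs (psc (*)) a t 1 V U"
    "\<forall>b \<phi> n. is_cpx I b \<phi> \<longrightarrow> bet (psc (psc (*))) b \<phi> (Suc n) V' ?E \<le> enat D * bet (psc (*)) b \<phi> (Suc n) V U + enat D * bet (psc (*)) b \<phi> n V U"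
    using M.step[OF Suc.prems(1)] by blast
  have p': "apair (psc (psc (*))) I V' ?E" using S(2) unfolding regseq_def by blast
  note V' = apairD(1,2,3)[OF p']
  have "grow m (\<lambda>n. bet (psc (psc (*))) b \<phi> n V' ?E)" by (rule grow_step[OF Suc.prems(2)]) (use S(5) c in blast)
  then have "grow m (\<lambda>n. bet (psc (*)) b \<phi> n (dc ` V') (dc ` ?E))" by (simp only: T.bet_f[OF c p'])
  from Suc.IH[OF T.regseq_f[OF S(2)] this]
  have "\<exists>e. (\<lambda>n. fact d * real (the_enat (hs (psc (psc (*))) a t n V' ?E)) / real n ^ d) \<longlonglongrightarrow> e
     \<and> 2 * real (the_enat (hs (psc (psc (*))) a t 1 V' ?E)) \<le> e" unfolding T.hs_f[OF V'] .
  then show ?case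
    by (rule conclusion_step[OF smod_psc[OF smod_mult] smod_psc[OF smod_psc[OF smod_mult]] Suc.prems(1) S(2,1,3,4)])
qed

end

subsection \<open>Free resolutions\<close>

definition lc :: "('s \<Rightarrow> 'x::ab_group_add \<Rightarrow> 'x) \<Rightarrow> nat \<Rightarrow> (nat \<Rightarrow> 'x) \<Rightarrow> (nat \<Rightarrow> 's) \<Rightarrow> 'x" where
  "lc sc b g c = (\<Sum>j<b. sc (c j) (g j))"

text \<open>A free resolution of \<open>U/V\<close> over \<open>S/I\<close>, written with matrices
  over \<open>S\<close>; kernels and images are compared modulo \<open>I\<close>.\<close>

definition resol where
  "resol sc I V U b g \<phi> \<longleftrightarrow> (\<forall>j<b 0. g j \<in> U) \<and> (\<forall>u\<in>U. \<exists>c\<in>pw (b 0) UNIV. u - lc sc (b 0) g c \<in> V)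
     \<and> (\<forall>c\<in>pw (b 0) UNIV. lc sc (b 0) g c \<in> V \<longleftrightarrow> c \<in> bnd (*) b \<phi> 0 I UNIV)
     \<and> (\<forall>n. cyc (*) b \<phi> (Suc n) I UNIV = bnd (*) b \<phi> (Suc n) I UNIV)"

context smod
begin

lemma addv_lc: "addv (lc sc b g)"
  by (simp add: addv_def lc_def sc_add_left sum.distrib)

lemma lc_psc: "lc sc b g (psc (*) s c) = sc s (lc sc b g c)"
  by (simp add: lc_def sc_sum sc_mult)

lemma lc_in: "submod sc U \<Longrightarrow> (\<And>j. j < b \<Longrightarrow> g j \<in> U) \<Longrightarrow> lc sc b g c \<in> U"
proof -
  assume U: "submod sc U" and g: "\<And>j. j < b \<Longrightarrow> g j \<in> U"
  show "lc sc b g c \<in> U" unfolding lc_def by (rule sub_sum[OF U]) (rule sub_sc[OF U], use g in simp)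
qed

lemma itw_lc: "itw (range (psc (*))) (range sc) (lc sc b g)"
  by (rule itw_lin[where sc = "psc (*)" and sc' = sc, OF addv_lc]) (rule lc_psc)

end

lemma dlt_pw: "i < b \<Longrightarrow> s \<in> U \<Longrightarrow> 0 \<in> U \<Longrightarrow> dlt i s \<in> pw b U"
  by (auto simp: pw_def dlt_def)

lemma mm_dlt: "k < c \<Longrightarrow> mm (*) r c \<phi> (dlt k (1::'s::comm_ring_1)) i = (if i < r then \<phi> i k else 0)"
proof -
  assume k: "k < c"
  have "(\<Sum>j<c. \<phi> i j * dlt k 1 j) = (\<Sum>j<c. if j = k then \<phi> i k else 0)"
    by (rule sum.cong) (simp_all add: dlt_def)
  also have "\<dots> = \<phi> i k" using k by simp
  finally show ?thesis by (simp add: mm_def)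
qed

text \<open>Evaluating consecutive differentials on the unit vectors reads off the entries of the
  composite.\<close>

lemma resol_cpx:
  fixes I :: "'s::comm_ring_1 set"
  assumes R: "resol sc I V U b g \<phi>" and I: "submod (*) I"
  shows "is_cpx I b \<phi>"
  unfolding is_cpx_def
proof (intro allI impI)
  interpret S: smod "(*) :: 's \<Rightarrow> _" by (rule smod_mult)
  fix n i k assume i: "i < b n" and k: "k < b (Suc (Suc n))"
  have "dlt k 1 \<in> pw (b (Suc (Suc n))) (UNIV :: 's set)" by (rule dlt_pw[OF k]) simp_all
  then have "mm (*) (b (Suc n)) (b (Suc (Suc n))) (\<phi> (Suc n)) (dlt k 1) \<in> bnd (*) b \<phi> (Suc n) I UNIV"
    by (rule S.mm_bnd[OF I])
  also have "bnd (*) b \<phi> (Suc n) I UNIV = cyc (*) b \<phi> (Suc n) I UNIV" using R unfolding resol_def by blast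
  finally have "mm (*) (b n) (b (Suc n)) (\<phi> n) (mm (*) (b (Suc n)) (b (Suc (Suc n))) (\<phi> (Suc n)) (dlt k 1)) \<in> pw (b n) I"
    by (simp add: cyc_def)
  from pwD[OF this i] have "(\<Sum>j<b (Suc n). \<phi> n i j * mm (*) (b (Suc n)) (b (Suc (Suc n))) (\<phi> (Suc n)) (dlt k 1) j) \<in> I"
    using i by (simp add: mm_def)
  moreover have "(\<Sum>j<b (Suc n). \<phi> n i j * mm (*) (b (Suc n)) (b (Suc (Suc n))) (\<phi> (Suc n)) (dlt k 1) j)
     = (\<Sum>j<b (Suc n). \<phi> n i j * \<phi> (Suc n) j k)"
    by (rule sum.cong) (simp_all add: mm_dlt[OF k])
  ultimately show "(\<Sum>j<b (Suc n). \<phi> n i j * \<phi> (Suc n) j k) \<in> I" by simp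
qed

text \<open>A maximal submodule among the finitely generated ones already contains each further
  element of \<open>K\<close>.\<close>

lemma noeth_fg:
  fixes sc :: "'s::comm_ring_1 \<Rightarrow> 'x::ab_group_add \<Rightarrow> 'x"
  assumes "smod sc" and no: "noeth (range sc) C E" and C: "submod sc C" and K: "submod sc K" and CK: "C \<subseteq> K" "K \<subseteq> E"
  shows "\<exists>r k. (\<forall>i<r. k i \<in> K) \<and> K = range (lc sc r k) \<boxplus> C"
proof -
  interpret smod sc by fact
  let ?L = "\<lambda>r k. range (lc sc r k) \<boxplus> C"
  have UN: "submod (psc (*)) (UNIV :: (nat \<Rightarrow> 's) set)" by (rule sub_UNIV)
  have L: "submod sc (?L r k)" for r k by (rule sub_ssum'[OF sub_image[OF UN itw_lc] C addops_sc])
  have CL: "C \<subseteq> ?L r k" for r k by (rule ssum_right[OF sub_0[OF sub_image[OF UN itw_lc]]])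
  have LK: "?L r k \<subseteq> K" if "\<forall>i<r. k i \<in> K" for r k
    by (rule ssum_least[OF K _ CK(1)]) (use lc_in[OF K] that in blast)
  let ?F = "{W. \<exists>r k. (\<forall>i<r. k i \<in> K) \<and> W = ?L r k}"
  have "\<exists>W\<in>?F. \<forall>W'\<in>?F. W \<subseteq> W' \<longrightarrow> W' = W"
  proof (rule noeth_max[OF no])
    have "?L 0 (\<lambda>_. 0) \<in> ?F" by (rule CollectI, rule exI[of _ 0], rule exI[of _ "\<lambda>_. 0"]) simp
    then show "?F \<noteq> {}" by (metis empty_iff)
    fix W assume "W \<in> ?F"
    then obtain r k where rk: "\<forall>i<r. k i \<in> K" "W = ?L r k" by blast
    show "submod sc W \<and> C \<subseteq> W \<and> W \<subseteq> E" unfolding rk(2) using L CL order_trans[OF LK[OF rk(1)] CK(2)] by (intro conjI)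
  qed
  then obtain W where W: "W \<in> ?F" "\<forall>W'\<in>?F. W \<subseteq> W' \<longrightarrow> W' = W" by (rule bexE)
  then obtain r k where rk: "\<forall>i<r. k i \<in> K" "W = ?L r k" by blast
  have "K \<subseteq> W"
  proof
    fix u assume u: "u \<in> K"
    let ?k = "k(r := u)"
    have kk: "\<forall>i<Suc r. ?k i \<in> K" using rk(1) u by (auto simp: less_Suc_eq)
    have e: "lc sc (Suc r) ?k c = lc sc r k c + sc (c r) u" for c
    proof -
      have "(\<Sum>j<r. sc (c j) (?k j)) = (\<Sum>j<r. sc (c j) (k j))" by (rule sum.cong) simp_all
      then show ?thesis by (simp add: lc_def)
    qed
    have "lc sc r k c \<in> range (lc sc (Suc r) ?k)" for c
    proof -
      have "lc sc (Suc r) ?k (c(r := 0)) = lc sc r k c"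
      proof -
        have "lc sc r k (c(r := 0)) = lc sc r k c" unfolding lc_def by (rule sum.cong) simp_all
        then show ?thesis unfolding e by (simp add: sc_0_left)
      qed
      then show ?thesis using rangeI[of "lc sc (Suc r) ?k" "c(r := 0)"] by (simp only:)
    qed
    then have "W \<subseteq> ?L (Suc r) ?k" unfolding rk(2) by (intro ssum_mono order_refl) blast
    moreover have "?L (Suc r) ?k \<in> ?F" using kk by blast
    ultimately have "?L (Suc r) ?k = W" using W(2) by blast
    moreover have "u \<in> ?L (Suc r) ?k"
    proof -
      have "lc sc r k (dlt r 1) = 0" unfolding lc_def by (rule sum.neutral) (simp add: dlt_def sc_0_left)
      then have "lc sc (Suc r) ?k (dlt r 1) = u" unfolding e by (simp add: dlt_def sc_one)
      then have "u \<in> range (lc sc (Suc r) ?k)" by (metis rangeI)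
      then show ?thesis by (rule subsetD[OF ssum_left[OF sub_0[OF C]]])
    qed
    ultimately show "u \<in> W" by simp
  qed
  then have "K = ?L r k" using LK[OF rk(1)] unfolding rk(2) by (intro equalityI)
  then show ?thesis using rk(1) by blast
qed

lemma syzygy_exists:
  fixes I :: "'s::comm_ring_1 set"
  assumes I: "submod (*) I" and no: "noeth (range (*)) I UNIV"
    and K: "submod (psc (*)) K" "pw b I \<subseteq> K" "K \<subseteq> pw b UNIV"
  shows "\<exists>b' \<psi>. K = mm (*) b b' \<psi> ` pw b' UNIV \<boxplus> pw b I"
proof -
  interpret S: smod "(*) :: 's \<Rightarrow> _" by (rule smod_mult)
  note sp = smod_psc[OF smod_mult]
  have nb: "noeth (range (psc (*))) (pw b I) (pw b (UNIV :: 's set))" by (rule S.noeth_pw[OF I sub_UNIV subset_UNIV no])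
  obtain r k where rk: "\<forall>i<r. k i \<in> K" "K = range (lc (psc (*)) r k) \<boxplus> pw b I"
    using noeth_fg[OF sp nb S.sub_pw'[OF I] K] by blast
  define \<psi> where "\<psi> i j = k j i" for i j
  have kz: "k j i = 0" if "j < r" "i \<ge> b" for i j using rk(1) K(3) that pwD0 by blast
  have e: "lc (psc (*)) r k c = mm (*) b r \<psi> c" for c
  proof (rule ext)
    fix i show "lc (psc (*)) r k c i = mm (*) b r \<psi> c i"
    proof (cases "i < b")
      case True
      then show ?thesis unfolding lc_def mm_def sum_fun_app by (simp add: \<psi>_def psc_def mult.commute)
    next
      case False
      then show ?thesis unfolding lc_def mm_def sum_fun_app by (simp add: psc_def kz)
    qed
  qed
  have "range (lc (psc (*)) r k) = mm (*) b r \<psi> ` pw r UNIV"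
  proof
    show "range (lc (psc (*)) r k) \<subseteq> mm (*) b r \<psi> ` pw r UNIV"
    proof
      fix y assume "y \<in> range (lc (psc (*)) r k)"
      then obtain c where c: "y = mm (*) b r \<psi> c" unfolding e by blast
      have "y = mm (*) b r \<psi> (\<lambda>i. if i < r then c i else 0)" unfolding c mm_def by (auto simp: fun_eq_iff intro!: sum.cong)
      moreover have "(\<lambda>i. if i < r then c i else 0) \<in> pw r UNIV" by (simp add: pw_def)
      ultimately show "y \<in> mm (*) b r \<psi> ` pw r UNIV" by blast
    qed
    show "mm (*) b r \<psi> ` pw r UNIV \<subseteq> range (lc (psc (*)) r k)" unfolding e[symmetric] by blast
  qed
  then show ?thesis using rk(2) by metis
qed

lemma resol_exists:
  fixes I :: "'s::comm_ring_1 set" and sc :: "'s \<Rightarrow> 'x::ab_group_add \<Rightarrow> 'x"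
  assumes sc: "smod sc" and I: "submod (*) I" and no: "noeth (range (*)) I UNIV"
    and p: "apair sc I V U" and noU: "noeth (range sc) V U"
  shows "\<exists>b g \<phi>. resol sc I V U b g \<phi>"
proof -
  interpret M: smod sc by (rule sc)
  interpret S: smod "(*) :: 's \<Rightarrow> _" by (rule smod_mult)
  note V = apairD(1)[OF p] and U = apairD(2)[OF p]
  obtain b0 g where g: "\<forall>i<b0. g i \<in> U" "U = range (lc sc b0 g) \<boxplus> V"
    using noeth_fg[OF sc noU V U apairD(3)[OF p] order_refl] by blast
  let ?K0 = "{c \<in> pw b0 UNIV. lc sc b0 g c \<in> V}"
  have K0: "submod (psc (*)) ?K0" by (rule sub_vimage[OF V S.sub_pw'[OF sub_UNIV] M.itw_lc])
  have lI: "lc sc b0 g c \<in> V" if "c \<in> pw b0 I" for c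
    unfolding lc_def by (rule sub_sum[OF V]) (rule apairD(4)[OF p], use that g(1) in \<open>simp_all add: pw_def\<close>)
  obtain b1 \<psi>0 where \<psi>0: "?K0 = mm (*) b0 b1 \<psi>0 ` pw b1 UNIV \<boxplus> pw b0 I"
    using syzygy_exists[OF I no K0] lI pw_mono[OF subset_UNIV] by blast
  have ex: "\<exists>b'' \<psi>'. {c \<in> pw b' UNIV. mm (*) b b' \<psi> c \<in> pw b I} = mm (*) b' b'' \<psi>' ` pw b'' UNIV \<boxplus> pw b' I" for b b' \<psi>
  proof (rule syzygy_exists[OF I no])
    show "submod (psc (*)) {c \<in> pw b' UNIV. mm (*) b b' \<psi> c \<in> pw b I}"
      by (rule sub_vimage[OF S.sub_pw'[OF I] S.sub_pw'[OF sub_UNIV] S.itw_mm])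
    show "pw b' I \<subseteq> {c \<in> pw b' UNIV. mm (*) b b' \<psi> c \<in> pw b I}" using pw_mono[of I UNIV b'] S.mm_pw[OF I] by blast
  qed blast
  \<comment> \<open>A state consists of two consecutive ranks and the matrix between them;
    \<open>P x y\<close> says that \<open>y\<close> continues the resolution exactly after
    \<open>x\<close>. Iterating a choice function yields all differentials.\<close>
  define P where "P x y \<longleftrightarrow> (case x of (b, b', \<psi>) \<Rightarrow> case y of (c, c', \<psi>') \<Rightarrow>
      c = b' \<and> {z \<in> pw b' UNIV. mm (*) b b' \<psi> z \<in> pw b I} = mm (*) b' c' \<psi>' ` pw c' UNIV \<boxplus> pw b' I)"
    for x y :: "nat \<times> nat \<times> (nat \<Rightarrow> nat \<Rightarrow> 's)"
  have "\<exists>f. \<forall>n. (n = 0 \<longrightarrow> f n = (b0, b1, \<psi>0)) \<and> P (f n) (f (Suc n))"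
  proof -
    have "\<exists>y. P x y" for x
    proof -
      obtain b b' \<psi> where x: "x = (b, b', \<psi>)" by (cases x)
      obtain c' \<psi>' where "{c \<in> pw b' UNIV. mm (*) b b' \<psi> c \<in> pw b I} = mm (*) b' c' \<psi>' ` pw c' UNIV \<boxplus> pw b' I" using ex by blast
      then have "P x (b', c', \<psi>')" by (simp add: P_def x)
      then show ?thesis by blast
    qed
    then obtain nx where nx: "\<And>x. P x (nx x)" by metis
    show ?thesis by (rule exI[of _ "\<lambda>n. (nx ^^ n) (b0, b1, \<psi>0)"]) (simp add: nx)
  qed
  then obtain f where f: "f 0 = (b0, b1, \<psi>0)" "\<And>n. P (f n) (f (Suc n))" by blast
  define b where "b n = fst (f n)" for n
  define \<phi> where "\<phi> n = snd (snd (f n))" for n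
  have fb: "f n = (b n, b (Suc n), \<phi> n)" for n
    using f(2)[of n] by (simp add: P_def b_def \<phi>_def split: prod.splits)
  have b01: "b 0 = b0" "b (Suc 0) = b1" "\<phi> 0 = \<psi>0" using f(1) fb[of 0] by simp_all
  have ex1: "{z \<in> pw (b (Suc n)) UNIV. mm (*) (b n) (b (Suc n)) (\<phi> n) z \<in> pw (b n) I}
     = mm (*) (b (Suc n)) (b (Suc (Suc n))) (\<phi> (Suc n)) ` pw (b (Suc (Suc n))) UNIV \<boxplus> pw (b (Suc n)) I" for n
    using f(2)[of n] unfolding fb P_def by simp
  have "resol sc I V U b g \<phi>"
    unfolding resol_def
  proof (intro conjI allI impI ballI)
    show "g j \<in> U" if "j < b 0" for j using g(1) that b01 by simp
    show "\<exists>c\<in>pw (b 0) UNIV. u - lc sc (b 0) g c \<in> V" if "u \<in> U" for u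
    proof -
      have "u \<in> range (lc sc b0 g) \<boxplus> V" using that g(2) by (simp only:)
      then obtain y v where yv: "y \<in> range (lc sc b0 g)" "v \<in> V" "u = y + v" by (rule ssumE)
      from yv(1) obtain c where "y = lc sc b0 g c" by (rule rangeE)
      then have cv: "v \<in> V" "u = lc sc b0 g c + v" using yv(2,3) by (simp_all only:)
      have "lc sc b0 g c = lc sc b0 g (\<lambda>i. if i < b0 then c i else 0)" unfolding lc_def by (rule sum.cong) simp_all
      then show ?thesis using cv by (intro bexI[of _ "\<lambda>i. if i < b0 then c i else 0"]) (simp_all add: b01 pw_def)
    qed
    show "lc sc (b 0) g c \<in> V \<longleftrightarrow> c \<in> bnd (*) b \<phi> 0 I UNIV" if "c \<in> pw (b 0) UNIV" for c
      using \<psi>0 that unfolding bnd_def b01 by blast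
    show "cyc (*) b \<phi> (Suc n) I UNIV = bnd (*) b \<phi> (Suc n) I UNIV" for n
      unfolding cyc_def bnd_def using ex1[of n] by simp
  qed
  then show ?thesis by blast
qed

subsection \<open>Balancing Tor\<close>

context lmod
begin

context
  fixes bF gF \<phi>F
  assumes F: "resol (*) I N UNIV bF gF \<phi>F"
begin

lemma F_cpx: "is_cpx I bF \<phi>F"
  by (rule resol_cpx[OF F sub_I])

lemma F_ker: "c \<in> pw (bF 0) UNIV \<Longrightarrow> lc (*) (bF 0) gF c \<in> N \<longleftrightarrow> c \<in> bnd (*) bF \<phi>F 0 I UNIV"
  using F unfolding resol_def by blast

lemma F_acyclic: "bet (*) bF \<phi>F (Suc n) I UNIV = 0"
  unfolding bet_def by (rule rlen_eq0) (use F in \<open>simp add: resol_def\<close>)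

text \<open>\<open>k\<close> is nonzero, so some generator is a unit modulo \<open>I\<close>; in
  degree 0 it can stand in for the whole family.\<close>

lemma F_unit: "\<exists>i<bF 0. gF i \<notin> N"
proof (rule ccontr)
  assume "\<not> ?thesis"
  then have gN: "gF i \<in> N" if "i < bF 0" for i using that by blast
  obtain c where c: "1 - lc (*) (bF 0) gF c \<in> N" using F unfolding resol_def by blast
  have "lc (*) (bF 0) gF c \<in> N" by (rule smod.lc_in[OF smod_mult sub_N]) (rule gN)
  then have "1 \<in> N" by (rule sub_diff_cancel[OF sub_N c])
  then show False using N1 by simp
qed

lemma mm_tensor: "mm sc r c \<phi> (\<lambda>i. sc (u i) v) = (\<lambda>i. sc (mm (*) r c \<phi> u i) v)"
  by (auto simp: mm_def fun_eq_iff sc_sum_left sc_mult sc_0_left)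

lemma F_tensor:
  assumes p: "apair sc I W K" and c: "c \<in> bnd (*) bF \<phi>F 0 I UNIV" and v: "v \<in> K"
  shows "(\<lambda>i. sc (c i) v) \<in> bnd sc bF \<phi>F 0 W K"
proof -
  note W = apairD(1)[OF p] and K = apairD(2)[OF p]
  interpret S: smod "(*) :: 's \<Rightarrow> _" by (rule smod_mult)
  obtain u w where uw: "u \<in> pw (bF (Suc 0)) UNIV" "w \<in> pw (bF 0) I" "c = mm (*) (bF 0) (bF (Suc 0)) (\<phi>F 0) u + w"
    using c by (rule S.bndE)
  have e: "(\<lambda>i. sc (c i) v) = mm sc (bF 0) (bF (Suc 0)) (\<phi>F 0) (\<lambda>i. sc (u i) v) + (\<lambda>i. sc (w i) v)"
    unfolding mm_tensor uw(3) by (simp add: fun_eq_iff sc_add_left)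
  have u': "(\<lambda>i. sc (u i) v) \<in> pw (bF (Suc 0)) K" using uw(1) sub_sc[OF K v] by (simp add: pw_def sc_0_left)
  have w': "(\<lambda>i. sc (w i) v) \<in> pw (bF 0) W" using uw(2) apairD(4)[OF p _ v] by (simp add: pw_def sc_0_left)
  show ?thesis unfolding e bnd_def by (rule ssumI[OF imageI[OF u'] w'])
qed

lemma dlt_smult: "(\<lambda>i. sc (dlt i0 s i) v) = dlt i0 (sc s v)"
  by (auto simp: dlt_def fun_eq_iff sc_0_left)

lemma lc_dlt: "i0 < b \<Longrightarrow> lc (*) b g (dlt i0 s) = s * (g i0 :: 's)"
proof -
  assume i: "i0 < b"
  have "(\<Sum>j<b. dlt i0 s j * g j) = (\<Sum>j<b. if j = i0 then s * g i0 else 0)" by (rule sum.cong) (simp_all add: dlt_def)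
  then show ?thesis using i by (simp add: lc_def)
qed

text \<open>Right exactness of the tensor product: \<open>H\<^sub>0(F \<otimes> K/W) = K/(mK + W)\<close>.\<close>

lemma right_exact:
  assumes p: "apair sc I W K" and NK: "\<And>s u. s \<in> N \<Longrightarrow> u \<in> K \<Longrightarrow> sc s u \<in> am a t K \<boxplus> W" and aN: "\<And>i. i < t \<Longrightarrow> a i \<in> N"
    and y: "y \<in> pw (bF 0) K" "(\<Sum>i<bF 0. sc (gF i) (y i)) \<in> am a t K \<boxplus> W"
  shows "y \<in> bnd sc bF \<phi>F 0 W K"
proof -
  note W = apairD(1)[OF p] and K = apairD(2)[OF p]
  let ?B = "bnd sc bF \<phi>F 0 W K"
  have B: "submod (psc sc) ?B" by (rule sub_bnd[OF W K])
  obtain i0 where i0: "i0 < bF 0" "gF i0 \<notin> N" using F_unit by blast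
  have sE: "dlt i0 v \<in> ?B" if "v \<in> W" for v
    using pw_bnd[OF K, of bF 0 W \<phi>F] dlt_pw[OF i0(1) that sub_0[OF W]] by blast
  \<comment> \<open>For \<open>s\<close> in \<open>N\<close> the multiple of the
    \<open>i0\<close>-th unit vector by \<open>s\<close> is a relation between the generators of
    \<open>k\<close>, and \<open>F_tensor\<close> turns relations into boundaries.\<close>
  have sN: "dlt i0 (sc s v) \<in> ?B" if s: "s \<in> N" and v: "v \<in> K" for s v
  proof -
    have "dlt i0 s \<in> pw (bF 0) UNIV" by (rule dlt_pw[OF i0(1)]) simp_all
    moreover have "lc (*) (bF 0) gF (dlt i0 s) \<in> N" unfolding lc_dlt[OF i0(1)]
      using sub_sc[OF sub_N s, of "gF i0"] by (simp add: mult.commute)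
    ultimately have "dlt i0 s \<in> bnd (*) bF \<phi>F 0 I UNIV" using F_ker by blast
    from F_tensor[OF p this v] show ?thesis unfolding dlt_smult .
  qed
  have tot: "dlt i0 (\<Sum>i<bF 0. sc (gF i) (y i)) \<in> ?B"
  proof -
    obtain m w where mw: "m \<in> am a t K" "w \<in> W" "(\<Sum>i<bF 0. sc (gF i) (y i)) = m + w" using y(2) by (rule ssumE)
    obtain u where u: "\<forall>i<t. u i \<in> K" "m = (\<Sum>i<t. sc (a i) (u i))" using mw(1) unfolding am_def by blast
    have "dlt i0 m \<in> ?B" unfolding u(2) addv_sum[OF addv_dlt]
      by (rule sub_sum[OF B]) (rule sN, use aN u(1) in simp_all)
    then show ?thesis unfolding mw(3) addv_add[OF addv_dlt] by (rule sub_add[OF B _ sE[OF mw(2)]])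
  qed
  \<comment> \<open>The commutativity relation between generators \<open>i\<close> and
    \<open>i0\<close>. Summed over \<open>i\<close>, it reduces \<open>gF i0\<close> times
    \<open>y\<close> to coordinate \<open>i0\<close>.\<close>
  have each: "dlt i (sc (gF i0) (y i)) - dlt i0 (sc (gF i) (y i)) \<in> ?B" if i: "i < bF 0" for i
  proof -
    let ?c = "dlt i (gF i0) - dlt i0 (gF i)"
    have "?c \<in> pw (bF 0) UNIV" using i i0(1) by (auto simp: pw_def dlt_def)
    moreover have "lc (*) (bF 0) gF ?c = 0"
      unfolding addv_diff[OF smod.addv_lc[OF smod_mult]] lc_dlt[OF i] lc_dlt[OF i0(1)] by (simp add: mult.commute)
    then have "lc (*) (bF 0) gF ?c \<in> N" using sub_0[OF sub_N] by simp
    ultimately have "?c \<in> bnd (*) bF \<phi>F 0 I UNIV" using F_ker by blast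
    from F_tensor[OF p this pwD[OF y(1) i]]
    have "(\<lambda>k. sc (?c k) (y i)) \<in> ?B" .
    moreover have "(\<lambda>k. sc (?c k) (y i)) = dlt i (sc (gF i0) (y i)) - dlt i0 (sc (gF i) (y i))"
      by (auto simp: dlt_def fun_eq_iff sc_0_left sc_diff_left)
    ultimately show ?thesis by (simp only:)
  qed
  have ye: "psc sc (gF i0) y = (\<Sum>i<bF 0. dlt i (sc (gF i0) (y i)))"
  proof -
    have "psc sc (gF i0) y = (\<Sum>i<bF 0. dlt i (psc sc (gF i0) y i))"
      by (rule dlt_expand) (simp add: pwD0[OF y(1)] sc_0)
    then show ?thesis by simp
  qed
  have "(\<Sum>i<bF 0. dlt i (sc (gF i0) (y i)) - dlt i0 (sc (gF i) (y i))) \<in> ?B"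
    by (rule sub_sum[OF B]) (rule each, simp)
  then have "psc sc (gF i0) y - dlt i0 (\<Sum>i<bF 0. sc (gF i) (y i)) \<in> ?B"
    unfolding sum_subtractf ye addv_sum[OF addv_dlt] .
  then have gy: "psc sc (gF i0) y \<in> ?B" by (rule sub_diff_cancel[OF B _ tot])
  interpret P: lmod I N "psc sc" unfolding lmod_def using lring_axioms smod_psc[of sc] smod_axioms by blast
  have "apair (psc sc) I ?B (pw (bF 0) K)"
    unfolding apair_def
  proof (intro conjI ballI)
    show "?B \<subseteq> pw (bF 0) K"
      using bnd_cyc[OF F_cpx p, of 0] by (simp add: cyc_def)
    fix s u assume s: "s \<in> I" "u \<in> pw (bF 0) K"
    then have "psc sc s u \<in> pw (bF 0) W" using apairD(4)[OF p s(1)] by (auto simp: pw_def sc_0)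
    then show "psc sc s u \<in> ?B" using pw_bnd[OF K] by blast
  qed (rule B, rule sub_pw'[OF K])
  then show ?thesis by (rule P.unit_cancel[OF _ y(1) i0(2) gy])
qed

end

end

lemma bet_0_D:
  assumes "smod sc" "apair sc I V U" "bet sc b \<phi> n V U = 0"
  shows "cyc sc b \<phi> n V U \<subseteq> bnd sc b \<phi> n V U \<or> \<not> bnd sc b \<phi> n V U \<subseteq> cyc sc b \<phi> n V U"
proof (rule ccontr)
  assume "\<not> ?thesis"
  then have "bnd sc b \<phi> n V U \<subset> cyc sc b \<phi> n V U" by blast
  from rlen_ge1[OF this smod.sub_cyc[OF assms(1) apairD(1,2)[OF assms(2)]]] show False
    using assms(3) unfolding bet_def by simp
qed

lemma pw_basis:
  assumes "w \<in> pw c (W :: 's::comm_ring_1 set)"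
  shows "w = (\<Sum>k<c. psc (*) (w k) (dlt k 1))"
proof -
  have "w = (\<Sum>k<c. dlt k (w k))" by (rule dlt_expand) (rule pwD0[OF assms])
  also have "\<dots> = (\<Sum>k<c. psc (*) (w k) (dlt k 1))"
    by (rule sum.cong[OF refl]) (auto simp: dlt_def psc_def fun_eq_iff)
  finally show ?thesis .
qed

lemma mm_basis:
  assumes "w \<in> pw c (UNIV :: 's::comm_ring_1 set)"
  shows "mm (*) r c \<phi> w = (\<Sum>k<c. psc (*) (w k) (mm (*) r c \<phi> (dlt k 1)))"
proof -
  interpret S: smod "(*) :: 's \<Rightarrow> _" by (rule smod_mult)
  have "mm (*) r c \<phi> w = mm (*) r c \<phi> (\<Sum>k<c. psc (*) (w k) (dlt k 1))" by (rule arg_cong[OF pw_basis[OF assms]])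
  also have "\<dots> = (\<Sum>k<c. psc (*) (w k) (mm (*) r c \<phi> (dlt k 1)))"
    unfolding addv_sum[OF S.addv_mm] S.mm_psc ..
  finally show ?thesis .
qed

context glring
begin

context
  fixes bF gF \<phi>F bG \<phi>G
  assumes F: "resol (*) I N UNIV bF gF \<phi>F" and cG: "is_cpx I bG \<phi>G"
    and exG: "\<And>n. cyc (*) bG \<phi>G (Suc n) I UNIV = bnd (*) bG \<phi>G (Suc n) I UNIV"
begin

text \<open>\<open>PP n\<close> is the free module in degree \<open>n\<close>, \<open>KK n\<close>
  the image of the next differential in it, and \<open>JJ n\<close> the part that vanishes over
  \<open>S/I\<close>.\<close>

abbreviation (input) "KK n \<equiv> bnd (*) bG \<phi>G n I UNIV"
abbreviation (input) "PP n \<equiv> pw (bG n) (UNIV :: 's set)"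
abbreviation (input) "JJ n \<equiv> pw (bG n) I"

lemma smp: "smod (psc ((*) :: 's \<Rightarrow> 's \<Rightarrow> 's))"
  by (rule smod_psc[OF smod_mult])

lemma apair_I: "apair (*) I I UNIV"
  unfolding apair_def using sub_I sub_UNIV by (auto simp: mult.commute dest: sub_sc)

lemma subK: "submod (psc (*)) (KK n)" and subP: "submod (psc (*)) (PP n)" and subJ: "submod (psc (*)) (JJ n)"
  by (rule smod.sub_bnd[OF smod_mult sub_I sub_UNIV], rule sub_pw[OF sub_UNIV smod_mult], rule sub_pw[OF sub_I smod_mult])

lemma JK: "JJ n \<subseteq> KK n"
  by (rule smod.pw_bnd[OF smod_mult sub_UNIV])

lemma KP: "KK n \<subseteq> PP n"
  by (rule order_trans[OF smod.bnd_cyc[OF smod_mult cG apair_I] smod.cyc_pw[OF smod_mult]])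

lemma JP: "apair (psc (*)) I (JJ n) (PP n)"
  unfolding apair_def
proof (intro conjI subJ subP pw_mono subset_UNIV ballI)
  fix s u assume s: "s \<in> I" and u: "u \<in> PP n"
  have "s * v \<in> I" for v using sub_sc[OF sub_I s, of v] by (simp add: mult.commute)
  then show "psc (*) s u \<in> JJ n" using pwD0[OF u] by (simp add: pw_def)
qed

lemma apair_JK: "apair (psc (*)) I (JJ n) (KK n)" by (rule apair_left[OF JP subK JK KP])
lemma apair_KP: "apair (psc (*)) I (KK n) (PP n)" by (rule apair_right[OF JP subK JK KP])

text \<open>Exactness modulo \<open>I\<close>: the differential identifies the cokernel
  \<open>PP (k+1) / KK (k+1)\<close> with its image \<open>KK k / JJ k\<close>.\<close>

lemma syzygy_iso: "bet (psc (*)) b \<phi> n (JJ k) (KK k) = bet (psc (*)) b \<phi> n (KK (Suc k)) (PP (Suc k))" if c: "is_cpx I b \<phi>"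
proof (rule bet_iso[where f = "mm (*) (bG k) (bG (Suc k)) (\<phi>G k)", OF smp smp c apair_KP apair_JK smod.addv_mm[OF smod_mult] smod.mm_psc[OF smod_mult]])
  let ?d = "mm (*) (bG k) (bG (Suc k)) (\<phi>G k)"
  show "?d ` PP (Suc k) \<subseteq> KK k" using smod.mm_bnd[OF smod_mult sub_I, where b = bG and n = k] by blast
  show "?d ` KK (Suc k) \<subseteq> JJ k" unfolding exG[symmetric] by (auto simp: cyc_def)
  show "KK k \<subseteq> ?d ` PP (Suc k) \<boxplus> JJ k" by (simp add: bnd_def)
  show "x \<in> KK (Suc k)" if "x \<in> PP (Suc k)" "?d x \<in> JJ k" for x
    unfolding exG[symmetric] using that by (simp add: cyc_def)
qed

lemma acyclic_free: "bet (psc (*)) bF \<phi>F (Suc n) (JJ k) (PP k) = 0"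
proof -
  interpret L: lmod I N "(*)" unfolding lmod_def using lring_axioms smod_mult by blast
  have "bet (psc (*)) bF \<phi>F (Suc n) (JJ k) (PP k) \<le> enat (bG k) * bet (*) bF \<phi>F (Suc n) I UNIV"
    by (rule smod.bet_pw[OF smod_mult L.F_cpx[OF F] apair_I])
  then show ?thesis unfolding L.F_acyclic[OF F] by simp
qed

lemma cpx_F: "is_cpx I bF \<phi>F"
  by (rule resol_cpx[OF F sub_I])

text \<open>Free modules are acyclic for \<open>F\<close>, so the connecting map embeds Tor into the
  Tor of the syzygy one degree lower, and \<open>syzygy_iso\<close> rewrites the syzygy as the next
  cokernel.\<close>

lemma dim_shift: "bet (psc (*)) bF \<phi>F (Suc n) (KK k) (PP k) \<le> bet (psc (*)) bF \<phi>F 1 (KK (k + n)) (PP (k + n))"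
proof (induction n arbitrary: k)
  case (Suc n)
  have "bet (psc (*)) bF \<phi>F (Suc (Suc n)) (KK k) (PP k) \<le> bet (psc (*)) bF \<phi>F (Suc (Suc n)) (JJ k) (PP k) + bet (psc (*)) bF \<phi>F (Suc n) (JJ k) (KK k)"
    by (rule smod.bet_quot[OF smp cpx_F JP subK JK KP])
  also have "\<dots> = bet (psc (*)) bF \<phi>F (Suc n) (KK (Suc k)) (PP (Suc k))"
    unfolding acyclic_free syzygy_iso[OF cpx_F] by simp
  also have "\<dots> \<le> bet (psc (*)) bF \<phi>F 1 (KK (Suc k + n)) (PP (Suc k + n))" by (rule Suc.IH)
  finally show ?case by (simp only: add_Suc_right add_Suc)
qed simp

lemma NK_gens: "s \<in> N \<Longrightarrow> u \<in> KK n \<Longrightarrow> psc (*) s u \<in> smod.am (psc (*)) a t (KK n) \<boxplus> JJ n"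
  by (rule glmod.N_am[OF glmod_I[OF smp] JP _ _ subK KP])

lemma sub_NK: "submod (psc (*)) (smod.am (psc (*)) a t (KK n) \<boxplus> JJ n)"
  by (rule sub_ssum'[OF smod.sub_am[OF smp subK] subJ smod.addops_sc[OF smp]])

text \<open>\<open>Tor\<^sub>1(k, P/K) = ker(K/mK \<rightarrow> P/mP)\<close>.\<close>

lemma tor_1_le: "bet (psc (*)) bF \<phi>F 1 (KK n) (PP n)
   \<le> rlen (range (psc (*))) (smod.am (psc (*)) a t (KK n) \<boxplus> JJ n) (KK n \<inter> pw (bG n) N)"
proof -
  interpret Q: lmod I N "psc (*)" unfolding lmod_def using lring_axioms smp by blast
  let ?O = "range (psc (psc (*) :: 's \<Rightarrow> (nat \<Rightarrow> 's) \<Rightarrow> _))"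
  let ?d = "mm (psc (*)) (bF 0) (bF 1) (\<phi>F 0)"
  \<comment> \<open>Modulo \<open>?V\<close> this is the kernel of the map from
    \<open>k \<otimes> K\<close> to \<open>k \<otimes> P\<close>, both computed with the resolution
    of \<open>k\<close>. The differential embeds \<open>Tor_1\<close> into it.\<close>
  let ?Y = "{y \<in> pw (bF 0) (KK n). y \<in> bnd (psc (*)) bF \<phi>F 0 (JJ n) (PP n)}"
  let ?V = "bnd (psc (*)) bF \<phi>F 0 (JJ n) (KK n)"
  have VY: "?V \<subseteq> ?Y"
  proof -
    have "?V \<subseteq> pw (bF 0) (KK n)" using Q.bnd_cyc[OF cpx_F apair_JK, of 0] by (simp add: cyc_def)
    then show ?thesis using Q.bnd_mono[OF order_refl KP] by blast
  qed
  have sY: "sub ?O ?Y"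
    using sub_Int[OF Q.sub_pw'[OF subK] Q.sub_bnd[OF subJ subP]] by (simp add: Int_def)
  have sV: "sub ?O ?V" by (rule Q.sub_bnd[OF subJ subK])
  have acyc: "cyc (psc (*)) bF \<phi>F 1 (JJ n) (PP n) \<subseteq> bnd (psc (*)) bF \<phi>F 1 (JJ n) (PP n)"
    using bet_0_D[OF smp JP acyclic_free[of 0]] Q.bnd_cyc[OF cpx_F JP, of 1] by simp
  have "bet (psc (*)) bF \<phi>F 1 (KK n) (PP n) \<le> rlen ?O ?V ?Y"
    unfolding bet_def
  proof (rule rlen_le_inj[OF Q.itw_mm Q.addops_psc Q.sub_bnd[OF subK subP] sV sY _ VY Q.bnd_cyc[OF cpx_F apair_KP]])
    show "?d ` cyc (psc (*)) bF \<phi>F 1 (KK n) (PP n) \<subseteq> ?Y"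
      using Q.mm_bnd[OF subJ, where b = bF and n = 0] by (auto simp: cyc_def)
    fix x assume x: "x \<in> cyc (psc (*)) bF \<phi>F 1 (KK n) (PP n)" "?d x \<in> ?V"
    have xP: "x \<in> pw (bF 1) (PP n)" using x(1) Q.cyc_pw by blast
    obtain u v where uv: "u \<in> pw (bF (Suc 0)) (KK n)" "v \<in> pw (bF 0) (JJ n)" "?d x = mm (psc (*)) (bF 0) (bF (Suc 0)) (\<phi>F 0) u + v"
      using x(2) by (rule Q.bndE)
    have uP: "u \<in> pw (bF 1) (PP n)" using uv(1) pw_mono[OF KP] by auto
    have "?d (x - u) = v" unfolding addv_diff[OF Q.addv_mm] uv(3) by simp
    then have "x - u \<in> cyc (psc (*)) bF \<phi>F 1 (JJ n) (PP n)"
      using uv(2) sub_diff[OF Q.sub_pw'[OF subP] xP uP] by (simp add: cyc_def)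
    then have "x - u \<in> bnd (psc (*)) bF \<phi>F 1 (KK n) (PP n)" using acyc Q.bnd_mono[OF JK order_refl] by blast
    moreover have "u \<in> bnd (psc (*)) bF \<phi>F 1 (KK n) (PP n)" using uv(1) Q.pw_bnd[OF subP, where b = bF and n = 1] by auto
    ultimately show "x \<in> bnd (psc (*)) bF \<phi>F 1 (KK n) (PP n)" by (rule sub_diff_cancel[OF Q.sub_bnd[OF subK subP]])
  qed
  also have "\<dots> \<le> rlen (range (psc (*))) (smod.am (psc (*)) a t (KK n) \<boxplus> JJ n) (KK n \<inter> pw (bG n) N)"
  proof -
    \<comment> \<open>Evaluation at the generators of \<open>k\<close> identifies the homology in
      degree 0 with the tensor product; \<open>right_exact\<close> supplies its injectivity.\<close>
    define \<sigma> where "\<sigma> y = (\<Sum>i<bF 0. psc (*) (gF i) (y i))" for y :: "nat \<Rightarrow> nat \<Rightarrow> 's"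
    have ad: "addv \<sigma>" unfolding \<sigma>_def addv_def plus_fun_apply Q.sc_add sum.distrib by blast
    have it: "itw ?O (range (psc (*))) \<sigma>"
    proof (rule itw_lin[OF ad])
      fix s and y :: "nat \<Rightarrow> nat \<Rightarrow> 's"
      show "\<sigma> (psc (psc (*)) s y) = psc (*) s (\<sigma> y)"
        unfolding \<sigma>_def Q.sc_sum by (rule sum.cong[OF refl]) (simp only: psc_apply Q.sc_commute)
    qed
    have sN: "submod (psc (*)) (pw (bG n) N)" by (rule sub_pw[OF sub_N smod_mult])
    \<comment> \<open>The columns of the first differential are relations between the generators of
      \<open>k\<close>, so they evaluate into \<open>N\<close>.\<close>
    have inN: "\<sigma> y \<in> pw (bG n) N" if y: "y \<in> bnd (psc (*)) bF \<phi>F 0 (JJ n) (PP n)" for y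
    proof -
      obtain u v where uv: "u \<in> pw (bF (Suc 0)) (PP n)" "v \<in> pw (bF 0) (JJ n)" "y = mm (psc (*)) (bF 0) (bF (Suc 0)) (\<phi>F 0) u + v"
        using y by (rule Q.bndE)
      have c: "(\<Sum>i<bF 0. gF i * \<phi>F 0 i k) \<in> N" if k: "k < bF (Suc 0)" for k
      proof -
        have d1: "dlt k (1::'s) \<in> pw (bF (Suc 0)) UNIV" by (rule dlt_pw[OF k]) simp_all
        let ?m = "mm (*) (bF 0) (bF (Suc 0)) (\<phi>F 0) (dlt k 1)"
        have "?m \<in> bnd (*) bF \<phi>F 0 I UNIV" by (rule smod.mm_bnd[where b = bF and n = 0, OF smod_mult sub_I d1])
        moreover have "?m \<in> pw (bF 0) UNIV" by (rule smod.mm_pw[OF smod_mult sub_UNIV d1])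
        ultimately have "lc (*) (bF 0) gF ?m \<in> N" using F unfolding resol_def by blast
        also have "lc (*) (bF 0) gF ?m = (\<Sum>i<bF 0. gF i * \<phi>F 0 i k)"
          unfolding lc_def by (rule sum.cong[OF refl]) (simp add: mm_dlt[OF k] mult.commute)
        finally show ?thesis .
      qed
      have "\<sigma> (mm (psc (*)) (bF 0) (bF (Suc 0)) (\<phi>F 0) u) = (\<Sum>i<bF 0. \<Sum>k<bF (Suc 0). psc (*) (gF i * \<phi>F 0 i k) (u k))"
        unfolding \<sigma>_def
      proof (rule sum.cong[OF refl])
        fix i assume "i \<in> {..<bF 0}"
        then have "mm (psc (*)) (bF 0) (bF (Suc 0)) (\<phi>F 0) u i = (\<Sum>k<bF (Suc 0). psc (*) (\<phi>F 0 i k) (u k))" by (simp add: mm_def)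
        then show "psc (*) (gF i) (mm (psc (*)) (bF 0) (bF (Suc 0)) (\<phi>F 0) u i) = (\<Sum>k<bF (Suc 0). psc (*) (gF i * \<phi>F 0 i k) (u k))"
          by (simp only: Q.sc_sum Q.sc_mult)
      qed
      also have "\<dots> = (\<Sum>k<bF (Suc 0). psc (*) (\<Sum>i<bF 0. gF i * \<phi>F 0 i k) (u k))"
        unfolding Q.sc_sum_left by (rule sum.swap)
      also have "\<dots> \<in> pw (bG n) N"
      proof (rule sub_sum[OF sN])
        fix k assume "k \<in> {..<bF (Suc 0)}"
        then have k: "k < bF (Suc 0)" by simp
        show "psc (*) (\<Sum>i<bF 0. gF i * \<phi>F 0 i k) (u k) \<in> pw (bG n) N"
          using sub_sc[OF sub_N c[OF k]] pwD[OF uv(1) k] by (simp add: pw_def mult.commute)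
      qed
      finally have "\<sigma> (mm (psc (*)) (bF 0) (bF (Suc 0)) (\<phi>F 0) u) \<in> pw (bG n) N" .
      moreover have "\<sigma> v \<in> pw (bG n) N" unfolding \<sigma>_def
      proof (rule sub_sum[OF sN])
        fix i assume "i \<in> {..<bF 0}"
        then have "v i \<in> pw (bG n) N" using pwD[OF uv(2), of i] pw_mono[OF IN] by auto
        then show "psc (*) (gF i) (v i) \<in> pw (bG n) N" by (rule sub_sc[OF sN])
      qed
      ultimately show ?thesis unfolding uv(3) addv_add[OF ad] by (rule sub_add[OF sN])
    qed
    show ?thesis
    proof (rule rlen_le_inj[OF it Q.addops_sc sV sub_NK sub_Int[OF subK sN] _ _ VY])
      show "\<sigma> ` ?Y \<subseteq> KK n \<inter> pw (bG n) N"
      proof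
        fix z assume "z \<in> \<sigma> ` ?Y"
        then obtain y where y: "y \<in> ?Y" "z = \<sigma> y" by (rule imageE)
        have "\<sigma> y \<in> KK n" unfolding \<sigma>_def
          by (rule sub_sum[OF subK]) (rule sub_sc[OF subK], use y(1) in \<open>auto dest: pwD\<close>)
        then show "z \<in> KK n \<inter> pw (bG n) N" using inN y by simp
      qed
      have "smod.am (psc (*)) a t (KK n) \<subseteq> pw (bG n) N"
      proof
        fix z assume "z \<in> smod.am (psc (*)) a t (KK n)"
        then obtain u where u: "\<forall>i<t. u i \<in> KK n" "z = (\<Sum>i<t. psc (*) (a i) (u i))" unfolding Q.am_def by blast
        show "z \<in> pw (bG n) N" unfolding u(2)
        proof (rule sub_sum[OF sN])
          fix i assume "i \<in> {..<t}"
          then have i: "a i \<in> N" "u i \<in> PP n" using aN u(1) KP by auto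
          have "a i * v \<in> N" for v using sub_sc[OF sub_N i(1), of v] by (simp add: mult.commute)
          then show "psc (*) (a i) (u i) \<in> pw (bG n) N" using pwD0[OF i(2)] by (simp add: pw_def)
        qed
      qed
      then show "smod.am (psc (*)) a t (KK n) \<boxplus> JJ n \<subseteq> KK n \<inter> pw (bG n) N"
        by (intro Int_greatest ssum_least[OF subK Q.am_subset[OF subK] JK] ssum_least[OF sN _ pw_mono[OF IN]])
      fix y assume y: "y \<in> ?Y" "\<sigma> y \<in> smod.am (psc (*)) a t (KK n) \<boxplus> JJ n"
      show "y \<in> ?V" by (rule Q.right_exact[OF F apair_JK NK_gens aN _ y(2)[unfolded \<sigma>_def]]) (use y(1) in simp_all)
    qed
  qed
  finally show ?thesis .
qed

text \<open>The differential maps the cycles of \<open>G \<otimes> k\<close> in degree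
  \<open>n + 1\<close> onto the elements of \<open>KK n\<close> with coordinates in
  \<open>N\<close>, and the boundaries into \<open>m KK n\<close>, up to
  \<open>JJ n\<close>.\<close>

lemma tor_1_le_bet: "rlen (range (psc (*))) (smod.am (psc (*)) a t (KK n) \<boxplus> JJ n) (KK n \<inter> pw (bG n) N) \<le> bet (*) bG \<phi>G (Suc n) N UNIV"
  unfolding bet_def
proof (rule rlen_le_surj[OF smod.itw_mm[OF smod_mult] smod.sub_cyc[OF smod_mult sub_N sub_UNIV] sub_NK _ _ smod.bnd_cyc[OF smod_mult cG apair_k]])
  let ?d = "mm (*) (bG n) (bG (Suc n)) (\<phi>G n)"
  let ?NK = "smod.am (psc (*)) a t (KK n) \<boxplus> JJ n"
  have sN: "submod (psc (*)) (pw (bG n) N)" by (rule sub_pw[OF sub_N smod_mult])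
  have JNK: "JJ n \<subseteq> ?NK" by (rule ssum_right[OF sub_0[OF smod.sub_am[OF smp subK]]])
  show "KK n \<inter> pw (bG n) N \<subseteq> ?d ` cyc (*) bG \<phi>G (Suc n) N UNIV \<boxplus> ?NK"
  proof
    fix y assume y: "y \<in> KK n \<inter> pw (bG n) N"
    then obtain u v where uv: "u \<in> PP (Suc n)" "v \<in> JJ n" "y = ?d u + v" by (auto elim: smod.bndE[OF smod_mult])
    have "v \<in> pw (bG n) N" using uv(2) pw_mono[OF IN] by blast
    then have "?d u \<in> pw (bG n) N" using sub_add_cancel[OF sN, of "?d u" v] y unfolding uv(3) by blast
    then have "u \<in> cyc (*) bG \<phi>G (Suc n) N UNIV" using uv(1) by (simp add: cyc_def)
    then show "y \<in> ?d ` cyc (*) bG \<phi>G (Suc n) N UNIV \<boxplus> ?NK" unfolding uv(3) using JNK uv(2) by (intro ssumI imageI) auto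
  qed
  show "?d ` bnd (*) bG \<phi>G (Suc n) N UNIV \<subseteq> ?NK"
  proof
    fix y assume "y \<in> ?d ` bnd (*) bG \<phi>G (Suc n) N UNIV"
    then obtain x where x: "x \<in> bnd (*) bG \<phi>G (Suc n) N UNIV" "y = ?d x" by (rule imageE)
    obtain u w where uw: "u \<in> PP (Suc (Suc n))" "w \<in> pw (bG (Suc n)) N" "x = mm (*) (bG (Suc n)) (bG (Suc (Suc n))) (\<phi>G (Suc n)) u + w"
      using x(1) by (rule smod.bndE[OF smod_mult])
    have "?d (mm (*) (bG (Suc n)) (bG (Suc (Suc n))) (\<phi>G (Suc n)) u) \<in> JJ n"
      by (rule smod.mm_mm[OF smod_mult cG apair_I uw(1)])
    moreover have "?d w \<in> ?NK"
    proof -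
      have wU: "w \<in> pw (bG (Suc n)) UNIV" using uw(2) pw_mono[OF subset_UNIV] by blast
      show ?thesis unfolding mm_basis[OF wU]
      proof (rule sub_sum[OF sub_NK])
        fix k assume "k \<in> {..<bG (Suc n)}"
        then have k: "k < bG (Suc n)" by simp
        have "dlt k (1::'s) \<in> PP (Suc n)" by (rule dlt_pw[OF k]) simp_all
        then have "?d (dlt k 1) \<in> KK n" by (rule smod.mm_bnd[OF smod_mult sub_I])
        with pwD[OF uw(2) k] show "psc (*) (w k) (?d (dlt k 1)) \<in> ?NK" by (rule NK_gens)
      qed
    qed
    ultimately show "y \<in> ?NK" unfolding x(2) uw(3) addv_add[OF smod.addv_mm[OF smod_mult]]
      using JNK by (intro sub_add[OF sub_NK]) auto
  qed
qed

end

text \<open>Dimension shifting reduces the left side to \<open>Tor_1\<close> of \<open>k\<close>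
  with the cokernel \<open>PP n / KK n\<close>, which is compared with the homology of
  \<open>G \<otimes> k\<close>. Positive degrees suffice for statements about growth.\<close>

theorem balance:
  fixes sc :: "'s \<Rightarrow> 'x::ab_group_add \<Rightarrow> 'x"
  assumes sc: "smod sc" and p: "apair sc I V U" and F: "resol (*) I N UNIV bF gF \<phi>F" and G: "resol sc I V U bG gG \<phi>G"
  shows "bet sc bF \<phi>F (Suc n) V U \<le> bet (*) bG \<phi>G (Suc n) N UNIV"
proof -
  have cG: "is_cpx I bG \<phi>G" by (rule resol_cpx[OF G sub_I])
  have exG: "cyc (*) bG \<phi>G (Suc n) I UNIV = bnd (*) bG \<phi>G (Suc n) I UNIV" for n using G unfolding resol_def by blast
  note facts = F cG exG
  let ?K = "bnd (*) bG \<phi>G 0 I UNIV" and ?P = "pw (bG 0) (UNIV :: 's set)"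
  have ker: "lc sc (bG 0) gG c \<in> V \<longleftrightarrow> c \<in> ?K" if "c \<in> ?P" for c using G that unfolding resol_def by blast
  have KP': "?K \<subseteq> ?P" by (rule KP[OF facts])
  have "bet sc bF \<phi>F (Suc n) V U = bet (psc (*)) bF \<phi>F (Suc n) ?K ?P"
  proof (rule bet_iso[where f = "lc sc (bG 0) gG", OF smp[OF facts] sc cpx_F[OF facts] apair_KP[OF facts] p smod.addv_lc[OF sc] smod.lc_psc[OF sc]])
    show "lc sc (bG 0) gG ` ?P \<subseteq> U"
    proof
      fix y assume "y \<in> lc sc (bG 0) gG ` ?P"
      then obtain c where c: "y = lc sc (bG 0) gG c" by blast
      show "y \<in> U" unfolding c by (rule smod.lc_in[OF sc apairD(2)[OF p]]) (use G in \<open>auto simp: resol_def\<close>)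
    qed
    show "lc sc (bG 0) gG ` ?K \<subseteq> V" using ker KP' by blast
    show "U \<subseteq> lc sc (bG 0) gG ` ?P \<boxplus> V"
    proof
      fix u assume "u \<in> U"
      then obtain c where c: "c \<in> ?P" "u - lc sc (bG 0) gG c \<in> V" using G unfolding resol_def by blast
      have "lc sc (bG 0) gG c + (u - lc sc (bG 0) gG c) \<in> lc sc (bG 0) gG ` ?P \<boxplus> V" by (rule ssumI[OF imageI[OF c(1)] c(2)])
      then show "u \<in> lc sc (bG 0) gG ` ?P \<boxplus> V" by simp
    qed
    show "x \<in> ?K" if "x \<in> ?P" "lc sc (bG 0) gG x \<in> V" for x using ker that by blast
  qed
  also have "\<dots> \<le> bet (psc (*)) bF \<phi>F 1 (bnd (*) bG \<phi>G n I UNIV) (pw (bG n) UNIV)"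
    using dim_shift[OF facts, of n 0] by simp
  also have "\<dots> \<le> rlen (range (psc (*))) (smod.am (psc (*)) a t (bnd (*) bG \<phi>G n I UNIV) \<boxplus> pw (bG n) I) (bnd (*) bG \<phi>G n I UNIV \<inter> pw (bG n) N)"
    by (rule tor_1_le[OF facts])
  also have "\<dots> \<le> bet (*) bG \<phi>G (Suc n) N UNIV" by (rule tor_1_le_bet[OF facts])
  finally show ?thesis .
qed

end

subsection \<open>Chains of primes\<close>

definition pri :: "'s::comm_ring_1 set \<Rightarrow> 's set \<Rightarrow> bool" where
  "pri I P \<longleftrightarrow> submod (*) P \<and> I \<subseteq> P \<and> 1 \<notin> P \<and> (\<forall>s t. s * t \<in> P \<longrightarrow> s \<in> P \<or> t \<in> P)"

lemma sub_multiples: "submod (*) (range (\<lambda>c. c * (s :: 's::comm_ring_1)))"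
proof (rule sub_scI)
  show "0 \<in> range (\<lambda>c. c * s)" by (rule range_eqI[of _ _ 0]) simp
  show "x - y \<in> range (\<lambda>c. c * s)" if "x \<in> range (\<lambda>c. c * s)" "y \<in> range (\<lambda>c. c * s)" for x y
    using that by (auto simp: left_diff_distrib[symmetric])
  show "r * x \<in> range (\<lambda>c. c * s)" if "x \<in> range (\<lambda>c. c * s)" for r x
    using that by (auto simp: mult.assoc[symmetric])
qed

text \<open>Krull's argument: an ideal maximal among those that miss the multiplicative set
  \<open>S\<close> is prime. Two elements outside it would give two members of \<open>S\<close>
  whose product lies in the ideal.\<close>

lemma prime_avoiding:
  fixes I :: "'s::comm_ring_1 set"
  assumes no: "noeth (range (*)) I UNIV" and J: "submod (*) J" "I \<subseteq> J" and S: "1 \<in> S" "\<And>s t. s \<in> S \<Longrightarrow> t \<in> S \<Longrightarrow> s * t \<in> S" "J \<inter> S = {}"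
  shows "\<exists>P. pri I P \<and> J \<subseteq> P \<and> P \<inter> S = {}"
proof -
  interpret R: smod "(*) :: 's \<Rightarrow> _" by (rule smod_mult)
  let ?F = "{W. submod (*) W \<and> J \<subseteq> W \<and> W \<inter> S = {}}"
  have "\<exists>W\<in>?F. \<forall>W'\<in>?F. W \<subseteq> W' \<longrightarrow> W' = W"
  proof (rule noeth_max[OF no])
    show "?F \<noteq> {}" using J S(3) by blast
    show "submod (*) W \<and> I \<subseteq> W \<and> W \<subseteq> UNIV" if "W \<in> ?F" for W using that J(2) by blast
  qed
  then obtain P where PF: "P \<in> ?F" and mF: "\<forall>W'\<in>?F. P \<subseteq> W' \<longrightarrow> W' = P" by (rule bexE)
  have P: "submod (*) P" "J \<subseteq> P" "P \<inter> S = {}" using PF by simp_all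
  have mx: "W = P" if "submod (*) W" "J \<subseteq> W" "W \<inter> S = {}" "P \<subseteq> W" for W
    by (rule bspec[OF mF, THEN mp]) (use that in simp_all)
  have meet: "\<exists>q\<in>P. \<exists>c. q + c * s \<in> S" if s: "s \<notin> P" for s
  proof (rule ccontr)
    assume n: "\<not> ?thesis"
    let ?W = "P \<boxplus> range (\<lambda>c. c * s)"
    have W: "submod (*) ?W" by (rule sub_ssum'[OF P(1) sub_multiples R.addops_sc])
    have PW: "P \<subseteq> ?W" by (rule ssum_left[OF sub_0[OF sub_multiples]])
    have "?W \<inter> S = {}" using n by (auto elim!: ssumE)
    then have "?W = P" by (rule mx[OF W order_trans[OF P(2) PW] _ PW])
    moreover have "0 + 1 * s \<in> ?W" by (rule ssumI[OF sub_0[OF P(1)]]) (rule rangeI)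
    ultimately show False using s by simp
  qed
  have "pri I P"
    unfolding pri_def
  proof (intro conjI allI impI)
    show "I \<subseteq> P" using J(2) P(2) by blast
    show "1 \<notin> P" using S(1) P(3) by blast
    fix s t assume st: "s * t \<in> P"
    show "s \<in> P \<or> t \<in> P"
    proof (rule ccontr)
      assume "\<not> ?thesis"
      then obtain q c q' c' where q: "q \<in> P" "q + c * s \<in> S" "q' \<in> P" "q' + c' * t \<in> S" using meet by blast
      have e: "(q + c * s) * (q' + c' * t) = (q' + c' * t) * q + (c * s) * q' + (c * c') * (s * t)" by (simp add: algebra_simps)
      have "(q' + c' * t) * q + (c * s) * q' + (c * c') * (s * t) \<in> P"
        by (intro sub_add[OF P(1)] sub_sc[OF P(1)] q st)
      then show False unfolding e[symmetric] using S(2)[OF q(2,4)] P(3) by blast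
    qed
  qed (rule P(1))
  then show ?thesis using P by blast
qed

context lmod
begin

definition ann :: "'x set \<Rightarrow> 'x set \<Rightarrow> 's set" where
  "ann V U = {s. \<forall>u\<in>U. sc s u \<in> V}"

lemma sub_ann: assumes V: "ssub V" shows "submod (*) (ann V U)"
proof (rule sub_scI)
  show "0 \<in> ann V U" using sub_0[OF V] by (simp add: ann_def sc_0_left)
  show "x - y \<in> ann V U" if "x \<in> ann V U" "y \<in> ann V U" for x y
    using that sub_diff[OF V] by (simp add: ann_def sc_diff_left)
  show "r * x \<in> ann V U" if "x \<in> ann V U" for r x
    using that sub_sc[OF V] by (simp add: ann_def sc_mult)
qed

text \<open>A regular element makes the support larger: below a prime containing the annihilator of
  \<open>U/(V + x U)\<close> there is a strictly smaller one containing the annihilator of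
  \<open>U/V\<close>. The two differ by \<open>x\<close>.\<close>

lemma prime_drop:
  assumes noI: "noeth (range (*)) I UNIV" and p: "apair sc I V U"
    and reg: "\<And>u. u \<in> U \<Longrightarrow> sc x u \<in> V \<Longrightarrow> u \<in> V"
    and P: "pri I P" "ann (V \<boxplus> sc x ` U) U \<subseteq> P"
  shows "\<exists>P'. pri I P' \<and> ann V U \<subseteq> P' \<and> P' \<subset> P"
proof -
  note V = apairD(1)[OF p] and U = apairD(2)[OF p]
  have P': "submod (*) P" "1 \<notin> P" "\<And>s t. s * t \<in> P \<Longrightarrow> s \<in> P \<or> t \<in> P" using P(1) unfolding pri_def by blast+
  \<comment> \<open>Missing this set forces the new prime inside \<open>P\<close> and away from
    \<open>x\<close>. The annihilator misses it because powers of \<open>x\<close> can be cancelled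
    on \<open>U/V\<close>.\<close>
  let ?S = "{x ^ i * s | i s. s \<notin> P}"
  have regi: "u \<in> V" if "u \<in> U" "sc (x ^ i) u \<in> V" for i u using that
  proof (induction i)
    case (Suc i)
    have "sc x (sc (x ^ i) u) \<in> V" using Suc.prems(2) by (simp add: sc_mult)
    then show ?case using Suc.IH[OF Suc.prems(1)] reg[OF sub_sc[OF U Suc.prems(1)]] by blast
  qed (simp add: sc_one)
  have VX: "V \<subseteq> V \<boxplus> sc x ` U"
  proof (rule ssum_left)
    have "sc x 0 \<in> sc x ` U" by (rule imageI[OF sub_0[OF U]])
    then show "0 \<in> sc x ` U" by (simp add: sc_0)
  qed
  have "\<exists>P'. pri I P' \<and> ann V U \<subseteq> P' \<and> P' \<inter> ?S = {}"
  proof (rule prime_avoiding[OF noI sub_ann[OF V]])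
    show "I \<subseteq> ann V U" using apairD(4)[OF p] by (auto simp: ann_def)
    have "x ^ 0 * 1 \<in> ?S" using P'(2) by blast
    then show "1 \<in> ?S" by simp
    show "s * t \<in> ?S" if st: "s \<in> ?S" "t \<in> ?S" for s t
    proof -
      obtain i j s' t' where e: "s = x ^ i * s'" "t = x ^ j * t'" "s' \<notin> P" "t' \<notin> P" using st by blast
      have "s * t = x ^ (i + j) * (s' * t')" by (simp add: e power_add mult_ac)
      moreover have "s' * t' \<notin> P" using P'(3) e by blast
      ultimately show ?thesis by blast
    qed
    show "ann V U \<inter> ?S = {}"
    proof (rule ccontr)
      assume "\<not> ?thesis"
      then obtain i s where s: "x ^ i * s \<in> ann V U" "s \<notin> P" by blast
      have "sc s u \<in> V" if u: "u \<in> U" for u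
        by (rule regi[OF sub_sc[OF U u], of i]) (use s(1) u in \<open>simp add: ann_def sc_mult\<close>)
      then have "s \<in> ann (V \<boxplus> sc x ` U) U" using VX by (auto simp: ann_def)
      then show False using s(2) P(2) by blast
    qed
  qed
  then obtain P' where Q: "pri I P'" "ann V U \<subseteq> P'" "P' \<inter> ?S = {}" by blast
  have "s \<in> P" if "s \<in> P'" for s
  proof (rule ccontr)
    assume "s \<notin> P"
    then have "x ^ 0 * s \<in> ?S" by blast
    then show False using that Q(3) by auto
  qed
  moreover have "x \<in> P"
  proof -
    have "sc x u \<in> V \<boxplus> sc x ` U" if "u \<in> U" for u
      by (rule subsetD[OF ssum_right[OF sub_0[OF V]] imageI[OF that]])
    then show ?thesis using P(2) by (auto simp: ann_def)
  qed
  moreover have "x \<notin> P'"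
  proof
    assume "x \<in> P'"
    moreover have "x ^ 1 * 1 \<in> ?S" using P'(2) by blast
    ultimately show False using Q(3) by auto
  qed
  ultimately have "P' \<subset> P" by blast
  then show ?thesis using Q by blast
qed

text \<open>\<open>X\<close> is maximal with \<open>U/X\<close> of infinite length. If
  \<open>s r\<close> annihilates \<open>U/X\<close> but neither factor does, then
  \<open>(X + s U)/X\<close> is an image of \<open>U/(X + r U)\<close>, and both layers of
  \<open>U/X\<close> are finite; so the annihilator is prime. It is not \<open>N\<close>, since a
  noetherian module killed by \<open>N\<close> has finite length.\<close>

lemma prime_top:
  assumes p: "apair sc I V U" and no: "noe V U" and inf: "len V U = \<infinity>"
  shows "\<exists>P. pri I P \<and> ann V U \<subseteq> P \<and> P \<subset> N"
proof -
  note V = apairD(1)[OF p] and U = apairD(2)[OF p]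
  let ?F = "{W. ssub W \<and> V \<subseteq> W \<and> W \<subseteq> U \<and> len W U = \<infinity>}"
  have "\<exists>W\<in>?F. \<forall>W'\<in>?F. W \<subseteq> W' \<longrightarrow> W' = W"
  proof (rule noeth_max[OF no])
    have "V \<in> ?F" using V apairD(3)[OF p] inf by simp
    then show "?F \<noteq> {}" by blast
    show "ssub W \<and> V \<subseteq> W \<and> W \<subseteq> U" if "W \<in> ?F" for W using that by simp
  qed
  then obtain X where XF: "X \<in> ?F" and mF: "\<forall>W'\<in>?F. X \<subseteq> W' \<longrightarrow> W' = X" by (rule bexE)
  have X: "ssub X" "V \<subseteq> X" "X \<subseteq> U" "len X U = \<infinity>" using XF by simp_all
  have mx: "W = X" if "ssub W" "V \<subseteq> W" "W \<subseteq> U" "len W U = \<infinity>" "X \<subseteq> W" for W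
    by (rule bspec[OF mF, THEN mp]) (use that in simp_all)
  have pX: "apair sc I X U" by (rule apair_right[OF p X(1-3)])
  have fin: "len (X \<boxplus> sc s ` U) U \<noteq> \<infinity>" "ssub (X \<boxplus> sc s ` U)" "X \<subseteq> X \<boxplus> sc s ` U" "X \<boxplus> sc s ` U \<subseteq> U" if s: "s \<notin> ann X U" for s
  proof -
    have sU: "ssub (sc s ` U)"
      by (rule sub_image[OF U itw_lin[OF addv_sc]]) (rule sc_commute)
    show W: "ssub (X \<boxplus> sc s ` U)" by (rule sub_ssum'[OF X(1) sU addops_sc])
    show XW: "X \<subseteq> X \<boxplus> sc s ` U" by (rule ssum_left[OF sub_0[OF sU]])
    show WU: "X \<boxplus> sc s ` U \<subseteq> U" by (rule ssum_least[OF U X(3)]) (use sub_sc[OF U] in blast)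
    obtain u where u: "u \<in> U" "sc s u \<notin> X" using s by (auto simp: ann_def)
    have "sc s u \<in> X \<boxplus> sc s ` U" by (rule subsetD[OF ssum_right[OF sub_0[OF X(1)]] imageI[OF u(1)]])
    then have "X \<boxplus> sc s ` U \<noteq> X" using u(2) by blast
    then show "len (X \<boxplus> sc s ` U) U \<noteq> \<infinity>" using mx[OF W order_trans[OF X(2) XW] WU _ XW] by blast
  qed
  have "pri I (ann X U)"
    unfolding pri_def
  proof (intro conjI allI impI)
    show "submod (*) (ann X U)" by (rule sub_ann[OF X(1)])
    show "I \<subseteq> ann X U" using apairD(4)[OF pX] by (auto simp: ann_def)
    show "1 \<notin> ann X U"
    proof
      assume "1 \<in> ann X U"
      then have "U \<subseteq> X" by (auto simp: ann_def sc_one)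
      then show False using rlen_eq0[of U X "range sc"] X(4) by simp
    qed
    fix s r assume sr: "s * r \<in> ann X U"
    show "s \<in> ann X U \<or> r \<in> ann X U"
    proof (rule ccontr)
      assume "\<not> ?thesis"
      then have s: "s \<notin> ann X U" and r: "r \<notin> ann X U" by blast+
      have sX: "sc s ` X \<subseteq> X" using sub_sc[OF X(1)] by blast
      have "len X (X \<boxplus> sc s ` U) \<le> len (X \<boxplus> sc r ` U) U"
      proof (rule rlen_le_surj[OF itw_lin[OF addv_sc] U X(1) _ _ fin(4)[OF r]])
        show "sc s (sc q u) = sc q (sc s u)" for q u by (rule sc_commute)
        show "X \<boxplus> sc s ` U \<subseteq> sc s ` U \<boxplus> X" unfolding ssum_commute[of X] by (rule order_refl)
        show "sc s ` (X \<boxplus> sc r ` U) \<subseteq> X"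
        proof
          fix y assume "y \<in> sc s ` (X \<boxplus> sc r ` U)"
          then obtain z u where zu: "z \<in> X" "u \<in> U" "y = sc s (z + sc r u)" by (auto elim!: ssumE)
          have "sc s (sc r u) \<in> X" using sr zu(2) by (simp add: ann_def sc_mult)
          then show "y \<in> X" unfolding zu(3) sc_add by (rule sub_add[OF X(1) sub_sc[OF X(1) zu(1)]])
        qed
      qed
      then have "len X (X \<boxplus> sc s ` U) \<noteq> \<infinity>" using fin(1)[OF r] by (metis enat_ord_simps(5))
      moreover have "len X U = len X (X \<boxplus> sc s ` U) + len (X \<boxplus> sc s ` U) U"
        by (rule rlen_add'[OF addops_sc X(1) fin(2)[OF s] U fin(3)[OF s] fin(4)[OF s]])
      ultimately show False using fin(1)[OF s] X(4) by (metis plus_eq_infty_iff_enat)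
    qed
  qed
  moreover have "ann X U \<subseteq> N"
  proof
    fix s assume s: "s \<in> ann X U"
    show "s \<in> N"
    proof (rule ccontr)
      assume "s \<notin> N"
      then have "U \<subseteq> X" using unit_cancel[OF pX] s by (auto simp: ann_def)
      then show False using rlen_eq0[of U X "range sc"] X(4) by simp
    qed
  qed
  moreover have "ann X U \<noteq> N"
  proof
    assume "ann X U = N"
    then have "sc s u \<in> X" if "s \<in> N" "u \<in> U" for s u using that by (auto simp: ann_def)
    then have "len X U \<noteq> \<infinity>" by (rule noe_finite_len[OF pX noeth_mono[OF no X(2) order_refl order_refl]])
    then show False using X(4) by blast
  qed
  moreover have "ann V U \<subseteq> ann X U" using X(2) by (auto simp: ann_def)
  ultimately show ?thesis by (intro exI[of _ "ann X U"]) blast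
qed

text \<open>\<open>prime_top\<close> gives a prime for the last quotient, and each of the
  \<open>d\<close> regular elements adds one below it by \<open>prime_drop\<close>:
  \<open>d + 1\<close> primes strictly under \<open>N\<close>.\<close>

lemma prime_chain:
  assumes noI: "noeth (range (*)) I UNIV" and p: "apair sc I V U" and no: "noe V U"
    and reg: "\<And>i u. i < d \<Longrightarrow> u \<in> U \<Longrightarrow> sc (x i) u \<in> vx sc x V U i \<Longrightarrow> u \<in> vx sc x V U i"
    and inf: "len (vx sc x V U d) U = \<infinity>"
  shows "\<exists>P. (\<forall>i\<le>d. pri I (P i)) \<and> (\<forall>i<d. P i \<subset> P (Suc i)) \<and> P d \<subset> N"
proof -
  have v: "ssub (vx sc x V U i)" "V \<subseteq> vx sc x V U i" "vx sc x V U i \<subseteq> U" for i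
    using vx_facts[OF apairD(1,2,3)[OF p]] by blast+
  have pv: "apair sc I (vx sc x V U i) U" for i by (rule apair_right[OF p v])
  have "\<exists>P. (\<forall>i\<le>k. pri I (P i)) \<and> (\<forall>i<k. P i \<subset> P (Suc i)) \<and> P k \<subset> N \<and> ann (vx sc x V U (d - k)) U \<subseteq> P 0" if "k \<le> d" for k
    using that
  proof (induction k)
    case 0
    obtain P where "pri I P" "ann (vx sc x V U d) U \<subseteq> P" "P \<subset> N"
      using prime_top[OF pv noeth_mono[OF no v(2) order_refl order_refl] inf] by blast
    then show ?case by (intro exI[of _ "\<lambda>_. P"]) simp
  next
    case (Suc k)
    then obtain P where P: "\<forall>i\<le>k. pri I (P i)" "\<forall>i<k. P i \<subset> P (Suc i)" "P k \<subset> N" "ann (vx sc x V U (d - k)) U \<subseteq> P 0" by auto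
    let ?j = "d - Suc k"
    have j: "?j < d" "d - k = Suc ?j" using Suc.prems by simp_all
    have "\<exists>P'. pri I P' \<and> ann (vx sc x V U ?j) U \<subseteq> P' \<and> P' \<subset> P 0"
      by (rule prime_drop[OF noI pv reg[OF j(1)]]) (use P(1,4) j(2) in auto)
    then obtain P' where P': "pri I P'" "ann (vx sc x V U ?j) U \<subseteq> P'" "P' \<subset> P 0" by blast
    define Q where "Q i = (case i of 0 \<Rightarrow> P' | Suc i' \<Rightarrow> P i')" for i
    have "\<forall>i\<le>Suc k. pri I (Q i)" using P(1) P'(1) by (auto simp: Q_def split: nat.split)
    moreover have "\<forall>i<Suc k. Q i \<subset> Q (Suc i)" using P(2) P'(3) by (auto simp: Q_def split: nat.split)
    moreover have "Q (Suc k) \<subset> N" "ann (vx sc x V U ?j) U \<subseteq> Q 0" using P(3) P'(2) by (simp_all add: Q_def)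
    ultimately show ?case by (intro exI[of _ Q]) blast
  qed
  from this[of d] show ?thesis by auto
qed

end

subsection \<open>Modules over a record ring and their presentations\<close>

locale cover = cring A for A (structure) +
  fixes h :: "'s::comm_ring_1 \<Rightarrow> 'a"
  assumes h_closed: "h x \<in> carrier A" and h_add: "h (x + y) = h x \<oplus> h y" and h_mult: "h (x * y) = h x \<otimes> h y"
    and h_one: "h 1 = \<one>" and h_surj: "a \<in> carrier A \<Longrightarrow> \<exists>s. h s = a"
begin

lemma h_zero: "h 0 = \<zero>"
proof -
  have "h 0 \<oplus> h 0 = h 0" using h_add[of 0 0] by simp
  then show ?thesis using h_closed by (simp add: add.r_cancel_one)
qed

lemma h_minus: "h (- x) = \<ominus> h x"
proof -
  have "h (- x) \<oplus> h x = \<zero>" using h_add[of "- x" x] by (simp add: h_zero)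
  then show ?thesis using h_closed by (simp add: minus_equality[symmetric])
qed

lemma h_diff: "h (x - y) = \<zero> \<longleftrightarrow> h x = h y"
proof -
  have e: "h (x - y) \<oplus> h y = h x" using h_add[of "x - y" y] by simp
  show ?thesis
  proof
    assume "h (x - y) = \<zero>"
    then show "h x = h y" using e h_closed by simp
  next
    assume "h x = h y"
    then have "h (x - y) \<oplus> h y = h y" using e by simp
    then show "h (x - y) = \<zero>" using h_closed by (simp add: add.r_cancel_one)
  qed
qed

definition I where "I = {s. h s = \<zero>}"

lemma sub_I: "submod (*) I"
proof (rule sub_scI)
  show "0 \<in> I" by (simp add: I_def h_zero)
  show "x - y \<in> I" if "x \<in> I" "y \<in> I" for x y using that by (simp add: I_def h_diff)
  show "s * x \<in> I" if "x \<in> I" for s x using that h_closed by (simp add: I_def h_mult)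
qed

lemma h_eq: "h x = h y \<longleftrightarrow> x - y \<in> I" by (simp add: I_def h_diff)

lemma ideal_image: assumes S: "submod (*) S" shows "ideal (h ` S) A"
proof (rule idealI)
  show "ring A" by unfold_locales
  show "subgroup (h ` S) (add_monoid A)"
  proof (rule add.subgroupI)
    show "h ` S \<subseteq> carrier A" using h_closed by blast
    show "h ` S \<noteq> {}" using sub_0[OF S] by blast
    show "\<ominus> a \<in> h ` S" if "a \<in> h ` S" for a using that sub_uminus[OF S] by (auto simp: h_minus[symmetric])
    show "a \<oplus> b \<in> h ` S" if "a \<in> h ` S" "b \<in> h ` S" for a b using that sub_add[OF S] by (auto simp: h_add[symmetric])
  qed
  fix a x assume a: "a \<in> h ` S" "x \<in> carrier A"
  obtain s r where sr: "s \<in> S" "a = h s" "x = h r" using a h_surj[OF a(2)] by blast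
  have "x \<otimes> a = h (r * s)" "a \<otimes> x = h (r * s)" unfolding sr h_mult using m_comm h_closed by blast+
  then show "x \<otimes> a \<in> h ` S" "a \<otimes> x \<in> h ` S" using sub_sc[OF S sr(1), of r] by blast+
qed

lemma ideal_vimage: assumes "ideal J A" shows "submod (*) {s. h s \<in> J}" "I \<subseteq> {s. h s \<in> J}" "h ` {s. h s \<in> J} = J"
proof -
  interpret J: ideal J A by fact
  show "submod (*) {s. h s \<in> J}"
  proof (rule sub_scI)
    show "0 \<in> {s. h s \<in> J}" by (simp add: h_zero)
    show "x - y \<in> {s. h s \<in> J}" if "x \<in> {s. h s \<in> J}" "y \<in> {s. h s \<in> J}" for x y
      using that by (simp add: diff_conv_add_uminus h_add h_minus del: add_uminus_conv_diff)
    show "s * x \<in> {s. h s \<in> J}" if "x \<in> {s. h s \<in> J}" for s x using that h_closed by (simp add: h_mult J.I_l_closed)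
  qed
  show "I \<subseteq> {s. h s \<in> J}" by (auto simp: I_def)
  show "h ` {s. h s \<in> J} = J" 
  proof (intro equalityI subsetI)
    fix x assume x: "x \<in> J"
    then obtain s where "h s = x" using h_surj J.a_subset by blast
    then show "x \<in> h ` {s. h s \<in> J}" using x by blast
  qed blast
qed

lemma mem_image: assumes "submod (*) S" "I \<subseteq> S" shows "h s \<in> h ` S \<longleftrightarrow> s \<in> S"
proof
  assume "h s \<in> h ` S"
  then obtain r where r: "h s = h r" "r \<in> S" by blast
  then have "s - r \<in> S" using assms(2) by (auto simp: h_eq)
  then show "s \<in> S" using r(2) by (rule sub_diff_cancel[OF assms(1)])
qed blast

lemma noeth_I: assumes "noetherian_ring A" shows "noeth (range (*)) I UNIV"
  unfolding noeth_def
proof (intro allI impI)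
  fix S :: "nat \<Rightarrow> 's set"
  assume S: "\<forall>n. submod (*) (S n) \<and> I \<subseteq> S n \<and> S n \<subseteq> UNIV \<and> S n \<subseteq> S (Suc n)"
  have mono: "S m \<subseteq> S n" if "m \<le> n" for m n by (rule lift_Suc_mono_le[of S, OF _ that]) (use S in blast)
  interpret R: noetherian_ring A by fact
  let ?C = "range (\<lambda>n. h ` S n)"
  have "subset.chain {J. ideal J A} ?C"
    unfolding subset_chain_def
  proof (intro conjI ballI)
    show "?C \<subseteq> {J. ideal J A}" using S ideal_image by blast
    fix X Y assume "X \<in> ?C" "Y \<in> ?C"
    then obtain m n where mn: "X = h ` S m" "Y = h ` S n" by blast
    show "X \<subseteq> Y \<or> Y \<subseteq> X" unfolding mn using mono[of m n] mono[of n m] by (metis image_mono nat_le_linear)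
  qed
  then have "\<Union>?C \<in> ?C" by (intro R.ideal_chain_is_trivial) auto
  then obtain K where K: "\<Union>?C = h ` S K" by blast
  have "S n = S K" if "n \<ge> K" for n
  proof
    show "S K \<subseteq> S n" by (rule mono[OF that])
    show "S n \<subseteq> S K"
    proof
      fix s assume "s \<in> S n"
      then have "h s \<in> h ` S K" unfolding K[symmetric] by blast
      then show "s \<in> S K" using mem_image[of "S K"] S by blast
    qed
  qed
  then show "\<exists>K. \<forall>n\<ge>K. S n = S K" by blast
qed

text \<open>\<open>Q\<close> is the quotient \<open>Z/B\<close> with scalars read through
  \<open>h\<close>, and \<open>p\<close> assigns to an element of \<open>Z\<close> its class. All
  notions about record modules are translated to pairs along this predicate.\<close>

definition pres :: "('s \<Rightarrow> 'y::ab_group_add \<Rightarrow> 'y) \<Rightarrow> ('y \<Rightarrow> 'z) \<Rightarrow> 'y set \<Rightarrow> 'y set \<Rightarrow> ('a, 'z, 'k) module_scheme \<Rightarrow> bool" where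
  "pres sc p B Z Q \<longleftrightarrow> smod sc \<and> submod sc B \<and> submod sc Z \<and> B \<subseteq> Z \<and> carrier Q = p ` Z \<and> \<zero>\<^bsub>Q\<^esub> = p 0
     \<and> (\<forall>x\<in>Z. \<forall>y\<in>Z. p x \<oplus>\<^bsub>Q\<^esub> p y = p (x + y)) \<and> (\<forall>s. \<forall>x\<in>Z. h s \<odot>\<^bsub>Q\<^esub> p x = p (sc s x))
     \<and> (\<forall>x\<in>Z. \<forall>y\<in>Z. p x = p y \<longleftrightarrow> x - y \<in> B)"

lemma presD:
  assumes "pres sc p B Z Q"
  shows "smod sc" "submod sc B" "submod sc Z" "B \<subseteq> Z" "carrier Q = p ` Z" "\<zero>\<^bsub>Q\<^esub> = p 0"
    "\<And>x y. x \<in> Z \<Longrightarrow> y \<in> Z \<Longrightarrow> p x \<oplus>\<^bsub>Q\<^esub> p y = p (x + y)" "\<And>s x. x \<in> Z \<Longrightarrow> h s \<odot>\<^bsub>Q\<^esub> p x = p (sc s x)"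
    "\<And>x y. x \<in> Z \<Longrightarrow> y \<in> Z \<Longrightarrow> p x = p y \<longleftrightarrow> x - y \<in> B"
  using assms unfolding pres_def by blast+

context
  fixes sc :: "'s \<Rightarrow> 'y::ab_group_add \<Rightarrow> 'y" and p :: "'y \<Rightarrow> 'z" and B Z and Q :: "('a, 'z, 'k) module_scheme"
  assumes P: "pres sc p B Z Q"
begin

lemma pres_group: "abelian_group Q"
proof (rule abelian_groupI)
  note Z = presD(3)[OF P] and c = presD(5)[OF P] and ad = presD(7)[OF P] and z = presD(6)[OF P]
  show "x \<oplus>\<^bsub>Q\<^esub> y \<in> carrier Q" if "x \<in> carrier Q" "y \<in> carrier Q" for x y
    using that sub_add[OF Z] by (auto simp: c ad)
  show "\<zero>\<^bsub>Q\<^esub> \<in> carrier Q" using sub_0[OF Z] by (auto simp: c z)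
  show "(x \<oplus>\<^bsub>Q\<^esub> y) \<oplus>\<^bsub>Q\<^esub> w = x \<oplus>\<^bsub>Q\<^esub> (y \<oplus>\<^bsub>Q\<^esub> w)" if "x \<in> carrier Q" "y \<in> carrier Q" "w \<in> carrier Q" for x y w
    using that sub_add[OF Z] by (auto simp: c ad add.assoc)
  show "x \<oplus>\<^bsub>Q\<^esub> y = y \<oplus>\<^bsub>Q\<^esub> x" if "x \<in> carrier Q" "y \<in> carrier Q" for x y
    using that by (auto simp: c ad add.commute)
  show "\<zero>\<^bsub>Q\<^esub> \<oplus>\<^bsub>Q\<^esub> x = x" if "x \<in> carrier Q" for x
    using that sub_0[OF Z] by (auto simp: c ad z)
  show "\<exists>y\<in>carrier Q. y \<oplus>\<^bsub>Q\<^esub> x = \<zero>\<^bsub>Q\<^esub>" if "x \<in> carrier Q" for x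
  proof -
    obtain u where u: "u \<in> Z" "x = p u" using \<open>x \<in> carrier Q\<close> c by blast
    have "p (- u) \<oplus>\<^bsub>Q\<^esub> x = \<zero>\<^bsub>Q\<^esub>" unfolding u(2) ad[OF sub_uminus[OF Z u(1)] u(1)] z by simp
    then show ?thesis using sub_uminus[OF Z u(1)] c by blast
  qed
qed

lemma pres_minus: assumes x: "x \<in> Z" shows "\<ominus>\<^bsub>Q\<^esub> p x = p (- x)"
proof -
  interpret Q: abelian_group Q by (rule pres_group)
  note Z = presD(3)[OF P] and c = presD(5)[OF P]
  have mx: "- x \<in> Z" by (rule sub_uminus[OF Z x])
  have "p (- x) \<oplus>\<^bsub>Q\<^esub> p x = \<zero>\<^bsub>Q\<^esub>" unfolding presD(7)[OF P mx x] presD(6)[OF P] by simp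
  then show ?thesis by (rule Q.minus_equality) (use x mx c in auto)
qed

lemma pres_sum: fixes b :: nat assumes "\<And>j. j < b \<Longrightarrow> y j \<in> Z" shows "(\<Oplus>\<^bsub>Q\<^esub>j\<in>{..<b}. p (y j)) = p (\<Sum>j<b. y j)"
  using assms
proof (induction b)
  interpret Q: abelian_group Q by (rule pres_group)
  note Z = presD(3)[OF P] and c = presD(5)[OF P]
  case 0
  then show ?case by (simp add: presD(6)[OF P])
next
  interpret Q: abelian_group Q by (rule pres_group)
  note Z = presD(3)[OF P] and c = presD(5)[OF P]
  case (Suc b)
  have y: "y b \<in> Z" "\<And>j. j < b \<Longrightarrow> y j \<in> Z" using Suc.prems by simp_all
  have s: "(\<Sum>j<b. y j) \<in> Z" by (rule sub_sum[OF Z]) (use y(2) in simp)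
  have "(\<Oplus>\<^bsub>Q\<^esub>j\<in>insert b {..<b}. p (y j)) = p (y b) \<oplus>\<^bsub>Q\<^esub> (\<Oplus>\<^bsub>Q\<^esub>j\<in>{..<b}. p (y j))"
    by (rule Q.finsum_insert) (use y c in auto)
  also have "\<dots> = p (y b + (\<Sum>j<b. y j))" using Suc.IH[OF y(2)] presD(7)[OF P y(1) s] by simp
  finally show ?case by (simp add: lessThan_Suc add.commute)
qed

lemma pres_inj: assumes "x \<in> Z" "submod sc X" "B \<subseteq> X" "X \<subseteq> Z" shows "p x \<in> p ` X \<longleftrightarrow> x \<in> X"
proof
  assume "p x \<in> p ` X"
  then obtain y where y: "p x = p y" "y \<in> X" by blast
  then have "x - y \<in> X" using presD(9)[OF P assms(1), of y] assms(3,4) by blast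
  then show "x \<in> X" using y(2) by (rule sub_diff_cancel[OF assms(2)])
qed blast

lemma pres_inj_eq:
  assumes "submod sc X" "B \<subseteq> X" "X \<subseteq> Z" "submod sc Y" "B \<subseteq> Y" "Y \<subseteq> Z"
  shows "p ` X = p ` Y \<longleftrightarrow> X = Y"
proof
  assume e: "p ` X = p ` Y"
  have "x \<in> X \<longleftrightarrow> x \<in> Y" if "x \<in> Z" for x using pres_inj[OF that assms(1-3)] pres_inj[OF that assms(4-6)] e by simp
  then show "X = Y" using assms(3,6) by blast
qed simp

lemma pres_submodule: "submodule N A Q \<longleftrightarrow> (\<exists>X. N = p ` X \<and> submod sc X \<and> B \<subseteq> X \<and> X \<subseteq> Z)"
proof
  note Z = presD(3)[OF P] and c = presD(5)[OF P]
  interpret Q: abelian_group Q by (rule pres_group)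
  {
    assume "submodule N A Q"
    then interpret N: submodule N A Q .
    have NQ: "N \<subseteq> carrier Q" using N.subset by simp
    let ?X = "{x \<in> Z. p x \<in> N}"
    have "N = p ` ?X" using NQ c by auto
    moreover have z: "\<zero>\<^bsub>Q\<^esub> \<in> N" using N.one_closed by simp
    moreover have "submod sc ?X"
    proof (rule sub_scI)
      show "0 \<in> ?X" using z sub_0[OF Z] by (simp add: presD(6)[OF P])
      fix x y assume x: "x \<in> ?X" and y: "y \<in> ?X"
      have "\<ominus>\<^bsub>Q\<^esub> p y \<in> N" using N.m_inv_closed[of "p y"] y by (simp add: a_inv_def)
      then have "p x \<oplus>\<^bsub>Q\<^esub> p (- y) \<in> N" using N.m_closed[of "p x" "p (- y)"] x pres_minus[of y] y by simp
      moreover have "p x \<oplus>\<^bsub>Q\<^esub> p (- y) = p (x - y)" using presD(7)[OF P, of x "- y"] x sub_uminus[OF Z, of y] y by simp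
      ultimately show "x - y \<in> ?X" using sub_diff[OF Z] x y by simp
    next
      fix s x assume x: "x \<in> ?X"
      have "h s \<odot>\<^bsub>Q\<^esub> p x \<in> N" using N.smult_closed[OF h_closed, of "p x" s] x by simp
      then show "sc s x \<in> ?X" using presD(8)[OF P, of x s] sub_sc[OF Z] x by simp
    qed
    moreover have "B \<subseteq> ?X"
    proof
      fix x assume x: "x \<in> B"
      then have xZ: "x \<in> Z" using presD(4)[OF P] by blast
      have "p x = p 0" using presD(9)[OF P xZ sub_0[OF Z]] x by simp
      then show "x \<in> ?X" using z xZ by (simp add: presD(6)[OF P])
    qed
    ultimately show "\<exists>X. N = p ` X \<and> submod sc X \<and> B \<subseteq> X \<and> X \<subseteq> Z" by (intro exI[of _ ?X]) blast
  }
  assume "\<exists>X. N = p ` X \<and> submod sc X \<and> B \<subseteq> X \<and> X \<subseteq> Z"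
  then obtain X where X: "N = p ` X" "submod sc X" "B \<subseteq> X" "X \<subseteq> Z" by blast
  show "submodule N A Q"
  proof (intro submodule.intro submodule_axioms.intro)
    show "subgroup N (add_monoid Q)"
    proof (rule Q.add.subgroupI)
      show "N \<subseteq> carrier Q" using X c by auto
      show "N \<noteq> {}" using X(1) sub_0[OF X(2)] by blast
      show "\<ominus>\<^bsub>Q\<^esub> a \<in> N" if a: "a \<in> N" for a
      proof -
        obtain x where x: "a = p x" "x \<in> X" using a X(1) by blast
        then have "x \<in> Z" using X(4) by blast
        then show ?thesis unfolding x(1) using pres_minus sub_uminus[OF X(2) x(2)] X(1) by simp
      qed
      show "a \<oplus>\<^bsub>Q\<^esub> b \<in> N" if ab: "a \<in> N" "b \<in> N" for a b
      proof -
        obtain x y where x: "a = p x" "x \<in> X" "b = p y" "y \<in> X" using ab X(1) by blast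
        then have "x \<in> Z" "y \<in> Z" using X(4) by blast+
        then show ?thesis unfolding x(1,3) using presD(7)[OF P] sub_add[OF X(2) x(2,4)] X(1) by simp
      qed
    qed
    show "a \<odot>\<^bsub>Q\<^esub> x \<in> N" if ax: "a \<in> carrier A" "x \<in> N" for a x
    proof -
      obtain s y where y: "a = h s" "x = p y" "y \<in> X" using h_surj[OF ax(1)] ax(2) X(1) by blast
      then have "y \<in> Z" using X(4) by blast
      then show ?thesis unfolding y(1,2) using presD(8)[OF P] sub_sc[OF X(2) y(3)] X(1) by simp
    qed
  qed
qed

text \<open>Chains of submodules correspond by \<open>pres_submodule\<close>. The first member of a
  chain in \<open>Q\<close> may be larger than the image of \<open>B\<close>, which
  \<open>ch_antimono\<close> absorbs.\<close>

lemma pres_length: "module_length A Q = rlen (range sc) B Z"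
proof -
  have "(\<exists>N. (\<forall>i\<le>n. submodule (N i) A Q) \<and> (\<forall>i<n. N i \<subset> N (Suc i))) \<longleftrightarrow> ch (range sc) n B Z" for n
  proof
    assume "\<exists>N. (\<forall>i\<le>n. submodule (N i) A Q) \<and> (\<forall>i<n. N i \<subset> N (Suc i))"
    then obtain N where N: "\<And>i. i \<le> n \<Longrightarrow> submodule (N i) A Q" "\<And>i. i < n \<Longrightarrow> N i \<subset> N (Suc i)" by blast
    have "\<exists>X. \<forall>i\<le>n. N i = p ` X i \<and> submod sc (X i) \<and> B \<subseteq> X i \<and> X i \<subseteq> Z"
      using N(1) unfolding pres_submodule by metis
    then obtain X where X: "\<And>i. i \<le> n \<Longrightarrow> N i = p ` X i" "\<And>i. i \<le> n \<Longrightarrow> submod sc (X i)" "\<And>i. i \<le> n \<Longrightarrow> B \<subseteq> X i" "\<And>i. i \<le> n \<Longrightarrow> X i \<subseteq> Z"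
      by metis
    have st: "X i \<subset> X (Suc i)" if i: "i < n" for i
    proof -
      have "x \<in> X (Suc i)" if x: "x \<in> X i" for x
      proof -
        have "x \<in> Z" using x X(4)[of i] i by auto
        moreover have "p x \<in> p ` X (Suc i)" using x N(2)[OF i] X(1)[of i] X(1)[of "Suc i"] i by auto
        ultimately show ?thesis using pres_inj[of x "X (Suc i)"] X(2-4)[of "Suc i"] i by auto
      qed
      moreover have "X i \<noteq> X (Suc i)" using N(2)[OF i] X(1)[of i] X(1)[of "Suc i"] i by auto
      ultimately show ?thesis by blast
    qed
    have "ch (range sc) k (X (n - k)) Z" if "k \<le> n" for k using that
    proof (induction k)
      case 0
      then show ?case using X(4)[of n] by simp
    next
      case (Suc k)
      have "X (n - Suc k) \<subset> X (n - k)" using st[of "n - Suc k"] Suc.prems by (simp add: Suc_diff_Suc)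
      then show ?case using Suc X(2)[of "n - k"] by auto
    qed
    from this[of n] have "ch (range sc) n (X 0) Z" by simp
    then show "ch (range sc) n B Z" by (rule ch_antimono) (use X(3) in simp)
  next
    assume c0: "ch (range sc) n B Z"
    have ex: "\<exists>N. N 0 = p ` Y \<and> (\<forall>i\<le>n. submodule (N i) A Q) \<and> (\<forall>i<n. N i \<subset> N (Suc i))"
      if "ch (range sc) n Y Z" "submod sc Y" "B \<subseteq> Y" for Y
      using that
    proof (induction n arbitrary: Y)
      case 0
      then have "submodule (p ` Y) A Q" unfolding pres_submodule by (intro exI[of _ Y]) simp
      then show ?case by (intro exI[of _ "\<lambda>_. p ` Y"]) simp
    next
      case (Suc n)
      then obtain W where W: "submod sc W" "Y \<subset> W" "ch (range sc) n W Z" by auto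
      have WZ: "W \<subseteq> Z" by (rule ch_subset[OF W(3)])
      have BW: "B \<subseteq> W" and YZ: "Y \<subseteq> Z" and YW: "Y \<noteq> W" using Suc.prems(3) W(2) WZ by auto
      obtain N where N: "N 0 = p ` W" "\<forall>i\<le>n. submodule (N i) A Q" "\<forall>i<n. N i \<subset> N (Suc i)"
        using Suc.IH[OF W(3,1) BW] by (elim exE conjE)
      have "submodule (p ` Y) A Q" unfolding pres_submodule by (rule exI[of _ Y]) (intro conjI refl Suc.prems(2,3) YZ)
      moreover have "p ` Y \<subset> p ` W"
        using pres_inj_eq[OF Suc.prems(2,3) YZ W(1) BW WZ] YW W(2) by (intro psubsetI image_mono) auto
      ultimately show ?case using N
        by (intro exI[of _ "\<lambda>i. case i of 0 \<Rightarrow> p ` Y | Suc j \<Rightarrow> N j"]) (auto split: nat.split)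
    qed
    obtain N where "N 0 = p ` B" "\<forall>i\<le>n. submodule (N i) A Q" "\<forall>i<n. N i \<subset> N (Suc i)"
      using ex[OF c0 presD(2)[OF P] order_refl] by (elim exE conjE)
    then show "\<exists>N. (\<forall>i\<le>n. submodule (N i) A Q) \<and> (\<forall>i<n. N i \<subset> N (Suc i))"
      by (intro exI[of _ N] conjI)
  qed
  note ch_iff = this
  show ?thesis unfolding module_length_def rlen_def
    by (rule arg_cong[where f = Sup], rule Collect_cong) (simp only: ex_simps ch_iff)
qed

lemma pres_quot:
  assumes X: "submod sc X" "B \<subseteq> X" "X \<subseteq> Z"
  shows "pres sc (\<lambda>z. (p ` X) +>\<^bsub>Q\<^esub> p z) X Z (quot_module Q (p ` X))"
proof -
  note Z = presD(3)[OF P] and c = presD(5)[OF P]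
  let ?q = "\<lambda>z. (p ` X) +>\<^bsub>Q\<^esub> p z"
  have q: "?q z = p ` {x + z | x. x \<in> X}" if z: "z \<in> Z" for z
    unfolding a_r_coset_def' using presD(7)[OF P _ z] X(3) by (auto simp: subset_iff image_iff)
  have eq: "?q x = ?q y \<longleftrightarrow> x - y \<in> X" if x: "x \<in> Z" and y: "y \<in> Z" for x y
  proof
    assume "?q x = ?q y"
    moreover have "p (0 + x) \<in> p ` {u + x | u. u \<in> X}" using sub_0[OF X(1)] by blast
    ultimately have "p x \<in> p ` {u + y | u. u \<in> X}" unfolding q[OF x] q[OF y] by (simp only: add_0_left)
    then obtain u where u: "u \<in> X" "p x = p (u + y)" by blast
    have "u + y \<in> Z" using u(1) X(3) sub_add[OF Z _ y] by blast
    then have "x - (u + y) \<in> X" using presD(9)[OF P x, of "u + y"] u(2) X(2) by blast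
    then have "(x - (u + y)) + u \<in> X" using u(1) by (rule sub_add[OF X(1)])
    then show "x - y \<in> X" by (simp add: algebra_simps)
  next
    assume xy: "x - y \<in> X"
    have "{u + x | u. u \<in> X} = {u + y | u. u \<in> X}"
    proof (intro equalityI subsetI)
      fix w assume "w \<in> {u + x | u. u \<in> X}"
      then obtain u where u: "u \<in> X" "w = u + x" by blast
      have "w = (u + (x - y)) + y" unfolding u(2) by (simp add: algebra_simps)
      then show "w \<in> {u + y | u. u \<in> X}" using sub_add[OF X(1) u(1) xy] by blast
    next
      fix w assume "w \<in> {u + y | u. u \<in> X}"
      then obtain u where u: "u \<in> X" "w = u + y" by blast
      have "w = (u - (x - y)) + x" unfolding u(2) by (simp add: algebra_simps)
      then show "w \<in> {u + x | u. u \<in> X}" using sub_diff[OF X(1) u(1) xy] by blast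
    qed
    then show "?q x = ?q y" unfolding q[OF x] q[OF y] by simp
  qed
  have mem: "w \<in> ?q z \<longleftrightarrow> (\<exists>x\<in>X. w = p (x + z))" if "z \<in> Z" for w z unfolding q[OF that] by blast
  have xz: "x + z \<in> Z" if "x \<in> X" "z \<in> Z" for x z using that X(3) sub_add[OF Z] by blast
  show ?thesis
    unfolding pres_def
  proof (intro conjI ballI allI)
    show "smod sc" by (rule presD(1)[OF P])
    show "carrier (quot_module Q (p ` X)) = ?q ` Z" by (auto simp: quot_module_def A_RCOSETS_def' c)
    show "\<zero>\<^bsub>quot_module Q (p ` X)\<^esub> = ?q 0" unfolding q[OF sub_0[OF Z]] by (simp add: quot_module_def)
    fix x y assume x: "x \<in> Z" and y: "y \<in> Z"
    show "?q x = ?q y \<longleftrightarrow> x - y \<in> X" by (rule eq[OF x y])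
    have "?q x <+>\<^bsub>Q\<^esub> ?q y = ?q (x + y)"
    proof (intro equalityI subsetI)
      fix w assume "w \<in> ?q x <+>\<^bsub>Q\<^esub> ?q y"
      then obtain u v where uv: "u \<in> X" "v \<in> X" "w = p (u + x) \<oplus>\<^bsub>Q\<^esub> p (v + y)"
        unfolding set_add_def' by (auto simp: mem[OF x] mem[OF y])
      have "w = p ((u + v) + (x + y))" unfolding uv(3) presD(7)[OF P xz[OF uv(1) x] xz[OF uv(2) y]] by (simp add: algebra_simps)
      then show "w \<in> ?q (x + y)" unfolding mem[OF sub_add[OF Z x y]] using sub_add[OF X(1) uv(1,2)] by blast
    next
      fix w assume "w \<in> ?q (x + y)"
      then obtain u where u: "u \<in> X" "w = p (u + (x + y))" unfolding mem[OF sub_add[OF Z x y]] by blast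
      have "w = p (u + x) \<oplus>\<^bsub>Q\<^esub> p (0 + y)"
        unfolding u(2) presD(7)[OF P xz[OF u(1) x] xz[OF sub_0[OF X(1)] y]] by (simp add: algebra_simps)
      moreover have "p (u + x) \<in> ?q x" "p (0 + y) \<in> ?q y" unfolding mem[OF x] mem[OF y] using u(1) sub_0[OF X(1)] by blast+
      ultimately show "w \<in> ?q x <+>\<^bsub>Q\<^esub> ?q y" unfolding set_add_def' by blast
    qed
    then show "?q x \<oplus>\<^bsub>quot_module Q (p ` X)\<^esub> ?q y = ?q (x + y)" by (simp add: quot_module_def)
  next
    fix s x assume x: "x \<in> Z"
    have sx: "sc s x \<in> Z" by (rule sub_sc[OF Z x])
    have "(p ` X) +>\<^bsub>Q\<^esub> (h s \<odot>\<^bsub>Q\<^esub> w) = ?q (sc s x)" if w: "w \<in> ?q x" for w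
    proof -
      obtain u where u: "u \<in> X" "w = p (u + x)" using w unfolding mem[OF x] by blast
      have ux: "sc s (u + x) \<in> Z" by (rule sub_sc[OF Z xz[OF u(1) x]])
      have "sc s (u + x) - sc s x \<in> X" using sub_sc[OF X(1) u(1), of s] unfolding smod.sc_add[OF presD(1)[OF P]] by simp
      then have "?q (sc s (u + x)) = ?q (sc s x)" unfolding eq[OF ux sx] .
      then show ?thesis unfolding u(2) presD(8)[OF P xz[OF u(1) x]] .
    qed
    moreover have "?q x \<noteq> {}" unfolding q[OF x] using sub_0[OF X(1)] by blast
    ultimately have "(\<Union>w\<in>?q x. (p ` X) +>\<^bsub>Q\<^esub> (h s \<odot>\<^bsub>Q\<^esub> w)) = ?q (sc s x)" by auto
    then show "h s \<odot>\<^bsub>quot_module Q (p ` X)\<^esub> ?q x = ?q (sc s x)" by (simp add: quot_module_def)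
  qed (use X Z in auto)
qed

lemma pres_restrict:
  assumes "submod sc Z'" "B \<subseteq> Z'" "Z' \<subseteq> Z"
  shows "pres sc p B Z' (Q\<lparr>carrier := p ` Z'\<rparr>)"
  using P assms unfolding pres_def by (auto 0 3 simp: subset_iff)

section \<open>Powers, matrices and homology through presentations\<close>

definition pp where "pp b x = (\<lambda>i\<in>{..<b}. p (x i))" for b :: nat and x :: "nat \<Rightarrow> 'y"

lemma pres_power: "pres (psc sc) (pp b) (pw b B) (pw b Z) (module_power Q b)"
proof -
  note Z = presD(3)[OF P] and c = presD(5)[OF P]
  show ?thesis
    unfolding pres_def
  proof (intro conjI ballI allI)
    show "smod (psc sc)" by (rule smod_psc[OF presD(1)[OF P]])
    show "submod (psc sc) (pw b B)" "submod (psc sc) (pw b Z)"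
      by (rule sub_pw[OF _ presD(1)[OF P]], rule presD[OF P])+
    show "pw b B \<subseteq> pw b Z" by (rule pw_mono[OF presD(4)[OF P]])
    show "carrier (module_power Q b) = pp b ` pw b Z"
    proof (intro equalityI subsetI)
      fix f assume "f \<in> carrier (module_power Q b)"
      then have f: "f \<in> {..<b} \<rightarrow>\<^sub>E p ` Z" by (simp add: module_power_def c)
      define x where "x i = (if i < b then SOME z. z \<in> Z \<and> p z = f i else 0)" for i
      have x: "x i \<in> Z \<and> p (x i) = f i" if "i < b" for i
      proof -
        have "\<exists>z. z \<in> Z \<and> p z = f i" using f that by (auto simp: PiE_def Pi_def image_iff) metis
        from someI_ex[OF this] show ?thesis using that by (simp add: x_def)
      qed
      have "x \<in> pw b Z" using x by (auto simp: pw_def x_def)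
      moreover have "f = pp b x"
      proof (rule ext)
        fix i show "f i = pp b x i" using x f by (cases "i < b") (auto simp: pp_def PiE_def extensional_def)
      qed
      ultimately show "f \<in> pp b ` pw b Z" by blast
    next
      fix f assume "f \<in> pp b ` pw b Z"
      then show "f \<in> carrier (module_power Q b)" by (auto simp: module_power_def pp_def c pw_def split: if_splits)
    qed
    show "\<zero>\<^bsub>module_power Q b\<^esub> = pp b 0" by (simp add: module_power_def pp_def presD(6)[OF P])
    fix x y assume x: "x \<in> pw b Z" and y: "y \<in> pw b Z"
    show "pp b x \<oplus>\<^bsub>module_power Q b\<^esub> pp b y = pp b (x + y)"
      using pwD[OF x] pwD[OF y] presD(7)[OF P] unfolding module_power_def pp_def
      by (simp, intro restrict_ext) simp
    have "pp b x = pp b y \<longleftrightarrow> (\<forall>i<b. p (x i) = p (y i))"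
    proof (intro iffI allI impI)
      fix i assume e: "pp b x = pp b y" and i: "i < b"
      have "pp b x i = pp b y i" by (simp only: e)
      then show "p (x i) = p (y i)" using i by (simp add: pp_def)
    next
      assume "\<forall>i<b. p (x i) = p (y i)"
      then show "pp b x = pp b y" unfolding pp_def by (intro restrict_ext) simp
    qed
    also have "\<dots> \<longleftrightarrow> (\<forall>i<b. x i - y i \<in> B)" using presD(9)[OF P] pwD[OF x] pwD[OF y] by blast
    also have "\<dots> \<longleftrightarrow> x - y \<in> pw b B" using pwD0[OF x] pwD0[OF y] by (simp add: pw_def)
    finally show "pp b x = pp b y \<longleftrightarrow> x - y \<in> pw b B" .
  next
    fix s x assume x: "x \<in> pw b Z"
    show "h s \<odot>\<^bsub>module_power Q b\<^esub> pp b x = pp b (psc sc s x)"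
      using pwD[OF x] presD(8)[OF P] unfolding module_power_def pp_def
      by (simp, intro restrict_ext) simp
  qed
qed

lemma pp_matrix:
  assumes \<phi>: "\<And>i j. i < r \<Longrightarrow> j < k \<Longrightarrow> \<phi> i j = h (\<phi>' i j)" and x: "x \<in> pw k Z"
  shows "matrix_map Q r k \<phi> (pp k x) = pp r (mm sc r k \<phi>' x)"
proof (rule ext)
  interpret Q: abelian_group Q by (rule pres_group)
  note Z = presD(3)[OF P] and c = presD(5)[OF P]
  fix i show "matrix_map Q r k \<phi> (pp k x) i = pp r (mm sc r k \<phi>' x) i"
  proof (cases "i < r")
    case True
    have "(\<Oplus>\<^bsub>Q\<^esub>j\<in>{..<k}. \<phi> i j \<odot>\<^bsub>Q\<^esub> pp k x j) = (\<Oplus>\<^bsub>Q\<^esub>j\<in>{..<k}. p (sc (\<phi>' i j) (x j)))"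
      by (rule Q.finsum_cong') (use \<phi>[OF True] pwD[OF x] sub_sc[OF Z] c in \<open>auto simp: pp_def presD(8)[OF P]\<close>)
    also have "\<dots> = p (\<Sum>j<k. sc (\<phi>' i j) (x j))" by (rule pres_sum) (rule sub_sc[OF Z pwD[OF x]])
    finally show ?thesis using True by (simp add: matrix_map_def pp_def mm_def)
  qed (simp add: matrix_map_def pp_def)
qed

context
  fixes b :: "nat \<Rightarrow> nat" and \<phi> \<phi>'
  assumes \<phi>: "\<And>n i j. i < b n \<Longrightarrow> j < b (Suc n) \<Longrightarrow> \<phi> n i j = h (\<phi>' n i j)"
begin

lemma pp_cycles: "complex_cycles Q b \<phi> n = pp (b n) ` cyc sc b \<phi>' n B Z"
proof (cases n)
  case 0
  then show ?thesis using presD(5)[OF pres_power] by (simp add: complex_cycles_def cyc_def)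
next
  case (Suc l)
  note PL = pres_power[of "b l"]
  have "pp (b l) (mm sc (b l) (b (Suc l)) (\<phi>' l) x) = pp (b l) 0 \<longleftrightarrow> mm sc (b l) (b (Suc l)) (\<phi>' l) x \<in> pw (b l) B"
    if x: "x \<in> pw (b (Suc l)) Z" for x
    using presD(9)[OF PL smod.mm_pw[OF presD(1)[OF P] presD(3)[OF P] x] sub_0[OF presD(3)[OF PL]]] by simp
  then have "{x \<in> pp (b (Suc l)) ` pw (b (Suc l)) Z. matrix_map Q (b l) (b (Suc l)) (\<phi> l) x = pp (b l) 0}
     = pp (b (Suc l)) ` {x \<in> pw (b (Suc l)) Z. mm sc (b l) (b (Suc l)) (\<phi>' l) x \<in> pw (b l) B}"
    using pp_matrix[of "b l" "b (Suc l)" "\<phi> l" "\<phi>' l", OF \<phi>] by auto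
  then show ?thesis unfolding Suc complex_cycles_def cyc_def nat.case presD(5)[OF pres_power] presD(6)[OF PL] .
qed

lemma pp_boundaries: "complex_boundaries Q b \<phi> n = pp (b n) ` bnd sc b \<phi>' n B Z"
proof -
  note Z = presD(3)[OF P] and PN = pres_power[of "b n"]
  let ?d = "mm sc (b n) (b (Suc n)) (\<phi>' n)"
  have "complex_boundaries Q b \<phi> n = pp (b n) ` ?d ` pw (b (Suc n)) Z"
    unfolding complex_boundaries_def presD(5)[OF pres_power] image_image
    by (rule image_cong[OF refl]) (rule pp_matrix[OF \<phi>])
  also have "\<dots> = pp (b n) ` bnd sc b \<phi>' n B Z"
  proof
    have "?d ` pw (b (Suc n)) Z \<subseteq> bnd sc b \<phi>' n B Z" unfolding bnd_def by (rule ssum_left[OF sub_0[OF presD(2)[OF PN]]])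
    then show "pp (b n) ` ?d ` pw (b (Suc n)) Z \<subseteq> pp (b n) ` bnd sc b \<phi>' n B Z" by (rule image_mono)
    show "pp (b n) ` bnd sc b \<phi>' n B Z \<subseteq> pp (b n) ` ?d ` pw (b (Suc n)) Z"
    proof
      fix y assume "y \<in> pp (b n) ` bnd sc b \<phi>' n B Z"
      then obtain x where x: "x \<in> bnd sc b \<phi>' n B Z" "y = pp (b n) x" by blast
      obtain u v where uv: "u \<in> pw (b (Suc n)) Z" "v \<in> pw (b n) B" "x = ?d u + v" using x(1) by (rule smod.bndE[OF presD(1)[OF P]])
      have d: "?d u \<in> pw (b n) Z" by (rule smod.mm_pw[OF presD(1)[OF P] Z uv(1)])
      have v: "v \<in> pw (b n) Z" using uv(2) presD(4)[OF PN] by blast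
      have xZ: "x \<in> pw (b n) Z" unfolding uv(3) by (rule sub_add[OF presD(3)[OF PN] d v])
      have "x - ?d u = v" unfolding uv(3) by (rule add_diff_cancel_left')
      then have "pp (b n) x = pp (b n) (?d u)" using presD(9)[OF PN xZ d] uv(2) by (simp only:)
      then show "y \<in> pp (b n) ` ?d ` pw (b (Suc n)) Z" unfolding x(2) using uv(1) by blast
    qed
  qed
  finally show ?thesis .
qed

end

end

end

text \<open>Type-class rings cannot be built from \<open>A\<close> inside a proof; the monoid ring of finite multisets over
  the element type, with integer coefficients, is a type-class ring that maps onto every \<open>A\<close>.\<close>

lemma cover_exists:
  fixes A :: "('a, 'r) ring_scheme"
  assumes "cring A" shows "\<exists>h :: ('a multiset, int) poly_mapping \<Rightarrow> 'a. cover A h"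
proof -
  interpret cring A by fact
  \<comment> \<open>The guard makes elements outside the carrier act trivially, so that the
    operators commute on the whole type and folding over a multiset is well defined.\<close>
  define g where "g x y = (if x \<in> carrier A \<and> y \<in> carrier A then x \<otimes>\<^bsub>A\<^esub> y else y)" for x y
  interpret g: comp_fun_commute g
    by unfold_locales (auto simp: fun_eq_iff g_def m_lcomm)
  define mon where "mon M = fold_mset g \<one>\<^bsub>A\<^esub> M" for M
  have mon_add: "mon (add_mset x M) = g x (mon M)" for x M by (simp add: mon_def)
  have mon_0: "mon {#} = \<one>\<^bsub>A\<^esub>" by (simp add: mon_def)
  have mc: "mon M \<in> carrier A" for M
    by (induction M) (simp_all add: mon_0 mon_add g_def)
  have mp: "mon (M + M') = mon M \<otimes>\<^bsub>A\<^esub> mon M'" for M M'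
  proof (induction M)
    case (add x M)
    have "mon (add_mset x M + M') = g x (mon M \<otimes>\<^bsub>A\<^esub> mon M')" using add by (simp add: mon_add)
    also have "\<dots> = g x (mon M) \<otimes>\<^bsub>A\<^esub> mon M'" using mc by (simp add: g_def m_assoc)
    finally show ?case by (simp add: mon_add)
  qed (use mc in \<open>simp add: mon_0\<close>)
  \<comment> \<open>Free abelian groups are integer-valued finitely supported functions; on
    multisets the same type carries the convolution product of the monoid ring. Additivity comes
    from the universal property, multiplicativity from induction over both factors.\<close>
  obtain h where h: "h \<in> hom (free_Abelian_group UNIV) (add_monoid A)" "\<And>M. h (frag_of M) = mon M"
    using comm_group.free_Abelian_group_universal[OF a_comm_group, of mon UNIV] mc by auto
  have hc: "h x \<in> carrier A" for x using h(1) by (auto simp: hom_def free_Abelian_group_def)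
  have ha: "h (x + y) = h x \<oplus>\<^bsub>A\<^esub> h y" for x y using h(1) by (simp add: hom_def free_Abelian_group_def)
  have h0: "h 0 = \<zero>\<^bsub>A\<^esub>"
  proof -
    have "h 0 \<oplus>\<^bsub>A\<^esub> h 0 = h 0" using ha[of 0 0] by simp
    then show ?thesis using hc by (simp add: add.r_cancel_one)
  qed
  have hd: "h a = h (a - b) \<oplus>\<^bsub>A\<^esub> h b" for a b using ha[of "a - b" b] by simp
  have dl: "h ((a - b) * y) = h (a - b) \<otimes>\<^bsub>A\<^esub> h y" if "h (a * y) = h a \<otimes>\<^bsub>A\<^esub> h y" "h (b * y) = h b \<otimes>\<^bsub>A\<^esub> h y" for a b y
  proof -
    have "h (a * y) = h ((a - b) * y) \<oplus>\<^bsub>A\<^esub> h (b * y)" using hd[of "a * y" "b * y"] by (simp add: left_diff_distrib)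
    moreover have "h a \<otimes>\<^bsub>A\<^esub> h y = h (a - b) \<otimes>\<^bsub>A\<^esub> h y \<oplus>\<^bsub>A\<^esub> h b \<otimes>\<^bsub>A\<^esub> h y"
      by (subst hd[of a b]) (rule l_distr[OF hc hc hc])
    ultimately have "h ((a - b) * y) \<oplus>\<^bsub>A\<^esub> h b \<otimes>\<^bsub>A\<^esub> h y = h (a - b) \<otimes>\<^bsub>A\<^esub> h y \<oplus>\<^bsub>A\<^esub> h b \<otimes>\<^bsub>A\<^esub> h y" using that by simp
    then show ?thesis using hc by (simp add: add.r_cancel)
  qed
  have hf: "h (frag_of M * y) = h (frag_of M) \<otimes>\<^bsub>A\<^esub> h y" for M y
    using subset_UNIV[of "Poly_Mapping.keys y"]
  proof (induction y rule: frag_induction)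
    case zero
    then show ?case using hc by (simp add: h0)
  next
    case (one N)
    have "frag_of M * frag_of N = frag_of (M + N)" by (simp add: mult_single)
    then show ?case by (simp only: h(2) mp)
  next
    case (diff a b)
    have "h ((a - b) * frag_of M) = h (a - b) \<otimes>\<^bsub>A\<^esub> h (frag_of M)"
      by (rule dl) (use diff m_comm hc in \<open>simp_all add: mult.commute\<close>)
    then show ?case using m_comm hc by (simp add: mult.commute)
  qed
  have hm: "h (x * y) = h x \<otimes>\<^bsub>A\<^esub> h y" for x y
    using subset_UNIV[of "Poly_Mapping.keys x"]
  proof (induction x rule: frag_induction)
    case zero
    then show ?case using hc by (simp add: h0)
  next
    case (one N)
    show ?case by (rule hf)
  next
    case (diff a b)
    then show ?case by (rule dl)
  qed
  have "cover A h"
  proof unfold_locales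
    show "h 1 = \<one>\<^bsub>A\<^esub>" using h(2)[of 0] by (simp add: mon_0[simplified])
    show "\<exists>s. h s = x" if "x \<in> carrier A" for x
      using h(2)[of "{#x#}"] that by (auto simp: mon_add mon_0 g_def)
  qed (rule hc ha hm)+
  then show ?thesis by blast
qed

lemma (in smod) bnd_pw: "submod sc V \<Longrightarrow> submod sc U \<Longrightarrow> V \<subseteq> U \<Longrightarrow> bnd sc b \<phi> n V U \<subseteq> pw (b n) U"
  unfolding bnd_def by (rule ssum_least[OF sub_pw']) (use mm_pw pw_mono in blast)+

section \<open>Resolutions and ideal multiples through presentations\<close>

context cover
begin

lemma pres_self: "pres (*) h I UNIV (self_module A)"
proof -
  have "x \<in> h ` UNIV" if x: "x \<in> carrier A" for x using h_surj[OF x] by blast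
  then have "carrier A = h ` UNIV" using h_closed by blast
  then show ?thesis
    unfolding pres_def
    by (intro conjI ballI allI smod_mult sub_I sub_UNIV subset_UNIV) (simp_all add: self_module_def h_add h_mult h_zero h_eq)
qed

lemma pres_apair: assumes P: "pres sc p V U E" shows "apair sc I V U"
  unfolding apair_def
proof (intro conjI ballI)
  fix s u assume s: "s \<in> I" and u: "u \<in> U"
  note U = presD(3)[OF P]
  have hs: "h s = h 0" using s by (simp add: I_def h_zero)
  have "p (sc s u) = p (sc 0 u)" unfolding presD(8)[OF P u, symmetric] hs ..
  then have "sc s u - sc 0 u \<in> V" using presD(9)[OF P sub_sc[OF U u] sub_sc[OF U u]] by blast
  then show "sc s u \<in> V" by (simp add: smod.sc_0_left[OF presD(1)[OF P]])
qed (rule presD[OF P])+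

lemma free_resolution_iff:
  assumes P: "pres sc p V U E" and g': "\<And>j. j < b 0 \<Longrightarrow> g' j \<in> U \<and> g j = p (g' j)"
    and \<phi>: "\<And>n i j. i < b n \<Longrightarrow> j < b (Suc n) \<Longrightarrow> \<phi> n i j = h (\<phi>' n i j)"
  shows "free_resolution A E b g \<phi> \<longleftrightarrow> resol sc I V U b g' \<phi>'"
proof -
  interpret R: smod "(*) :: 's \<Rightarrow> _" by (rule smod_mult)
  interpret E: abelian_group E by (rule pres_group[OF P])
  note V = presD(2)[OF P] and U = presD(3)[OF P] and c = presD(5)[OF P] and sc = presD(1)[OF P]
  note PP = pres_power[OF pres_self] and ap = pres_apair[OF P] and pI = pres_apair[OF pres_self]
  let ?P = "\<lambda>n. pw (b n) (UNIV :: 's set)" and ?J = "\<lambda>n. pw (b n) I"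
  let ?B = "\<lambda>n. bnd (*) b \<phi>' n I UNIV" and ?Z = "\<lambda>n. cyc (*) b \<phi>' n I UNIV"
  have sB: "submod (psc (*)) (?B n)" "?J n \<subseteq> ?B n" "?B n \<subseteq> ?P n" for n
    by (rule R.sub_bnd[OF sub_I sub_UNIV], rule R.pw_bnd[OF sub_UNIV], rule R.bnd_pw[OF sub_I sub_UNIV subset_UNIV])
  have sZ: "submod (psc (*)) (?Z n)" "?J n \<subseteq> ?Z n" "?Z n \<subseteq> ?P n" for n
    by (rule R.sub_cyc[OF sub_I sub_UNIV], rule R.pw_cyc[OF sub_I subset_UNIV], rule R.cyc_pw)
  have lcU: "lc sc (b 0) g' x \<in> U" for x by (rule smod.lc_in[OF sc U]) (use g' in blast)
  have aug: "augmentation E (b 0) g (pp h (b 0) x) = p (lc sc (b 0) g' x)" for x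
  proof -
    have "augmentation E (b 0) g (pp h (b 0) x) = (\<Oplus>\<^bsub>E\<^esub>j\<in>{..<b 0}. p (sc (x j) (g' j)))"
      unfolding augmentation_def
      by (rule E.finsum_cong') (use g' sub_sc[OF U] c in \<open>auto simp: pp_def[OF pres_self] presD(8)[OF P]\<close>)
    also have "\<dots> = p (lc sc (b 0) g' x)" unfolding lc_def by (rule pres_sum[OF P]) (use g' sub_sc[OF U] in blast)
    finally show ?thesis .
  qed
  have a1: "augmentation E (b 0) g ` carrier (module_power (self_module A) (b 0)) = carrier E
      \<longleftrightarrow> (\<forall>u\<in>U. \<exists>x\<in>?P 0. u - lc sc (b 0) g' x \<in> V)"
  proof -
    have "augmentation E (b 0) g ` carrier (module_power (self_module A) (b 0)) = (\<lambda>x. p (lc sc (b 0) g' x)) ` ?P 0"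
      unfolding presD(5)[OF PP] image_image aug ..
    moreover have "\<dots> = carrier E \<longleftrightarrow> (\<forall>u\<in>U. \<exists>x\<in>?P 0. p u = p (lc sc (b 0) g' x))"
      unfolding c using lcU by (auto simp: image_iff set_eq_iff)
    ultimately show ?thesis using presD(9)[OF P _ lcU] by simp
  qed
  let ?K = "{x \<in> ?P 0. lc sc (b 0) g' x \<in> V}"
  have sK: "submod (psc (*)) ?K" by (rule sub_vimage[OF V R.sub_pw'[OF sub_UNIV] smod.itw_lc[OF sc]])
  have JK: "?J 0 \<subseteq> ?K"
  proof
    fix x assume x: "x \<in> ?J 0"
    have "lc sc (b 0) g' x \<in> V" unfolding lc_def
      by (rule sub_sum[OF V], rule apairD(4)[OF ap]) (use pwD[OF x] g' in auto)
    then show "x \<in> ?K" using x pw_mono[OF subset_UNIV[of I]] by auto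
  qed
  have a2: "{x \<in> carrier (module_power (self_module A) (b 0)). augmentation E (b 0) g x = \<zero>\<^bsub>E\<^esub>}
      = complex_boundaries (self_module A) b \<phi> 0 \<longleftrightarrow> (\<forall>x\<in>?P 0. lc sc (b 0) g' x \<in> V \<longleftrightarrow> x \<in> ?B 0)"
  proof -
    have "p (lc sc (b 0) g' x) = \<zero>\<^bsub>E\<^esub> \<longleftrightarrow> lc sc (b 0) g' x \<in> V" for x
      using presD(9)[OF P lcU[of x] sub_0[OF U]] by (simp add: presD(6)[OF P])
    then have "{x \<in> carrier (module_power (self_module A) (b 0)). augmentation E (b 0) g x = \<zero>\<^bsub>E\<^esub>} = pp h (b 0) ` ?K"
      unfolding presD(5)[OF PP] using aug by auto
    moreover have "complex_boundaries (self_module A) b \<phi> 0 = pp h (b 0) ` ?B 0"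
      by (rule pp_boundaries[OF pres_self \<phi>])
    moreover have "pp h (b 0) ` ?K = pp h (b 0) ` ?B 0 \<longleftrightarrow> ?K = ?B 0"
      by (rule pres_inj_eq[OF PP sK JK _ sB]) blast
    moreover have "?K = ?B 0 \<longleftrightarrow> (\<forall>x\<in>?P 0. lc sc (b 0) g' x \<in> V \<longleftrightarrow> x \<in> ?B 0)" using sB(3)[of 0] by blast
    ultimately show ?thesis by simp
  qed
  have a3: "complex_cycles (self_module A) b \<phi> (Suc n) = complex_boundaries (self_module A) b \<phi> (Suc n) \<longleftrightarrow> ?Z (Suc n) = ?B (Suc n)" for n
  proof -
    have "complex_cycles (self_module A) b \<phi> (Suc n) = pp h (b (Suc n)) ` ?Z (Suc n)"
      by (rule pp_cycles[OF pres_self \<phi>])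
    moreover have "complex_boundaries (self_module A) b \<phi> (Suc n) = pp h (b (Suc n)) ` ?B (Suc n)"
      by (rule pp_boundaries[OF pres_self \<phi>])
    ultimately show ?thesis using pres_inj_eq[OF PP sZ sB] by simp
  qed
  have "\<forall>j<b 0. g j \<in> carrier E" "\<forall>n. \<forall>i<b n. \<forall>j<b (Suc n). \<phi> n i j \<in> carrier A" "\<forall>j<b 0. g' j \<in> U"
    using g' c \<phi> h_closed by auto
  then show ?thesis unfolding free_resolution_def resol_def a1 a2 a3 by blast
qed

text \<open>Existence of some resolution makes the choice in \<open>Tor\<close> a genuine
  resolution; its generators and matrix entries are then lifted to preimages under \<open>p\<close>
  and \<open>h\<close>.\<close>

lemma chosen_resolution:
  assumes P: "pres sc p V U E" and no: "noeth (range (*)) I UNIV" "noeth (range sc) V U"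
  shows "\<exists>b g g' \<phi> \<phi>'. (SOME (b, g, \<phi>). free_resolution A E b g \<phi>) = (b, g, \<phi>) \<and> resol sc I V U b g' \<phi>'
    \<and> (\<forall>n i j. i < b n \<longrightarrow> j < b (Suc n) \<longrightarrow> \<phi> n i j = h (\<phi>' n i j))"
proof -
  obtain b0 g0 \<phi>0 where r0: "resol sc I V U b0 g0 \<phi>0"
    using resol_exists[OF presD(1)[OF P] sub_I no(1) pres_apair[OF P] no(2)] by blast
  have "free_resolution A E b0 (\<lambda>j. p (g0 j)) (\<lambda>n i j. h (\<phi>0 n i j))"
    by (subst free_resolution_iff[OF P, where g' = g0 and \<phi>' = \<phi>0]) (use r0 in \<open>auto simp: resol_def\<close>)
  then have ex: "\<exists>z. case z of (b, g, \<phi>) \<Rightarrow> free_resolution A E b g \<phi>" by (intro exI[of _ "(b0, \<lambda>j. p (g0 j), \<lambda>n i j. h (\<phi>0 n i j))"]) simp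
  obtain b g \<phi> where c: "(SOME (b, g, \<phi>). free_resolution A E b g \<phi>) = (b, g, \<phi>)" by (metis prod_cases3)
  have fr: "free_resolution A E b g \<phi>" using someI_ex[OF ex] unfolding c by simp
  define g' where "g' j = (SOME z. z \<in> U \<and> p z = g j)" for j
  define \<phi>' where "\<phi>' n i j = (SOME s. h s = \<phi> n i j)" for n i j
  have g': "g' j \<in> U \<and> g j = p (g' j)" if "j < b 0" for j
  proof -
    have "g j \<in> carrier E" using fr that unfolding free_resolution_def by blast
    then have "\<exists>z. z \<in> U \<and> p z = g j" using presD(5)[OF P] by auto
    from someI_ex[OF this] show ?thesis by (simp add: g'_def)
  qed
  have \<phi>': "\<phi> n i j = h (\<phi>' n i j)" if "i < b n" "j < b (Suc n)" for n i j
  proof -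
    have "\<phi> n i j \<in> carrier A" using fr that unfolding free_resolution_def by blast
    from someI_ex[OF h_surj[OF this]] show ?thesis by (simp add: \<phi>'_def)
  qed
  have "resol sc I V U b g' \<phi>'" using fr free_resolution_iff[where b = b and g = g and g' = g' and \<phi> = \<phi> and \<phi>' = \<phi>', OF P g' \<phi>'] by blast
  then show ?thesis using c \<phi>' by blast
qed

lemma ideal_smult_eq:
  assumes P: "pres sc p V U E" and J: "J \<subseteq> carrier A" and W: "submod sc W" "V \<subseteq> W" "W \<subseteq> U"
    and 1: "\<And>s u. h s \<in> J \<Longrightarrow> u \<in> U \<Longrightarrow> sc s u \<in> W"
    and 2: "\<And>X. submod sc X \<Longrightarrow> V \<subseteq> X \<Longrightarrow> X \<subseteq> U \<Longrightarrow> (\<And>s u. h s \<in> J \<Longrightarrow> u \<in> U \<Longrightarrow> sc s u \<in> X) \<Longrightarrow> W \<subseteq> X"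
  shows "ideal_smult A J E = p ` W"
proof -
  let ?S = "{a \<odot>\<^bsub>E\<^esub> x | a x. a \<in> J \<and> x \<in> carrier E}"
  have S: "?S = {p (sc s u) | s u. h s \<in> J \<and> u \<in> U}"
  proof (intro equalityI subsetI)
    fix y assume "y \<in> ?S"
    then obtain a x where ax: "y = a \<odot>\<^bsub>E\<^esub> x" "a \<in> J" "x \<in> carrier E" by blast
    obtain s where s: "h s = a" using h_surj J ax(2) by blast
    obtain u where u: "u \<in> U" "x = p u" using ax(3) presD(5)[OF P] by blast
    have "y = p (sc s u)" unfolding ax(1) s[symmetric] u(2) by (rule presD(8)[OF P u(1)])
    then show "y \<in> {p (sc s u) | s u. h s \<in> J \<and> u \<in> U}" using s ax(2) u(1) by blast
  next
    fix y assume "y \<in> {p (sc s u) | s u. h s \<in> J \<and> u \<in> U}"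
    then obtain s u where su: "y = p (sc s u)" "h s \<in> J" "u \<in> U" by blast
    have "y = h s \<odot>\<^bsub>E\<^esub> p u" unfolding su(1) by (rule presD(8)[OF P su(3), symmetric])
    then show "y \<in> ?S" using su(2,3) presD(5)[OF P] by blast
  qed
  show ?thesis
    unfolding ideal_smult_def submodule_gen_def
  proof (intro equalityI)
    have "submodule (p ` W) A E" unfolding pres_submodule[OF P] using W by blast
    moreover have "?S \<subseteq> p ` W" unfolding S using 1 by blast
    ultimately show "\<Inter>{N. submodule N A E \<and> ?S \<subseteq> N} \<subseteq> p ` W" by blast
    show "p ` W \<subseteq> \<Inter>{N. submodule N A E \<and> ?S \<subseteq> N}"
    proof (rule Inter_greatest)
      fix N assume "N \<in> {N. submodule N A E \<and> ?S \<subseteq> N}"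
      then obtain X where X: "N = p ` X" "submod sc X" "V \<subseteq> X" "X \<subseteq> U" and SX: "?S \<subseteq> p ` X"
        unfolding pres_submodule[OF P] by blast
      have "sc s u \<in> X" if "h s \<in> J" "u \<in> U" for s u
        using pres_inj[OF P sub_sc[OF presD(3)[OF P] that(2)] X(2-4)] SX that unfolding S by blast
      then have "W \<subseteq> X" by (rule 2[OF X(2-4)])
      then show "p ` W \<subseteq> N" unfolding X(1) by (rule image_mono)
    qed
  qed
qed

lemma ideal_smult_Idl:
  assumes P: "pres sc p V U E" and xs: "\<And>j. j < length xs \<Longrightarrow> xs ! j = h (x j)" and i: "i \<le> length xs"
  shows "ideal_smult A (Idl (set (take i xs))) E = p ` vx sc x V U i"
proof (rule ideal_smult_eq[OF P])
  interpret M: smod sc by (rule presD(1)[OF P])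
  note V = presD(2)[OF P] and U = presD(3)[OF P] and VU = presD(4)[OF P]
  have W: "submod sc (vx sc x V U i)" "V \<subseteq> vx sc x V U i" "vx sc x V U i \<subseteq> U" for i
    using M.vx_facts[OF V U VU] by blast+
  show "submod sc (vx sc x V U i)" by (rule W(1))
  show "V \<subseteq> vx sc x V U i" by (rule W(2))
  show "vx sc x V U i \<subseteq> U" by (rule W(3))
  have set_eq: "set (take i xs) = (\<lambda>j. h (x j)) ` {..<i}"
  proof (intro equalityI subsetI)
    fix y assume "y \<in> set (take i xs)"
    then obtain j where j: "j < length (take i xs)" "take i xs ! j = y" unfolding in_set_conv_nth by blast
    then have "y = h (x j)" using xs[of j] by simp
    then show "y \<in> (\<lambda>j. h (x j)) ` {..<i}" using j(1) by simp
  next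
    fix y assume "y \<in> (\<lambda>j. h (x j)) ` {..<i}"
    then obtain j where j: "j < i" "y = h (x j)" by blast
    then have "y = take i xs ! j" "j < length (take i xs)" using xs[of j] i by simp_all
    then show "y \<in> set (take i xs)" using nth_mem by blast
  qed
  have carr: "set (take i xs) \<subseteq> carrier A" unfolding set_eq using h_closed by blast
  interpret J: ideal "Idl (set (take i xs))" A by (rule genideal_ideal[OF carr])
  show "Idl (set (take i xs)) \<subseteq> carrier A" by (rule J.a_subset)
  have xin: "h (x j) \<in> Idl (set (take i xs))" if "j < i" for j
    using genideal_self[OF carr] that unfolding set_eq by blast
  \<comment> \<open>The scalars that carry \<open>U\<close> into \<open>vx\<close>. They form an
    ideal containing all \<open>x j\<close> with \<open>j < i\<close>, so minimality of the
    generated ideal applies.\<close>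
  let ?T = "{s. \<forall>u\<in>U. sc s u \<in> vx sc x V U i}"
  have T: "submod (*) ?T"
  proof (rule sub_scI)
    show "0 \<in> ?T" using sub_0[OF W(1)] by (simp add: M.sc_0_left)
    show "r - s \<in> ?T" if "r \<in> ?T" "s \<in> ?T" for r s using that sub_diff[OF W(1)] by (simp add: M.sc_diff_left)
    show "r * s \<in> ?T" if "s \<in> ?T" for r s using that sub_sc[OF W(1)] by (simp add: M.sc_mult)
  qed
  have IT: "I \<subseteq> ?T" using apairD(4)[OF pres_apair[OF P]] W(2) by blast
  have vj: "sc (x j) u \<in> vx sc x V U k" if "j < k" "u \<in> U" for j k u
    using that(1)
  proof (induction k)
    case (Suc k)
    have sU: "0 \<in> sc (x k) ` U" using imageI[OF sub_0[OF U], of "sc (x k)"] by (simp add: M.sc_0)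
    show ?case
    proof (cases "j = k")
      case True
      show ?thesis unfolding True vx.simps by (rule subsetD[OF ssum_right[OF sub_0[OF W(1)]] imageI[OF that(2)]])
    next
      case False
      then have "sc (x j) u \<in> vx sc x V U k" using Suc by simp
      then show ?thesis unfolding vx.simps by (rule subsetD[OF ssum_left[OF sU]])
    qed
  qed simp
  have "set (take i xs) \<subseteq> h ` ?T" unfolding set_eq using vj by blast
  then have JT: "Idl (set (take i xs)) \<subseteq> h ` ?T" by (rule genideal_minimal[OF ideal_image[OF T]])
  show "sc s u \<in> vx sc x V U i" if "h s \<in> Idl (set (take i xs))" "u \<in> U" for s u
    using mem_image[OF T IT, of s] JT that by blast
  fix X assume X: "submod sc X" "V \<subseteq> X" "X \<subseteq> U" "\<And>s u. h s \<in> Idl (set (take i xs)) \<Longrightarrow> u \<in> U \<Longrightarrow> sc s u \<in> X"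
  have "vx sc x V U k \<subseteq> X" if "k \<le> i" for k
    using that
  proof (induction k)
    case (Suc k)
    have "sc (x k) ` U \<subseteq> X" using X(4)[OF xin[of k]] Suc.prems by auto
    then show ?case unfolding vx.simps by (intro ssum_least[OF X(1)]) (use Suc in auto)
  qed (use X(2) in simp)
  then show "vx sc x V U i \<subseteq> X" by simp
qed

end

section \<open>Local rings and their invariants through a cover\<close>

locale local_cover = cover A h for A :: "('a, 'r) ring_scheme" (structure) and h :: "'s::comm_ring_1 \<Rightarrow> 'a" +
  assumes loc: "noetherian_local_ring A"
begin

abbreviation "m \<equiv> max_ideal A"

definition N where "N = {s. h s \<in> m}"

lemma maximal_m: "maximalideal m A" and maximal_unique: "maximalideal J A \<Longrightarrow> J = m"
proof -
  have e: "\<exists>!m. maximalideal m A" using loc by (simp add: noetherian_local_ring_def)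
  show "maximalideal m A" unfolding max_ideal_def by (rule theI'[OF e])
  then show "maximalideal J A \<Longrightarrow> J = m" using e by blast
qed

lemma ideal_m: "ideal m A" using maximal_m by (rule maximalideal.axioms(1))

lemma hN: "h ` N = m" unfolding N_def by (rule ideal_vimage(3)[OF ideal_m])

lemma noethI: "noeth (range (*)) I UNIV"
  using loc by (intro noeth_I) (simp add: noetherian_local_ring_def)

lemma subN: "submod (*) N" and IN: "I \<subseteq> N"
  unfolding N_def by (rule ideal_vimage[OF ideal_m])+

lemma one_N: "1 \<notin> N"
proof
  assume "1 \<in> N"
  then have "\<one> \<in> m" by (simp add: N_def h_one)
  then have "m = carrier A" using ideal.one_imp_carrier[OF ideal_m] by blast
  then show False using maximalideal.I_notcarr[OF maximal_m] by simp
qed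

text \<open>A non-unit lies in a proper ideal and hence in a maximal one, found by the chain
  condition; uniqueness identifies that ideal with \<open>m\<close>.\<close>

lemma unit_N: assumes s: "s \<notin> N" shows "\<exists>s'. s' * s - 1 \<in> I"
proof (rule ccontr)
  assume n: "\<not> ?thesis"
  interpret R: smod "(*) :: 's \<Rightarrow> _" by (rule smod_mult)
  let ?F = "{W. submod (*) W \<and> I \<subseteq> W \<and> 1 \<notin> W \<and> s \<in> W}"
  let ?W = "range (\<lambda>c. c * s) \<boxplus> I"
  note rs = sub_multiples[of s]
  have W1: "1 \<notin> ?W"
  proof
    assume "1 \<in> ?W"
    then obtain c i where ci: "i \<in> I" "1 = c * s + i" by (auto elim!: ssumE)
    have "c * s - 1 = - i" unfolding ci(2) by simp
    then have "c * s - 1 \<in> I" using sub_uminus[OF sub_I ci(1)] by simp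
    then show False using n by blast
  qed
  have sW: "s \<in> ?W" using subsetD[OF ssum_left[OF sub_0[OF sub_I]] rangeI[of "\<lambda>c. c * s" 1]] by simp
  have W: "?W \<in> ?F" using sub_ssum'[OF rs sub_I R.addops_sc] ssum_right[OF sub_0[OF rs]] W1 sW by blast
  have "\<exists>W\<in>?F. \<forall>W'\<in>?F. W \<subseteq> W' \<longrightarrow> W' = W"
  proof (rule noeth_max[OF noethI])
    show "?F \<noteq> {}" using W by blast
    show "submod (*) W \<and> I \<subseteq> W \<and> W \<subseteq> UNIV" if "W \<in> ?F" for W using that by blast
  qed
  then obtain X where X: "X \<in> ?F" and mx: "\<forall>W'\<in>?F. X \<subseteq> W' \<longrightarrow> W' = X" by blast
  have "maximalideal (h ` X) A"
  proof (rule maximalidealI)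
    show iX: "ideal (h ` X) A" using X ideal_image by blast
    have "h 1 \<notin> h ` X" using mem_image[of X 1] X by blast
    then show "carrier A \<noteq> h ` X" using h_closed by blast
    fix J assume J: "ideal J A" "h ` X \<subseteq> J" "J \<subseteq> carrier A"
    let ?J = "{s. h s \<in> J}"
    note v = ideal_vimage[OF J(1)]
    have XJ: "X \<subseteq> ?J" using J(2) by blast
    show "J = h ` X \<or> J = carrier A"
    proof (cases "1 \<in> ?J")
      case True
      then have "\<one> \<in> J" by (simp add: h_one)
      then show ?thesis using ideal.one_imp_carrier[OF J(1)] by blast
    next
      case False
      then have "?J \<in> ?F" using v X XJ by blast
      then have "?J = X" using mx XJ by blast
      then show ?thesis using v(3) by simp
    qed
  qed
  then have "h ` X = m" by (rule maximal_unique)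
  then have "h s \<in> m" using X by blast
  then show False using s by (simp add: N_def)
qed

lemma lring: "lring I N"
  by unfold_locales (rule sub_I subN IN one_N unit_N, assumption?)+

lemma glring_exists: "\<exists>a t. glring I N a t"
proof -
  obtain t a where ta: "\<forall>i<t. a i \<in> N" "N = range (lc (*) t a) \<boxplus> I"
    using noeth_fg[OF smod_mult noethI sub_I subN IN subset_UNIV] by blast
  have "glring I N a t"
    unfolding glring_def glring_axioms_def
  proof (intro conjI allI impI lring)
    show "a i \<in> N" if "i < t" for i using ta(1) that by blast
    show "\<exists>c. s - (\<Sum>i<t. c i * a i) \<in> I" if "s \<in> N" for s
    proof -
      have "s \<in> range (lc (*) t a) \<boxplus> I" using that ta(2) by (simp only:)
      then obtain y v where yv: "y \<in> range (lc (*) t a)" "v \<in> I" "s = y + v" by (rule ssumE)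
      obtain c where "y = lc (*) t a c" using yv(1) by (rule rangeE)
      then have "s - (\<Sum>i<t. c i * a i) \<in> I" using yv(2,3) by (simp add: lc_def)
      then show ?thesis by (rule exI[of _ c])
    qed
  qed
  then show ?thesis by blast
qed

lemma pres_residue: "pres (*) (\<lambda>s. m +>\<^bsub>self_module A\<^esub> h s) N UNIV (residue_field A)"
  using pres_quot[OF pres_self subN IN subset_UNIV] unfolding hN residue_field_def .

text \<open>The resolution chosen in \<open>Tor\<close> resolves \<open>E\<close>, so the
  coefficients are the pair \<open>N\<close>, \<open>UNIV\<close> of the residue field.\<close>

lemma betti_eq:
  assumes P: "pres sc p V U E" and no: "noeth (range sc) V U"
  shows "\<exists>b g \<phi>. resol sc I V U b g \<phi> \<and> (\<forall>n. betti A E n = the_enat (bet (*) b \<phi> n N UNIV))"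
proof -
  obtain b g g' \<phi> \<phi>' where r: "(SOME (b, g, \<phi>). free_resolution A E b g \<phi>) = (b, g, \<phi>)" "resol sc I V U b g' \<phi>'"
    "\<forall>n i j. i < b n \<longrightarrow> j < b (Suc n) \<longrightarrow> \<phi> n i j = h (\<phi>' n i j)"
    using chosen_resolution[OF P noethI no] by blast
  have \<phi>: "\<phi> n i j = h (\<phi>' n i j)" if "i < b n" "j < b (Suc n)" for n i j using r(3) that by blast
  interpret R: smod "(*) :: 's \<Rightarrow> _" by (rule smod_mult)
  note PR = pres_residue
  have ap: "apair (*) I N UNIV" by (rule pres_apair[OF PR])
  have c: "is_cpx I b \<phi>'" by (rule resol_cpx[OF r(2) sub_I])
  have "module_length A (Tor A n E (residue_field A)) = bet (*) b \<phi>' n N UNIV" for n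
  proof -
    let ?q = "pp (\<lambda>s. m +>\<^bsub>self_module A\<^esub> h s) (b n)"
    let ?Z = "cyc (*) b \<phi>' n N UNIV" and ?B = "bnd (*) b \<phi>' n N UNIV"
    have "pres (psc (*)) ?q (pw (b n) N) ?Z ((module_power (residue_field A) (b n))\<lparr>carrier := ?q ` ?Z\<rparr>)"
      by (rule pres_restrict[OF pres_power[OF PR] R.sub_cyc[OF subN sub_UNIV] R.pw_cyc[OF subN subset_UNIV] R.cyc_pw])
    note pr = this
    have zc: "complex_cycles (residue_field A) b \<phi> n = ?q ` ?Z" by (rule pp_cycles[OF PR \<phi>])
    have bc: "complex_boundaries (residue_field A) b \<phi> n = ?q ` ?B" by (rule pp_boundaries[OF PR \<phi>])
    from pres_length[OF pres_quot[OF pr R.sub_bnd[OF subN sub_UNIV] R.pw_bnd[OF sub_UNIV] R.bnd_cyc[OF c ap]]]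
    show ?thesis
      unfolding Tor_def r(1) Let_def prod.case bet_def zc bc .
  qed
  then show ?thesis using r(2) unfolding betti_def by auto
qed

lemma ideal_power_carrier: "ideal_power A m n \<subseteq> carrier A"
proof (induction n)
  case (Suc n)
  have "x \<in> carrier A" if "x \<in> m \<cdot> ideal_power A m n" for x
    using that
  proof (induction rule: ideal_prod.induct)
    case (prod i j)
    then show ?case using Suc ideal.Icarr[OF ideal_m] by auto
  qed simp
  then show ?case by auto
qed simp

lemma ideal_smult_power:
  assumes G: "glring I N a t" and P: "pres sc p V U E"
  shows "ideal_smult A (ideal_power A m n) E = p ` (smod.mpw sc a t n U \<boxplus> V)"
proof (rule ideal_smult_eq[OF P ideal_power_carrier])
  interpret M: glmod I N sc a t by (rule glring.glmod_I[OF G presD(1)[OF P]])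
  note V = presD(2)[OF P] and U = presD(3)[OF P] and VU = presD(4)[OF P] and ap = pres_apair[OF P]
  note sm = M.sub_mpw[OF U] and mU = M.mpw_subset[OF U]
  show "submod sc (M.mpw a t n U \<boxplus> V)" by (rule sub_ssum'[OF sm V M.addops_sc])
  show "V \<subseteq> M.mpw a t n U \<boxplus> V" by (rule ssum_right[OF sub_0[OF sm]])
  show "M.mpw a t n U \<boxplus> V \<subseteq> U" by (rule ssum_least[OF U mU VU])
  show "sc s u \<in> M.mpw a t n U \<boxplus> V" if "h s \<in> ideal_power A m n" "u \<in> U" for s u
    using that
  proof (induction n arbitrary: s u)
    case 0
    then show ?case using sub_sc[OF U] ssum_left[OF sub_0[OF V], of U] by auto
  next
    case (Suc n)
    note sW = sub_ssum'[OF M.sub_mpw[OF U, of a t "Suc n"] V M.addops_sc]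
    \<comment> \<open>Induction over the generation of the product ideal. The claim covers all
      preimages of \<open>c\<close>, since two of them differ by an element of \<open>I\<close>,
      which carries \<open>U\<close> into \<open>V\<close>.\<close>
    have "\<forall>s. h s = c \<longrightarrow> (\<forall>u\<in>U. sc s u \<in> M.mpw a t (Suc n) U \<boxplus> V)" if "c \<in> m \<cdot> ideal_power A m n" for c
      using that
    proof (induction rule: ideal_prod.induct)
      case (prod i j)
      obtain s1 where s1: "h s1 = i" using h_surj ideal.Icarr[OF ideal_m prod(1)] by blast
      obtain s2 where s2: "h s2 = j" using h_surj prod(2) ideal_power_carrier by blast
      show ?case
      proof (intro allI impI ballI)
        fix s u assume s: "h s = i \<otimes> j" and u: "u \<in> U"
        have "s - s1 * s2 \<in> I" unfolding h_eq[symmetric] h_mult s1 s2 s ..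
        then have d: "sc (s - s1 * s2) u \<in> V" by (rule apairD(4)[OF ap _ u])
        have "sc s2 u \<in> M.mpw a t n U \<boxplus> V" by (rule Suc.IH) (use s2 prod(2) u in simp_all)
        then obtain y v where yv: "y \<in> M.mpw a t n U" "v \<in> V" "sc s2 u = y + v" by (rule ssumE)
        have "s1 \<in> N" using s1 prod(1) by (simp add: N_def)
        then have "sc s1 y \<in> M.mpw a t (Suc n) U \<boxplus> V" unfolding M.mpw_Suc by (rule M.N_am[OF ap _ yv(1) sm mU])
        moreover have "sc s1 v + sc (s - s1 * s2) u \<in> V" by (rule sub_add[OF V sub_sc[OF V yv(2)] d])
        then have "sc s1 v + sc (s - s1 * s2) u \<in> M.mpw a t (Suc n) U \<boxplus> V"
          by (rule subsetD[OF ssum_right[OF sub_0[OF M.sub_mpw[OF U]]]])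
        ultimately have "sc s1 y + (sc s1 v + sc (s - s1 * s2) u) \<in> M.mpw a t (Suc n) U \<boxplus> V" by (rule sub_add[OF sW])
        moreover have "sc s u = sc s1 y + (sc s1 v + sc (s - s1 * s2) u)"
          unfolding M.sc_diff_left M.sc_mult yv(3) M.sc_add by simp
        ultimately show "sc s u \<in> M.mpw a t (Suc n) U \<boxplus> V" by (simp only:)
      qed
    next
      case (sum c1 c2)
      have c1: "c1 \<in> carrier A" and c2: "c2 \<in> carrier A"
        using sum(1,2) ideal_power_carrier[of "Suc n"] by auto
      obtain s1 where s1: "h s1 = c1" using h_surj[OF c1] by blast
      show ?case
      proof (intro allI impI ballI)
        fix s u assume s: "h s = c1 \<oplus> c2" and u: "u \<in> U"
        obtain s2 where s2: "h s2 = c2" using h_surj[OF c2] by blast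
        have "s - (s1 + s2) \<in> I" unfolding h_eq[symmetric] h_add s1 s2 s ..
        then have "sc (s - (s1 + s2)) u \<in> V" by (rule apairD(4)[OF ap _ u])
        then have "sc (s - (s1 + s2)) u \<in> M.mpw a t (Suc n) U \<boxplus> V"
          by (rule subsetD[OF ssum_right[OF sub_0[OF M.sub_mpw[OF U]]]])
        moreover have "sc s1 u + sc s2 u \<in> M.mpw a t (Suc n) U \<boxplus> V"
          by (rule sub_add[OF sW]) (use sum(3,4) s1 s2 u in blast)+
        ultimately have "sc (s - (s1 + s2)) u + (sc s1 u + sc s2 u) \<in> M.mpw a t (Suc n) U \<boxplus> V" by (rule sub_add[OF sW])
        then show "sc s u \<in> M.mpw a t (Suc n) U \<boxplus> V" by (simp add: M.sc_diff_left M.sc_add_left)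
      qed
    qed
    then show ?case using Suc.prems by simp
  qed
  fix X assume X: "submod sc X" "V \<subseteq> X" "X \<subseteq> U" "\<And>s u. h s \<in> ideal_power A m n \<Longrightarrow> u \<in> U \<Longrightarrow> sc s u \<in> X"
  have "M.mpw a t n U \<subseteq> X" using X(1,4)
  proof (induction n arbitrary: X)
    case 0
    show ?case
    proof
      fix u assume "u \<in> M.mpw a t 0 U"
      then show "u \<in> X" using 0(2)[of 1 u] by (simp add: h_one M.sc_one)
    qed
  next
    case (Suc n)
    \<comment> \<open>The elements that all of \<open>N\<close> carries into \<open>X\<close>; the
      induction hypothesis places \<open>m^n U\<close> here, and one more multiplication lands in
      \<open>X\<close>.\<close>
    let ?X = "{u \<in> U. \<forall>s\<in>N. sc s u \<in> X}"
    note sX = Suc.prems(1)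
    have "M.mpw a t n U \<subseteq> ?X"
    proof (rule Suc.IH)
      show "submod sc ?X"
      proof (rule sub_scI)
        show "0 \<in> ?X" using sub_0[OF U] sub_0[OF sX] by (simp add: M.sc_0)
        show "u - v \<in> ?X" if "u \<in> ?X" "v \<in> ?X" for u v using that sub_diff[OF U] sub_diff[OF sX] by (simp add: M.sc_diff)
        show "sc r u \<in> ?X" if "u \<in> ?X" for r u
          using that sub_sc[OF U] sub_sc[OF sX] by (simp add: M.sc_commute[of _ r])
      qed
      fix s u assume su: "h s \<in> ideal_power A m n" "u \<in> U"
      have "sc r (sc s u) \<in> X" if "r \<in> N" for r
      proof -
        have "h (r * s) \<in> m \<cdot> ideal_power A m n"
          unfolding h_mult by (rule ideal_prod.prod) (use that su in \<open>simp_all add: N_def\<close>)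
        then show ?thesis using Suc.prems(2)[of "r * s" u] su(2) by (simp add: M.sc_mult)
      qed
      then show "sc s u \<in> ?X" using sub_sc[OF U su(2)] by blast
    qed
    then have n: "sc r u \<in> X" if "r \<in> N" "u \<in> M.mpw a t n U" for r u using that by blast
    show ?case unfolding M.mpw_Suc M.am_def
    proof
      fix y assume "y \<in> {\<Sum>i<t. sc (a i) (u i) | u. \<forall>i<t. u i \<in> M.mpw a t n U}"
      then obtain u where u: "\<forall>i<t. u i \<in> M.mpw a t n U" "y = (\<Sum>i<t. sc (a i) (u i))" by blast
      show "y \<in> X" unfolding u(2) by (rule sub_sum[OF sX], rule n) (use u(1) M.aN in auto)
    qed
  qed
  then show "M.mpw a t n U \<boxplus> V \<subseteq> X" by (rule ssum_least[OF X(1) _ X(2)])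
qed

lemma ideal_power_1: "ideal_power A m 1 = m"
proof -
  interpret J: ideal m A by (rule ideal_m)
  have "x \<in> m" if "x \<in> m \<cdot> carrier A" for x
    using that by (induction rule: ideal_prod.induct) (simp_all add: J.I_r_closed)
  moreover have "x \<in> m \<cdot> carrier A" if "x \<in> m" for x
    using ideal_prod.prod[of x m "\<one>" "carrier A" A] that by simp
  ultimately show ?thesis by auto
qed

lemma length_power:
  assumes G: "glring I N a t" and P: "pres sc p V U E"
  shows "module_length A (quot_module E (ideal_smult A (ideal_power A m n) E)) = hs sc a t n V U"
proof -
  interpret M: glmod I N sc a t by (rule glring.glmod_I[OF G presD(1)[OF P]])
  note V = presD(2)[OF P] and U = presD(3)[OF P] and VU = presD(4)[OF P]
  show ?thesis
    unfolding ideal_smult_power[OF G P] hs_def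
    by (rule pres_length[OF pres_quot[OF P]])
       (rule sub_ssum'[OF M.sub_mpw[OF U] V M.addops_sc], rule ssum_right[OF sub_0[OF M.sub_mpw[OF U]]],
        rule ssum_least[OF U M.mpw_subset[OF U] VU])
qed

lemma prime_image: "pri I P \<Longrightarrow> primeideal (h ` P) A"
proof (rule primeidealI)
  assume p: "pri I P"
  then have P: "submod (*) P" "I \<subseteq> P" "1 \<notin> P" "\<And>s t. s * t \<in> P \<Longrightarrow> s \<in> P \<or> t \<in> P" unfolding pri_def by blast+
  show "ideal (h ` P) A" by (rule ideal_image[OF P(1)])
  show "cring A" by unfold_locales
  have "h 1 \<notin> h ` P" using mem_image[OF P(1,2)] P(3) by blast
  then show "carrier A \<noteq> h ` P" using h_closed by blast
  fix a b assume ab: "a \<in> carrier A" "b \<in> carrier A" "a \<otimes> b \<in> h ` P"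
  obtain s r where sr: "h s = a" "h r = b" using h_surj ab by blast
  have "h (s * r) \<in> h ` P" unfolding h_mult sr by (rule ab(3))
  then have "s \<in> P \<or> r \<in> P" using mem_image[OF P(1,2)] P(4) by blast
  then show "a \<in> h ` P \<or> b \<in> h ` P" using sr by blast
qed

text \<open>With \<open>N\<close> on top there are \<open>d + 2\<close> primes, a chain with
  \<open>d + 1\<close> strict inclusions in a ring of dimension \<open>d\<close>.\<close>

lemma prime_chain_bound:
  assumes dim: "krull_dim A = ereal (real d)"
    and Q: "\<forall>i\<le>d. pri I (Q i)" "\<forall>i<d. Q i \<subset> Q (Suc i)" "Q d \<subset> N"
  shows False
proof -
  define R where "R i = (if i \<le> d then Q i else N)" for i
  have "pri I N"
    unfolding pri_def
  proof (intro conjI allI impI)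
    fix s r assume sr: "s * r \<in> N"
    show "s \<in> N \<or> r \<in> N"
    proof (rule ccontr)
      assume "\<not> ?thesis"
      then obtain s' where s': "s' * s - 1 \<in> I" and r: "r \<notin> N" using unit_N by blast
      have "(s' * s - 1) * r \<in> N" using sub_sc[OF subN, of "s' * s - 1" r] s' IN by (auto simp: mult.commute)
      moreover have "s' * (s * r) \<in> N" by (rule sub_sc[OF subN sr])
      ultimately have "s' * (s * r) - (s' * s - 1) * r \<in> N" by (rule sub_diff[OF subN, rotated])
      moreover have "s' * (s * r) - (s' * s - 1) * r = r" by (simp add: algebra_simps)
      ultimately show False using r by simp
    qed
  qed (rule subN IN one_N)+
  then have pR: "pri I (R i)" for i using Q(1) by (simp add: R_def)
  have sR: "R i \<subset> R (Suc i)" if "i < Suc d" for i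
    using Q(2,3) that by (cases "i = d") (auto simp: R_def)
  have mR: "submod (*) (R i)" "I \<subseteq> R i" for i using pR[of i] unfolding pri_def by blast+
  have "h ` R i \<subset> h ` R (Suc i)" if i: "i < Suc d" for i
  proof -
    obtain s where s: "s \<in> R (Suc i)" "s \<notin> R i" using sR[OF i] by blast
    then have "h s \<notin> h ` R i" using mem_image[OF mR] by blast
    then show ?thesis using sR[OF i] s(1) by blast
  qed
  then have "ereal (real (Suc d)) \<le> krull_dim A"
    unfolding krull_dim_def using prime_image[OF pR]
    by (intro Sup_upper CollectI exI[of _ "Suc d"] exI[of _ "\<lambda>i. h ` R i"]) simp
  then show False unfolding dim by simp
qed

end

text \<open>Both sides only concern large \<open>n\<close>, which keeps the comparison power
  positive.\<close>

lemma grow_iff_limsup: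
  "limsup (\<lambda>n. ereal (real (\<beta> n) / pwr k n)) < \<infinity> \<longleftrightarrow> grow k (\<lambda>n. enat (\<beta> n))"
proof
  assume "limsup (\<lambda>n. ereal (real (\<beta> n) / pwr k n)) < \<infinity>"
  then obtain C where C: "limsup (\<lambda>n. ereal (real (\<beta> n) / pwr k n)) < ereal C"
    using ereal_dense3 by (metis ereal_dense2)
  obtain n0 where n0: "\<And>n. n \<ge> n0 \<Longrightarrow> ereal (real (\<beta> n) / pwr k n) < ereal C"
    using Limsup_lessD[OF C] unfolding eventually_sequentially by blast
  show "grow k (\<lambda>n. enat (\<beta> n))"
  proof (rule growI[of "max n0 1"])
    fix n assume n: "n \<ge> max n0 1"
    have "real (\<beta> n) / pwr k n < C" using n0[of n] n by simp
    moreover have "pwr k n > 0" using n by simp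
    ultimately have "real (\<beta> n) \<le> C * pwr k n" by (simp add: divide_less_eq)
    then show "\<exists>i. enat (\<beta> n) = enat i \<and> real i \<le> C * pwr k n" by blast
  qed
next
  assume "grow k (\<lambda>n. enat (\<beta> n))"
  then obtain C n1 where C: "\<And>n. n \<ge> n1 \<Longrightarrow> \<exists>i. enat (\<beta> n) = enat i \<and> real i \<le> C * pwr k n"
    unfolding grow_def by blast
  have "limsup (\<lambda>n. ereal (real (\<beta> n) / pwr k n)) \<le> ereal C"
  proof (rule Limsup_bounded, unfold eventually_sequentially, intro exI allI impI)
    fix n assume n: "max n1 1 \<le> n"
    have "real (\<beta> n) \<le> C * pwr k n" using C[of n] n by auto
    moreover have "pwr k n > 0" using n by simp
    ultimately show "ereal (real (\<beta> n) / pwr k n) \<le> ereal C" by (simp add: divide_le_eq)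
  qed
  then show "limsup (\<lambda>n. ereal (real (\<beta> n) / pwr k n)) < \<infinity>" by (rule le_less_trans) simp
qed

lemma (in cover) fg_pres:
  assumes M: "module A M" and fg: "finitely_generated A M"
  shows "\<exists>n \<pi> V. pres (psc (*)) \<pi> V (pw n (UNIV :: 's set)) M"
proof -
  interpret M: module A M by (rule M)
  obtain S where S: "finite S" "S \<subseteq> carrier M" "submodule_gen A M S = carrier M" using fg unfolding finitely_generated_def by blast
  obtain n g where ng: "S = g ` {i::nat. i < n}" using finite_imp_nat_seg_image_inj_on[OF S(1)] by blast
  have g: "g j \<in> carrier M" if "j < n" for j using S(2) that unfolding ng by blast
  let ?P = "pw n (UNIV :: 's set)"
  define \<pi> where "\<pi> x = (\<Oplus>\<^bsub>M\<^esub>j\<in>{..<n}. h (x j) \<odot>\<^bsub>M\<^esub> g j)" for x :: "nat \<Rightarrow> 's"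
  have cl: "(\<lambda>j. h (x j) \<odot>\<^bsub>M\<^esub> g j) \<in> {..<n} \<rightarrow> carrier M" for x using g h_closed by auto
  have pc: "\<pi> x \<in> carrier M" for x unfolding \<pi>_def by (rule M.finsum_closed[OF cl])
  have pa: "\<pi> x \<oplus>\<^bsub>M\<^esub> \<pi> y = \<pi> (x + y)" for x y
    unfolding \<pi>_def M.finsum_addf[OF cl cl, symmetric]
    by (rule M.finsum_cong') (use g h_closed in \<open>auto simp: h_add M.smult_l_distr\<close>)
  have ps: "h s \<odot>\<^bsub>M\<^esub> \<pi> x = \<pi> (psc (*) s x)" for s x
    unfolding \<pi>_def M.finsum_smult_ldistr[OF finite_lessThan h_closed cl]
    by (rule M.finsum_cong') (use g h_closed in \<open>auto simp: h_mult M.smult_assoc1\<close>)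
  have p0: "\<pi> 0 = \<zero>\<^bsub>M\<^esub>"
  proof -
    have "\<pi> 0 \<oplus>\<^bsub>M\<^esub> \<pi> 0 = \<pi> 0" using pa[of 0 0] by simp
    then show ?thesis using pc by (simp add: M.add.r_cancel_one)
  qed
  have pd: "\<pi> (x - y) = \<zero>\<^bsub>M\<^esub> \<longleftrightarrow> \<pi> x = \<pi> y" for x y
  proof -
    have e: "\<pi> (x - y) \<oplus>\<^bsub>M\<^esub> \<pi> y = \<pi> x" using pa[of "x - y" y] by simp
    show ?thesis
    proof
      assume "\<pi> (x - y) = \<zero>\<^bsub>M\<^esub>"
      then show "\<pi> x = \<pi> y" using e pc by simp
    next
      assume "\<pi> x = \<pi> y"
      then have "\<pi> (x - y) \<oplus>\<^bsub>M\<^esub> \<pi> y = \<pi> y" using e by simp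
      then show "\<pi> (x - y) = \<zero>\<^bsub>M\<^esub>" using pc by (simp add: M.add.r_cancel_one)
    qed
  qed
  let ?V = "{x \<in> ?P. \<pi> x = \<zero>\<^bsub>M\<^esub>}"
  have sP: "submod (psc (*)) ?P" by (rule sub_pw[OF sub_UNIV smod_mult])
  have sV: "submod (psc (*)) ?V"
  proof (rule sub_scI)
    show "0 \<in> ?V" using sub_0[OF sP] p0 by blast
    show "x - y \<in> ?V" if "x \<in> ?V" "y \<in> ?V" for x y
    proof -
      have "\<pi> (x - y) = \<zero>\<^bsub>M\<^esub>" unfolding pd using that by simp
      then show ?thesis using sub_diff[OF sP] that by blast
    qed
    show "psc (*) s x \<in> ?V" if x: "x \<in> ?V" for s x
    proof -
      have "\<pi> (psc (*) s x) = \<zero>\<^bsub>M\<^esub>" unfolding ps[symmetric] using x h_closed by simp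
      then show ?thesis using sub_sc[OF sP] x by blast
    qed
  qed
  have "submodule (\<pi> ` ?P) A M"
  proof (intro submodule.intro submodule_axioms.intro)
    show "subgroup (\<pi> ` ?P) (add_monoid M)"
    proof (rule M.add.subgroupI)
      show "\<pi> ` ?P \<subseteq> carrier M" using pc by blast
      show "\<pi> ` ?P \<noteq> {}" using sub_0[OF sP] by blast
      show "\<ominus>\<^bsub>M\<^esub> a \<in> \<pi> ` ?P" if a: "a \<in> \<pi> ` ?P" for a
      proof -
        obtain x where x: "x \<in> ?P" "a = \<pi> x" using a by blast
        have "\<pi> (- x) \<oplus>\<^bsub>M\<^esub> \<pi> x = \<zero>\<^bsub>M\<^esub>" unfolding pa by (simp add: p0)
        then have "\<ominus>\<^bsub>M\<^esub> a = \<pi> (- x)" unfolding x(2) by (rule M.minus_equality) (rule pc)+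
        then show ?thesis using sub_uminus[OF sP x(1)] by blast
      qed
      show "a \<oplus>\<^bsub>M\<^esub> b \<in> \<pi> ` ?P" if ab: "a \<in> \<pi> ` ?P" "b \<in> \<pi> ` ?P" for a b
      proof -
        obtain x y where "x \<in> ?P" "a = \<pi> x" "y \<in> ?P" "b = \<pi> y" using ab by blast
        then show ?thesis using sub_add[OF sP, of x y] pa by simp
      qed
    qed
    show "a \<odot>\<^bsub>M\<^esub> y \<in> \<pi> ` ?P" if ay: "a \<in> carrier A" "y \<in> \<pi> ` ?P" for a y
    proof -
      obtain s x where "a = h s" "x \<in> ?P" "y = \<pi> x" using h_surj[OF ay(1)] ay(2) by blast
      then show ?thesis using sub_sc[OF sP, of x s] ps by simp
    qed
  qed
  moreover have "S \<subseteq> \<pi> ` ?P"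
  proof
    fix y assume "y \<in> S"
    then obtain j where j: "j < n" "y = g j" unfolding ng by blast
    have "\<pi> (dlt j 1) = (\<Oplus>\<^bsub>M\<^esub>i\<in>{..<n}. if j = i then g i else \<zero>\<^bsub>M\<^esub>)"
      unfolding \<pi>_def by (rule M.finsum_cong') (use g in \<open>auto simp: dlt_def h_one h_zero\<close>)
    also have "\<dots> = g j" by (rule M.finsum_singleton) (use j g in auto)
    finally have "y = \<pi> (dlt j 1)" using j(2) by simp
    moreover have "dlt j 1 \<in> ?P" by (rule dlt_pw[OF j(1)]) simp_all
    ultimately show "y \<in> \<pi> ` ?P" by blast
  qed
  ultimately have "carrier M \<subseteq> \<pi> ` ?P" unfolding S(3)[symmetric] submodule_gen_def by blast
  then have cM: "carrier M = \<pi> ` ?P" using pc by blast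
  have "pres (psc (*)) \<pi> ?V ?P M"
    unfolding pres_def
  proof (intro conjI ballI allI)
    fix x y assume xy: "x \<in> ?P" "y \<in> ?P"
    show "\<pi> x = \<pi> y \<longleftrightarrow> x - y \<in> ?V" using sub_diff[OF sP xy] pd by blast
  qed (use smod_psc[OF smod_mult] sV sP cM p0 pa ps in \<open>blast | simp\<close>)+
  then show ?thesis by blast
qed

section \<open>The inequality for maximal Cohen-Macaulay modules\<close>

theorem theorem1p4:
  fixes A :: "('a, 'r) ring_scheme" and M :: "('a, 'b, 'm) module_scheme" and d :: nat
  assumes "complete_intersection TYPE('q) A"
    and "krull_dim A = ereal (real d)"
    and "module A M"
    and "finitely_generated A M"
    and "maximal_cohen_macaulay A M"
    and "complexity A M < complexity A (residue_field A)"
  shows "multiplicity_module A M \<ge> 2 * real (num_generators A M)"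
proof -
  have loc: "noetherian_local_ring A" using assms(1) unfolding complete_intersection_def by blast
  then have "cring A" unfolding noetherian_local_ring_def by blast
  then obtain h :: "('a multiset, int) poly_mapping \<Rightarrow> 'a" where "cover A h" using cover_exists by blast
  then interpret local_cover A h unfolding local_cover_def local_cover_axioms_def using loc by blast
  obtain a t where G: "glring I N a t" using glring_exists by blast
  interpret G: glring I N a t by (rule G)
  obtain n0 \<pi> V where P: "pres (psc (*)) \<pi> V (pw n0 UNIV) M" using fg_pres[OF assms(3,4)] by blast
  let ?U = "pw n0 (UNIV :: ('a multiset, int) poly_mapping set)"
  note V = presD(2)[OF P] and U = presD(3)[OF P] and ap = pres_apair[OF P]
  have psm: "smod (psc ((*) :: ('a multiset, int) poly_mapping \<Rightarrow> _))" by (rule smod_psc[OF smod_mult])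
  \<comment> \<open>The chain condition for the free module holds above \<open>I^n0\<close>; it
    passes to the relations \<open>V\<close> because they contain \<open>I^n0\<close>.\<close>
  have IV: "pw n0 I \<subseteq> V"
  proof
    fix x assume x: "x \<in> pw n0 I"
    have "(\<Sum>k<n0. psc (*) (x k) (dlt k 1)) \<in> V"
    proof (rule sub_sum[OF V])
      fix k assume "k \<in> {..<n0}"
      then have k: "k < n0" by simp
      have "dlt k (1 :: ('a multiset, int) poly_mapping) \<in> ?U" by (rule dlt_pw[OF k]) simp_all
      then show "psc (*) (x k) (dlt k 1) \<in> V" by (rule apairD(4)[OF ap pwD[OF x k]])
    qed
    then show "x \<in> V" unfolding pw_basis[OF x, symmetric] .
  qed
  have noU: "noeth (range (psc (*))) V ?U"
    by (rule noeth_mono[OF smod.noeth_pw[OF smod_mult sub_I sub_UNIV subset_UNIV noethI] IV order_refl order_refl])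
  have noN: "noeth (range (*)) N UNIV" by (rule noeth_mono[OF noethI IN order_refl order_refl])
  obtain bG gG \<phi>G where rG: "resol (psc (*)) I V ?U bG gG \<phi>G" "\<And>n. betti A M n = the_enat (bet (*) bG \<phi>G n N UNIV)"
    using betti_eq[OF P noU] by blast
  obtain bF gF \<phi>F where rF: "resol (*) I N UNIV bF gF \<phi>F" "\<And>n. betti A (residue_field A) n = the_enat (bet (*) bF \<phi>F n N UNIV)"
    using betti_eq[OF pres_residue noN] by blast
  have cF: "is_cpx I bF \<phi>F" and cG: "is_cpx I bG \<phi>G" by (rule resol_cpx[OF rF(1) sub_I], rule resol_cpx[OF rG(1) sub_I])
  have eF: "enat (betti A (residue_field A) n) = bet (*) bF \<phi>F n N UNIV" for n
    unfolding rF(2) using G.bet_k_finite[OF cF] by (metis enat.exhaust the_enat.simps not_infinity_eq)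
  have eG: "enat (betti A M n) = bet (*) bG \<phi>G n N UNIV" for n
    unfolding rG(2) using G.bet_k_finite[OF cG] by (metis enat.exhaust the_enat.simps not_infinity_eq)
  \<comment> \<open>Complexity is an infimum of exponents, so strict inequality yields one that
    bounds the growth for \<open>M\<close> but not for the residue field.\<close>
  obtain k where k: "grow k (\<lambda>n. enat (betti A M n))" "\<not> grow k (\<lambda>n. enat (betti A (residue_field A) n))"
  proof -
    have "\<exists>z\<in>{enat m | m. limsup (\<lambda>n. ereal (real (betti A M n) / pwr m n)) < \<infinity>}. z < complexity A (residue_field A)"
      using assms(6) unfolding complexity_def[of A M] Inf_less_iff .
    then obtain z where z: "z \<in> {enat m | m. limsup (\<lambda>n. ereal (real (betti A M n) / pwr m n)) < \<infinity>}"
      "z < complexity A (residue_field A)"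
      by (rule bexE)
    then obtain k where k: "z = enat k" "limsup (\<lambda>n. ereal (real (betti A M n) / pwr k n)) < \<infinity>" by blast
    have "\<not> limsup (\<lambda>n. ereal (real (betti A (residue_field A) n) / pwr k n)) < \<infinity>"
    proof
      assume "limsup (\<lambda>n. ereal (real (betti A (residue_field A) n) / pwr k n)) < \<infinity>"
      then have "complexity A (residue_field A) \<le> enat k" unfolding complexity_def by (intro Inf_lower) blast
      then show False using z(2) k(1) by simp
    qed
    then show ?thesis using that k(2) unfolding grow_iff_limsup by blast
  qed
  \<comment> \<open>From here on the fixed complex is the resolution of the residue field, with
    \<open>M\<close> as coefficients.\<close>
  have g: "grow k (\<lambda>n. bet (psc (*)) bF \<phi>F n V ?U)"
  proof (rule grow_mono[OF k(1)[unfolded eG], of 1])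
    fix n :: nat assume "n \<ge> 1"
    then obtain l where l: "n = Suc l" by (cases n) auto
    show "bet (psc (*)) bF \<phi>F n V ?U \<le> bet (*) bG \<phi>G n N UNIV"
      unfolding l by (rule G.balance[OF psm ap rF(1) rG(1)])
  qed
  have dimM: "module_dim A M = ereal (real d)" and depM: "module_depth A M = ereal (real d)"
    using assms(2,5) unfolding maximal_cohen_macaulay_def cohen_macaulay_def by simp_all
  obtain xs where xs: "set xs \<subseteq> m" "regular_sequence A M xs" "length xs = d"
  proof -
    let ?S = "{ereal (real (length xs)) | xs. set xs \<subseteq> m \<and> regular_sequence A M xs}"
    have sup: "Sup ?S = ereal (real d)" using depM unfolding module_depth_def .
    \<comment> \<open>Lengths are integers: a regular sequence longer than \<open>d - 1\<close> and
      bounded by the supremum \<open>d\<close> has length exactly \<open>d\<close>.\<close>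
    have "ereal (real d - 1) < Sup ?S" unfolding sup by simp
    then obtain z where z: "z \<in> ?S" "ereal (real d - 1) < z" unfolding less_Sup_iff by blast
    then obtain xs where xs: "z = ereal (real (length xs))" "set xs \<subseteq> m" "regular_sequence A M xs" by blast
    have "z \<le> ereal (real d)" using Sup_upper[OF z(1)] unfolding sup .
    then have "length xs = d" using z(2) unfolding xs(1) by simp
    then show ?thesis using that xs(2,3) by blast
  qed
  define x where "x j = (SOME s. h s = xs ! j)" for j
  have x: "xs ! j = h (x j)" if "j < length xs" for j
  proof -
    have "xs ! j \<in> carrier A" using xs(1) that ideal.Icarr[OF ideal_m] nth_mem by blast
    from someI_ex[OF h_surj[OF this]] show ?thesis by (simp add: x_def)
  qed
  have xN: "x j \<in> N" if "j < d" for j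
    using x[of j] xs(1,3) that nth_mem[of j xs] by (auto simp: N_def)
  have vf: "submod (psc (*)) (vx (psc (*)) x V ?U i)" "V \<subseteq> vx (psc (*)) x V ?U i" "vx (psc (*)) x V ?U i \<subseteq> ?U" for i
    using smod.vx_facts[OF psm V U presD(4)[OF P]] by blast+
  have reg: "u \<in> vx (psc (*)) x V ?U i" if i: "i < d" and u: "u \<in> ?U" "psc (*) (x i) u \<in> vx (psc (*)) x V ?U i" for i u
  proof -
    have "i \<le> length xs" using i xs(3) by simp
    note e = ideal_smult_Idl[OF P x this]
    have "(xs ! i) \<odot>\<^bsub>M\<^esub> \<pi> u = \<pi> (psc (*) (x i) u)" using x[of i] i xs(3) presD(8)[OF P u(1)] by simp
    moreover have "\<pi> u \<in> carrier M" using u(1) presD(5)[OF P] by blast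
    ultimately have "\<pi> u \<in> \<pi> ` vx (psc (*)) x V ?U i"
      using xs(2,3) i u(2) unfolding regular_sequence_def e[symmetric] by (metis e image_eqI)
    then show ?thesis using pres_inj[OF P u(1) vf] by blast
  qed
  \<comment> \<open>This is where the depth meets the dimension: an infinite length would give more
    primes below \<open>N\<close> than \<open>dim A = d\<close> permits.\<close>
  have fin: "rlen (range (psc (*))) (vx (psc (*)) x V ?U d) ?U \<noteq> \<infinity>"
  proof
    assume inf: "rlen (range (psc (*))) (vx (psc (*)) x V ?U d) ?U = \<infinity>"
    have L: "lmod I N (psc (*))" unfolding lmod_def using lring psm by blast
    show False using lmod.prime_chain[OF L noethI ap noU reg inf] prime_chain_bound[OF assms(2)] by blast
  qed
  have R: "regseq (psc (*)) I N d x V ?U"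
    unfolding regseq_def using ap noU xN reg fin by blast
  obtain e where e: "(\<lambda>n. fact d * real (the_enat (hs (psc (*)) a t n V ?U)) / real n ^ d) \<longlonglongrightarrow> e"
    "2 * real (the_enat (hs (psc (*)) a t 1 V ?U)) \<le> e"
    using G.regular_sequence_case[OF R cF g k(2)[unfolded eF]] by blast
  have r: "(THE r::nat. module_dim A M = ereal (real r)) = d" unfolding dimM by (rule the_equality) simp_all
  have "multiplicity_module A M = e"
    unfolding multiplicity_module_def r Let_def length_power[OF G P] by (rule limI[OF e(1)])
  moreover have "num_generators A M = the_enat (hs (psc (*)) a t 1 V ?U)"
    unfolding num_generators_def length_power[OF G P, of 1, symmetric] ideal_power_1 ..
  ultimately show ?thesis using e(2) by simp
qed

end
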